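(* Let $N\ge1$, $p>2$, let $f$ be a continuous nondecreasing function with $f(s)=0$ if and only if $s=0$, convex on $[0,\infty)$, put $F(s)=\int_0^sf(\sigma)d\sigma$, and assume $$\int_1^\infty s^{-p-\frac pN}f(s)\,ds<\infty,\qquad\int_1^\infty\frac{ds}{f(s)}<\infty,\qquad\int_1^\infty\frac{ds}{F(s)^{1/p}}=\infty .$$ Then there exist infinitely many different positive solutions $u$ of $\partial_tu-\Delta_pu+f(u)=0$ in $Q_\infty=\mathbb R^N\times(0,\infty)$ such that $tr_{\mathbb R^N}(u)=\nu_\infty$, where $\nu_\infty$ is the Borel measure with $\nu_\infty(\mathcal O)=\infty$ for every non-empty open $\mathcal O\subset\mathbb R^N$.
   Context: $\Delta_p u=\operatorname{div}(|\nabla u|^{p-2}\nabla u)$. "Positive" means nonnegative and not identically zero. Solution in $Q_\infty$: a function $u\in C(Q_\infty)$ that is a weak solution, i.e. nonnegative, with $u,|\nabla u|^p,f(u)\in L^1_{loc}(Q_\infty)$ and $\iint\big(-G(u)\partial_t\varphi+|\nabla u|^{p-2}\nabla u\cdot\nabla(g(u)\varphi)+f(u)g(u)\varphi\big)dx\,dt=0$ for all $\varphi\in C_c^\infty(Q_\infty)$ and all $g\in C(\mathbb R)\cap W^{1,\infty}(\mathbb R)$, where $G'=g$. Initial trace. $\mathcal R(u)$ is the open set of $y\in\mathbb R^N$ having an open neighborhood $U$ and a nonnegative Radon measure $\mu_U$ on $U$ with $\lim_{t\to0}\int_Uu(x,t)\zeta(x)dx=\int_U\zeta\,d\mu_U$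 for all $\zeta\in C_c(U)$. $\mathcal S(u)=\mathbb R^N\setminus\mathcal R(u)$ is the closed set of $y$ with $\limsup_{t\to0}\int_Uu(x,t)dx=\infty$ for every open neighborhood $U$ of $y$. There is a unique nonnegative Radon measure $\mu$ on $\mathcal R(u)$ with $\lim_{t\to0}\int u(x,t)\zeta(x)dx=\int\zeta\,d\mu$ for all $\zeta\in C_c(\mathcal R(u))$. The initial trace $tr_{\mathbb R^N}(u)$ is the couple $(\mathcal S(u),\mu)$, identified with the Borel measure $\nu$ given by $\nu(E)=\infty$ if $E\cap\mathcal S(u)\ne\emptyset$ and $\nu(E)=\mu(E)$ if $E\subset\mathcal R(u)$. Thus $tr_{\mathbb R^N}(u)=\nu_\infty$ iff $\mathcal S(u)=\mathbb R^N$. *)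

theory Defs
  imports "HOL-Analysis.Analysis"
begin

section \<open>Test functions\<close>

text \<open>All test functions live on the whole space, i.e. they are extended by zero outside
  the open set containing their support.\<close>

fun C_k :: "nat \<Rightarrow> ('b::euclidean_space \<Rightarrow> real) \<Rightarrow> bool" where
  "C_k 0 \<phi> \<longleftrightarrow> continuous_on UNIV \<phi>"
| "C_k (Suc k) \<phi> \<longleftrightarrow> (\<forall>z. \<phi> differentiable (at z)) \<and>
     (\<forall>d\<in>Basis. C_k k (\<lambda>z. frechet_derivative \<phi> (at z) d))"

definition compact_support_in :: "'b::euclidean_space set \<Rightarrow> ('b \<Rightarrow> real) \<Rightarrow> bool" where
  "compact_support_in \<Omega> \<phi> \<longleftrightarrow>
     compact (closure {z. \<phi> z \<noteq> 0}) \<and> closure {z. \<phi> z \<noteq> 0} \<subseteq> \<Omega>"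

definition Cc :: "'b::euclidean_space set \<Rightarrow> ('b \<Rightarrow> real) set" where
  "Cc \<Omega> = {\<zeta>. continuous_on UNIV \<zeta> \<and> compact_support_in \<Omega> \<zeta>}"

definition Cc_infty :: "'b::euclidean_space set \<Rightarrow> ('b \<Rightarrow> real) set" where
  "Cc_infty \<Omega> = {\<phi>. (\<forall>k. C_k k \<phi>) \<and> compact_support_in \<Omega> \<phi>}"


section \<open>Local integrability and weak derivatives\<close>

definition L1_loc :: "'b::euclidean_space set \<Rightarrow> ('b \<Rightarrow> real) set" where
  "L1_loc \<Omega> = {h. \<forall>K. compact K \<longrightarrow> K \<subseteq> \<Omega> \<longrightarrow> set_integrable lborel K h}"

text \<open>\<open>h\<close> is the distributional derivative of \<open>w\<close> in the direction \<open>d\<close> on \<open>\<Omega>\<close>.\<close>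

definition has_weak_deriv ::
    "'b::euclidean_space set \<Rightarrow> 'b \<Rightarrow> ('b \<Rightarrow> real) \<Rightarrow> ('b \<Rightarrow> real) \<Rightarrow> bool" where
  "has_weak_deriv \<Omega> d w h \<longleftrightarrow> w \<in> L1_loc \<Omega> \<and> h \<in> L1_loc \<Omega> \<and>
     (\<forall>\<phi>\<in>Cc_infty \<Omega>.
        (LINT z:\<Omega>|lborel. w z * frechet_derivative \<phi> (at z) d)
          = - (LINT z:\<Omega>|lborel. h z * \<phi> z))"

definition L_infty :: "(real \<Rightarrow> real) set" where
  "L_infty = {g \<in> borel_measurable lborel. \<exists>C. AE s in lborel. \<bar>g s\<bar> \<le> C}"

definition W1_infty :: "(real \<Rightarrow> real) set" where
  "W1_infty = {g \<in> L_infty. \<exists>h\<in>L_infty. has_weak_deriv UNIV 1 g h}"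


section \<open>Weak solutions of the p-Laplace heat equation with absorption\<close>

definition Q_infty :: "('a::euclidean_space \<times> real) set" where
  "Q_infty = UNIV \<times> {0<..}"

definition has_weak_grad ::
    "('a::euclidean_space \<times> real \<Rightarrow> real) \<Rightarrow> ('a \<times> real \<Rightarrow> 'a) \<Rightarrow> bool" where
  "has_weak_grad w V \<longleftrightarrow>
     (\<forall>i\<in>Basis. has_weak_deriv Q_infty (i, 0) w (\<lambda>z. V z \<bullet> i))"

text \<open>In the following definition \<open>V\<close> is the spatial gradient of \<open>u\<close> and \<open>W\<close> that of
  \<open>g(u)\<phi>\<close>. Weak gradients are unique almost everywhere on \<open>Q_infty\<close>, so neither existential
  quantifier leaves a choice that matters. The integral identity includes the integrability of
  its integrand, because the Bochner integral of a non-integrable function is \<open>0\<close> by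
  convention.\<close>

definition weak_solution ::
    "real \<Rightarrow> (real \<Rightarrow> real) \<Rightarrow> ('a::euclidean_space \<times> real \<Rightarrow> real) \<Rightarrow> bool" where
  "weak_solution p f u \<longleftrightarrow>
     (\<forall>z\<in>Q_infty. u z \<ge> 0) \<and>
     u \<in> L1_loc Q_infty \<and>
     (\<lambda>z. f (u z)) \<in> L1_loc Q_infty \<and>
     (\<exists>V. has_weak_grad u V \<and>
        (\<lambda>z. norm (V z) powr p) \<in> L1_loc Q_infty \<and>
        (\<forall>\<phi>\<in>Cc_infty Q_infty. \<forall>g G.
           continuous_on UNIV g \<longrightarrow> g \<in> W1_infty \<longrightarrow>
           (\<forall>s. (G has_real_derivative g s) (at s)) \<longrightarrow>
           (\<exists>W. has_weak_grad (\<lambda>z. g (u z) * \<phi> z) W \<and>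
              has_bochner_integral lborel
                (\<lambda>z. indicator Q_infty z *\<^sub>R
                   (- G (u z) * frechet_derivative \<phi> (at z) (0, 1)
                    + norm (V z) powr (p - 2) * (V z \<bullet> W z)
                    + f (u z) * g (u z) * \<phi> z))
                0)))"

text \<open>Membership in \<open>extensional Q_infty\<close> fixes the values outside \<open>Q_infty\<close>, so that distinct
  HOL functions are distinct as functions on \<open>Q_infty\<close>.\<close>

definition positive_solutions ::
    "real \<Rightarrow> (real \<Rightarrow> real) \<Rightarrow> ('a::euclidean_space \<times> real \<Rightarrow> real) set" where
  "positive_solutions p f = {u \<in> extensional Q_infty.
     continuous_on Q_infty u \<and> weak_solution p f u \<and> (\<exists>z\<in>Q_infty. u z \<noteq> 0)}"


section \<open>Initial trace\<close>

definition radon_measure_on :: "'a::euclidean_space set \<Rightarrow> 'a measure \<Rightarrow> bool" where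
  "radon_measure_on U \<mu> \<longleftrightarrow> sets \<mu> = sets (restrict_space borel U) \<and>
     (\<forall>K. compact K \<longrightarrow> K \<subseteq> U \<longrightarrow> emeasure \<mu> K < \<infinity>) \<and>
     (\<forall>E\<in>sets \<mu>. emeasure \<mu> E = (SUP K\<in>{K. compact K \<and> K \<subseteq> E}. emeasure \<mu> K))"

definition initial_measure_on ::
    "('a::euclidean_space \<times> real \<Rightarrow> real) \<Rightarrow> 'a set \<Rightarrow> 'a measure \<Rightarrow> bool" where
  "initial_measure_on u U \<mu> \<longleftrightarrow> radon_measure_on U \<mu> \<and>
     (\<forall>\<zeta>\<in>Cc U. ((\<lambda>t. LINT x:U|lborel. u (x, t) * \<zeta> x) \<longlongrightarrow> (LINT x|\<mu>. \<zeta> x)) (at_right 0))"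

definition regular_set :: "('a::euclidean_space \<times> real \<Rightarrow> real) \<Rightarrow> 'a set" where
  "regular_set u = {y. \<exists>U \<mu>. open U \<and> y \<in> U \<and> initial_measure_on u U \<mu>}"

definition singular_set :: "('a::euclidean_space \<times> real \<Rightarrow> real) \<Rightarrow> 'a set" where
  "singular_set u = UNIV - regular_set u"

text \<open>The initial trace is represented by the Borel measure \<open>\<nu>\<close> encoding the couple consisting
  of the singular set and the Radon measure on the regular set.\<close>

definition has_initial_trace ::
    "('a::euclidean_space \<times> real \<Rightarrow> real) \<Rightarrow> 'a measure \<Rightarrow> bool" where
  "has_initial_trace u \<nu> \<longleftrightarrow> sets \<nu> = sets borel \<and>
     (\<exists>\<mu>. initial_measure_on u (regular_set u) \<mu> \<and>
        (\<forall>E\<in>sets borel.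
           emeasure \<nu> E = (if E \<inter> singular_set u \<noteq> {} then \<infinity> else emeasure \<mu> E)))"

text \<open>A Borel measure that is infinite on non-empty open sets need not be unique; among initial
  traces it is, and it is the following one (see \<open>nu_infty_unique\<close>).\<close>

definition nu_infty :: "'a::euclidean_space measure" where
  "nu_infty = measure_of UNIV (sets borel) (\<lambda>E. if E = {} then 0 else \<infinity>)"

lemma sets_nu_infty [simp]: "sets nu_infty = sets borel"
  unfolding nu_infty_def by (metis sets.sets_measure_of_eq space_borel)

lemma emeasure_nu_infty:
  assumes "E \<in> sets borel"
  shows "emeasure nu_infty E = (if E = {} then 0 else \<infinity>)"
proof (rule emeasure_measure_of[OF nu_infty_def])
  show "sets borel \<subseteq> Pow (UNIV :: 'a set)" by simp
  show "positive (sets nu_infty) (\<lambda>E::'a set. if E = {} then 0 else \<infinity>)"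
    by (simp add: positive_def)
  show "E \<in> sets nu_infty" using assms by simp
  show "countably_additive (sets nu_infty) (\<lambda>E::'a set. if E = {} then 0 else \<infinity>)"
  proof (rule countably_additiveI)
    fix A :: "nat \<Rightarrow> 'a set"
    show "(\<Sum>i. if A i = {} then 0 else \<infinity>) = (if (\<Union>i. A i) = {} then 0 else (\<infinity>::ennreal))"
    proof (cases "\<forall>i. A i = {}")
      case False
      then obtain i where i: "A i \<noteq> {}" by blast
      have "(\<Sum>k\<in>{i}. if A k = {} then 0 else (\<infinity>::ennreal)) \<le> (\<Sum>i. if A i = {} then 0 else \<infinity>)"
        by (rule sum_le_suminf) auto
      with i show ?thesis by (auto simp: top_unique)
    qed auto
  qed
qed

lemma nu_infty_open: "open X \<Longrightarrow> X \<noteq> {} \<Longrightarrow> emeasure nu_infty X = \<infinity>"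
  by (simp add: emeasure_nu_infty)

lemma open_regular_set: "open (regular_set u)"
proof (subst open_subopen, intro ballI)
  fix y assume "y \<in> regular_set u"
  then obtain U \<mu> where U: "open U" "y \<in> U" "initial_measure_on u U \<mu>"
    unfolding regular_set_def by blast
  then have "U \<subseteq> regular_set u" unfolding regular_set_def by blast
  with U show "\<exists>T. open T \<and> y \<in> T \<and> T \<subseteq> regular_set u" by blast
qed

lemma singular_set_UNIV:
  assumes "has_initial_trace u \<nu>" and "\<And>X. open X \<Longrightarrow> X \<noteq> {} \<Longrightarrow> emeasure \<nu> X = \<infinity>"
  shows "singular_set u = UNIV"
proof (rule ccontr)
  assume "singular_set u \<noteq> UNIV"
  then obtain y where y: "y \<in> regular_set u" by (auto simp: singular_set_def)
  then obtain e where e: "e > 0" "cball y e \<subseteq> regular_set u"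
    using open_regular_set open_contains_cball by blast
  from assms(1) obtain \<mu> where \<mu>: "radon_measure_on (regular_set u) \<mu>"
    and eq: "\<And>E. E \<in> sets borel \<Longrightarrow>
      emeasure \<nu> E = (if E \<inter> singular_set u \<noteq> {} then \<infinity> else emeasure \<mu> E)"
    unfolding has_initial_trace_def initial_measure_on_def by blast
  have b: "cball y e \<inter> singular_set u = {}" using e by (auto simp: singular_set_def)
  have "emeasure \<mu> (cball y e) < \<infinity>"
    using \<mu> e(2) compact_cball[of y e] by (simp add: radon_measure_on_def)
  then have "emeasure \<nu> (cball y e) < \<infinity>" using eq[of "cball y e"] b by simp
  moreover have "emeasure \<nu> (ball y e) \<le> emeasure \<nu> (cball y e)"
    using assms(1) by (intro emeasure_mono) (auto simp: has_initial_trace_def)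
  moreover have "emeasure \<nu> (ball y e) = \<infinity>" using assms(2) e by simp
  ultimately show False by (auto simp: top_unique)
qed

lemma nu_infty_unique:
  assumes "has_initial_trace u \<nu>" and "\<And>X. open X \<Longrightarrow> X \<noteq> {} \<Longrightarrow> emeasure \<nu> X = \<infinity>"
  shows "\<nu> = nu_infty"
proof (rule measure_eqI)
  show "sets \<nu> = sets nu_infty" using assms(1) by (simp add: has_initial_trace_def)
  fix E assume "E \<in> sets \<nu>"
  then have E: "E \<in> sets borel" using assms(1) by (simp add: has_initial_trace_def)
  have S: "singular_set u = UNIV" by (rule singular_set_UNIV[OF assms])
  from assms(1) E have "E \<noteq> {} \<Longrightarrow> emeasure \<nu> E = \<infinity>"
    unfolding has_initial_trace_def S by force
  then show "emeasure \<nu> E = emeasure nu_infty E"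
    by (cases "E = {}") (simp_all add: emeasure_nu_infty E)
qed

lemma has_initial_trace_nu_infty_iff: "has_initial_trace u nu_infty \<longleftrightarrow> singular_set u = UNIV"
proof
  assume "has_initial_trace u nu_infty"
  then show "singular_set u = UNIV" by (rule singular_set_UNIV) (rule nu_infty_open)
next
  assume S: "singular_set u = UNIV"
  then have R: "regular_set u = {}" by (auto simp: singular_set_def)
  define \<mu> :: "'a measure" where "\<mu> = restrict_space borel {}"
  have sp: "space \<mu> = {}" by (simp add: \<mu>_def space_restrict_space)
  have st: "sets \<mu> = {{}}" by (auto simp: \<mu>_def sets_restrict_space)
  have "radon_measure_on {} \<mu>"
    unfolding radon_measure_on_def st by (auto simp: \<mu>_def sets_restrict_space)
  moreover have "(LINT x|\<mu>. \<zeta> x) = 0" for \<zeta> :: "'a \<Rightarrow> real"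
  proof -
    have "(LINT x|\<mu>. \<zeta> x) = (LINT x|\<mu>. 0)"
      by (rule Bochner_Integration.integral_cong) (simp_all add: sp)
    then show ?thesis by simp
  qed
  ultimately have "initial_measure_on u {} \<mu>"
    by (simp add: initial_measure_on_def set_lebesgue_integral_def)
  then show "has_initial_trace u nu_infty"
    unfolding has_initial_trace_def R S by (auto simp: emeasure_nu_infty intro!: exI[of _ \<mu>])
qed

end

theory Submission
  imports Defs "HOL-Library.Diagonal_Subsequence" "HOL-Computational_Algebra.Polynomial"
begin

text \<open>It suffices to find one solution depending on a single space variable, with infinite trace and
  unbounded in space: its translates are then pairwise distinct. Let \<open>w\<close> be an even steady state,
  which is finite everywhere because the integral of \<open>1 / F powr (1 / p)\<close> diverges, and let
  \<open>\<Phi>' = - f(\<Phi>)\<close>, \<open>\<Phi>(0) = k\<close>, which stays bounded for positive times as \<open>k \<rightarrow> \<infinity>\<close> because the integral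
  of \<open>1 / f\<close> converges. As \<open>f\<close> is superadditive, \<open>\<Phi> + w\<close> is a supersolution, so the solution with
  initial value \<open>k + w\<close> lies between \<open>max \<Phi> w\<close> and \<open>\<Phi> + w\<close> and decreases in time. Hence the flux
  \<open>J = \<bar>u\<^sub>x\<bar> powr (p - 2) * u\<^sub>x\<close> satisfies \<open>J\<^sub>x \<le> f(u)\<close>. In one dimension this one-sided bound gives
  local bounds on the slope, equicontinuity, and almost everywhere convergence of the fluxes of
  approximate solutions. The approximations come from an explicit finite difference scheme, which
  is monotone under a CFL condition, with all its parameters sent to their limits at once.\<close>

section \<open>An explicit monotone scheme\<close>

text \<open>The main obstacle is the nonlinear flux: weak convergence of slopes would not identify
  its limit. Everything is therefore arranged so that the flux is decreasing up to a Lipschitz term,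
  a property that follows from comparison for solutions decreasing in time and that survives
  discretisation. A difference scheme makes existence a finite recursion: since p > 2,
  \<open>j\<close> is locally Lipschitz, and an explicit step is order preserving once the time step
  is small. Mesh, window and initial level can vary together because every bound depends on them
  only through a threshold.

  The second obstacle is the class of test functions g(u) \<phi> with g merely Lipschitz. For smooth
  g the scheme leaves a Taylor remainder of G in time, and it is monotonicity in time, not a bound
  on the time derivative, that makes this remainder vanish. The passage to general g uses that the
  identity is affine in the derivative of g.\<close>

definition jp :: "real \<Rightarrow> real \<Rightarrow> real" where
  "jp p s = sgn s * \<bar>s\<bar> powr (p - 1)"

definition jinv :: "real \<Rightarrow> real \<Rightarrow> real" where
  "jinv p s = sgn s * \<bar>s\<bar> powr (1 / (p - 1))"

text \<open>The mean value theorem with the derivative estimated at the right end. It is used with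
  exponent p - 1 for the Lipschitz bound on \<open>j\<close> and with exponent p / (p - 1) for the
  first integral of the steady equation.\<close>

lemma powr_diff_le:
  fixes a b q :: real
  assumes "0 \<le> a" "a \<le> b" "q \<ge> 1"
  shows "b powr q - a powr q \<le> q * b powr (q - 1) * (b - a)"
proof (cases "a = b")
  case False
  then have ab: "a < b" using assms by simp
  obtain l z where z: "a < z" "z < b" "DERIV (\<lambda>s. s powr q) z :> l"
    "b powr q - a powr q = (b - a) * l"
  proof -
    have "continuous_on {a..b} (\<lambda>s. s powr q)"
      using assms by (intro continuous_on_powr' continuous_intros) auto
    moreover have "(\<lambda>s. s powr q) differentiable (at z)" if "a < z" for z
      using that assms has_real_derivative_powr[of z q] real_differentiable_def by fastforce
    ultimately show ?thesis using MVT[OF ab] that by blast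
  qed
  have "DERIV (\<lambda>s. s powr q) z :> q * z powr (q - 1)"
    using z assms by (intro has_real_derivative_powr) auto
  then have l: "l = q * z powr (q - 1)" using z(3) DERIV_unique by blast
  have "z powr (q - 1) \<le> b powr (q - 1)" using z assms by (intro powr_mono2) auto
  then have "(b - a) * l \<le> (b - a) * (q * b powr (q - 1))"
    unfolding l using ab assms by (intro mult_left_mono) auto
  then show ?thesis using z(4) by (simp add: mult_ac)
qed simp

locale absorption =
  fixes p :: real and f :: "real \<Rightarrow> real"
  assumes p2: "p > 2"
    and f_cont: "continuous_on UNIV f"
    and f_mono: "mono f"
    and f_zero: "\<And>s. f s = 0 \<longleftrightarrow> s = 0"
    and f_convex: "convex_on {0..} f"
begin

abbreviation "j \<equiv> jp p"

lemma j_0 [simp]: "j 0 = 0" by (simp add: jp_def)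

lemma j_minus [simp]: "j (- s) = - j s" by (simp add: jp_def sgn_minus)

lemma j_nonneg_eq: "0 \<le> s \<Longrightarrow> j s = s powr (p - 1)"
  by (cases "s = 0") (auto simp: jp_def)

lemma j_eq_powr_mult: "j s = \<bar>s\<bar> powr (p - 2) * s"
proof (cases "s = 0")
  case False
  then have "\<bar>s\<bar> powr (p - 1) = \<bar>s\<bar> powr (p - 2) * \<bar>s\<bar>"
    using powr_add[of "\<bar>s\<bar>" "p - 2" 1] by simp
  then show ?thesis by (simp add: jp_def sgn_if)
qed simp

lemma abs_j: "\<bar>j s\<bar> = \<bar>s\<bar> powr (p - 1)"
  by (cases "s = 0") (auto simp: jp_def abs_mult sgn_if)

lemma jinv_j [simp]: "jinv p (j s) = s"
proof (cases "s = 0")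
  case False
  have "\<bar>j s\<bar> powr (1 / (p - 1)) = \<bar>s\<bar>"
    using p2 by (simp add: abs_j powr_powr)
  moreover have "sgn (j s) = sgn s"
    using False by (auto simp: jp_def sgn_mult)
  ultimately show ?thesis by (simp add: jinv_def sgn_mult_abs)
qed (simp add: jinv_def)

lemma j_jinv [simp]: "j (jinv p s) = s"
proof (cases "s = 0")
  case False
  have "\<bar>jinv p s\<bar> = \<bar>s\<bar> powr (1 / (p - 1))"
    using False by (simp add: jinv_def abs_mult sgn_if)
  then have "\<bar>jinv p s\<bar> powr (p - 1) = \<bar>s\<bar>"
    using p2 by (simp add: powr_powr)
  moreover have "sgn (jinv p s) = sgn s"
    using False by (auto simp: jinv_def sgn_mult)
  ultimately show ?thesis by (simp add: jp_def[of p "jinv p s"] sgn_mult_abs)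
qed (simp add: jinv_def)

lemma j_less_nonneg: "0 \<le> a \<Longrightarrow> a < b \<Longrightarrow> j a < j b"
  using p2 by (simp add: j_nonneg_eq powr_less_mono2)

lemma j_strict_mono: "strict_mono j"
proof (rule strict_monoI)
  fix a b :: real assume ab: "a < b"
  consider "0 \<le> a" | "b \<le> 0" | "a < 0" "0 < b" by linarith
  then show "j a < j b"
  proof cases
    case 1 then show ?thesis using ab j_less_nonneg by simp
  next
    case 2 then show ?thesis using j_less_nonneg[of "- b" "- a"] ab by simp
  next
    case 3
    then show ?thesis using j_less_nonneg[of 0 b] j_less_nonneg[of 0 "- a"] by simp
  qed
qed

lemma j_le_iff [simp]: "j a \<le> j b \<longleftrightarrow> a \<le> b"
  using j_strict_mono by (simp add: strict_mono_less_eq)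

lemma j_less_iff [simp]: "j a < j b \<longleftrightarrow> a < b"
  using j_strict_mono by (simp add: strict_mono_less)

lemma j_nonneg_iff [simp]: "0 \<le> j a \<longleftrightarrow> 0 \<le> a"
  using j_le_iff[of 0 a] by simp

lemma jinv_le_iff [simp]: "jinv p a \<le> jinv p b \<longleftrightarrow> a \<le> b"
  using j_le_iff[of "jinv p a" "jinv p b"] by simp

lemma jinv_0 [simp]: "jinv p 0 = 0" by (simp add: jinv_def)

lemma jinv_nonneg_iff [simp]: "0 \<le> jinv p a \<longleftrightarrow> 0 \<le> a"
  using jinv_le_iff[of 0 a] by simp

lemma continuous_sgn_powr:
  fixes q :: real assumes "q > 0"
  shows "continuous_on UNIV (\<lambda>s. sgn s * \<bar>s\<bar> powr q)"
proof -
  \<comment> \<open>Splitting into positive and negative parts leaves only powers of nonnegative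
    continuous functions, so 0 needs no separate treatment.\<close>
  have "(\<lambda>s::real. sgn s * \<bar>s\<bar> powr q) = (\<lambda>s. (max s 0) powr q - (max (- s) 0) powr q)"
    using assms by (auto simp: fun_eq_iff sgn_if max_def)
  moreover have "continuous_on UNIV (\<lambda>s::real. (max s 0) powr q - (max (- s) 0) powr q)"
    using assms by (intro continuous_on_diff continuous_on_powr' continuous_intros) auto
  ultimately show ?thesis by (simp only:)
qed

lemma j_cont: "continuous_on UNIV j"
  unfolding jp_def[abs_def] using p2 by (intro continuous_sgn_powr) simp

lemma jinv_cont: "continuous_on UNIV (jinv p)"
  unfolding jinv_def[abs_def] using p2 by (intro continuous_sgn_powr) simp

lemma j_lipschitz_nonneg:
  assumes "0 \<le> a" "a \<le> b" "b \<le> B"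
  shows "j b - j a \<le> (p - 1) * B powr (p - 2) * (b - a)"
proof -
  have "b powr (p - 1) - a powr (p - 1) \<le> (p - 1) * b powr (p - 2) * (b - a)"
    using powr_diff_le[of a b "p - 1"] assms p2 by simp
  also have "\<dots> \<le> (p - 1) * B powr (p - 2) * (b - a)"
    using assms p2 by (intro mult_right_mono mult_left_mono powr_mono2) auto
  finally show ?thesis using assms by (simp add: j_nonneg_eq)
qed

text \<open>Because p > 2, the derivative (p - 1) |s|^(p - 2) of \<open>j\<close> is bounded on
  bounded sets; its bound becomes the constant in the CFL condition. Arguments of opposite signs are
  compared through 0, using that \<open>j\<close> is odd.\<close>

lemma j_lipschitz:
  assumes "- B \<le> a" "a \<le> b" "b \<le> B"
  shows "j b - j a \<le> (p - 1) * B powr (p - 2) * (b - a)"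
proof -
  consider "0 \<le> a" | "b \<le> 0" | "a < 0" "0 < b" by linarith
  then show ?thesis
  proof cases
    case 1 then show ?thesis using assms j_lipschitz_nonneg by simp
  next
    case 2
    then show ?thesis using assms j_lipschitz_nonneg[of "- b" "- a" B] by simp
  next
    case 3
    then show ?thesis
      using assms j_lipschitz_nonneg[of 0 b B] j_lipschitz_nonneg[of 0 "- a" B]
      by (simp add: algebra_simps)
  qed
qed

lemma f_0 [simp]: "f 0 = 0" by (simp add: f_zero)

lemma f_le: "a \<le> b \<Longrightarrow> f a \<le> f b"
  using f_mono by (rule monoD)

lemma f_nonneg: "0 \<le> s \<Longrightarrow> 0 \<le> f s"
  using f_le[of 0 s] by simp

lemma f_pos: "0 < s \<Longrightarrow> 0 < f s"
  using f_nonneg[of s] f_zero[of s] by linarith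

lemma f_measurable [measurable]: "f \<in> borel_measurable borel"
  using f_cont by (rule borel_measurable_continuous_onI)

text \<open>A convex function vanishing at 0 lies below its chord from 0 to a + b; the two chord
  estimates add up. This is what makes the sum of the space-independent solution and the steady
  state a supersolution.\<close>

lemma f_superadd:
  assumes "0 \<le> a" "0 \<le> b"
  shows "f a + f b \<le> f (a + b)"
proof (cases "a + b = 0")
  case False
  then have s: "a + b > 0" using assms by simp
  have *: "f c \<le> c / (a + b) * f (a + b)" if "0 \<le> c" "c \<le> a + b" for c
  proof -
    have "f ((1 - c / (a + b)) *\<^sub>R 0 + (c / (a + b)) *\<^sub>R (a + b))
        \<le> (1 - c / (a + b)) * f 0 + (c / (a + b)) * f (a + b)"
      using s that by (intro convex_onD[OF f_convex]) auto
    then show ?thesis using s by simp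
  qed
  have "f a + f b \<le> a / (a + b) * f (a + b) + b / (a + b) * f (a + b)"
    using *[of a] *[of b] assms by simp
  also have "\<dots> = f (a + b)"
    using s by (simp flip: add_divide_distrib distrib_right)
  finally show ?thesis .
next
  case True
  then have "a = 0" "b = 0" using assms by auto
  then show ?thesis by simp
qed

text \<open>Chord slopes of a convex function increase, so the chord from a to b is compared with
  the one from b to M + 1. The extra 1 gives the latter length at least 1, so its slope is at most
  \<open>f (M + 1)\<close> and no derivative of f is needed.\<close>

lemma f_lipschitz:
  assumes "0 \<le> a" "a \<le> b" "b \<le> M"
  shows "f b - f a \<le> f (M + 1) * (b - a)"
proof (cases "a = b")
  case False
  then have ab: "a < b" "b < M + 1" using assms by auto
  have "(f a - f b) / (a - b) \<le> (f a - f (M + 1)) / (a - (M + 1))"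
       "(f a - f (M + 1)) / (a - (M + 1)) \<le> (f b - f (M + 1)) / (b - (M + 1))"
    using convex_on_slope_le[OF f_convex, of a "M + 1" b] ab assms by auto
  then have "(f b - f a) / (b - a) \<le> (f (M + 1) - f b) / (M + 1 - b)"
    using minus_divide_divide[of "f b - f a" "b - a"] minus_divide_divide[of "f (M + 1) - f b" "M + 1 - b"]
    by simp
  also have "\<dots> \<le> f (M + 1) / 1"
    using assms f_nonneg[of b] f_nonneg[of "M + 1"] by (intro frac_le) auto
  finally show ?thesis using ab by (simp add: field_simps)
qed simp

text \<open>Discrete steady state on a half line: \<open>steady d i\<close> is its value at the \<open>i\<close>-th node, and
  \<open>steady_flux d i\<close> the flux between the nodes \<open>i\<close> and \<open>i + 1\<close>. The initial flux is half of the
  source at node \<open>0\<close>, so that the even reflection \<open>w\<close> is steady at \<open>0\<close> as well.\<close>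

primrec steady_pair :: "real \<Rightarrow> nat \<Rightarrow> real \<times> real" where
  "steady_pair d 0 = (1, d * f 1 / 2)"
| "steady_pair d (Suc i) = (let v = fst (steady_pair d i) + d * jinv p (snd (steady_pair d i)) in (v, snd (steady_pair d i) + d * f v))"

definition "steady d i = fst (steady_pair d i)"
definition "steady_flux d i = snd (steady_pair d i)"

lemma steady_simps [simp]: "steady d 0 = 1" "steady d (Suc i) = steady d i + d * jinv p (steady_flux d i)"
  and steady_flux_0 [simp]: "steady_flux d 0 = d * f 1 / 2"
  by (simp_all add: steady_def steady_flux_def Let_def)

lemma steady_flux_Suc: "steady_flux d (Suc i) = steady_flux d i + d * f (steady d (Suc i))"
  by (simp add: steady_def steady_flux_def Let_def)

lemma steady_JJ_bounds:
  assumes "d > 0"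
  shows "1 \<le> steady d i \<and> 0 \<le> steady_flux d i \<and> d * f 1 * i \<le> steady_flux d i"
proof (induction i)
  case 0 then show ?case using assms f_pos[of 1] by simp
next
  case (Suc i)
  have v: "1 \<le> steady d (Suc i)" using Suc assms by (simp add: add_increasing2)
  have "d * f 1 \<le> d * f (steady d (Suc i))" using v assms f_le by simp
  moreover have "d * f 1 * Suc i = d * f 1 * i + d * f 1" by (simp add: algebra_simps)
  moreover have "0 \<le> d * f 1" using assms f_pos[of 1] by simp
  ultimately show ?case using Suc v unfolding steady_flux_Suc by linarith
qed

lemma steady_mono: "d > 0 \<Longrightarrow> i \<le> i' \<Longrightarrow> steady d i \<le> steady d i'"
  by (rule lift_Suc_mono_le[of "steady d"]) (use steady_JJ_bounds in auto)

text \<open>Past distance 1 the flux has collected at least \<open>f 1\<close>, because the source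
  is at least \<open>f 1\<close> everywhere, and from there on the slope is at least
  \<open>jinv p (f 1)\<close>. The subtracted 1 + d keeps the bound nonpositive until then,
  including the step that crosses distance 1.\<close>

lemma steady_lower:
  assumes "d > 0"
  shows "jinv p (f 1) * (d * i - 1 - d) \<le> steady d i"
proof (induction i)
  case 0
  have "jinv p (f 1) * (d * 0 - 1 - d) \<le> 0"
    using assms f_pos[of 1] by (intro mult_nonneg_nonpos) auto
  then show ?case by simp
next
  case (Suc i)
  show ?case
  proof (cases "1 \<le> d * i")
    case True
    then have "f 1 * 1 \<le> f 1 * (d * i)" using f_pos[of 1] by (intro mult_left_mono) auto
    then have "f 1 \<le> steady_flux d i" using steady_JJ_bounds[OF assms, of i] by (simp add: mult_ac)
    then have "d * jinv p (f 1) \<le> d * jinv p (steady_flux d i)" using assms by simp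
    then show ?thesis using Suc by (simp add: algebra_simps)
  next
    case False
    then have "jinv p (f 1) * (d * Suc i - 1 - d) \<le> 0"
      using f_pos[of 1] by (intro mult_nonneg_nonpos) (auto simp: algebra_simps)
    then show ?thesis using steady_JJ_bounds[OF assms, of "Suc i"] by linarith
  qed
qed

definition w :: "real \<Rightarrow> int \<Rightarrow> real" where
  "w d i = steady d (nat \<bar>i\<bar>)"

lemma w_minus: "w d (- i) = w d i" by (simp add: w_def)

lemma w_ge_1: "d > 0 \<Longrightarrow> 1 \<le> w d i" using steady_JJ_bounds by (simp add: w_def)

lemma w_mono: "d > 0 \<Longrightarrow> \<bar>i\<bar> \<le> \<bar>l\<bar> \<Longrightarrow> w d i \<le> w d l"
  unfolding w_def by (rule steady_mono) auto

lemma w_steady: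
  assumes "d > 0"
  shows "j ((w d (i + 1) - w d i) / d) - j ((w d i - w d (i - 1)) / d) = d * f (w d i)"
proof -
  have pos: "j ((w d (i + 1) - w d i) / d) - j ((w d i - w d (i - 1)) / d) = d * f (w d i)"
    if "i > 0" for i
  proof -
    define m where "m = nat (i - 1)"
    have "nat \<bar>i\<bar> = Suc m" "nat \<bar>i + 1\<bar> = Suc (Suc m)" "nat \<bar>i - 1\<bar> = m"
      using that by (auto simp: m_def)
    then have "w d i = steady d (Suc m)" "w d (i + 1) = steady d (Suc (Suc m))" "w d (i - 1) = steady d m"
      by (simp_all add: w_def)
    then show ?thesis using assms steady_flux_Suc[of d m] by simp
  qed
  consider "i > 0" | "i = 0" | "i < 0" by linarith
  then show ?thesis
  proof cases
    case 1 then show ?thesis by (rule pos)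
  next
    \<comment> \<open>At the centre the two fluxes are opposite by evenness, each of size d f(1) /
      2, and their difference is the full source.\<close>
    case 2 then show ?thesis using assms by (simp add: w_def)
  next
    case 3
    have "j ((w d (- i + 1) - w d (- i)) / d) - j ((w d (- i) - w d (- i - 1)) / d) = d * f (w d (- i))"
      using 3 by (intro pos) simp
    moreover have "w d (- i + 1) = w d (i - 1)" "w d (- i - 1) = w d (i + 1)"
    proof -
      have "\<bar>- i + 1\<bar> = \<bar>i - 1\<bar>" "\<bar>- i - 1\<bar> = \<bar>i + 1\<bar>" by linarith+
      then show "w d (- i + 1) = w d (i - 1)" "w d (- i - 1) = w d (i + 1)"
        by (simp_all only: w_def)
    qed
    moreover have "j ((w d (i - 1) - w d i) / d) = - j ((w d i - w d (i - 1)) / d)"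
      "j ((w d i - w d (i + 1)) / d) = - j ((w d (i + 1) - w d i) / d)"
      by (simp_all flip: j_minus add: minus_divide_left)
    ultimately show ?thesis by (simp only: w_minus)
  qed
qed

end

section \<open>The explicit scheme and its comparison principle\<close>

text \<open>The CFL condition. For values in [0, M] the difference quotients are at most M /
  \<delta> in modulus, and there \<open>j\<close> has Lipschitz constant (p - 1) (M / \<delta>)^(p -
  2), while f has \<open>f (M + 1)\<close>; the factor 2 counts the two fluxes at a node. The index
  R + 1 appears because updating a node of the window reads its neighbours.\<close>

locale scheme = absorption +
  fixes \<delta> h k :: real and R :: nat
  assumes \<delta>_pos: "\<delta> > 0" and h_pos: "h > 0" and k_ge_1: "k \<ge> 1"
    and cfl: "h * (2 * ((p - 1) * ((k + w \<delta> (int R + 1)) / \<delta>) powr (p - 2)) / \<delta>\<^sup>2 + f (k + w \<delta> (int R + 1) + 1)) \<le> 1"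
begin

abbreviation "M \<equiv> k + w \<delta> (int R + 1)"
abbreviation "W \<equiv> w \<delta>"

definition T :: "(int \<Rightarrow> real) \<Rightarrow> int \<Rightarrow> real" where
  "T u i = u i + h * ((j ((u (i + 1) - u i) / \<delta>) - j ((u i - u (i - 1)) / \<delta>)) / \<delta> - f (u i))"

text \<open>The value at the centre is raised first, with the neighbours fixed (facts 1, 3 and 5):
  the flux difference and the absorption then act downwards, and the CFL condition lets the identity
  part of \<open>T\<close> compensate. Raising the neighbours afterwards (facts 2 and 4) only helps,
  since \<open>j\<close> is increasing.\<close>

lemma T_mono:
  assumes "\<And>l. i - 1 \<le> l \<Longrightarrow> l \<le> i + 1 \<Longrightarrow> 0 \<le> u l \<and> u l \<le> v l \<and> v l \<le> M"
  shows "T u i \<le> T v i"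
proof -
  define L where "L = (p - 1) * (M / \<delta>) powr (p - 2)"
  define e where "e = v i - u i"
  have r: "0 \<le> u (i - 1)" "u (i - 1) \<le> v (i - 1)" "v (i - 1) \<le> M"
    "0 \<le> u i" "u i \<le> v i" "v i \<le> M" "0 \<le> u (i + 1)" "u (i + 1) \<le> v (i + 1)" "v (i + 1) \<le> M"
    using assms by auto
  have b: "- (M / \<delta>) \<le> (a - c) / \<delta>" "(a - c) / \<delta> \<le> M / \<delta>"
    if "0 \<le> a" "a \<le> M" "0 \<le> c" "c \<le> M" for a c
    using that \<delta>_pos divide_right_mono[of "- M" "a - c" \<delta>] divide_right_mono[of "a - c" M \<delta>]
    unfolding minus_divide_left by auto
  have "j ((u (i + 1) - u i) / \<delta>) - j ((u (i + 1) - v i) / \<delta>)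
      \<le> L * ((u (i + 1) - u i) / \<delta> - (u (i + 1) - v i) / \<delta>)"
    unfolding L_def using r \<delta>_pos by (intro j_lipschitz b) (auto intro: divide_right_mono)
  also have "\<dots> = L * e / \<delta>" by (simp add: e_def diff_divide_distrib algebra_simps)
  finally have 1: "j ((u (i + 1) - u i) / \<delta>) - j ((u (i + 1) - v i) / \<delta>) \<le> L * e / \<delta>" .
  have 2: "j ((u (i + 1) - v i) / \<delta>) \<le> j ((v (i + 1) - v i) / \<delta>)"
    using r \<delta>_pos by (simp add: divide_right_mono)
  have "j ((v i - u (i - 1)) / \<delta>) - j ((u i - u (i - 1)) / \<delta>)
      \<le> L * ((v i - u (i - 1)) / \<delta> - (u i - u (i - 1)) / \<delta>)"
    unfolding L_def using r \<delta>_pos by (intro j_lipschitz b) (auto intro: divide_right_mono)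
  also have "\<dots> = L * e / \<delta>" by (simp add: e_def diff_divide_distrib algebra_simps)
  finally have 3: "j ((v i - u (i - 1)) / \<delta>) - j ((u i - u (i - 1)) / \<delta>) \<le> L * e / \<delta>" .
  have 4: "j ((v i - v (i - 1)) / \<delta>) \<le> j ((v i - u (i - 1)) / \<delta>)"
    using r \<delta>_pos by (simp add: divide_right_mono)
  have 5: "f (v i) - f (u i) \<le> f (M + 1) * e"
    unfolding e_def using r by (intro f_lipschitz) auto
  define a where "a = (j ((v (i + 1) - v i) / \<delta>) - j ((v i - v (i - 1)) / \<delta>)) / \<delta>"
  define b where "b = (j ((u (i + 1) - u i) / \<delta>) - j ((u i - u (i - 1)) / \<delta>)) / \<delta>"
  have "b - a = ((j ((u (i + 1) - u i) / \<delta>) - j ((u i - u (i - 1)) / \<delta>))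
      - (j ((v (i + 1) - v i) / \<delta>) - j ((v i - v (i - 1)) / \<delta>))) / \<delta>"
    by (simp add: a_def b_def diff_divide_distrib)
  also have "\<dots> \<le> (2 * (L * e / \<delta>)) / \<delta>"
    using 1 2 3 4 \<delta>_pos by (intro divide_right_mono; linarith)
  finally have "b - a \<le> 2 * L / \<delta>\<^sup>2 * e" by (simp add: power2_eq_square)
  with 5 have "(b - f (u i)) - (a - f (v i)) \<le> (2 * L / \<delta>\<^sup>2 + f (M + 1)) * e"
    by (simp add: algebra_simps)
  then have "h * ((b - f (u i)) - (a - f (v i))) \<le> h * ((2 * L / \<delta>\<^sup>2 + f (M + 1)) * e)"
    using h_pos by (intro mult_left_mono) auto
  also have "\<dots> \<le> 1 * e"
    unfolding mult.assoc[symmetric] using cfl r by (intro mult_right_mono) (auto simp: L_def e_def)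
  finally show ?thesis unfolding T_def a_def[symmetric] b_def[symmetric] e_def
    by (simp add: algebra_simps)
qed

primrec Phi :: "nat \<Rightarrow> real" where
  "Phi 0 = k"
| "Phi (Suc n) = Phi n - h * f (Phi n)"

lemma h_f_le_1: "h * f (M + 1) \<le> 1"
proof -
  have "h * f (M + 1) \<le> h * (2 * ((p - 1) * (M / \<delta>) powr (p - 2)) / \<delta>\<^sup>2 + f (M + 1))"
    using h_pos p2 by (intro mult_left_mono) auto
  with cfl show ?thesis by linarith
qed

text \<open>By the CFL condition the amount removed in one Euler step is at most the current
  value.\<close>

lemma Phi_bounds: "0 \<le> Phi n \<and> Phi n \<le> k"
proof (induction n)
  case 0 then show ?case using k_ge_1 by simp
next
  case (Suc n)
  have "f (Phi n) - f 0 \<le> f (M + 1) * (Phi n - 0)"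
    using Suc w_ge_1[OF \<delta>_pos, of "int R + 1"] by (intro f_lipschitz) auto
  then have "h * f (Phi n) \<le> h * (f (M + 1) * Phi n)" using h_pos by simp
  also have "\<dots> \<le> 1 * Phi n"
    unfolding mult.assoc[symmetric] using Suc h_f_le_1 by (intro mult_right_mono) auto
  finally show ?case using Suc h_pos f_nonneg[of "Phi n"] by (simp add: add_increasing2 algebra_simps)
qed

lemma Phi_Suc_le: "Phi (Suc n) \<le> Phi n"
  using Phi_bounds[of n] h_pos f_nonneg[of "Phi n"] by simp

text \<open>Outside the window \<open>\<bar>i\<bar> \<le> R\<close> the scheme is frozen to its supersolution \<open>Phi + w\<close>, which is
  what makes the solution unbounded in space in the limit.\<close>

primrec U :: "nat \<Rightarrow> int \<Rightarrow> real" where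
  "U 0 = (\<lambda>i. k + W i)"
| "U (Suc n) = (\<lambda>i. if \<bar>i\<bar> \<le> int R then T (U n) i else Phi (Suc n) + W i)"

lemma T_W: "T W i = W i"
  using w_steady[OF \<delta>_pos, of i] \<delta>_pos by (simp add: T_def)

lemma T_const: "T (\<lambda>_. c) i = c - h * f c"
  by (simp add: T_def)

text \<open>The flux of \<open>W\<close> balances f(W), not f(c + W); superadditivity of f leaves at
  least f(c) to drive the decay of the constant.\<close>

lemma T_barrier: "0 \<le> c \<Longrightarrow> T (\<lambda>i. c + W i) i \<le> c - h * f c + W i"
proof -
  assume c: "0 \<le> c"
  have "T (\<lambda>i. c + W i) i = c + W i + h * (f (W i) - f (c + W i))"
    using w_steady[OF \<delta>_pos, of i] \<delta>_pos by (simp add: T_def)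
  moreover have "h * (f (W i) - f (c + W i)) \<le> h * (- f c)"
    using f_superadd[of c "W i"] c w_ge_1[OF \<delta>_pos, of i] h_pos by (intro mult_left_mono) auto
  ultimately show ?thesis by simp
qed

lemma W_le: "\<bar>i\<bar> \<le> int R + 1 \<Longrightarrow> W i \<le> M - k"
  using w_mono[OF \<delta>_pos, of i "int R + 1"] by simp

lemma W_pos: "0 \<le> W i" using w_ge_1[OF \<delta>_pos, of i] by simp

text \<open>Induction with the three comparison functions \<open>W\<close>, the constant
  \<open>Phi n\<close>, and \<open>Phi n + W\<close>. The operator \<open>T\<close> carries the
  first two exactly to the bounds of the next step and the third below its bound;
  \<open>T_mono\<close> does the rest inside the window, and freezing gives the bounds
  outside.\<close>

lemma U_bounds: "W i \<le> U n i \<and> Phi n \<le> U n i \<and> U n i \<le> Phi n + W i"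
proof (induction n arbitrary: i)
  case 0 then show ?case using k_ge_1 W_pos[of i] by simp
next
  case (Suc n)
  show ?case
  proof (cases "\<bar>i\<bar> \<le> int R")
    case True
    then have l: "\<bar>l\<bar> \<le> int R + 1" if "i - 1 \<le> l" "l \<le> i + 1" for l using that by auto
    have "T W i \<le> T (U n) i"
      using Suc W_le Phi_bounds[of n] W_pos by (intro T_mono) (smt (verit) l)
    moreover have "T (\<lambda>_. Phi n) i \<le> T (U n) i"
      using Suc W_le Phi_bounds[of n] W_pos by (intro T_mono) (smt (verit) l)
    moreover have "T (U n) i \<le> T (\<lambda>i. Phi n + W i) i"
      using Suc W_le Phi_bounds[of n] W_pos by (intro T_mono) (smt (verit) l)
    ultimately show ?thesis using True T_barrier[of "Phi n" i] Phi_bounds[of n]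
      by (simp add: T_W T_const)
  next
    case False
    then show ?thesis using Phi_bounds[of "Suc n"] W_pos[of i] by simp
  qed
qed

lemma U_nonneg: "0 \<le> U n i" using U_bounds[of i n] W_pos[of i] by linarith

lemma U_ge_1: "1 \<le> U n i" using U_bounds[of i n] w_ge_1[OF \<delta>_pos, of i] by linarith

lemma U_le_M: "\<bar>i\<bar> \<le> int R + 1 \<Longrightarrow> U n i \<le> M"
  using U_bounds[of i n] W_le[of i] Phi_bounds[of n] by linarith

text \<open>The initial value is a supersolution, so the first step goes down, and monotonicity of
  \<open>T\<close> reproduces this at every later step.\<close>

lemma U_Suc_le: "U (Suc n) i \<le> U n i"
proof (induction n arbitrary: i)
  case 0
  show ?case using U_bounds[of i 1] Phi_bounds[of 1] by simp
next
  case (Suc n)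
  show ?case
  proof (cases "\<bar>i\<bar> \<le> int R")
    case True
    have "T (U (Suc n)) i \<le> T (U n) i"
      using Suc U_nonneg U_le_M True by (intro T_mono) (auto simp del: U.simps)
    then show ?thesis using True by simp
  next
    case False
    then show ?thesis using Phi_Suc_le[of "Suc n"] by simp
  qed
qed

lemma U_antimono: "n \<le> m \<Longrightarrow> U m i \<le> U n i"
  by (rule lift_Suc_antimono_le[of "\<lambda>n. U n i"]) (rule U_Suc_le)

section \<open>One-sided flux bound, slope bound and modulus in time\<close>

definition D :: "nat \<Rightarrow> int \<Rightarrow> real" where
  "D n i = (U n (i + 1) - U n i) / \<delta>"

lemma U_step: "U n (i + 1) = U n i + \<delta> * D n i"
  using \<delta>_pos by (simp add: D_def)

lemma U_eq:
  assumes "\<bar>i\<bar> \<le> int R"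
  shows "(U (Suc n) i - U n i) / h = (j (D n i) - j (D n (i - 1))) / \<delta> - f (U n i)"
  using assms h_pos by (simp add: T_def D_def)

text \<open>The time difference in the scheme is nonpositive, so the divergence of the flux is at
  most the absorption. The slope bound uses this one side only.\<close>

lemma flux_step:
  assumes "\<bar>i\<bar> \<le> int R"
  shows "j (D n i) - j (D n (i - 1)) \<le> \<delta> * f (U n i)"
proof -
  have "(U (Suc n) i - U n i) / h \<le> 0"
    using U_Suc_le[of n i] h_pos by (intro divide_nonpos_pos) auto
  then have "(j (D n i) - j (D n (i - 1))) / \<delta> \<le> f (U n i)"
    using U_eq[OF assms, of n] by linarith
  then show ?thesis using \<delta>_pos by (simp add: field_simps)
qed

lemma flux_le:
  assumes "\<And>l. i < l \<Longrightarrow> l \<le> i + int m \<Longrightarrow> \<bar>l\<bar> \<le> int R \<and> U n l \<le> B"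
  shows "j (D n (i + int m)) \<le> j (D n i) + m * \<delta> * f B"
  using assms
proof (induction m)
  case (Suc m)
  have "j (D n (i + int m)) \<le> j (D n i) + m * \<delta> * f B"
    using Suc.prems by (intro Suc.IH) auto
  moreover have "j (D n (i + int (Suc m))) - j (D n (i + int (Suc m) - 1)) \<le> \<delta> * f (U n (i + int (Suc m)))"
    using Suc.prems by (intro flux_step) auto
  moreover have "\<delta> * f (U n (i + int (Suc m))) \<le> \<delta> * f B"
    using Suc.prems[of "i + int (Suc m)"] \<delta>_pos f_le by simp
  ultimately show ?case by (simp add: algebra_simps)
qed simp

lemma U_telescope: "U n (i + int m) = U n i + \<delta> * (\<Sum>q<m. D n (i + int q))"
proof (induction m)
  case (Suc m)
  then show ?case using U_step[of n "i + int m"] by (simp add: algebra_simps)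
qed simp

text \<open>If the flux at i were above f(B) + j(B), then at distance at most 1 to the left it could
  be smaller by at most f(B), so the slope would exceed B on m + 1 cells. These cover a length at
  least 1, and \<open>U\<close> would rise by more than B although it stays in [0, B]. A very
  negative flux is excluded likewise by going right.\<close>

lemma slope_bound:
  assumes m: "1 \<le> (m + 1) * \<delta>" "m * \<delta> \<le> 1"
    and B: "\<And>l. i - int m \<le> l \<Longrightarrow> l \<le> i + int m + 1 \<Longrightarrow> \<bar>l\<bar> \<le> int R \<and> U n l \<le> B"
  shows "\<bar>j (D n i)\<bar> \<le> f B + j B"
proof -
  have B1: "1 \<le> B" using U_ge_1[of n i] B[of i] by simp
  have fB: "0 \<le> f B" using B1 f_nonneg by simp
  have qm: "q * \<delta> * f B \<le> f B" if "q \<le> m" for q :: nat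
  proof -
    have "q * \<delta> \<le> m * \<delta>" using that \<delta>_pos by simp
    then have "q * \<delta> * f B \<le> 1 * f B" using m(2) fB by (intro mult_right_mono) auto
    then show ?thesis by simp
  qed
  have Bm: "B \<le> \<delta> * (real (Suc m) * B)"
    using mult_right_mono[OF m(1), of B] B1 by (simp add: algebra_simps)
  have "j (D n i) \<le> f B + j B"
  proof (rule ccontr)
    assume *: "\<not> ?thesis"
    have D: "B < D n (i - int q)" if "q \<le> m" for q
    proof -
      have "j (D n ((i - int q) + int q)) \<le> j (D n (i - int q)) + q * \<delta> * f B"
        using B that by (intro flux_le) auto
      then have "j B < j (D n (i - int q))" using * qm[OF that] unfolding diff_add_cancel by linarith
      then show ?thesis by (simp only: j_less_iff)
    qed
    have "(\<Sum>q<Suc m. B) < (\<Sum>q<Suc m. D n (i - int m + int q))"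
    proof (rule sum_strict_mono)
      fix q assume "q \<in> {..<Suc m}"
      then show "B < D n (i - int m + int q)" using D[of "m - q"] by (simp add: of_nat_diff algebra_simps)
    qed (auto simp: lessThan_Suc)
    then have "\<delta> * (real (Suc m) * B) < \<delta> * (\<Sum>q<Suc m. D n (i - int m + int q))"
      using \<delta>_pos by simp
    then have "B < U n (i - int m + int (Suc m)) - U n (i - int m)"
      using Bm unfolding U_telescope by linarith
    moreover have "U n (i - int m + int (Suc m)) \<le> B" using B[of "i + 1"] by (simp add: algebra_simps)
    ultimately show False using U_nonneg[of n "i - int m"] by linarith
  qed
  moreover have "- (f B + j B) \<le> j (D n i)"
  proof (rule ccontr)
    assume *: "\<not> ?thesis"
    have D: "D n (i + int q) < - B" if "q \<le> m" for q
    proof -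
      have "j (D n (i + int q)) \<le> j (D n i) + q * \<delta> * f B"
        using B that by (intro flux_le) auto
      then have "j (D n (i + int q)) < j (- B)" using * qm[OF that] unfolding j_minus by linarith
      then show ?thesis by (simp only: j_less_iff)
    qed
    have "(\<Sum>q<Suc m. D n (i + int q)) < (\<Sum>q<Suc m. - B)"
      by (rule sum_strict_mono) (use D in auto)
    then have "\<delta> * (\<Sum>q<Suc m. D n (i + int q)) < \<delta> * (\<Sum>q<Suc m. - B)"
      using \<delta>_pos by (simp only: mult_less_cancel_left_pos)
    also have "\<dots> \<le> - B" using Bm by (simp add: algebra_simps)
    finally have "U n (i + int (Suc m)) < U n i - B"
      using U_telescope[of n i "Suc m"] by linarith
    moreover have "U n i \<le> B" using B[of i] by simp
    ultimately show False using U_nonneg[of n "i + int (Suc m)"] by linarith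
  qed
  ultimately show ?thesis by linarith
qed

text \<open>Summing the scheme over a block telescopes the fluxes, so only the two end fluxes and
  the absorption remain.\<close>

lemma mass_step:
  assumes "\<And>l. i \<le> l \<Longrightarrow> l < i + int K \<Longrightarrow> \<bar>l\<bar> \<le> int R \<and> U n l \<le> B"
    and "\<bar>j (D n (i - 1))\<bar> \<le> C" "\<bar>j (D n (i + int K - 1))\<bar> \<le> C"
  shows "(\<Sum>q<K. \<delta> * (U n (i + int q) - U (Suc n) (i + int q))) \<le> h * (2 * C + K * \<delta> * f B)"
proof -
  have "\<delta> * (U n (i + int q) - U (Suc n) (i + int q))
      \<le> h * (j (D n (i - 1 + int q)) - j (D n (i - 1 + int (Suc q)))) + h * (\<delta> * f B)"
    if "q < K" for q
  proof -
    have "(U (Suc n) (i + int q) - U n (i + int q)) / h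
        = (j (D n (i + int q)) - j (D n (i + int q - 1))) / \<delta> - f (U n (i + int q))"
      using assms(1)[of "i + int q"] that by (intro U_eq) auto
    then have "\<delta> * (U n (i + int q) - U (Suc n) (i + int q))
        = h * (j (D n (i + int q - 1)) - j (D n (i + int q))) + h * (\<delta> * f (U n (i + int q)))"
      using \<delta>_pos h_pos by (simp add: field_simps)
    moreover have "h * (\<delta> * f (U n (i + int q))) \<le> h * (\<delta> * f B)"
      using assms(1)[of "i + int q"] that h_pos \<delta>_pos f_le by simp
    ultimately show ?thesis by (simp add: algebra_simps)
  qed
  then have "(\<Sum>q<K. \<delta> * (U n (i + int q) - U (Suc n) (i + int q)))
      \<le> (\<Sum>q<K. h * (j (D n (i - 1 + int q)) - j (D n (i - 1 + int (Suc q)))) + h * (\<delta> * f B))"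
    by (intro sum_mono) auto
  also have "\<dots> = h * (j (D n (i - 1)) - j (D n (i - 1 + int K))) + K * (h * (\<delta> * f B))"
    using sum_lessThan_telescope'[of "\<lambda>q. j (D n (i - 1 + int q))" K]
    by (simp add: sum.distrib flip: sum_distrib_left)
  also have "\<dots> \<le> h * (2 * C) + K * (h * (\<delta> * f B))"
  proof -
    have "j (D n (i - 1)) - j (D n (i - 1 + int K)) \<le> 2 * C"
      using assms(2,3) by (simp add: algebra_simps)
    then show ?thesis using h_pos by simp
  qed
  finally show ?thesis by (simp add: algebra_simps)
qed

text \<open>The mass lost on a window is controlled by the flux through its ends, and the slope bound
  turns a loss of mass into a pointwise loss. A window of length \<open>sqrt (t - s)\<close> is optimal.\<close>

lemma time_modulus:
  assumes "n \<le> n'"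
    and B: "\<And>l \<nu>. i - 1 \<le> l \<Longrightarrow> l \<le> i + int K \<Longrightarrow> n \<le> \<nu> \<Longrightarrow>
      \<bar>l\<bar> \<le> int R \<and> U \<nu> l \<le> B \<and> \<bar>j (D \<nu> l)\<bar> \<le> C \<and> \<bar>D \<nu> l\<bar> \<le> \<Lambda>"
  shows "(U n i - U n' i) * (K * \<delta>) \<le> (real n' - real n) * h * (2 * C + K * \<delta> * f B) + 2 * \<Lambda> * (K * \<delta>)\<^sup>2"
proof -
  have mass: "(\<Sum>q<K. \<delta> * (U n (i + int q) - U (n + m) (i + int q))) \<le> m * (h * (2 * C + K * \<delta> * f B))" for m
  proof (induction m)
    case (Suc m)
    have "(\<Sum>q<K. \<delta> * (U (n + m) (i + int q) - U (Suc (n + m)) (i + int q))) \<le> h * (2 * C + K * \<delta> * f B)"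
      using B[of _ "n + m"] by (intro mass_step) auto
    moreover have "(\<Sum>q<K. \<delta> * (U n (i + int q) - U (n + Suc m) (i + int q)))
      = (\<Sum>q<K. \<delta> * (U n (i + int q) - U (n + m) (i + int q)))
        + (\<Sum>q<K. \<delta> * (U (n + m) (i + int q) - U (Suc (n + m)) (i + int q)))"
      by (simp add: algebra_simps flip: sum.distrib del: U.simps)
    ultimately show ?case using Suc by (simp add: algebra_simps del: U.simps)
  qed simp
  \<comment> \<open>Within the window a value differs from the one at i by at most slope bound times
    window length. Summed over the window, and at both times, this is the term 2 \<Lambda> (K
    \<delta>)^2.\<close>
  have near: "\<bar>U \<nu> (i + int q) - U \<nu> i\<bar> \<le> \<delta> * (K * \<Lambda>)" if "n \<le> \<nu>" "q < K" for \<nu> q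
  proof -
    have L: "0 \<le> \<Lambda>" using B[of i \<nu>] that by auto
    have "\<bar>\<Sum>r<q. D \<nu> (i + int r)\<bar> \<le> (\<Sum>r<q. \<Lambda>)"
      using B that by (intro order_trans[OF sum_abs] sum_mono) auto
    also have "\<dots> \<le> K * \<Lambda>" using that L by (simp add: mult_right_mono)
    finally have "\<delta> * \<bar>\<Sum>r<q. D \<nu> (i + int r)\<bar> \<le> \<delta> * (K * \<Lambda>)"
      using \<delta>_pos by simp
    then show ?thesis using \<delta>_pos by (simp add: U_telescope[of \<nu> i q] abs_mult)
  qed
  have "(\<Sum>q<K. \<delta> * (U n i - U n' i - 2 * (\<delta> * (K * \<Lambda>))))
      \<le> (\<Sum>q<K. \<delta> * (U n (i + int q) - U n' (i + int q)))"
  proof (intro sum_mono mult_left_mono)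
    fix q assume "q \<in> {..<K}"
    then show "U n i - U n' i - 2 * (\<delta> * (K * \<Lambda>)) \<le> U n (i + int q) - U n' (i + int q)"
      using near[of n q] near[of n' q] assms(1) by auto
  qed (use \<delta>_pos in auto)
  also have "\<dots> \<le> (n' - n) * (h * (2 * C + K * \<delta> * f B))"
    using mass[of "n' - n"] assms(1) by simp
  finally show ?thesis using assms(1)
    by (simp add: algebra_simps power2_eq_square of_nat_diff)
qed

end

section \<open>Bounds independent of the mesh\<close>

context absorption begin

lemma jinv_nonneg_eq: "0 \<le> s \<Longrightarrow> jinv p s = s powr (1 / (p - 1))"
  by (cases "s = 0") (auto simp: jinv_def)

end

text \<open>The hypothesis \<open>osgood\<close> bounds solutions of the ordinary differential
  equation at positive times uniformly in their initial value; \<open>no_large_solution\<close> is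
  the failure of the Keller-Osserman condition, so steady states cannot blow up at a finite
  distance.\<close>

locale flat_absorption = absorption +
  fixes F :: "real \<Rightarrow> real"
  assumes F_eq: "\<And>s. F s = (LBINT \<sigma>=0..s. f \<sigma>)"
    and osgood: "(\<integral>\<^sup>+s\<in>{1..}. ennreal (1 / f s) \<partial>lborel) < \<infinity>"
    and no_large_solution: "(\<integral>\<^sup>+s\<in>{1..}. ennreal (1 / F s powr (1 / p)) \<partial>lborel) = \<infinity>"
begin

section \<open>Growth of the discrete steady state\<close>

lemma F_deriv: "(F has_real_derivative f s) (at s)"
proof -
  \<comment> \<open>An interval with s in its interior that also contains the base point 0, whatever
    the sign of s.\<close>
  let ?a = "min 0 s - 1" and ?b = "max 0 s + 1"
  have "((\<lambda>u. LBINT y=ereal 0..ereal u. f y) has_vector_derivative f s) (at s within {?a..?b})"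
    using continuous_on_subset[OF f_cont]
    by (intro interval_integral_FTC2) (auto simp: zero_ereal_def[symmetric])
  moreover have "at s within {?a..?b} = at s"
    by (rule at_within_interior) auto
  moreover have "F = (\<lambda>u. LBINT y=ereal 0..ereal u. f y)"
    by (auto simp: F_eq zero_ereal_def)
  ultimately show ?thesis by (simp add: has_real_derivative_iff_has_vector_derivative)
qed

lemma F_0: "F 0 = 0" by (simp add: F_eq zero_ereal_def)

lemma F_diff_bounds:
  assumes "a \<le> b"
  shows "(b - a) * f a \<le> F b - F a \<and> F b - F a \<le> (b - a) * f b"
proof (cases "a = b")
  case False
  then have "a < b" using assms by simp
  then obtain z where "a < z" "z < b" "F b - F a = (b - a) * f z"
    using MVT2[of a b F f] F_deriv by blast
  then show ?thesis using assms f_le[of a z] f_le[of z b] by (auto intro!: mult_left_mono)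
qed simp

lemma F_mono: "0 \<le> a \<Longrightarrow> a \<le> b \<Longrightarrow> F a \<le> F b"
  using F_diff_bounds[of a b] f_nonneg[of a] mult_nonneg_nonneg[of "b - a" "f a"] by linarith

lemma F_pos: assumes "1 \<le> s" shows "0 < F s"
proof -
  have "0 < f (1/2)" by (rule f_pos) simp
  then have "0 < F 1" using F_diff_bounds[of "1/2" 1] F_mono[of 0 "1/2"] F_0 by simp
  then show ?thesis using F_mono[of 1 s] assms by simp
qed

lemma F_measurable [measurable]: "F \<in> borel_measurable borel"
  by (intro borel_measurable_continuous_onI DERIV_continuous_on[of UNIV F f])
    (auto intro: F_deriv)

text \<open>Discrete first integral \<open>\<bar>w'\<bar>\<^sup>p \<le> p / (p - 1) (F(w) - F(1))\<close> of the steady equation.\<close>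

lemma steady_flux_powr_le:
  assumes "d > 0"
  shows "steady_flux d i powr (p / (p - 1)) \<le> p / (p - 1) * (F (steady d (Suc i)) - F 1)"
proof -
  \<comment> \<open>The conjugate exponent: the flux to the power q is the slope to the power
    p.\<close>
  define q where "q = p / (p - 1)"
  have q: "q \<ge> 1" "q - 1 = 1 / (p - 1)" using p2 by (simp_all add: q_def field_simps)
  have slope: "steady_flux d i powr (q - 1) * (d * f (steady d i)) \<le> F (steady d (Suc i)) - F (steady d i)" for i
  proof -
    have "steady_flux d i powr (q - 1) = jinv p (steady_flux d i)"
      using steady_JJ_bounds[OF assms, of i] q by (simp add: jinv_nonneg_eq)
    then have "steady_flux d i powr (q - 1) * (d * f (steady d i)) = (steady d (Suc i) - steady d i) * f (steady d i)"
      by simp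
    moreover have "steady d i \<le> steady d (Suc i)" by (rule steady_mono[OF assms]) simp
    ultimately show ?thesis using F_diff_bounds[of "steady d i" "steady d (Suc i)"] by argo
  qed
  have "steady_flux d i powr q \<le> q * (F (steady d (Suc i)) - F 1)"
  proof (induction i)
    case 0
    have J: "0 < steady_flux d 0" using assms f_pos[of 1] by simp
    have "steady_flux d 0 powr q = steady_flux d 0 powr (q - 1) * steady_flux d 0"
      using J powr_add[of "steady_flux d 0" "q - 1" 1] by simp
    also have "\<dots> \<le> steady_flux d 0 powr (q - 1) * (d * f (steady d 0))"
      using assms f_pos[of 1] by (intro mult_left_mono) auto
    also have "\<dots> \<le> F (steady d (Suc 0)) - F 1" using slope[of 0] by simp
    also have "\<dots> \<le> q * (F (steady d (Suc 0)) - F 1)"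
      using q F_mono[of 1 "steady d (Suc 0)"] steady_JJ_bounds[OF assms, of "Suc 0"]
      by (intro mult_le_cancel_right1[THEN iffD2]) auto
    finally show ?case .
  next
    case (Suc i)
    have "steady_flux d i \<le> steady_flux d (Suc i)"
      unfolding steady_flux_Suc using assms f_nonneg[of "steady d (Suc i)"] steady_JJ_bounds[OF assms, of "Suc i"]
      by (simp del: steady_simps)
    \<comment> \<open>Convexity of the power q, estimated at the new flux. The derivative there is q
      times the slope leading from node i + 1 to node i + 2, so the increment is paid for by
      \<open>F\<close> one node further on.\<close>
    then have "steady_flux d (Suc i) powr q - steady_flux d i powr q
        \<le> q * steady_flux d (Suc i) powr (q - 1) * (steady_flux d (Suc i) - steady_flux d i)"
      using q steady_JJ_bounds[OF assms, of i] by (intro powr_diff_le) auto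
    also have "\<dots> = q * (steady_flux d (Suc i) powr (q - 1) * (d * f (steady d (Suc i))))"
      by (simp add: steady_flux_Suc del: steady_simps)
    also have "\<dots> \<le> q * (F (steady d (Suc (Suc i))) - F (steady d (Suc i)))"
      using q slope[of "Suc i"] by (intro mult_left_mono) auto
    finally show ?case using Suc by (simp add: algebra_simps del: steady_simps)
  qed
  then show ?thesis by (simp add: q_def)
qed

lemma steady_flux_powr_le':
  assumes "d > 0"
  shows "steady_flux d i powr (p / (p - 1)) \<le> p / (p - 1) * F (steady d (Suc i))"
proof -
  have "p / (p - 1) * (F (steady d (Suc i)) - F 1) \<le> p / (p - 1) * F (steady d (Suc i))"
    using F_pos[of 1] p2 by (intro mult_left_mono) auto
  then show ?thesis using steady_flux_powr_le[OF assms, of i] by linarith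
qed

lemma slope_le:
  assumes "d > 0"
  shows "jinv p (steady_flux d i) \<le> (p / (p - 1) * F (steady d (Suc i))) powr (1 / p)"
proof -
  have J: "0 \<le> steady_flux d i" using steady_JJ_bounds[OF assms] by blast
  have v: "1 \<le> steady d (Suc i)" using steady_JJ_bounds[OF assms] by blast
  have "jinv p (steady_flux d i) = (steady_flux d i powr (p / (p - 1))) powr (1 / p)"
    using p2 J by (simp add: jinv_nonneg_eq powr_powr)
  also have "\<dots> \<le> (p / (p - 1) * F (steady d (Suc i))) powr (1 / p)"
    using steady_flux_powr_le'[OF assms, of i] p2 by (intro powr_mono2) auto
  finally show ?thesis .
qed

text \<open>In contrast to \<open>slope_le\<close>, the flux leaving a node is estimated by the
  value at that same node, at the cost of one source term. This controls the next value before
  anything is known about it.\<close>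

lemma steady_flux_le:
  assumes "d > 0"
  shows "steady_flux d i \<le> (p / (p - 1) * F (steady d i)) powr ((p - 1) / p) + d * f (steady d i)"
proof (cases i)
  case 0
  have "0 \<le> (p / (p - 1) * F 1) powr ((p - 1) / p)" by simp
  moreover have "0 \<le> d * f 1" using assms f_pos[of 1] by simp
  ultimately show ?thesis using 0 by simp
next
  case (Suc l)
  have J: "0 \<le> steady_flux d l" using steady_JJ_bounds[OF assms] by blast
  have "steady_flux d l = (steady_flux d l powr (p / (p - 1))) powr ((p - 1) / p)"
    using p2 J by (simp add: powr_powr)
  also have "\<dots> \<le> (p / (p - 1) * F (steady d i)) powr ((p - 1) / p)"
    using steady_flux_powr_le'[OF assms, of l] p2 Suc by (intro powr_mono2) auto
  finally show ?thesis using Suc by (simp add: steady_flux_Suc del: steady_simps)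
qed

lemma ex_level:
  fixes B :: real
  obtains m :: real where "1 \<le> m"
    "ennreal B < (\<integral>\<^sup>+s. ennreal (1 / F s powr (1 / p)) * indicator {1..m} s \<partial>lborel)"
proof -
  define \<nu> where "\<nu> = density lborel (\<lambda>s. ennreal (1 / F s powr (1 / p)))"
  have em: "emeasure \<nu> A = (\<integral>\<^sup>+s. ennreal (1 / F s powr (1 / p)) * indicator A s \<partial>lborel)"
    if "A \<in> sets borel" for A
    unfolding \<nu>_def using that by (subst emeasure_density) auto
  have "(\<lambda>n. emeasure \<nu> {1..real n}) \<longlonglongrightarrow> emeasure \<nu> (\<Union>n. {1..real n})"
    by (rule Lim_emeasure_incseq) (auto simp: incseq_def \<nu>_def)
  moreover have "(\<Union>n. {1..real n}) = {1..}"
  proof (intro equalityI subsetI)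
    fix x :: real assume "x \<in> {1..}"
    then show "x \<in> (\<Union>n. {1..real n})" using real_arch_simple[of x] by auto
  qed auto
  ultimately have "(\<lambda>n. emeasure \<nu> {1..real n}) \<longlonglongrightarrow> \<infinity>"
    using no_large_solution by (simp add: em)
  then have "\<forall>\<^sub>F n in sequentially. ennreal B < emeasure \<nu> {1..real n}"
    by (rule order_tendstoD) simp
  then obtain n where "n \<ge> 1" "ennreal B < emeasure \<nu> {1..real n}"
    unfolding eventually_sequentially by (meson linear order_refl)
  then show ?thesis using that[of "real n"] by (simp add: em)
qed

text \<open>The first integral is a separable inequality w' \<le> c F(w)^(1/p), so the integral of
  F^(-1/p) from 1 to w grows at most linearly with distance; as the full integral diverges, w is
  bounded on bounded intervals, uniformly in the mesh. The discrete inequality is implicit, with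
  \<open>F\<close> at the next node, and most of the work is to return to the present node for small
  d.\<close>

lemma steady_local_bound:
  fixes r :: real
  obtains B d0 where "0 < d0" "\<And>d i. 0 < d \<Longrightarrow> d \<le> d0 \<Longrightarrow> d * real i \<le> r \<Longrightarrow> steady d i \<le> B"
proof -
  define c where "c = (p / (p - 1)) powr (1 / p)"
  have c: "c > 0" using p2 by (simp add: c_def)
  \<comment> \<open>The level B is chosen so that reaching it would need more of the integral than
    distance r allows. The factor 2 pays for the passage from the next node to the present
    one.\<close>
  obtain B where B: "1 \<le> B"
    "ennreal (2 * c * r) < (\<integral>\<^sup>+s. ennreal (1 / F s powr (1 / p)) * indicator {1..B} s \<partial>lborel)"
    using ex_level by blast
  \<comment> \<open>While the value is at most B, the slope is at most S. The threshold
    \<open>d0\<close> then lets one step raise the value by at most 1 and \<open>F\<close> by at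
    most \<open>F 1\<close>, so that \<open>F\<close> at most doubles.\<close>
  define S where "S = jinv p ((p / (p - 1) * F B) powr ((p - 1) / p) + f B)"
  define d0 where "d0 = min 1 (min (1 / (S + 1)) (F 1 / (f (B + 1) * (S + 1))))"
  have S: "0 \<le> S" unfolding S_def using f_nonneg[of B] B by simp
  have fB: "0 < f (B + 1)" using B by (intro f_pos) simp
  have d0: "d0 > 0" using S F_pos[of 1] fB by (simp add: d0_def)
  have step: "steady d (Suc i) - steady d i \<le> 2 * c * d * F (steady d i) powr (1 / p)"
    if d: "0 < d" "d \<le> d0" and v: "steady d i \<le> B" for d i
  proof -
    have v1: "1 \<le> steady d i" using steady_JJ_bounds[OF d(1)] by blast
    have d1: "d \<le> 1" "d * S \<le> 1" "f (B + 1) * (d * S) \<le> F 1"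
    proof -
      have "d \<le> 1" "d \<le> 1 / (S + 1)" "d \<le> F 1 / (f (B + 1) * (S + 1))"
        using d by (auto simp: d0_def)
      then have "d * (S + 1) \<le> 1" "d * (f (B + 1) * (S + 1)) \<le> F 1"
        using S fB by (simp_all add: pos_le_divide_eq)
      moreover have "d * S \<le> d * (S + 1)" using d by simp
      moreover have "d * (f (B + 1) * S) \<le> d * (f (B + 1) * (S + 1))" using d fB by simp
      ultimately show "d \<le> 1" "d * S \<le> 1" "f (B + 1) * (d * S) \<le> F 1"
        using \<open>d \<le> 1\<close> by (auto simp: mult_ac)
    qed
    have "steady_flux d i \<le> (p / (p - 1) * F (steady d i)) powr ((p - 1) / p) + d * f (steady d i)"
      using steady_flux_le d by simp
    also have "\<dots> \<le> (p / (p - 1) * F B) powr ((p - 1) / p) + 1 * f B"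
      using v v1 p2 d1 d F_mono[of "steady d i" B] F_pos[of "steady d i"] f_le[of "steady d i" B] f_nonneg[of "steady d i"]
      by (intro add_mono powr_mono2 mult_mono mult_left_mono) auto
    finally have JS: "jinv p (steady_flux d i) \<le> S" by (simp add: S_def)
    then have dS: "d * jinv p (steady_flux d i) \<le> d * S" using d by simp
    then have v2: "steady d (Suc i) \<le> B + 1" "steady d i \<le> steady d (Suc i)"
      using d1 v steady_mono[OF d(1), of i "Suc i"] by auto
    have "F (steady d (Suc i)) - F (steady d i) \<le> (steady d (Suc i) - steady d i) * f (steady d (Suc i))"
      using F_diff_bounds v2 by blast
    also have "\<dots> \<le> (d * S) * f (B + 1)"
      using dS v2 f_le f_nonneg v1 S d by (intro mult_mono) auto
    also have "\<dots> \<le> F (steady d i)" using d1 F_mono[of 1 "steady d i"] v1 by (simp add: mult_ac)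
    finally have F2: "F (steady d (Suc i)) \<le> 2 * F (steady d i)" by simp
    \<comment> \<open>Doubling \<open>F\<close> costs a factor 2^(1/p), estimated by 2 through 2
      \<le> 2^p.\<close>
    have "F (steady d (Suc i)) powr (1 / p) \<le> (2 powr p * F (steady d i)) powr (1 / p)"
    proof (rule powr_mono2)
      have "2 powr 1 \<le> 2 powr p" using p2 by (intro powr_mono) auto
      then have "2 * F (steady d i) \<le> 2 powr p * F (steady d i)"
        using F_pos[OF v1] by (intro mult_right_mono) auto
      then show "F (steady d (Suc i)) \<le> 2 powr p * F (steady d i)" using F2 by linarith
      show "0 \<le> F (steady d (Suc i))" using F_pos[of "steady d (Suc i)"] v1 v2 by linarith
    qed (use p2 in auto)
    also have "\<dots> = 2 * F (steady d i) powr (1 / p)"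
      using p2 F_pos[OF v1] by (simp add: powr_mult powr_powr)
    finally have "c * F (steady d (Suc i)) powr (1 / p) \<le> c * (2 * F (steady d i) powr (1 / p))"
      using c by simp
    moreover have "jinv p (steady_flux d i) \<le> c * F (steady d (Suc i)) powr (1 / p)"
    proof -
      have "0 \<le> F (steady d (Suc i))" using F_pos[of "steady d (Suc i)"] v1 v2 by linarith
      then show ?thesis
        using slope_le[OF d(1), of i] p2 powr_mult[of "p / (p - 1)" "F (steady d (Suc i))" "1 / p"]
        unfolding c_def by simp
    qed
    ultimately have "d * jinv p (steady_flux d i) \<le> d * (c * (2 * F (steady d i) powr (1 / p)))"
      using d by (intro mult_left_mono) auto
    then show ?thesis by (simp add: mult_ac)
  qed
  let ?I = "\<lambda>m. \<integral>\<^sup>+s. ennreal (1 / F s powr (1 / p)) * indicator {1..m} s \<partial>lborel"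
  have "steady d i \<le> B \<and> ?I (steady d i) \<le> ennreal (2 * c * (d * i))"
    if d: "0 < d" "d \<le> d0" and r: "d * real i \<le> r" for d i
    using r
  proof (induction i)
    case 0
    have "?I 1 \<le> (\<integral>\<^sup>+(s::real). ennreal (1 / F 1 powr (1 / p)) * indicator {1} s \<partial>lborel)"
      by (intro nn_integral_mono) (auto split: split_indicator)
    then show ?case using B by (simp add: nn_integral_cmult)
  next
    case (Suc i)
    have "d * real i \<le> r" using Suc.prems d by (simp add: algebra_simps)
    then have IH: "steady d i \<le> B" "?I (steady d i) \<le> ennreal (2 * c * (d * i))" using Suc.IH by auto
    have v: "1 \<le> steady d i" "steady d i \<le> steady d (Suc i)" using steady_JJ_bounds[OF d(1), of i] steady_mono[OF d(1), of i "Suc i"] by auto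
    have Fv: "0 < F (steady d i) powr (1 / p)" using F_pos[OF v(1)] by simp
    \<comment> \<open>Beyond the present value the integrand is at most its value there, so the new
      piece of the integral is at most the step divided by F^(1/p), that is at most 2 c d.\<close>
    have "?I (steady d (Suc i)) \<le> (\<integral>\<^sup>+s. ennreal (1 / F s powr (1 / p)) * indicator {1..steady d i} s
        + ennreal (1 / F (steady d i) powr (1 / p)) * indicator {steady d i..steady d (Suc i)} s \<partial>lborel)"
    proof (intro nn_integral_mono)
      fix s :: real
      have "1 / F s powr (1 / p) \<le> 1 / F (steady d i) powr (1 / p)" if "steady d i \<le> s"
        using that v F_mono[of "steady d i" s] F_pos[of "steady d i"] F_pos[of s] p2
        by (intro divide_left_mono powr_mono2) auto
      then show "ennreal (1 / F s powr (1 / p)) * indicator {1..steady d (Suc i)} s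
        \<le> ennreal (1 / F s powr (1 / p)) * indicator {1..steady d i} s
        + ennreal (1 / F (steady d i) powr (1 / p)) * indicator {steady d i..steady d (Suc i)} s"
        by (auto split: split_indicator simp del: steady_simps intro: ennreal_leI)
    qed
    also have "\<dots> = ?I (steady d i) + ennreal (1 / F (steady d i) powr (1 / p)) * ennreal (steady d (Suc i) - steady d i)"
      using v by (subst nn_integral_add) (auto simp: nn_integral_cmult simp del: steady_simps)
    finally have I1: "?I (steady d (Suc i)) \<le> \<dots>" .
    have "ennreal (1 / F (steady d i) powr (1 / p)) * ennreal (steady d (Suc i) - steady d i)
      = ennreal ((steady d (Suc i) - steady d i) / F (steady d i) powr (1 / p))"
      using v Fv by (subst ennreal_mult'[symmetric]) auto
    also have "\<dots> \<le> ennreal (2 * c * d)"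
      using step[OF d IH(1)] Fv by (intro ennreal_leI) (simp add: field_simps del: steady_simps)
    finally have "?I (steady d i) + ennreal (1 / F (steady d i) powr (1 / p)) * ennreal (steady d (Suc i) - steady d i)
        \<le> ennreal (2 * c * (d * i)) + ennreal (2 * c * d)"
      using IH(2) by (intro add_mono)
    with I1 have "?I (steady d (Suc i)) \<le> ennreal (2 * c * (d * i)) + ennreal (2 * c * d)"
      by (rule order_trans)
    also have "\<dots> = ennreal (2 * c * (d * Suc i))"
      using c d by (subst ennreal_plus[symmetric]) (auto simp: algebra_simps)
    finally have I: "?I (steady d (Suc i)) \<le> ennreal (2 * c * (d * Suc i))" .
    have "steady d (Suc i) \<le> B"
    proof (rule ccontr)
      assume "\<not> steady d (Suc i) \<le> B"
      then have "?I B \<le> ?I (steady d (Suc i))"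
        by (intro nn_integral_mono) (auto split: split_indicator)
      also have "\<dots> \<le> ennreal (2 * c * r)"
        using I Suc.prems c by (elim order_trans) (intro ennreal_leI mult_left_mono, auto)
      finally show False using B(2) by simp
    qed
    with I show ?case by simp
  qed
  then show ?thesis using that[OF d0] by blast
qed

section \<open>Bounds for the space-independent solution\<close>

lemma ex_tail:
  fixes t :: real
  assumes "t > 0"
  obtains m :: real where "1 \<le> m"
    "(\<integral>\<^sup>+s. ennreal (1 / f s) * indicator {m..} s \<partial>lborel) < ennreal t"
proof -
  define \<nu> where "\<nu> = density lborel (\<lambda>s. ennreal (1 / f s))"
  have em: "emeasure \<nu> A = (\<integral>\<^sup>+s. ennreal (1 / f s) * indicator A s \<partial>lborel)"
    if "A \<in> sets borel" for A
    unfolding \<nu>_def using that by (subst emeasure_density) auto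
  have le: "emeasure \<nu> {real (Suc n)..} \<le> emeasure \<nu> {1..}" for n
    by (intro emeasure_mono) (auto simp: \<nu>_def)
  have "(\<lambda>n. emeasure \<nu> {real (Suc n)..}) \<longlonglongrightarrow> emeasure \<nu> (\<Inter>n. {real (Suc n)..})"
  proof (rule Lim_emeasure_decseq)
    show "emeasure \<nu> {real (Suc n)..} \<noteq> \<infinity>" for n
      using le[of n] osgood by (auto simp: em top_unique)
  qed (auto simp: decseq_def \<nu>_def)
  moreover have "(\<Inter>n. {real (Suc n)..}) = {}"
  proof -
    have "\<exists>n. \<not> real (Suc n) \<le> x" for x
    proof -
      obtain n where "x < real n" using reals_Archimedean2 by blast
      then have "\<not> real (Suc n) \<le> x" by simp
      then show ?thesis ..
    qed
    then show ?thesis by auto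
  qed
  ultimately have "(\<lambda>n. emeasure \<nu> {real (Suc n)..}) \<longlonglongrightarrow> 0" by simp
  then have "\<forall>\<^sub>F n in sequentially. emeasure \<nu> {real (Suc n)..} < ennreal t"
    using assms by (intro order_tendstoD) auto
  then obtain n where "emeasure \<nu> {real (Suc n)..} < ennreal t"
    by (auto simp: eventually_sequentially)
  then show ?thesis using that[of "real (Suc n)"] by (simp add: em)
qed

end

locale flat_scheme = scheme + flat_absorption
begin

text \<open>One Euler step satisfies h = (Phi(n) - Phi(n + 1)) / f(Phi(n)), which is at most the
  integral of 1 / f over the interval passed, since f increases. Adding the steps compares elapsed
  time with the tail of a convergent integral in which k no longer occurs. The level m \<ge> 1 keeps
  f positive on the range used.\<close>

lemma Phi_tail:
  assumes "1 \<le> m" "m < Phi n"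
  shows "ennreal (n * h) \<le> (\<integral>\<^sup>+s. ennreal (1 / f s) * indicator {Phi n..} s \<partial>lborel)"
  using assms(2)
proof (induction n)
  case (Suc n)
  let ?I = "\<lambda>A. \<integral>\<^sup>+s. ennreal (1 / f s) * indicator A s \<partial>lborel"
  have le: "Phi (Suc n) \<le> Phi n" by (rule Phi_Suc_le)
  have m: "m < Phi n" using Suc.prems le by linarith
  have fp: "0 < f (Phi n)" using m assms by (intro f_pos) linarith
  have Suc_h: "ennreal (Suc n * h) = ennreal h + ennreal (n * h)"
    using h_pos by (subst ennreal_plus[symmetric]) (auto simp: algebra_simps)
  have "ennreal h = ennreal (1 / f (Phi n)) * ennreal (Phi n - Phi (Suc n))"
    using fp h_pos by (subst ennreal_mult'[symmetric]) auto
  also have "\<dots> = (\<integral>\<^sup>+s. ennreal (1 / f (Phi n)) * indicator {Phi (Suc n)..<Phi n} s \<partial>lborel)"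
    using le by (simp add: nn_integral_cmult del: Phi.simps)
  also have "\<dots> \<le> ?I {Phi (Suc n)..<Phi n}"
  proof (intro nn_integral_mono)
    fix s
    have "1 / f (Phi n) \<le> 1 / f s" if "Phi (Suc n) \<le> s" "s < Phi n"
      using that Suc.prems assms f_le[of s "Phi n"] fp f_pos[of s] by (intro divide_left_mono) auto
    then show "ennreal (1 / f (Phi n)) * indicator {Phi (Suc n)..<Phi n} s
      \<le> ennreal (1 / f s) * indicator {Phi (Suc n)..<Phi n} s"
      by (auto split: split_indicator intro: ennreal_leI simp del: Phi.simps)
  qed
  finally have "ennreal h + ennreal (n * h) \<le> ?I {Phi (Suc n)..<Phi n} + ?I {Phi n..}"
    using Suc.IH[OF m] by (rule add_mono)
  also have "\<dots> = (\<integral>\<^sup>+s. ennreal (1 / f s) * indicator {Phi (Suc n)..<Phi n} s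
      + ennreal (1 / f s) * indicator {Phi n..} s \<partial>lborel)"
    by (rule nn_integral_add[symmetric]) auto
  also have "\<dots> = ?I {Phi (Suc n)..}"
    using le by (intro nn_integral_cong) (auto split: split_indicator simp del: Phi.simps)
  finally show ?case unfolding Suc_h .
qed simp

text \<open>The level m is determined by t alone, so the bound survives k tending to
  infinity.\<close>

lemma Phi_upper:
  assumes "1 \<le> m" "(\<integral>\<^sup>+s. ennreal (1 / f s) * indicator {m..} s \<partial>lborel) < ennreal t" "t \<le> n * h"
  shows "Phi n \<le> m"
proof (rule ccontr)
  assume "\<not> Phi n \<le> m"
  then have m: "m < Phi n" by simp
  have "ennreal t \<le> ennreal (n * h)" using assms by (intro ennreal_leI)
  also have "\<dots> \<le> (\<integral>\<^sup>+s. ennreal (1 / f s) * indicator {Phi n..} s \<partial>lborel)"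
    using Phi_tail[OF assms(1) m] .
  also have "\<dots> \<le> (\<integral>\<^sup>+s. ennreal (1 / f s) * indicator {m..} s \<partial>lborel)"
    using m by (intro nn_integral_mono) (auto split: split_indicator)
  finally show False using assms(2) by simp
qed

text \<open>From above the level m an Euler step cannot fall below m - h f(m), since the step map is
  monotone under the CFL condition; from below m it loses at most h f(m). As k grows this yields the
  blow-up at t = 0.\<close>

lemma Phi_lower:
  assumes "0 \<le> m" "m \<le> k"
  shows "m - n * h * f m \<le> Phi n"
proof (induction n)
  case (Suc n)
  have fm: "0 \<le> h * f m" "0 \<le> n * (h * f m)" using f_nonneg[OF assms(1)] h_pos by auto
  show ?case
  proof (cases "m \<le> Phi n")
    case True
    have "f (Phi n) - f m \<le> f (M + 1) * (Phi n - m)"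
      using True assms Phi_bounds[of n] W_pos[of "int R + 1"] by (intro f_lipschitz) auto
    then have "h * (f (Phi n) - f m) \<le> h * (f (M + 1) * (Phi n - m))" using h_pos by simp
    also have "\<dots> \<le> 1 * (Phi n - m)"
      unfolding mult.assoc[symmetric] using True h_f_le_1 by (intro mult_right_mono) auto
    finally show ?thesis using fm by (simp add: algebra_simps)
  next
    case False
    then have "h * f (Phi n) \<le> h * f m" using h_pos f_le by simp
    then show ?thesis using Suc by (simp add: algebra_simps)
  qed
qed (use assms in simp)

end

context flat_absorption begin

section \<open>Choice of the parameters and local estimates\<close>

text \<open>The window will have (n + 1)^2 cells of width 1 / (n + 1) on each side, hence half-width
  n + 1: windows exhaust the line although the mesh shrinks. The initial level k is n + 1 as well,
  and \<open>cap n\<close> is the resulting bound M of the scheme.\<close>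

definition mesh :: "nat \<Rightarrow> real" where "mesh n = 1 / (real n + 1)"

definition cap :: "nat \<Rightarrow> real" where "cap n = real n + 1 + w (mesh n) (int ((n + 1)\<^sup>2) + 1)"

text \<open>The first entry of the minimum forces convergence to 0, the second is the CFL condition;
  the 1 added to its denominator gives positivity from mere nonnegativity of the rest.\<close>

definition time_step :: "nat \<Rightarrow> real" where
  "time_step n = min (mesh n) (1 / (2 * ((p - 1) * (cap n / mesh n) powr (p - 2)) / (mesh n)\<^sup>2 + f (cap n + 1) + 1))"

text \<open>Piecewise constant extension by rounding down: for t \<ge> 0, translation by one mesh
  width or one time step acts on the indices exactly, without interpolation error.\<close>

definition grid_sol :: "nat \<Rightarrow> real \<Rightarrow> real \<Rightarrow> real" where
  "grid_sol n x t = scheme.U p f (mesh n) (time_step n) (real n + 1) ((n + 1)\<^sup>2) (nat \<lfloor>t / time_step n\<rfloor>) \<lfloor>x / mesh n\<rfloor>"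

definition grid_slope :: "nat \<Rightarrow> real \<Rightarrow> real \<Rightarrow> real" where
  "grid_slope n x t = (grid_sol n (x + mesh n) t - grid_sol n x t) / mesh n"

lemma mesh_pos: "0 < mesh n" and mesh_le_1: "mesh n \<le> 1"
  by (simp_all add: mesh_def)

lemma mesh_tendsto: "mesh \<longlonglongrightarrow> 0"
  using LIMSEQ_inverse_real_of_nat by (simp add: mesh_def[abs_def] inverse_eq_divide add.commute)

lemma cap_pos: "0 < cap n"
  using w_ge_1[OF mesh_pos, of n "int ((n + 1)\<^sup>2) + 1"] unfolding cap_def by linarith

lemma time_step_denom: "0 \<le> 2 * ((p - 1) * (cap n / mesh n) powr (p - 2)) / (mesh n)\<^sup>2 + f (cap n + 1)"
  using p2 cap_pos[of n] f_nonneg[of "cap n + 1"] by (intro add_nonneg_nonneg) auto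

lemma time_step_pos: "0 < time_step n"
proof -
  have "0 < 2 * ((p - 1) * (cap n / mesh n) powr (p - 2)) / (mesh n)\<^sup>2 + f (cap n + 1) + 1"
    using time_step_denom[of n] by linarith
  then show ?thesis unfolding time_step_def using mesh_pos[of n] by simp
qed

lemma time_step_le: "time_step n \<le> mesh n" by (simp add: time_step_def)

lemma time_step_tendsto: "time_step \<longlonglongrightarrow> 0"
  by (rule tendsto_sandwich[OF _ _ tendsto_const mesh_tendsto])
    (auto intro!: always_eventually less_imp_le time_step_pos time_step_le)

lemma flat_scheme_grid: "flat_scheme p f (mesh n) (time_step n) (real n + 1) ((n + 1)\<^sup>2) F"
proof unfold_locales
  show "0 < mesh n" "0 < time_step n" by (rule mesh_pos time_step_pos)+
  show "1 \<le> real n + 1" by simp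
  let ?L = "2 * ((p - 1) * (cap n / mesh n) powr (p - 2)) / (mesh n)\<^sup>2 + f (cap n + 1)"
  have "time_step n * ?L \<le> 1 / (?L + 1) * ?L"
    using time_step_denom[of n] by (intro mult_right_mono) (auto simp: time_step_def)
  also have "\<dots> \<le> 1" using time_step_denom[of n] by simp
  finally show "time_step n * (2 * ((p - 1) * ((real n + 1 + w (mesh n) (int ((n + 1)\<^sup>2) + 1)) / mesh n) powr (p - 2)) / (mesh n)\<^sup>2
    + f (real n + 1 + w (mesh n) (int ((n + 1)\<^sup>2) + 1) + 1)) \<le> 1"
    by (simp only: cap_def)
qed

lemma floor_shift: "\<lfloor>(x + mesh n) / mesh n\<rfloor> = \<lfloor>x / mesh n\<rfloor> + 1" "\<lfloor>(x - mesh n) / mesh n\<rfloor> = \<lfloor>x / mesh n\<rfloor> - 1"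
proof -
  have "(x + mesh n) / mesh n = x / mesh n + 1" "(x - mesh n) / mesh n = x / mesh n - 1"
    using mesh_pos[of n] by (simp_all add: add_divide_distrib diff_divide_distrib)
  then show "\<lfloor>(x + mesh n) / mesh n\<rfloor> = \<lfloor>x / mesh n\<rfloor> + 1" "\<lfloor>(x - mesh n) / mesh n\<rfloor> = \<lfloor>x / mesh n\<rfloor> - 1"
    by simp_all
qed

lemma nat_floor_shift:
  assumes "0 \<le> t" shows "nat \<lfloor>(t + time_step n) / time_step n\<rfloor> = Suc (nat \<lfloor>t / time_step n\<rfloor>)"
proof -
  have "(t + time_step n) / time_step n = t / time_step n + 1"
    using time_step_pos[of n] by (simp add: add_divide_distrib)
  moreover have "0 \<le> \<lfloor>t / time_step n\<rfloor>" using assms time_step_pos[of n] by simp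
  ultimately show ?thesis by (simp add: nat_add_distrib)
qed

lemma grid_sol_antimono: "s \<le> t \<Longrightarrow> grid_sol n x t \<le> grid_sol n x s"
proof -
  interpret S: flat_scheme p f "mesh n" "time_step n" "real n + 1" "(n + 1)\<^sup>2" F by (rule flat_scheme_grid)
  assume "s \<le> t"
  then have "s / time_step n \<le> t / time_step n" using time_step_pos[of n] by (intro divide_right_mono) auto
  then have "nat \<lfloor>s / time_step n\<rfloor> \<le> nat \<lfloor>t / time_step n\<rfloor>" by (intro nat_mono floor_mono)
  then show ?thesis unfolding grid_sol_def by (rule S.U_antimono)
qed

lemma grid_sol_ge_1: "1 \<le> grid_sol n x t"
proof -
  interpret S: flat_scheme p f "mesh n" "time_step n" "real n + 1" "(n + 1)\<^sup>2" F by (rule flat_scheme_grid)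
  show ?thesis unfolding grid_sol_def by (rule S.U_ge_1)
qed

lemma floor_mult_bounds:
  assumes "(0::real) < d"
  shows "d * of_int \<lfloor>x / d\<rfloor> \<le> x" "x < d * of_int \<lfloor>x / d\<rfloor> + d"
proof -
  have "d * of_int \<lfloor>x / d\<rfloor> \<le> d * (x / d)" using assms by (intro mult_left_mono) auto
  then show "d * of_int \<lfloor>x / d\<rfloor> \<le> x" using assms by simp
  have "d * (x / d) < d * (of_int \<lfloor>x / d\<rfloor> + 1)" using assms by (intro mult_strict_left_mono) linarith+
  then show "x < d * of_int \<lfloor>x / d\<rfloor> + d" using assms by (simp add: algebra_simps)
qed

lemma grid_sol_growth: "jinv p (f 1) * (\<bar>x\<bar> - 3) \<le> grid_sol n x t"
proof -
  interpret S: flat_scheme p f "mesh n" "time_step n" "real n + 1" "(n + 1)\<^sup>2" F by (rule flat_scheme_grid)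
  let ?i = "\<lfloor>x / mesh n\<rfloor>"
  have "\<bar>x\<bar> - mesh n \<le> mesh n * \<bar>of_int ?i\<bar>"
    using floor_mult_bounds[OF mesh_pos[of n], where x = x] abs_mult[of "mesh n" "of_int ?i"] mesh_pos[of n] by linarith
  \<comment> \<open>The 3 collects the offset 1 + d of \<open>steady_lower\<close> and one more mesh
    width lost by rounding, all mesh widths being at most 1.\<close>
  then have "\<bar>x\<bar> - 3 \<le> mesh n * real (nat \<bar>?i\<bar>) - 1 - mesh n"
    using mesh_le_1[of n] by simp
  then have "jinv p (f 1) * (\<bar>x\<bar> - 3) \<le> jinv p (f 1) * (mesh n * real (nat \<bar>?i\<bar>) - 1 - mesh n)"
    using f_pos[of 1] by (intro mult_left_mono) auto
  also have "\<dots> \<le> w (mesh n) ?i" unfolding w_def by (rule steady_lower[OF mesh_pos])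
  also have "\<dots> \<le> grid_sol n x t" unfolding grid_sol_def using S.U_bounds by blast
  finally show ?thesis .
qed

text \<open>The lower bound for \<open>Phi\<close> is used at level m + 1, which k = n + 1 reaches
  once n \<ge> m, and \<open>t1\<close> is so short that at most 1 is lost.\<close>

lemma grid_sol_blowup:
  assumes "0 \<le> m"
  obtains t1 n1 where "0 < t1" "\<And>n x t. n1 \<le> n \<Longrightarrow> 0 < t \<Longrightarrow> t \<le> t1 \<Longrightarrow> m \<le> grid_sol n x t"
proof -
  define t1 where "t1 = 1 / (f (m + 1) + 1)"
  have f0: "0 \<le> f (m + 1)" using assms by (intro f_nonneg) simp
  obtain n1 :: nat where n1: "m \<le> real n1" using real_arch_simple by blast
  show ?thesis
  proof
    show "0 < t1" using f0 by (simp add: t1_def)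
    fix n :: nat and x t :: real assume a: "n1 \<le> n" "0 < t" "t \<le> t1"
    interpret S: flat_scheme p f "mesh n" "time_step n" "real n + 1" "(n + 1)\<^sup>2" F by (rule flat_scheme_grid)
    let ?v = "nat \<lfloor>t / time_step n\<rfloor>"
    have "0 \<le> \<lfloor>t / time_step n\<rfloor>" using a time_step_pos[of n] by simp
    then have "real ?v * time_step n \<le> t" using floor_mult_bounds(1)[OF time_step_pos[of n], of t] by (simp add: mult.commute)
    then have "real ?v * time_step n * f (m + 1) \<le> t1 * f (m + 1)" using a f0 by (intro mult_right_mono) auto
    also have "\<dots> \<le> 1" using f0 by (simp add: t1_def)
    finally have "m \<le> m + 1 - real ?v * time_step n * f (m + 1)" by simp
    also have "\<dots> \<le> S.Phi ?v" using assms n1 a by (intro S.Phi_lower) auto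
    also have "\<dots> \<le> grid_sol n x t" unfolding grid_sol_def using S.U_bounds by blast
    finally show "m \<le> grid_sol n x t" .
  qed
qed

text \<open>The local estimates are proved together because they share the bound C and the threshold
  \<open>n0\<close>. They need nested neighbourhoods: values are bounded up to distance r + 3 and
  slopes up to r + 3 / 2, since each slope bound looks at values about a unit length to either
  side.\<close>

lemma grid_sol_local:
  assumes "0 \<le> r" "0 < t0"
  obtains C n0 where "0 \<le> C"
    "\<And>n x t. n0 \<le> n \<Longrightarrow> \<bar>x\<bar> \<le> r \<Longrightarrow> t0 \<le> t \<Longrightarrow> grid_sol n x t \<le> C"
    "\<And>n x t. n0 \<le> n \<Longrightarrow> \<bar>x\<bar> \<le> r \<Longrightarrow> t0 \<le> t \<Longrightarrow> \<bar>j (grid_slope n x t)\<bar> \<le> C \<and> \<bar>grid_slope n x t\<bar> \<le> C"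
    "\<And>n x t. n0 \<le> n \<Longrightarrow> \<bar>x\<bar> \<le> r \<Longrightarrow> t0 \<le> t \<Longrightarrow>
       (grid_sol n x (t + time_step n) - grid_sol n x t) / time_step n = (j (grid_slope n x t) - j (grid_slope n (x - mesh n) t)) / mesh n - f (grid_sol n x t)"
    "\<And>n x y t s. n0 \<le> n \<Longrightarrow> \<bar>x\<bar> \<le> r \<Longrightarrow> \<bar>y\<bar> \<le> r \<Longrightarrow> t0 \<le> t \<Longrightarrow> t0 \<le> s \<Longrightarrow> \<bar>t - s\<bar> \<le> 1 / 16 \<Longrightarrow>
       \<bar>grid_sol n x t - grid_sol n y s\<bar> \<le> C * (\<bar>x - y\<bar> + sqrt (\<bar>t - s\<bar> + time_step n) + mesh n)"
    "\<And>n x y t. n0 \<le> n \<Longrightarrow> \<bar>x\<bar> \<le> r \<Longrightarrow> \<bar>y\<bar> \<le> r \<Longrightarrow> t0 \<le> t \<Longrightarrow> mesh n < y - x \<Longrightarrow>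
       \<exists>\<theta>. \<bar>\<theta> - (y - x)\<bar> \<le> mesh n \<and>
         j (grid_slope n y t) \<le> j ((grid_sol n y t - grid_sol n x t) / \<theta>) + C * (y - x + mesh n) \<and>
         j ((grid_sol n y t - grid_sol n x t) / \<theta>) \<le> j (grid_slope n x t) + C * (y - x + mesh n)"
proof -
  obtain d0 Bw where d0: "0 < d0" and Bw: "\<And>d i. 0 < d \<Longrightarrow> d \<le> d0 \<Longrightarrow> d * real i \<le> r + 3 \<Longrightarrow> steady d i \<le> Bw"
    using steady_local_bound[of "r + 3"] by metis
  \<comment> \<open>Half of \<open>t0\<close> is given away because rounding may replace t by a grid
    time up to one time step earlier.\<close>
  obtain m where m: "1 \<le> m" "(\<integral>\<^sup>+s. ennreal (1 / f s) * indicator {m..} s \<partial>lborel) < ennreal (t0 / 2)"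
    using ex_tail[of "t0 / 2"] assms by auto
  define B where "B = m + Bw"
  have B: "1 \<le> B" using m(1) Bw[of d0 0] d0 assms by (simp add: B_def)
  define C1 where "C1 = f B + j B"
  define \<Lambda> where "\<Lambda> = jinv p C1"
  have C1: "0 \<le> C1" "0 \<le> f B" using B f_nonneg[of B] by (auto simp: C1_def)
  have \<Lambda>0: "0 \<le> \<Lambda>" using C1 by (simp add: \<Lambda>_def)
  define C where "C = B + C1 + 2 * \<Lambda> + (2 * C1 + f B + 2 * \<Lambda>)"
  have C: "0 \<le> C" "B \<le> C" "C1 \<le> C" "\<Lambda> \<le> C" "f B \<le> C" "2 * C1 + f B + 2 * \<Lambda> \<le> C"
    using B C1 \<Lambda>0 by (auto simp: C_def)
  \<comment> \<open>In this order: the steady state is bounded on the mesh, a few mesh widths fit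
    into the margins between the neighbourhoods, rounded times stay above t0 / 2, and the window of
    the scheme reaches beyond r + 3.\<close>
  obtain n0 where n0: "\<And>n. n0 \<le> n \<Longrightarrow> mesh n \<le> d0" "\<And>n. n0 \<le> n \<Longrightarrow> mesh n \<le> 1 / 16"
      "\<And>n. n0 \<le> n \<Longrightarrow> time_step n \<le> t0 / 2" "\<And>n. n0 \<le> n \<Longrightarrow> r + 3 \<le> real n"
  proof -
    have "\<forall>\<^sub>F n in sequentially. mesh n < d0 \<and> mesh n < 1 / 16 \<and> time_step n < t0 / 2 \<and> r + 3 \<le> real n"
      using d0 assms by (intro eventually_conj order_tendstoD(2)[OF mesh_tendsto]
        order_tendstoD(2)[OF time_step_tendsto] eventually_ge_at_top filterlim_real_sequentially[unfolded filterlim_at_top, rule_format]) auto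
    then show ?thesis using that unfolding eventually_sequentially by (meson less_imp_le)
  qed
  have fb: "mesh n * of_int \<lfloor>x / mesh n\<rfloor> \<le> x" "x < mesh n * of_int \<lfloor>x / mesh n\<rfloor> + mesh n" for n x
    using floor_mult_bounds[OF mesh_pos[of n], where x = x] by auto
  have idx: "mesh n * \<bar>of_int \<lfloor>x / mesh n\<rfloor>\<bar> \<le> \<bar>x\<bar> + mesh n" for n x
    using fb[where n = n and x = x] abs_mult[of "mesh n" "of_int \<lfloor>x / mesh n\<rfloor>"] mesh_pos[of n] by linarith
  have tidx: "t0 / 2 \<le> real (nat \<lfloor>t / time_step n\<rfloor>) * time_step n" if "n0 \<le> n" "t0 \<le> t" for n t
    using floor_mult_bounds(2)[OF time_step_pos[of n], of t] n0(3)[OF that(1)] that(2) assms time_step_pos[of n]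
    by (simp add: mult.commute)
  have R: "\<bar>i\<bar> \<le> int ((n + 1)\<^sup>2) \<and> scheme.U p f (mesh n) (time_step n) (real n + 1) ((n + 1)\<^sup>2) \<nu> i \<le> B"
    if "n0 \<le> n" "mesh n * \<bar>of_int i\<bar> \<le> r + 3" "t0 / 2 \<le> real \<nu> * time_step n" for n \<nu> i
  proof -
    interpret S: flat_scheme p f "mesh n" "time_step n" "real n + 1" "(n + 1)\<^sup>2" F by (rule flat_scheme_grid)
    have "\<bar>of_int i\<bar> \<le> (r + 3) * (real n + 1)"
      using that(2) by (simp add: mesh_def field_simps)
    also have "\<dots> \<le> (real n + 1) * (real n + 1)"
      using n0(4)[OF that(1)] by (intro mult_right_mono) auto
    finally have "of_int \<bar>i\<bar> \<le> (of_int (int ((n + 1)\<^sup>2)) :: real)"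
      by (simp add: power2_eq_square algebra_simps)
    then have "\<bar>i\<bar> \<le> int ((n + 1)\<^sup>2)" by (simp only: of_int_le_iff)
    moreover have "S.U \<nu> i \<le> B"
    proof -
      have "S.Phi \<nu> \<le> m" by (rule S.Phi_upper[OF m that(3)])
      moreover have "w (mesh n) i \<le> Bw" unfolding w_def
        using that n0(1)[OF that(1)] by (intro Bw mesh_pos) (auto simp: n0)
      ultimately show ?thesis using S.U_bounds[of i \<nu>] by (simp add: B_def)
    qed
    ultimately show ?thesis by simp
  qed
  have SB: "\<bar>j (scheme.D p f (mesh n) (time_step n) (real n + 1) ((n + 1)\<^sup>2) \<nu> i)\<bar> \<le> C1
      \<and> \<bar>scheme.D p f (mesh n) (time_step n) (real n + 1) ((n + 1)\<^sup>2) \<nu> i\<bar> \<le> \<Lambda>"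
    if n: "n0 \<le> n" and i: "mesh n * \<bar>of_int i\<bar> \<le> r + 3 / 2" and \<nu>: "t0 / 2 \<le> real \<nu> * time_step n" for n \<nu> i
  proof -
    interpret S: flat_scheme p f "mesh n" "time_step n" "real n + 1" "(n + 1)\<^sup>2" F by (rule flat_scheme_grid)
    \<comment> \<open>On this mesh n + 1 cells have length exactly 1.\<close>
    have "\<bar>j (S.D \<nu> i)\<bar> \<le> C1" unfolding C1_def
    proof (rule S.slope_bound[where m = "n + 1"])
      show "1 \<le> (real (n + 1) + 1) * mesh n" "real (n + 1) * mesh n \<le> 1"
        by (simp_all add: mesh_def field_simps)
      fix l assume l: "i - int (n + 1) \<le> l" "l \<le> i + int (n + 1) + 1"
      have "\<bar>of_int l\<bar> \<le> \<bar>of_int i\<bar> + (real n + 2)" using l by linarith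
      then have "mesh n * \<bar>of_int l\<bar> \<le> mesh n * (\<bar>of_int i\<bar> + (real n + 2))"
        using mesh_pos[of n] by (intro mult_left_mono) auto
      also have "\<dots> = mesh n * \<bar>of_int i\<bar> + (1 + mesh n)"
      proof -
        have "mesh n * (real n + 2) = 1 + mesh n" by (simp add: mesh_def field_simps)
        then show ?thesis by (simp add: distrib_left)
      qed
      finally have "mesh n * \<bar>of_int l\<bar> \<le> r + 3" using i n0(2)[OF n] by simp
      from R[OF n this \<nu>] show "\<bar>l\<bar> \<le> int ((n + 1)\<^sup>2) \<and> S.U \<nu> l \<le> B" .
    qed
    moreover from this have "j (S.D \<nu> i) \<le> j \<Lambda>" "j (- \<Lambda>) \<le> j (S.D \<nu> i)"
      by (auto simp: \<Lambda>_def simp del: j_le_iff)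
    then have "\<bar>S.D \<nu> i\<bar> \<le> \<Lambda>" unfolding j_le_iff by linarith
    ultimately show ?thesis by simp
  qed
  have DDS: "grid_slope n x t = scheme.D p f (mesh n) (time_step n) (real n + 1) ((n + 1)\<^sup>2) (nat \<lfloor>t / time_step n\<rfloor>) \<lfloor>x / mesh n\<rfloor>" for n x t
  proof -
    interpret S: flat_scheme p f "mesh n" "time_step n" "real n + 1" "(n + 1)\<^sup>2" F by (rule flat_scheme_grid)
    show ?thesis unfolding grid_slope_def grid_sol_def S.D_def floor_shift ..
  qed
  show ?thesis
  proof (rule that[of C n0])
    show "0 \<le> C" by fact
  next
    fix n :: nat and x t :: real assume a: "n0 \<le> n" "\<bar>x\<bar> \<le> r" "t0 \<le> t"
    have i: "mesh n * \<bar>of_int \<lfloor>x / mesh n\<rfloor>\<bar> \<le> r + 3 / 2" using idx[of n x] a n0(2)[OF a(1)] by simp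
    have R1: "\<bar>\<lfloor>x / mesh n\<rfloor>\<bar> \<le> int ((n + 1)\<^sup>2)" and uB: "grid_sol n x t \<le> B"
      using R[OF a(1) _ tidx[OF a(1,3)], of "\<lfloor>x / mesh n\<rfloor>"] i by (auto simp: grid_sol_def)
    show "grid_sol n x t \<le> C" using uB C by simp
    show "\<bar>j (grid_slope n x t)\<bar> \<le> C \<and> \<bar>grid_slope n x t\<bar> \<le> C"
      using SB[OF a(1) i tidx[OF a(1,3)]] C by (auto simp: DDS)
    interpret S: flat_scheme p f "mesh n" "time_step n" "real n + 1" "(n + 1)\<^sup>2" F by (rule flat_scheme_grid)
    show "(grid_sol n x (t + time_step n) - grid_sol n x t) / time_step n = (j (grid_slope n x t) - j (grid_slope n (x - mesh n) t)) / mesh n - f (grid_sol n x t)"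
      unfolding DDS grid_sol_def using S.U_eq[OF R1, of "nat \<lfloor>t / time_step n\<rfloor>"] a assms
      by (simp add: floor_shift nat_floor_shift del: S.U.simps)
  next
    fix n :: nat and x y t s :: real
    assume n: "n0 \<le> n" and xy: "\<bar>x\<bar> \<le> r" "\<bar>y\<bar> \<le> r" and ts: "t0 \<le> t" "t0 \<le> s" "\<bar>t - s\<bar> \<le> 1 / 16"
    interpret S: flat_scheme p f "mesh n" "time_step n" "real n + 1" "(n + 1)\<^sup>2" F by (rule flat_scheme_grid)
    have space: "\<bar>grid_sol n x t - grid_sol n y t\<bar> \<le> \<Lambda> * (y - x + mesh n)" if "x \<le> y" "\<bar>x\<bar> \<le> r" "\<bar>y\<bar> \<le> r" for x y
    proof -
      let ?i = "\<lfloor>x / mesh n\<rfloor>" and ?l = "\<lfloor>y / mesh n\<rfloor>"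
      define q where "q = nat (?l - ?i)"
      have "?i \<le> ?l" using that mesh_pos[of n] by (intro floor_mono divide_right_mono) auto
      then have l: "?l = ?i + int q" by (simp add: q_def)
      have "\<bar>\<Sum>a<q. S.D (nat \<lfloor>t / time_step n\<rfloor>) (?i + int a)\<bar> \<le> (\<Sum>a<q. \<Lambda>)"
      proof (intro order_trans[OF sum_abs] sum_mono)
        fix a assume "a \<in> {..<q}"
        then have "?i \<le> ?i + int a" "?i + int a \<le> ?l" using l by auto
        then have "\<bar>of_int (?i + int a)\<bar> \<le> max \<bar>of_int ?i\<bar> \<bar>(of_int ?l :: real)\<bar>" by linarith
        then have "mesh n * \<bar>of_int (?i + int a)\<bar> \<le> mesh n * max \<bar>of_int ?i\<bar> \<bar>of_int ?l\<bar>"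
          using mesh_pos[of n] by (intro mult_left_mono) auto
        also have "\<dots> \<le> r + 3 / 2"
          using idx[of n x] idx[of n y] that n0(2)[OF n] by (auto simp: max_def)
        finally show "\<bar>S.D (nat \<lfloor>t / time_step n\<rfloor>) (?i + int a)\<bar> \<le> \<Lambda>"
          using SB[OF n _ tidx[OF n ts(1)]] by blast
      qed
      then have "mesh n * \<bar>\<Sum>a<q. S.D (nat \<lfloor>t / time_step n\<rfloor>) (?i + int a)\<bar> \<le> mesh n * (q * \<Lambda>)"
        using mesh_pos[of n] by (intro mult_left_mono) auto
      then have "\<bar>grid_sol n y t - grid_sol n x t\<bar> \<le> mesh n * (q * \<Lambda>)"
        using mesh_pos[of n] unfolding grid_sol_def l S.U_telescope by (simp add: abs_mult)
      also have "\<dots> = \<Lambda> * (mesh n * of_int ?l - mesh n * of_int ?i)" using l by (simp add: algebra_simps)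
      also have "\<dots> \<le> \<Lambda> * (y - x + mesh n)"
        using fb[where n = n and x = x] fb[where n = n and x = y] \<Lambda>0 by (intro mult_left_mono) auto
      finally show ?thesis by (simp add: abs_minus_commute)
    qed
    have time: "\<bar>grid_sol n y t - grid_sol n y s\<bar> \<le> (2 * C1 + f B + 2 * \<Lambda>) * (sqrt (s - t + time_step n) + mesh n)"
      if "t \<le> s" "t0 \<le> t" "s - t \<le> 1 / 16" for t s
    proof -
      let ?a = "nat \<lfloor>t / time_step n\<rfloor>" and ?b = "nat \<lfloor>s / time_step n\<rfloor>" and ?i = "\<lfloor>y / mesh n\<rfloor>"
      define \<tau> where "\<tau> = (real ?b - real ?a) * time_step n"
      have ab: "?a \<le> ?b" using that time_step_pos[of n] by (intro nat_mono floor_mono divide_right_mono) auto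
      have fl: "0 \<le> \<lfloor>t / time_step n\<rfloor>" "0 \<le> \<lfloor>s / time_step n\<rfloor>" using that assms time_step_pos[of n] by auto
      have \<tau>: "0 \<le> \<tau>" "\<tau> \<le> s - t + time_step n"
      proof -
        show "0 \<le> \<tau>" using ab time_step_pos[of n] by (simp add: \<tau>_def)
        show "\<tau> \<le> s - t + time_step n"
          using floor_mult_bounds[OF time_step_pos[of n], where x = t] floor_mult_bounds[OF time_step_pos[of n], where x = s] fl
          by (simp add: \<tau>_def algebra_simps)
      qed
      \<comment> \<open>The window is sqrt \<tau> rounded up to whole cells, with at least one cell.
        The restriction to time differences of at most 1 / 16 keeps sqrt \<tau> below 1 / 2, so the
        window stays where slopes are bounded.\<close>
      define K where "K = nat \<lfloor>sqrt \<tau> / mesh n\<rfloor> + 1"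
      have "0 \<le> \<lfloor>sqrt \<tau> / mesh n\<rfloor>" using \<tau> mesh_pos[of n] by simp
      then have K: "sqrt \<tau> \<le> K * mesh n" "K * mesh n \<le> sqrt \<tau> + mesh n"
        using floor_mult_bounds[OF mesh_pos[of n], where x = "sqrt \<tau>"] by (auto simp: K_def algebra_simps)
      have K0: "0 < K * mesh n" using mesh_pos[of n] by (simp add: K_def)
      have "\<tau> \<le> 1 / 4" using \<tau>(2) that n0(2)[OF n] time_step_le[of n] by simp
      then have "sqrt \<tau> \<le> sqrt ((1 / 2)\<^sup>2)" by (intro real_sqrt_le_mono) (simp add: power2_eq_square)
      then have "sqrt \<tau> \<le> 1 / 2" by (simp add: real_sqrt_abs)
      then have K1: "K * mesh n \<le> 1" using K n0(2)[OF n] by simp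
      have "\<tau> = (sqrt \<tau>)\<^sup>2" using \<tau> by simp
      also have "\<dots> \<le> (K * mesh n)\<^sup>2" using K \<tau> by (intro power_mono) auto
      finally have \<tau>K: "\<tau> \<le> (K * mesh n)\<^sup>2" .
      have "(S.U ?a ?i - S.U ?b ?i) * (K * mesh n)
        \<le> (real ?b - real ?a) * time_step n * (2 * C1 + K * mesh n * f B) + 2 * \<Lambda> * (K * mesh n)\<^sup>2"
      proof (rule S.time_modulus[OF ab])
        fix l \<nu> assume l: "?i - 1 \<le> l" "l \<le> ?i + int K" and \<nu>: "?a \<le> \<nu>"
        have "real ?a * time_step n \<le> real \<nu> * time_step n" using \<nu> time_step_pos[of n] by simp
        then have \<nu>t: "t0 / 2 \<le> real \<nu> * time_step n" using tidx[OF n that(2)] by simp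
        have "1 \<le> K" by (simp add: K_def)
        then have "\<bar>of_int l\<bar> \<le> \<bar>of_int ?i\<bar> + real K" using l by linarith
        then have "mesh n * \<bar>of_int l\<bar> \<le> mesh n * (\<bar>of_int ?i\<bar> + real K)"
          using mesh_pos[of n] by (intro mult_left_mono) auto
        also have "\<dots> \<le> (r + 1 / 16) + (1 / 2 + 1 / 16)"
          using idx[of n y] xy n0(2)[OF n] K(2) \<open>sqrt \<tau> \<le> 1 / 2\<close> by (simp add: algebra_simps)
        finally have li: "mesh n * \<bar>of_int l\<bar> \<le> r + 3 / 2" by simp
        show "\<bar>l\<bar> \<le> int ((n + 1)\<^sup>2) \<and> S.U \<nu> l \<le> B \<and> \<bar>j (S.D \<nu> l)\<bar> \<le> C1 \<and> \<bar>S.D \<nu> l\<bar> \<le> \<Lambda>"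
          using R[OF n _ \<nu>t, of l] SB[OF n li \<nu>t] li by simp
      qed
      also have "\<dots> \<le> (K * mesh n)\<^sup>2 * (2 * C1 + 1 * f B) + 2 * \<Lambda> * (K * mesh n)\<^sup>2"
      proof -
        have "K * mesh n * f B \<le> 1 * f B" using K1 C1(2) by (rule mult_right_mono)
        moreover have "0 \<le> K * mesh n * f B" using K0 C1 by simp
        ultimately have "\<tau> * (2 * C1 + K * mesh n * f B) \<le> (K * mesh n)\<^sup>2 * (2 * C1 + 1 * f B)"
          using \<tau>K \<tau> C1 by (intro mult_mono) auto
        then show ?thesis unfolding \<tau>_def[symmetric] by simp
      qed
      also have "\<dots> = ((K * mesh n) * (2 * C1 + f B + 2 * \<Lambda>)) * (K * mesh n)"
        by (simp add: power2_eq_square algebra_simps)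
      finally have "S.U ?a ?i - S.U ?b ?i \<le> (K * mesh n) * (2 * C1 + f B + 2 * \<Lambda>)"
        using K0 by (simp only: mult_le_cancel_right_pos)
      also have "\<dots> \<le> (sqrt (s - t + time_step n) + mesh n) * (2 * C1 + f B + 2 * \<Lambda>)"
      proof (rule mult_right_mono)
        show "K * mesh n \<le> sqrt (s - t + time_step n) + mesh n"
          using K(2) real_sqrt_le_mono[OF \<tau>(2)] by linarith
      qed (use C1 \<Lambda>0 in auto)
      finally have "grid_sol n y t - grid_sol n y s \<le> (2 * C1 + f B + 2 * \<Lambda>) * (sqrt (s - t + time_step n) + mesh n)"
        by (simp add: grid_sol_def mult.commute)
      moreover have "grid_sol n y s \<le> grid_sol n y t" using that by (intro grid_sol_antimono)
      ultimately show ?thesis by simp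
    qed
    have 1: "\<bar>grid_sol n x t - grid_sol n y t\<bar> \<le> 2 * \<Lambda> * (\<bar>x - y\<bar> + mesh n)"
    proof -
      have "\<bar>grid_sol n x t - grid_sol n y t\<bar> \<le> \<Lambda> * (\<bar>x - y\<bar> + mesh n)"
        using space[of x y] space[of y x] xy by (cases "x \<le> y") (auto simp: abs_minus_commute)
      moreover have "0 \<le> \<Lambda> * (\<bar>x - y\<bar> + mesh n)" using \<Lambda>0 mesh_pos[of n] by simp
      ultimately show ?thesis by simp
    qed
    have 2: "\<bar>grid_sol n y t - grid_sol n y s\<bar> \<le> (2 * C1 + f B + 2 * \<Lambda>) * (sqrt (\<bar>t - s\<bar> + time_step n) + mesh n)"
      using time[of t s] time[of s t] ts by (cases "t \<le> s") (auto simp: abs_minus_commute)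
    have "\<bar>grid_sol n x t - grid_sol n y s\<bar> \<le> 2 * \<Lambda> * (\<bar>x - y\<bar> + mesh n)
        + (2 * C1 + f B + 2 * \<Lambda>) * (sqrt (\<bar>t - s\<bar> + time_step n) + mesh n)"
      using 1 2 by linarith
    also have "\<dots> \<le> C * \<bar>x - y\<bar> + C * sqrt (\<bar>t - s\<bar> + time_step n) + C * mesh n"
    proof -
      have "2 * \<Lambda> * \<bar>x - y\<bar> \<le> C * \<bar>x - y\<bar>" using B C1 \<Lambda>0 by (intro mult_right_mono) (auto simp: C_def)
      moreover have "(2 * C1 + f B + 2 * \<Lambda>) * sqrt (\<bar>t - s\<bar> + time_step n) \<le> C * sqrt (\<bar>t - s\<bar> + time_step n)"
        using C time_step_pos[of n] by (intro mult_right_mono) auto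
      moreover have "(2 * \<Lambda> + (2 * C1 + f B + 2 * \<Lambda>)) * mesh n \<le> C * mesh n"
        using B C1 mesh_pos[of n] by (intro mult_right_mono) (auto simp: C_def)
      ultimately show ?thesis by (simp add: algebra_simps)
    qed
    finally show "\<bar>grid_sol n x t - grid_sol n y s\<bar> \<le> C * (\<bar>x - y\<bar> + sqrt (\<bar>t - s\<bar> + time_step n) + mesh n)"
      by (simp add: algebra_simps)
  next
    fix n :: nat and x y t :: real
    assume n: "n0 \<le> n" and xy: "\<bar>x\<bar> \<le> r" "\<bar>y\<bar> \<le> r" and t: "t0 \<le> t" and d: "mesh n < y - x"
    interpret S: flat_scheme p f "mesh n" "time_step n" "real n + 1" "(n + 1)\<^sup>2" F by (rule flat_scheme_grid)
    let ?i = "\<lfloor>x / mesh n\<rfloor>" and ?l = "\<lfloor>y / mesh n\<rfloor>" and ?v = "nat \<lfloor>t / time_step n\<rfloor>"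
    define q where "q = nat (?l - ?i)"
    have "mesh n * of_int ?i < mesh n * of_int ?l" using fb[where n = n and x = x] fb[where n = n and x = y] d by linarith
    then have "?i < ?l" using mesh_pos[of n] by simp
    then have l: "?l = ?i + int q" and q: "0 < q" by (simp_all add: q_def)
    \<comment> \<open>The exact length of the cells summed, which differs from y - x by
      rounding.\<close>
    define \<theta> where "\<theta> = mesh n * q"
    have \<theta>: "0 < \<theta>" using q mesh_pos[of n] by (simp add: \<theta>_def)
    have \<theta>': "\<theta> = mesh n * of_int ?l - mesh n * of_int ?i" using l by (simp add: \<theta>_def algebra_simps)
    have \<theta>d: "\<bar>\<theta> - (y - x)\<bar> \<le> mesh n" using fb[where n = n and x = x] fb[where n = n and x = y] \<theta>' by linarith
    have avg: "(grid_sol n y t - grid_sol n x t) / \<theta> = (\<Sum>a<q. S.D ?v (?i + int a)) / q"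
      unfolding grid_sol_def l S.U_telescope using q mesh_pos[of n] by (simp add: \<theta>_def)
    have near: "\<bar>b\<bar> \<le> int ((n + 1)\<^sup>2) \<and> S.U ?v b \<le> B" if "?i \<le> b" "b \<le> ?l" for b
    proof -
      have "\<bar>of_int b\<bar> \<le> max \<bar>of_int ?i\<bar> \<bar>(of_int ?l :: real)\<bar>" using that by linarith
      then have "mesh n * \<bar>of_int b\<bar> \<le> mesh n * max \<bar>of_int ?i\<bar> \<bar>of_int ?l\<bar>"
        using mesh_pos[of n] by (intro mult_left_mono) auto
      also have "\<dots> \<le> r + 3" using idx[of n x] idx[of n y] xy n0(2)[OF n] by (auto simp: max_def)
      finally show ?thesis using R[OF n _ tidx[OF n t]] by blast
    qed
    have part: "real a * mesh n * f B \<le> C * (y - x + mesh n)" if "a \<le> q" for a :: nat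
    proof -
      have "real a * mesh n \<le> \<theta>" using that mesh_pos[of n] by (simp add: \<theta>_def mult.commute)
      then have "real a * mesh n * f B \<le> \<theta> * f B" using C1 by (intro mult_right_mono)
      also have "\<dots> \<le> (y - x + mesh n) * C" using \<theta>d C C1 \<theta> by (intro mult_mono) auto
      finally show ?thesis by (simp add: mult.commute)
    qed
    \<comment> \<open>Along the axis the flux rises by at most C times the distance, so each flux
      between x and y is nearly below the one at x and nearly above the one at y. The mean is taken
      over slopes, not fluxes, hence \<open>jinv p\<close> before averaging and \<open>j\<close>
      after it.\<close>
    have up: "S.D ?v (?i + int a) \<le> jinv p (j (S.D ?v ?i) + C * (y - x + mesh n))" if "a < q" for a
    proof -
      have "j (S.D ?v (?i + int a)) \<le> j (S.D ?v ?i) + a * mesh n * f B"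
        using near l that by (intro S.flux_le) auto
      also have "\<dots> \<le> j (S.D ?v ?i) + C * (y - x + mesh n)" using part[of a] that by simp
      finally have "jinv p (j (S.D ?v (?i + int a))) \<le> jinv p (j (S.D ?v ?i) + C * (y - x + mesh n))"
        by (simp only: jinv_le_iff)
      then show ?thesis by (simp only: jinv_j)
    qed
    have lo: "jinv p (j (S.D ?v ?l) - C * (y - x + mesh n)) \<le> S.D ?v (?i + int a)" if "a < q" for a
    proof -
      have "j (S.D ?v ((?i + int a) + int (q - a))) \<le> j (S.D ?v (?i + int a)) + real (q - a) * mesh n * f B"
        using near l that by (intro S.flux_le) auto
      also have "\<dots> \<le> j (S.D ?v (?i + int a)) + C * (y - x + mesh n)" using part[of "q - a"] by simp
      finally have "j (S.D ?v ?l) - C * (y - x + mesh n) \<le> j (S.D ?v (?i + int a))"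
        using l that by (simp add: of_nat_diff)
      then have "jinv p (j (S.D ?v ?l) - C * (y - x + mesh n)) \<le> jinv p (j (S.D ?v (?i + int a)))"
        by (simp only: jinv_le_iff)
      then show ?thesis by (simp only: jinv_j)
    qed
    have "(\<Sum>a<q. S.D ?v (?i + int a)) \<le> q * jinv p (j (S.D ?v ?i) + C * (y - x + mesh n))"
      using sum_bounded_above[of "{..<q}" "\<lambda>a. S.D ?v (?i + int a)"] up by auto
    then have "(grid_sol n y t - grid_sol n x t) / \<theta> \<le> jinv p (j (S.D ?v ?i) + C * (y - x + mesh n))"
      unfolding avg using q by (simp add: field_simps)
    then have 1: "j ((grid_sol n y t - grid_sol n x t) / \<theta>) \<le> j (jinv p (j (S.D ?v ?i) + C * (y - x + mesh n)))"
      by (simp only: j_le_iff)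
    have "q * jinv p (j (S.D ?v ?l) - C * (y - x + mesh n)) \<le> (\<Sum>a<q. S.D ?v (?i + int a))"
      using sum_bounded_below[of "{..<q}" _ "\<lambda>a. S.D ?v (?i + int a)"] lo by auto
    then have "jinv p (j (S.D ?v ?l) - C * (y - x + mesh n)) \<le> (grid_sol n y t - grid_sol n x t) / \<theta>"
      unfolding avg using q by (simp add: field_simps)
    then have 2: "j (jinv p (j (S.D ?v ?l) - C * (y - x + mesh n))) \<le> j ((grid_sol n y t - grid_sol n x t) / \<theta>)"
      by (simp only: j_le_iff)
    show "\<exists>\<theta>. \<bar>\<theta> - (y - x)\<bar> \<le> mesh n \<and>
         j (grid_slope n y t) \<le> j ((grid_sol n y t - grid_sol n x t) / \<theta>) + C * (y - x + mesh n) \<and>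
         j ((grid_sol n y t - grid_sol n x t) / \<theta>) \<le> j (grid_slope n x t) + C * (y - x + mesh n)"
      using \<theta>d 1 2 unfolding DDS j_jinv by (intro exI[of _ \<theta>]) auto
  qed
qed

lemma grid_sol_measurable:
  fixes a :: "'a \<Rightarrow> real"
  assumes [measurable]: "a \<in> borel_measurable N" "b \<in> borel_measurable N"
  shows "(\<lambda>z. grid_sol n (a z) (b z)) \<in> borel_measurable N"
proof -
  let ?U = "scheme.U p f (mesh n) (time_step n) (real n + 1) ((n + 1)\<^sup>2)"
  have "(\<lambda>z. ?U (nat \<lfloor>b z / time_step n\<rfloor>) \<lfloor>a z / mesh n\<rfloor>) \<in> borel_measurable N"
    by measurable
  then show ?thesis by (simp add: grid_sol_def)
qed

end

section \<open>Limits of the scheme\<close>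

text \<open>Cantor's diagonal argument. The diagonal sequence is a subsequence of the i-th one only
  from some index on, which is why an initial segment is discarded at the end.\<close>

lemma pointwise_convergent_subsequence:
  fixes g :: "nat \<Rightarrow> 'a \<Rightarrow> real"
  assumes "countable S" and bdd: "\<And>x. x \<in> S \<Longrightarrow> Bseq (\<lambda>n. g n x)"
  obtains \<sigma> :: "nat \<Rightarrow> nat" where "strict_mono \<sigma>" "\<And>x. x \<in> S \<Longrightarrow> convergent (\<lambda>n. g (\<sigma> n) x)"
proof (cases "S = {}")
  case True
  then show ?thesis using that[of id] by (auto simp: strict_mono_id)
next
  case False
  define s where "s = from_nat_into S"
  have s: "s i \<in> S" for i unfolding s_def by (rule from_nat_into[OF False])
  interpret subseqs "\<lambda>i \<sigma>. convergent (\<lambda>n. g (\<sigma> n) (s i))"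
  proof
    fix i and r :: "nat \<Rightarrow> nat" assume "strict_mono r"
    have "bounded (range (\<lambda>n. g (r n) (s i)))"
      using bdd[OF s, of i] unfolding Bseq_eq_bounded by (rule bounded_subset) auto
    then obtain l r' where "strict_mono r'" "((\<lambda>n. g (r n) (s i)) \<circ> r') \<longlonglongrightarrow> l"
      using bounded_imp_convergent_subsequence by blast
    then show "\<exists>r'. strict_mono r' \<and> convergent (\<lambda>n. g ((r \<circ> r') n) (s i))"
      by (auto simp: convergent_def comp_def)
  qed
  show ?thesis
  proof (rule that[OF subseq_diagseq])
    fix x assume "x \<in> S"
    then obtain i where i: "x = s i"
      unfolding s_def using from_nat_into_surj[OF assms(1)] by metis
    have "convergent (\<lambda>n. g ((diagseq \<circ> (+) (Suc i)) n) (s i))"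
    proof (rule diagseq_holds)
      fix a b :: "nat \<Rightarrow> nat" and k assume "strict_mono b" "convergent (\<lambda>n. g (a n) (s k))"
      then show "convergent (\<lambda>n. g ((a \<circ> b) n) (s k))"
        using convergent_subseq_convergent[of "\<lambda>n. g (a n) (s k)" b] by (simp add: comp_def)
    qed
    then have "convergent (\<lambda>n. g (diagseq (n + Suc i)) (s i))" by (simp add: comp_def add.commute)
    then show "convergent (\<lambda>n. g (diagseq n) x)"
      unfolding i by (rule convergent_ignore_initial_segment[THEN iffD1])
  qed
qed

section \<open>What a convergent family of approximations has to satisfy\<close>

text \<open>The limit passage uses only these properties and no longer the scheme. The estimates are
  asked eventually and on bounded sets away from t = 0, so they survive passing to a subsequence and
  translating in space. In \<open>v_flux\<close> the length \<theta> is left unspecified because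
  rounding makes it depend on n, x and y.\<close>

locale approximation = absorption +
  fixes v :: "nat \<Rightarrow> real \<Rightarrow> real \<Rightarrow> real" and \<delta> h :: "nat \<Rightarrow> real" and u :: "real \<Rightarrow> real \<Rightarrow> real"
  assumes \<delta>_pos: "\<And>n. 0 < \<delta> n" and \<delta>_lim: "\<delta> \<longlonglongrightarrow> 0"
    and h_pos: "\<And>n. 0 < h n" and h_lim: "h \<longlonglongrightarrow> 0"
    and v_measurable: "\<And>n. (\<lambda>z. v n (fst z) (snd z)) \<in> borel_measurable borel"
    and v_ge_1: "\<And>n x t. 1 \<le> v n x t"
    and v_antimono: "\<And>n x s t. s \<le> t \<Longrightarrow> v n x t \<le> v n x s"
    and v_local: "\<And>r t0. 0 \<le> r \<Longrightarrow> 0 < t0 \<Longrightarrow> \<exists>C\<ge>0. \<forall>\<^sub>F n in sequentially. \<forall>x t. \<bar>x\<bar> \<le> r \<longrightarrow> t0 \<le> t \<longrightarrow>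
      v n x t \<le> C \<and> \<bar>j ((v n (x + \<delta> n) t - v n x t) / \<delta> n)\<bar> \<le> C \<and> \<bar>(v n (x + \<delta> n) t - v n x t) / \<delta> n\<bar> \<le> C"
    and v_eq: "\<And>r t0. 0 \<le> r \<Longrightarrow> 0 < t0 \<Longrightarrow> \<forall>\<^sub>F n in sequentially. \<forall>x t. \<bar>x\<bar> \<le> r \<longrightarrow> t0 \<le> t \<longrightarrow>
      (v n x (t + h n) - v n x t) / h n = (j ((v n (x + \<delta> n) t - v n x t) / \<delta> n)
        - j ((v n x t - v n (x - \<delta> n) t) / \<delta> n)) / \<delta> n - f (v n x t)"
    and v_small: "\<And>r t0 \<epsilon>. 0 \<le> r \<Longrightarrow> 0 < t0 \<Longrightarrow> 0 < \<epsilon> \<Longrightarrow> \<forall>\<^sub>F n in sequentially.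
      \<forall>x t. \<bar>x\<bar> \<le> r \<longrightarrow> t0 \<le> t \<longrightarrow> v n x t - v n x (t + h n) \<le> \<epsilon>"
    and v_flux: "\<And>r t0. 0 \<le> r \<Longrightarrow> 0 < t0 \<Longrightarrow> \<exists>C\<ge>0. \<forall>\<^sub>F n in sequentially.
      \<forall>x y t. \<bar>x\<bar> \<le> r \<longrightarrow> \<bar>y\<bar> \<le> r \<longrightarrow> t0 \<le> t \<longrightarrow> \<delta> n < y - x \<longrightarrow>
       (\<exists>\<theta>. \<bar>\<theta> - (y - x)\<bar> \<le> \<delta> n \<and>
         j ((v n (y + \<delta> n) t - v n y t) / \<delta> n) \<le> j ((v n y t - v n x t) / \<theta>) + C * (y - x + \<delta> n) \<and>
         j ((v n y t - v n x t) / \<theta>) \<le> j ((v n (x + \<delta> n) t - v n x t) / \<delta> n) + C * (y - x + \<delta> n))"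
    and v_lim: "\<And>x t. 0 < t \<Longrightarrow> (\<lambda>n. v n x t) \<longlonglongrightarrow> u x t"
    and u_cont: "continuous_on (UNIV \<times> {0<..}) (\<lambda>(x, t). u x t)"
    and u_blowup: "\<And>m. 0 \<le> m \<Longrightarrow> \<exists>t1>0. \<forall>x t. 0 < t \<longrightarrow> t \<le> t1 \<longrightarrow> m \<le> u x t"
    and u_growth: "\<exists>a b. 0 < a \<and> (\<forall>x t. 0 < t \<longrightarrow> a * (\<bar>x\<bar> - b) \<le> u x t)"

context flat_absorption begin

lemma modulus_tendsto:
  assumes "0 < \<epsilon>"
  obtains \<eta> where "0 < \<eta>" "C * (\<eta> + sqrt (2 * \<eta>) + \<eta>) < (\<epsilon>::real)" "\<eta> \<le> 1 / 16"
proof -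
  have "((\<lambda>\<eta>::real. C * (\<eta> + sqrt (2 * \<eta>) + \<eta>)) \<longlongrightarrow> C * (0 + sqrt (2 * 0) + 0)) (at_right 0)"
    by (intro tendsto_intros)
  then have "\<forall>\<^sub>F \<eta> in at_right 0. C * (\<eta> + sqrt (2 * \<eta>) + \<eta>) < \<epsilon>"
    using assms by (intro order_tendstoD) auto
  moreover have "\<forall>\<^sub>F \<eta>::real in at_right 0. 0 < \<eta> \<and> \<eta> \<le> 1 / 16"
    by (auto simp: eventually_at_right_field intro!: exI[of _ "1/16"])
  ultimately have "\<forall>\<^sub>F \<eta>::real in at_right 0. C * (\<eta> + sqrt (2 * \<eta>) + \<eta>) < \<epsilon> \<and> 0 < \<eta> \<and> \<eta> \<le> 1 / 16"
    by (rule eventually_conj)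
  then have "\<exists>\<eta>::real. C * (\<eta> + sqrt (2 * \<eta>) + \<eta>) < \<epsilon> \<and> 0 < \<eta> \<and> \<eta> \<le> 1 / 16"
    by (rule eventually_happens'[rotated]) simp
  then show ?thesis using that by blast
qed

text \<open>The approximations are step functions, so compactness theorems for continuous functions
  do not apply directly. Convergence at rational points is extended to all points by the common
  modulus of continuity, whose mesh terms vanish along the sequence.\<close>

lemma ex_limit:
  obtains \<sigma> where "strict_mono \<sigma>" "\<And>x t. 0 < t \<Longrightarrow> convergent (\<lambda>n. grid_sol (\<sigma> n) x t)"
proof -
  define S :: "(real \<times> real) set" where "S = \<rat> \<times> (\<rat> \<inter> {0<..})"
  have "countable S" unfolding S_def by (intro countable_SIGMA countable_rat countable_Int1)
  moreover have "Bseq (\<lambda>n. grid_sol n (fst z) (snd z))" if "z \<in> S" for z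
  proof -
    have "0 \<le> \<bar>fst z\<bar>" "0 < snd z" using that by (auto simp: S_def)
    then obtain C n0 where "\<And>n x t. n0 \<le> n \<Longrightarrow> \<bar>x\<bar> \<le> \<bar>fst z\<bar> \<Longrightarrow> snd z \<le> t \<Longrightarrow> grid_sol n x t \<le> C"
      by (rule grid_sol_local) blast
    then have "norm (grid_sol n (fst z) (snd z)) \<le> C" if "n0 \<le> n" for n
      using that grid_sol_ge_1[of n "fst z" "snd z"] by simp
    then have "\<forall>\<^sub>F n in sequentially. norm (grid_sol n (fst z) (snd z)) \<le> C"
      by (auto simp: eventually_sequentially)
    then show ?thesis by (rule BfunI)
  qed
  ultimately have "\<exists>\<sigma>. strict_mono \<sigma> \<and> (\<forall>z\<in>S. convergent (\<lambda>n. grid_sol (\<sigma> n) (fst z) (snd z)))"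
  proof (rule pointwise_convergent_subsequence[of S "\<lambda>n z. grid_sol n (fst z) (snd z)"])
    fix \<sigma> :: "nat \<Rightarrow> nat"
    assume "strict_mono \<sigma>" "\<And>z. z \<in> S \<Longrightarrow> convergent (\<lambda>n. grid_sol (\<sigma> n) (fst z) (snd z))"
    then show ?thesis by (intro exI[of _ \<sigma>]) simp
  qed
  then obtain \<sigma> where \<sigma>: "strict_mono \<sigma>" "\<And>z. z \<in> S \<Longrightarrow> convergent (\<lambda>n. grid_sol (\<sigma> n) (fst z) (snd z))"
    by blast
  show ?thesis
  proof (rule that[OF \<sigma>(1)])
    fix x t :: real assume t: "0 < t"
    obtain C n0 where C: "0 \<le> C" and mod: "\<And>n x' y t' s. n0 \<le> n \<Longrightarrow> \<bar>x'\<bar> \<le> \<bar>x\<bar> + 1 \<Longrightarrow> \<bar>y\<bar> \<le> \<bar>x\<bar> + 1 \<Longrightarrow>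
        t / 2 \<le> t' \<Longrightarrow> t / 2 \<le> s \<Longrightarrow> \<bar>t' - s\<bar> \<le> 1 / 16 \<Longrightarrow>
        \<bar>grid_sol n x' t' - grid_sol n y s\<bar> \<le> C * (\<bar>x' - y\<bar> + sqrt (\<bar>t' - s\<bar> + time_step n) + mesh n)"
      by (rule grid_sol_local[of "\<bar>x\<bar> + 1" "t / 2"]) (use t in auto)
    have "Cauchy (\<lambda>n. grid_sol (\<sigma> n) x t)"
    proof (rule metric_CauchyI)
      fix \<epsilon> :: real assume "0 < \<epsilon>"
      then obtain \<eta> where \<eta>: "0 < \<eta>" "C * (\<eta> + sqrt (2 * \<eta>) + \<eta>) < \<epsilon> / 3" "\<eta> \<le> 1 / 16"
        using modulus_tendsto[of "\<epsilon> / 3" C] by auto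
      \<comment> \<open>The rational neighbour is taken to the right and at a later time, so that
        both times stay above t / 2.\<close>
      obtain y where y: "y \<in> \<rat>" "x < y" "y < x + \<eta>" using Rats_dense_in_real[of x "x + \<eta>"] \<eta> by auto
      obtain s where s: "s \<in> \<rat>" "t < s" "s < t + \<eta>" using Rats_dense_in_real[of t "t + \<eta>"] \<eta> by auto
      have "(y, s) \<in> S" using y s t by (auto simp: S_def)
      from \<sigma>(2)[OF this] have "Cauchy (\<lambda>n. grid_sol (\<sigma> n) y s)" by (simp add: convergent_Cauchy)
      then obtain N where N: "\<And>m n. N \<le> m \<Longrightarrow> N \<le> n \<Longrightarrow> \<bar>grid_sol (\<sigma> m) y s - grid_sol (\<sigma> n) y s\<bar> < \<epsilon> / 3"
        using \<open>0 < \<epsilon>\<close> metric_CauchyD[of "\<lambda>n. grid_sol (\<sigma> n) y s" "\<epsilon> / 3"] by (auto simp: dist_real_def)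
      have "\<forall>\<^sub>F n in sequentially. mesh n < \<eta> \<and> time_step n < \<eta> \<and> n0 \<le> n"
        using \<eta> by (intro eventually_conj order_tendstoD(2)[OF mesh_tendsto]
          order_tendstoD(2)[OF time_step_tendsto] eventually_ge_at_top) auto
      then obtain N' where N': "\<And>n. N' \<le> n \<Longrightarrow> mesh n < \<eta> \<and> time_step n < \<eta> \<and> n0 \<le> n"
        by (auto simp: eventually_sequentially)
      have near: "\<bar>grid_sol (\<sigma> n) x t - grid_sol (\<sigma> n) y s\<bar> < \<epsilon> / 3" if "N' \<le> n" for n
      proof -
        have \<sigma>n: "N' \<le> \<sigma> n" using that seq_suble[OF \<sigma>(1), of n] by simp
        have "\<bar>grid_sol (\<sigma> n) x t - grid_sol (\<sigma> n) y s\<bar> \<le> C * (\<bar>x - y\<bar> + sqrt (\<bar>t - s\<bar> + time_step (\<sigma> n)) + mesh (\<sigma> n))"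
          using N'[OF \<sigma>n] \<eta> y s t by (intro mod) auto
        also have "\<dots> \<le> C * (\<eta> + sqrt (2 * \<eta>) + \<eta>)"
          using N'[OF \<sigma>n] \<eta> y s C by (intro mult_left_mono add_mono real_sqrt_le_mono) auto
        finally show ?thesis using \<eta> by simp
      qed
      show "\<exists>M. \<forall>m\<ge>M. \<forall>n\<ge>M. dist (grid_sol (\<sigma> m) x t) (grid_sol (\<sigma> n) x t) < \<epsilon>"
      proof (intro exI[of _ "max N N'"] allI impI)
        fix m n assume "max N N' \<le> m" "max N N' \<le> n"
        then have "\<bar>grid_sol (\<sigma> m) x t - grid_sol (\<sigma> m) y s\<bar> < \<epsilon> / 3"
          "\<bar>grid_sol (\<sigma> n) x t - grid_sol (\<sigma> n) y s\<bar> < \<epsilon> / 3" "\<bar>grid_sol (\<sigma> m) y s - grid_sol (\<sigma> n) y s\<bar> < \<epsilon> / 3"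
          using near[of m] near[of n] N[of m n] by simp_all
        then show "dist (grid_sol (\<sigma> m) x t) (grid_sol (\<sigma> n) x t) < \<epsilon>"
          unfolding dist_real_def by linarith
      qed
    qed
    then show "convergent (\<lambda>n. grid_sol (\<sigma> n) x t)" by (simp add: Cauchy_convergent)
  qed
qed

lemma eventually_subseq': "strict_mono \<sigma> \<Longrightarrow> n0 \<le> n \<Longrightarrow> n0 \<le> \<sigma> n" for \<sigma> :: "nat \<Rightarrow> nat"
  using seq_suble[of \<sigma> n] by simp

lemma ex_approximation: "\<exists>v \<delta> h u. approximation p f v \<delta> h u"
proof -
  obtain \<sigma> where \<sigma>: "strict_mono \<sigma>" and conv: "\<And>x t. 0 < t \<Longrightarrow> convergent (\<lambda>n. grid_sol (\<sigma> n) x t)"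
    using ex_limit by blast
  define v where "v n = grid_sol (\<sigma> n)" for n
  define \<delta> where "\<delta> = mesh \<circ> \<sigma>"
  define h where "h = time_step \<circ> \<sigma>"
  define u where "u x t = lim (\<lambda>n. v n x t)" for x t
  have DDv: "(v n (x + \<delta> n) t - v n x t) / \<delta> n = grid_slope (\<sigma> n) x t" for n x t
    by (simp add: v_def \<delta>_def grid_slope_def)
  have DDv': "(v n x t - v n (x - \<delta> n) t) / \<delta> n = grid_slope (\<sigma> n) (x - \<delta> n) t" for n x t
    by (simp add: v_def \<delta>_def grid_slope_def)
  have lim: "(\<lambda>n. v n x t) \<longlonglongrightarrow> u x t" if "0 < t" for x t
    using conv[OF that] by (simp add: u_def v_def convergent_LIMSEQ_iff)
  have \<delta>: "\<delta> \<longlonglongrightarrow> 0" "h \<longlonglongrightarrow> 0"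
    unfolding \<delta>_def h_def by (rule LIMSEQ_subseq_LIMSEQ[OF _ \<sigma>], rule mesh_tendsto time_step_tendsto)+
  have ev: "\<forall>\<^sub>F n in sequentially. n0 \<le> \<sigma> n" for n0
    using eventually_subseq'[OF \<sigma>] by (auto simp: eventually_sequentially)
  have "approximation p f v \<delta> h u"
  proof unfold_locales
    show "0 < \<delta> n" "0 < h n" for n by (simp_all add: \<delta>_def h_def mesh_pos time_step_pos)
    show "\<delta> \<longlonglongrightarrow> 0" "h \<longlonglongrightarrow> 0" by fact+
    show "(\<lambda>z. v n (fst z) (snd z)) \<in> borel_measurable borel" for n
      unfolding v_def by (rule grid_sol_measurable) (simp_all flip: borel_prod)
    show "1 \<le> v n x t" for n x t by (simp add: v_def grid_sol_ge_1)
    show "v n x t \<le> v n x s" if "s \<le> t" for n x s t using that by (simp add: v_def grid_sol_antimono)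
    show "(\<lambda>n. v n x t) \<longlonglongrightarrow> u x t" if "0 < t" for x t using that by (rule lim)
    fix r t0 :: real assume r: "0 \<le> r" and t0: "0 < t0"
    obtain C n0 where C: "0 \<le> C" and c:
    "\<And>n x t. n0 \<le> n \<Longrightarrow> \<bar>x\<bar> \<le> r \<Longrightarrow> t0 \<le> t \<Longrightarrow> grid_sol n x t \<le> C"
    "\<And>n x t. n0 \<le> n \<Longrightarrow> \<bar>x\<bar> \<le> r \<Longrightarrow> t0 \<le> t \<Longrightarrow> \<bar>j (grid_slope n x t)\<bar> \<le> C \<and> \<bar>grid_slope n x t\<bar> \<le> C"
    "\<And>n x t. n0 \<le> n \<Longrightarrow> \<bar>x\<bar> \<le> r \<Longrightarrow> t0 \<le> t \<Longrightarrow>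
       (grid_sol n x (t + time_step n) - grid_sol n x t) / time_step n = (j (grid_slope n x t) - j (grid_slope n (x - mesh n) t)) / mesh n - f (grid_sol n x t)"
    "\<And>n x y t s. n0 \<le> n \<Longrightarrow> \<bar>x\<bar> \<le> r \<Longrightarrow> \<bar>y\<bar> \<le> r \<Longrightarrow> t0 \<le> t \<Longrightarrow> t0 \<le> s \<Longrightarrow> \<bar>t - s\<bar> \<le> 1 / 16 \<Longrightarrow>
       \<bar>grid_sol n x t - grid_sol n y s\<bar> \<le> C * (\<bar>x - y\<bar> + sqrt (\<bar>t - s\<bar> + time_step n) + mesh n)"
    "\<And>n x y t. n0 \<le> n \<Longrightarrow> \<bar>x\<bar> \<le> r \<Longrightarrow> \<bar>y\<bar> \<le> r \<Longrightarrow> t0 \<le> t \<Longrightarrow> mesh n < y - x \<Longrightarrow>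
       \<exists>\<theta>. \<bar>\<theta> - (y - x)\<bar> \<le> mesh n \<and>
         j (grid_slope n y t) \<le> j ((grid_sol n y t - grid_sol n x t) / \<theta>) + C * (y - x + mesh n) \<and>
         j ((grid_sol n y t - grid_sol n x t) / \<theta>) \<le> j (grid_slope n x t) + C * (y - x + mesh n)"
      by (rule grid_sol_local[OF r t0]) blast
    show "\<exists>C\<ge>0. \<forall>\<^sub>F n in sequentially. \<forall>x t. \<bar>x\<bar> \<le> r \<longrightarrow> t0 \<le> t \<longrightarrow>
      v n x t \<le> C \<and> \<bar>j ((v n (x + \<delta> n) t - v n x t) / \<delta> n)\<bar> \<le> C \<and> \<bar>(v n (x + \<delta> n) t - v n x t) / \<delta> n\<bar> \<le> C"
      unfolding DDv using c(1,2) C ev[of n0]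
      by (intro exI[of _ C] conjI) (auto simp: v_def elim!: eventually_mono)
    show "\<forall>\<^sub>F n in sequentially. \<forall>x t. \<bar>x\<bar> \<le> r \<longrightarrow> t0 \<le> t \<longrightarrow>
      (v n x (t + h n) - v n x t) / h n = (j ((v n (x + \<delta> n) t - v n x t) / \<delta> n)
        - j ((v n x t - v n (x - \<delta> n) t) / \<delta> n)) / \<delta> n - f (v n x t)"
      unfolding DDv DDv' using ev[of n0]
    proof eventually_elim
      case (elim n)
      then show ?case using c(3)[OF elim] by (auto simp: v_def \<delta>_def h_def)
    qed
    show "\<exists>C\<ge>0. \<forall>\<^sub>F n in sequentially.
      \<forall>x y t. \<bar>x\<bar> \<le> r \<longrightarrow> \<bar>y\<bar> \<le> r \<longrightarrow> t0 \<le> t \<longrightarrow> \<delta> n < y - x \<longrightarrow>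
       (\<exists>\<theta>. \<bar>\<theta> - (y - x)\<bar> \<le> \<delta> n \<and>
         j ((v n (y + \<delta> n) t - v n y t) / \<delta> n) \<le> j ((v n y t - v n x t) / \<theta>) + C * (y - x + \<delta> n) \<and>
         j ((v n y t - v n x t) / \<theta>) \<le> j ((v n (x + \<delta> n) t - v n x t) / \<delta> n) + C * (y - x + \<delta> n))"
      unfolding DDv
    proof (intro exI[of _ C] conjI C)
      show "\<forall>\<^sub>F n in sequentially.
        \<forall>x y t. \<bar>x\<bar> \<le> r \<longrightarrow> \<bar>y\<bar> \<le> r \<longrightarrow> t0 \<le> t \<longrightarrow> \<delta> n < y - x \<longrightarrow>
         (\<exists>\<theta>. \<bar>\<theta> - (y - x)\<bar> \<le> \<delta> n \<and>
           j (grid_slope (\<sigma> n) y t) \<le> j ((v n y t - v n x t) / \<theta>) + C * (y - x + \<delta> n) \<and>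
           j ((v n y t - v n x t) / \<theta>) \<le> j (grid_slope (\<sigma> n) x t) + C * (y - x + \<delta> n))"
        using ev[of n0]
      proof eventually_elim
        case (elim n)
        then show ?case using c(5)[OF elim] by (simp add: v_def \<delta>_def del: j_le_iff)
      qed
    qed
    show "\<forall>\<^sub>F n in sequentially. \<forall>x t. \<bar>x\<bar> \<le> r \<longrightarrow> t0 \<le> t \<longrightarrow> v n x t - v n x (t + h n) \<le> \<epsilon>"
      if \<epsilon>: "0 < \<epsilon>" for \<epsilon>
    proof -
      obtain \<eta> where \<eta>: "0 < \<eta>" "C * (\<eta> + sqrt (2 * \<eta>) + \<eta>) < \<epsilon>" "\<eta> \<le> 1 / 16"
        using modulus_tendsto[OF \<epsilon>, of C] by blast
      have "\<forall>\<^sub>F n in sequentially. \<delta> n < \<eta> \<and> h n < \<eta> \<and> n0 \<le> \<sigma> n"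
        using \<eta> ev[of n0] by (intro eventually_conj order_tendstoD(2)[OF \<delta>(1)] order_tendstoD(2)[OF \<delta>(2)]) auto
      then show ?thesis
      proof eventually_elim
        case (elim n)
        show ?case
        proof (intro allI impI)
          fix x t :: real assume xt: "\<bar>x\<bar> \<le> r" "t0 \<le> t"
          have hn: "0 < h n" by (simp add: h_def time_step_pos)
          have "\<bar>grid_sol (\<sigma> n) x t - grid_sol (\<sigma> n) x (t + h n)\<bar>
              \<le> C * (\<bar>x - x\<bar> + sqrt (\<bar>t - (t + h n)\<bar> + time_step (\<sigma> n)) + mesh (\<sigma> n))"
            using xt elim hn \<eta> by (intro c(4)) auto
          also have "\<dots> \<le> C * (\<eta> + sqrt (2 * \<eta>) + \<eta>)"
            using elim hn \<eta> C
            by (intro mult_left_mono add_mono real_sqrt_le_mono) (auto simp: h_def \<delta>_def)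
          finally show "v n x t - v n x (t + h n) \<le> \<epsilon>" using \<eta> by (simp add: v_def)
        qed
      qed
    qed
  next
    show "\<exists>t1>0. \<forall>x t. 0 < t \<longrightarrow> t \<le> t1 \<longrightarrow> m \<le> u x t" if "0 \<le> m" for m
    proof -
      obtain t1 n1 where t1: "0 < t1" "\<And>n x t. n1 \<le> n \<Longrightarrow> 0 < t \<Longrightarrow> t \<le> t1 \<Longrightarrow> m \<le> grid_sol n x t"
        using grid_sol_blowup[OF \<open>0 \<le> m\<close>] by metis
      have "m \<le> u x t" if "0 < t" "t \<le> t1" for x t
      proof (rule tendsto_lowerbound[OF lim[OF that(1)]])
        show "\<forall>\<^sub>F n in sequentially. m \<le> v n x t"
          using ev[of n1] by eventually_elim (use t1 that in \<open>auto simp: v_def\<close>)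
      qed simp
      then show ?thesis using t1(1) by blast
    qed
    have "jinv p (f 1) * (\<bar>x\<bar> - 3) \<le> u x t" if "0 < t" for x t
      by (rule tendsto_lowerbound[OF lim[OF that]]) (auto simp: v_def grid_sol_growth)
    moreover have "0 < jinv p (f 1)"
    proof -
      have "0 < j (jinv p (f 1))" using f_pos[of 1] by simp
      then show ?thesis using j_less_iff[of 0 "jinv p (f 1)"] by simp
    qed
    ultimately show "\<exists>a b. 0 < a \<and> (\<forall>x t. 0 < t \<longrightarrow> a * (\<bar>x\<bar> - b) \<le> u x t)"
      by blast
    show "continuous_on (UNIV \<times> {0<..}) (\<lambda>(x, t). u x t)"
    proof (intro continuous_at_imp_continuous_on ballI)
      fix z :: "real \<times> real" assume "z \<in> UNIV \<times> {0<..}"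
      then obtain x t where z: "z = (x, t)" and t: "0 < t" by auto
      obtain C n0 where C: "0 \<le> C" and mod: "\<And>n x' y t' s. n0 \<le> n \<Longrightarrow> \<bar>x'\<bar> \<le> \<bar>x\<bar> + 1 \<Longrightarrow> \<bar>y\<bar> \<le> \<bar>x\<bar> + 1 \<Longrightarrow>
        t / 2 \<le> t' \<Longrightarrow> t / 2 \<le> s \<Longrightarrow> \<bar>t' - s\<bar> \<le> 1 / 16 \<Longrightarrow>
        \<bar>grid_sol n x' t' - grid_sol n y s\<bar> \<le> C * (\<bar>x' - y\<bar> + sqrt (\<bar>t' - s\<bar> + time_step n) + mesh n)"
        by (rule grid_sol_local[of "\<bar>x\<bar> + 1" "t / 2"]) (use t in auto)
      \<comment> \<open>Mesh width and time step drop out of the modulus in the limit, which is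
        therefore locally Lipschitz in space and Hoelder continuous with exponent 1/2 in time,
        although the approximations jump.\<close>
      have u_mod: "\<bar>u y s - u x t\<bar> \<le> C * (\<bar>y - x\<bar> + sqrt (\<bar>s - t\<bar>))"
        if "\<bar>y\<bar> \<le> \<bar>x\<bar> + 1" "t / 2 \<le> s" "\<bar>s - t\<bar> \<le> 1 / 16" for y s
      proof (rule tendsto_le)
        show "(\<lambda>n. \<bar>v n y s - v n x t\<bar>) \<longlonglongrightarrow> \<bar>u y s - u x t\<bar>"
          using that t by (intro tendsto_intros lim) auto
        have "(\<lambda>n. C * (\<bar>y - x\<bar> + sqrt (\<bar>s - t\<bar> + h n) + \<delta> n)) \<longlonglongrightarrow> C * (\<bar>y - x\<bar> + sqrt (\<bar>s - t\<bar> + 0) + 0)"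
          by (intro tendsto_intros \<delta>)
        then show "(\<lambda>n. C * (\<bar>y - x\<bar> + sqrt (\<bar>s - t\<bar> + h n) + \<delta> n)) \<longlonglongrightarrow> C * (\<bar>y - x\<bar> + sqrt (\<bar>s - t\<bar>))"
          by simp
        show "\<forall>\<^sub>F n in sequentially. \<bar>v n y s - v n x t\<bar> \<le> C * (\<bar>y - x\<bar> + sqrt (\<bar>s - t\<bar> + h n) + \<delta> n)"
          using ev[of n0]
        proof eventually_elim
          case (elim n)
          then show ?case using mod[OF elim, of y x s t] that t by (simp add: v_def h_def \<delta>_def)
        qed
      qed simp
      have "((\<lambda>w. case w of (y, s) \<Rightarrow> u y s) \<longlongrightarrow> u x t) (at z)"
      proof (rule LIM_zero_cancel, rule Lim_null_comparison)
        have "((\<lambda>w. C * (\<bar>fst w - x\<bar> + sqrt \<bar>snd w - t\<bar>)) \<longlongrightarrow> C * (\<bar>fst z - x\<bar> + sqrt \<bar>snd z - t\<bar>)) (at z)"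
          by (intro tendsto_intros)
        then show "((\<lambda>w. C * (\<bar>fst w - x\<bar> + sqrt \<bar>snd w - t\<bar>)) \<longlongrightarrow> 0) (at z)" by (simp add: z)
        have "\<forall>\<^sub>F w in at z. dist (fst w) (fst z) < 1" "\<forall>\<^sub>F w in at z. dist (snd w) (snd z) < min (t / 2) (1 / 16)"
          using t by (auto simp del: min_less_iff_conj intro!: tendstoD tendsto_fst tendsto_snd tendsto_ident_at)
        then show "\<forall>\<^sub>F w in at z. norm ((case w of (y, s) \<Rightarrow> u y s) - u x t) \<le> C * (\<bar>fst w - x\<bar> + sqrt \<bar>snd w - t\<bar>)"
        proof eventually_elim
          case (elim w)
          obtain y s where w: "w = (y, s)" by (cases w)
          have "\<bar>y\<bar> \<le> \<bar>x\<bar> + 1" "t / 2 \<le> s" "\<bar>s - t\<bar> \<le> 1 / 16"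
            using elim unfolding w z dist_real_def fst_conv snd_conv min_less_iff_conj by linarith+
          from u_mod[OF this] show ?case by (simp add: w)
        qed
      qed
      then show "isCont (\<lambda>(x, t). u x t) z" by (simp add: isCont_def z)
    qed
  qed
  then show ?thesis by blast
qed

end

section \<open>Weak derivatives as limits of difference quotients\<close>

lemma compact_in_slab:
  fixes K :: "('a::euclidean_space \<times> real) set"
  assumes "compact K" "K \<subseteq> Q_infty"
  obtains r t0 where "0 \<le> r" "0 < t0" "\<And>z. z \<in> K \<Longrightarrow> norm (fst z) \<le> r \<and> t0 \<le> snd z"
proof -
  have "bounded (fst ` K)"
    using assms by (intro compact_imp_bounded compact_continuous_image continuous_intros)
  then obtain r where r: "\<And>z. z \<in> K \<Longrightarrow> norm (fst z) \<le> r" by (auto simp: bounded_iff)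
  have "\<exists>t0>0. \<forall>z\<in>K. t0 \<le> snd z"
  proof (cases "K = {}")
    case False
    have "\<exists>z\<in>K. \<forall>y\<in>K. snd z \<le> snd y"
      using assms(1) False by (intro continuous_attains_inf continuous_intros)
    then obtain z where "z \<in> K" "\<forall>y\<in>K. snd z \<le> snd y" by blast
    then show ?thesis using assms(2) by (intro exI[of _ "snd z"]) (auto simp: Q_infty_def)
  qed (auto intro: exI[of _ 1])
  then obtain t0 where "0 < t0" "\<forall>z\<in>K. t0 \<le> snd z" by blast
  then show ?thesis using that[of "max r 0" t0] r by fastforce
qed

lemma lborel_integral_translate:
  fixes \<phi> :: "'b::euclidean_space \<Rightarrow> real"
  assumes [measurable]: "\<phi> \<in> borel_measurable borel"
  shows "(\<integral>z. \<phi> (z + d) \<partial>lborel) = (\<integral>z. \<phi> z \<partial>lborel)"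
proof -
  have "(\<integral>z. \<phi> z \<partial>lborel) = (\<integral>z. \<phi> z \<partial>(distr lborel borel ((+) d)))"
    by (simp add: lborel_distr_plus)
  also have "\<dots> = (\<integral>z. \<phi> (d + z) \<partial>lborel)" by (rule integral_distr) auto
  finally show ?thesis by (simp add: add.commute)
qed

lemma abs_mult_bound: "\<bar>a\<bar> \<le> A \<Longrightarrow> \<bar>b\<bar> \<le> B \<Longrightarrow> \<bar>a * b\<bar> \<le> A * B" for a b :: real
  unfolding abs_mult by (rule mult_mono) auto

lemma integrable_bounded_compact:
  fixes \<phi> :: "'b::euclidean_space \<Rightarrow> real"
  assumes "\<phi> \<in> borel_measurable borel" "compact K" "\<And>z. \<bar>\<phi> z\<bar> \<le> B * indicator K z"
  shows "integrable lborel \<phi>"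
proof (rule Bochner_Integration.integrable_bound)
  show "integrable lborel (\<lambda>z. B * indicator K z :: real)"
    using assms(2) by (intro integrable_mult_right integrable_real_indicator)
      (auto simp: borel_compact emeasure_compact_finite[unfolded infinity_ennreal_def])
  show "AE z in lborel. norm (\<phi> z) \<le> norm (B * indicator K z :: real)"
    using assms(3) by (auto simp: order_trans[OF _ abs_ge_self])
qed (use assms in simp)

text \<open>Dominated convergence with a bound required only eventually; the sequence is shifted
  past the exceptional indices.\<close>

lemma integral_tendsto_compact:
  fixes F :: "nat \<Rightarrow> 'b::euclidean_space \<Rightarrow> real"
  assumes "\<And>n. F n \<in> borel_measurable borel" "\<phi> \<in> borel_measurable borel" "compact K"
    and "\<forall>\<^sub>F n in sequentially. \<forall>z. \<bar>F n z\<bar> \<le> B * indicator K z"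
    and "AE z in lborel. (\<lambda>n. F n z) \<longlonglongrightarrow> \<phi> z"
  shows "integrable lborel \<phi>" "(\<lambda>n. \<integral>z. F n z \<partial>lborel) \<longlonglongrightarrow> (\<integral>z. \<phi> z \<partial>lborel)"
proof -
  obtain N where N: "\<And>n z. N \<le> n \<Longrightarrow> \<bar>F n z\<bar> \<le> B * indicator K z"
    using assms(4) by (auto simp: eventually_sequentially)
  let ?G = "\<lambda>n. F (n + N)"
  have i: "integrable lborel (\<lambda>z. B * indicator K z :: real)"
    using assms(3) by (intro integrable_mult_right integrable_real_indicator)
      (auto simp: borel_compact emeasure_compact_finite[unfolded infinity_ennreal_def])
  have l: "AE z in lborel. (\<lambda>n. ?G n z) \<longlonglongrightarrow> \<phi> z"
    using assms(5) by eventually_elim (rule LIMSEQ_ignore_initial_segment)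
  have b: "AE z in lborel. norm (?G n z) \<le> B * indicator K z" for n using N by simp
  show "integrable lborel \<phi>"
    by (rule integrable_dominated_convergence[OF _ _ i l b]) (use assms in simp_all)
  have "(\<lambda>n. \<integral>z. ?G n z \<partial>lborel) \<longlonglongrightarrow> (\<integral>z. \<phi> z \<partial>lborel)"
    by (rule integral_dominated_convergence[OF _ _ i l b]) (use assms in simp_all)
  then show "(\<lambda>n. \<integral>z. F n z \<partial>lborel) \<longlonglongrightarrow> (\<integral>z. \<phi> z \<partial>lborel)"
    by (rule LIMSEQ_offset)
qed

lemma Cc_infty_C1:
  assumes "\<phi> \<in> Cc_infty \<Omega>"
  shows "\<phi> differentiable (at z)" "continuous_on UNIV \<phi>"
    "d \<in> Basis \<Longrightarrow> continuous_on UNIV (\<lambda>z. frechet_derivative \<phi> (at z) d)"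
proof -
  have 0: "C_k 0 \<phi>" and 1: "C_k (Suc 0) \<phi>" using assms by (auto simp: Cc_infty_def simp del: C_k.simps)
  show "\<phi> differentiable (at z)" "continuous_on UNIV \<phi>"
    "d \<in> Basis \<Longrightarrow> continuous_on UNIV (\<lambda>z. frechet_derivative \<phi> (at z) d)"
    using 0 1 by auto
qed

lemma line_derivative:
  fixes \<phi> :: "'b::euclidean_space \<Rightarrow> real"
  assumes "\<And>z. \<phi> differentiable (at z)"
  shows "((\<lambda>r. \<phi> (z + r *\<^sub>R d)) has_real_derivative frechet_derivative \<phi> (at (z + r *\<^sub>R d)) d) (at r)"
proof -
  have "(\<phi> has_derivative frechet_derivative \<phi> (at (z + r *\<^sub>R d))) (at (z + r *\<^sub>R d))"
    using assms frechet_derivative_works by blast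
  moreover have "((\<lambda>r. z + r *\<^sub>R d) has_derivative (\<lambda>r. r *\<^sub>R d)) (at r)"
    by (auto intro!: derivative_eq_intros)
  ultimately have D: "((\<lambda>r. \<phi> (z + r *\<^sub>R d)) has_derivative
      (\<lambda>x. frechet_derivative \<phi> (at (z + r *\<^sub>R d)) (x *\<^sub>R d))) (at r)"
    by (rule has_derivative_compose[rotated])
  have "linear (frechet_derivative \<phi> (at (z + r *\<^sub>R d)))"
    using assms by (rule linear_frechet_derivative)
  then have "(\<lambda>x. frechet_derivative \<phi> (at (z + r *\<^sub>R d)) (x *\<^sub>R d))
      = (\<lambda>x. frechet_derivative \<phi> (at (z + r *\<^sub>R d)) d * x)"
    by (auto simp: linear_cmul mult.commute)
  then show ?thesis using D by (simp add: has_field_derivative_def)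
qed

lemma difference_quotient:
  fixes \<phi> :: "'b::euclidean_space \<Rightarrow> real"
  assumes diff: "\<And>z. \<phi> differentiable (at z)"
    and s: "s \<longlonglongrightarrow> 0" "\<And>n. s n \<noteq> (0::real)"
  shows "(\<lambda>n. (\<phi> (z + s n *\<^sub>R d) - \<phi> z) / s n) \<longlonglongrightarrow> frechet_derivative \<phi> (at z) d"
proof -
  have "((\<lambda>r. \<phi> (z + r *\<^sub>R d)) has_real_derivative frechet_derivative \<phi> (at z) d) (at 0)"
    using line_derivative[OF diff, of z d 0] by simp
  then have "((\<lambda>r. (\<phi> (z + r *\<^sub>R d) - \<phi> z) / r) \<longlongrightarrow> frechet_derivative \<phi> (at z) d) (at 0)"
    by (simp add: DERIV_def)
  then show ?thesis
    by (rule filterlim_compose) (use s in \<open>auto simp: filterlim_at\<close>)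
qed

lemma difference_bound:
  fixes \<phi> :: "'b::euclidean_space \<Rightarrow> real"
  assumes diff: "\<And>z. \<phi> differentiable (at z)" and L: "\<And>z. \<bar>frechet_derivative \<phi> (at z) d\<bar> \<le> L"
  shows "\<bar>\<phi> (z + r *\<^sub>R d) - \<phi> z\<bar> \<le> L * \<bar>r\<bar>"
proof -
  have "norm (\<phi> (z + r *\<^sub>R d) - \<phi> (z + 0 *\<^sub>R d)) \<le> L * norm (r - 0)"
  proof (rule field_differentiable_bound[of UNIV _ "\<lambda>r. frechet_derivative \<phi> (at (z + r *\<^sub>R d)) d"])
    show "((\<lambda>r. \<phi> (z + r *\<^sub>R d)) has_field_derivative frechet_derivative \<phi> (at (z + r *\<^sub>R d)) d) (at r within UNIV)" for r
      using line_derivative[OF diff] by simp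
  qed (use L in auto)
  then show ?thesis by simp
qed

lemma frechet_derivative_zero_outside:
  fixes \<phi> :: "'b::euclidean_space \<Rightarrow> real"
  assumes "z \<notin> closure {z. \<phi> z \<noteq> 0}"
  shows "frechet_derivative \<phi> (at z) d = 0"
proof -
  have "((\<lambda>_. 0) has_derivative (\<lambda>_. 0)) (at z)" by simp
  then have "(\<phi> has_derivative (\<lambda>_. 0)) (at z)"
  proof (rule has_derivative_transform_within_open[of _ _ _ _ "- closure {z. \<phi> z \<noteq> 0}"])
    show "0 = \<phi> y" if "y \<in> - closure {z. \<phi> z \<noteq> 0}" for y
      using that closure_subset[of "{z. \<phi> z \<noteq> 0}"] by auto
  qed (use assms in auto)
  then show ?thesis using frechet_derivative_at by metis
qed

lemma test_function_bounds:
  assumes "\<phi> \<in> Cc_infty \<Omega>" "d \<in> Basis"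
  obtains K L where "compact K" "K \<subseteq> \<Omega>" "0 \<le> L" "\<And>z. \<bar>\<phi> z\<bar> \<le> L * indicator K z"
    "\<And>z. \<bar>frechet_derivative \<phi> (at z) d\<bar> \<le> L * indicator K z"
proof -
  let ?K = "closure {z. \<phi> z \<noteq> 0}"
  have K: "compact ?K" "?K \<subseteq> \<Omega>" using assms by (simp_all add: Cc_infty_def compact_support_in_def)
  have "bounded (\<phi> ` ?K)" "bounded ((\<lambda>z. frechet_derivative \<phi> (at z) d) ` ?K)"
    using Cc_infty_C1[OF assms(1)] assms(2) K
    by (auto intro!: compact_imp_bounded compact_continuous_image intro: continuous_on_subset)
  then obtain A B where AB: "\<And>z. z \<in> ?K \<Longrightarrow> \<bar>\<phi> z\<bar> \<le> A"
      "\<And>z. z \<in> ?K \<Longrightarrow> \<bar>frechet_derivative \<phi> (at z) d\<bar> \<le> B"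
    by (auto simp: bounded_iff)
  show ?thesis
  proof (rule that[OF K, of "max 0 (max A B)"])
    show "\<bar>\<phi> z\<bar> \<le> max 0 (max A B) * indicator ?K z" for z
    proof (cases "z \<in> ?K")
      case False
      then have "\<phi> z = 0" using closure_subset[of "{z. \<phi> z \<noteq> 0}"] by auto
      then show ?thesis by simp
    qed (use AB(1)[of z] in auto)
    show "\<bar>frechet_derivative \<phi> (at z) d\<bar> \<le> max 0 (max A B) * indicator ?K z" for z
    proof (cases "z \<in> ?K")
      case False
      then show ?thesis using frechet_derivative_zero_outside[of z \<phi> d] by simp
    qed (use AB(2)[of z] in auto)
  qed simp
qed

text \<open>Supports translated by a small step have to remain in one compact subset of the domain,
  where the local bounds are available.\<close>

lemma compact_neighbourhood:
  fixes K :: "'b::euclidean_space set"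
  assumes "compact K" "open \<Omega>" "K \<subseteq> \<Omega>"
  obtains \<epsilon> K' where "0 < \<epsilon>" "compact K'" "K \<subseteq> K'" "K' \<subseteq> \<Omega>"
    "\<And>z y. y \<in> K \<Longrightarrow> dist z y \<le> \<epsilon> \<Longrightarrow> z \<in> K'"
proof (cases "K = {}")
  case True
  then show ?thesis using that[of 1 "{}"] by auto
next
  case False
  obtain \<epsilon> where e: "\<epsilon> > 0" "{x. infdist x K \<le> \<epsilon>} \<subseteq> \<Omega>"
    using compact_in_open_separated[OF False assms(1,2,3)] by blast
  show ?thesis
  proof (rule that[OF e(1) compact_infdist_le[OF False assms(1) e(1)] _ e(2)])
    show "K \<subseteq> {x. infdist x K \<le> \<epsilon>}" using e by auto
    show "z \<in> {x. infdist x K \<le> \<epsilon>}" if "y \<in> K" "dist z y \<le> \<epsilon>" for z y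
      using infdist_le[OF that(1), of z] that(2) by simp
  qed
qed

lemma L1_locI:
  fixes W :: "'b::euclidean_space \<Rightarrow> real"
  assumes \<Omega>: "open \<Omega>" and m: "(\<lambda>z. indicator \<Omega> z * W z) \<in> borel_measurable borel"
    and b: "\<And>K. compact K \<Longrightarrow> K \<subseteq> \<Omega> \<Longrightarrow> \<exists>B. \<forall>z\<in>K. \<bar>W z\<bar> \<le> B"
  shows "W \<in> L1_loc \<Omega>"
  unfolding L1_loc_def
proof (intro CollectI allI impI)
  fix K assume K: "compact K" "K \<subseteq> \<Omega>"
  obtain B where B: "\<And>z. z \<in> K \<Longrightarrow> \<bar>W z\<bar> \<le> B" using b[OF K] by blast
  have [measurable]: "K \<in> sets borel" using K by (simp add: borel_compact)
  have eq: "(\<lambda>z. indicator K z *\<^sub>R W z) = (\<lambda>z. indicator K z * (indicator \<Omega> z * W z))"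
    using K by (auto simp: fun_eq_iff indicator_def)
  have "integrable lborel (\<lambda>z. indicator K z *\<^sub>R W z)"
  proof (rule integrable_bounded_compact[OF _ K(1)])
    show "(\<lambda>z. indicator K z *\<^sub>R W z) \<in> borel_measurable borel"
      unfolding eq using m by measurable
    show "\<bar>indicator K z *\<^sub>R W z\<bar> \<le> B * indicator K z" for z
      using B[of z] by (simp add: indicator_def)
  qed
  then show "set_integrable lborel K W" by (simp add: set_integrable_def)
qed

text \<open>Integration by parts for difference quotients is translation invariance of Lebesgue
  measure, so the functions \<open>w n\<close> need not be differentiable. Both sides then pass to
  the limit by dominated convergence, since the quotients are assumed to converge almost
  everywhere.\<close>

lemma weak_deriv_of_difference_quotients:
  fixes w :: "nat \<Rightarrow> 'b::euclidean_space \<Rightarrow> real"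
  assumes \<Omega>: "open \<Omega>" and d: "d \<in> Basis" and s: "s \<longlonglongrightarrow> 0" "\<And>n. 0 < s n"
    and wm: "\<And>n. w n \<in> borel_measurable borel"
    and Wm: "(\<lambda>z. indicator \<Omega> z * W z) \<in> borel_measurable borel"
    and Em: "(\<lambda>z. indicator \<Omega> z * E z) \<in> borel_measurable borel"
    and Wb: "\<And>K. compact K \<Longrightarrow> K \<subseteq> \<Omega> \<Longrightarrow> \<exists>B. \<forall>z\<in>K. \<bar>W z\<bar> \<le> B"
    and Eb: "\<And>K. compact K \<Longrightarrow> K \<subseteq> \<Omega> \<Longrightarrow> \<exists>B. \<forall>z\<in>K. \<bar>E z\<bar> \<le> B"
    and b: "\<And>K. compact K \<Longrightarrow> K \<subseteq> \<Omega> \<Longrightarrow> \<exists>B\<ge>0. \<forall>\<^sub>F n in sequentially. \<forall>z\<in>K. \<bar>w n z\<bar> \<le> B \<and>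
      \<bar>(w n (z + s n *\<^sub>R d) - w n z) / s n\<bar> \<le> B"
    and Wl: "AE z in lborel. z \<in> \<Omega> \<longrightarrow> (\<lambda>n. w n z) \<longlonglongrightarrow> W z"
    and El: "AE z in lborel. z \<in> \<Omega> \<longrightarrow> (\<lambda>n. (w n (z + s n *\<^sub>R d) - w n z) / s n) \<longlonglongrightarrow> E z"
  shows "has_weak_deriv \<Omega> d W E"
  unfolding has_weak_deriv_def
proof (intro conjI ballI)
  show "W \<in> L1_loc \<Omega>" "E \<in> L1_loc \<Omega>" by (rule L1_locI; fact)+
  fix \<phi> assume \<phi>: "\<phi> \<in> Cc_infty \<Omega>"
  let ?D = "\<lambda>z. frechet_derivative \<phi> (at z) d"
  let ?E = "\<lambda>n z. (w n (z + s n *\<^sub>R d) - w n z) / s n"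
  note C1 = Cc_infty_C1[OF \<phi>]
  have [measurable]: "\<phi> \<in> borel_measurable borel" "?D \<in> borel_measurable borel"
    using C1 d by (auto intro: borel_measurable_continuous_onI)
  note wm[measurable]
  obtain K L where K: "compact K" "K \<subseteq> \<Omega>" and L: "0 \<le> L" "\<And>z. \<bar>\<phi> z\<bar> \<le> L * indicator K z" "\<And>z. \<bar>?D z\<bar> \<le> L * indicator K z"
    using test_function_bounds[OF \<phi> d] by blast
  obtain \<epsilon> K' where K': "0 < \<epsilon>" "compact K'" "K \<subseteq> K'" "K' \<subseteq> \<Omega>"
    "\<And>z y. y \<in> K \<Longrightarrow> dist z y \<le> \<epsilon> \<Longrightarrow> z \<in> K'"
    using compact_neighbourhood[OF K(1) \<Omega> K(2)] by blast
  obtain B where B0: "0 \<le> B" and B: "\<forall>\<^sub>F n in sequentially. \<forall>z\<in>K'. \<bar>w n z\<bar> \<le> B \<and> \<bar>?E n z\<bar> \<le> B"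
    using b[OF K'(2,4)] by blast
  have out: "\<phi> z = 0" "?D z = 0" if "z \<notin> K" for z using L(2,3)[of z] that by auto
  have ev: "\<forall>\<^sub>F n in sequentially. s n < \<epsilon> \<and> (\<forall>z\<in>K'. \<bar>w n z\<bar> \<le> B \<and> \<bar>?E n z\<bar> \<le> B)"
    using K'(1) by (intro eventually_conj B order_tendstoD(2)[OF s(1)])
  let ?A = "\<lambda>n z. w n z * ((\<phi> (z - s n *\<^sub>R d) - \<phi> z) / s n)"
  have A_bound: "\<bar>?A n z\<bar> \<le> (B * L) * indicator K' z" if n: "s n < \<epsilon>" "\<forall>z\<in>K'. \<bar>w n z\<bar> \<le> B \<and> \<bar>?E n z\<bar> \<le> B" for n z
  proof (cases "z \<in> K'")
    case True
    have "\<bar>?D y\<bar> \<le> L" for y using L(1) L(3)[of y] by (cases "y \<in> K") auto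
    then have "\<bar>\<phi> (z + (- s n) *\<^sub>R d) - \<phi> z\<bar> \<le> L * \<bar>- s n\<bar>"
      by (intro difference_bound C1)
    then have "\<bar>(\<phi> (z - s n *\<^sub>R d) - \<phi> z) / s n\<bar> \<le> L"
      using s(2)[of n] by (simp add: field_simps)
    moreover have "\<bar>w n z\<bar> \<le> B" using n(2) True by blast
    ultimately have "\<bar>?A n z\<bar> \<le> B * L" by (intro abs_mult_bound)
    then show ?thesis using True by simp
  next
    case False
    then have "z \<notin> K" using K'(3) by auto
    moreover have "z - s n *\<^sub>R d \<notin> K"
    proof
      assume "z - s n *\<^sub>R d \<in> K"
      moreover have "dist z (z - s n *\<^sub>R d) \<le> \<epsilon>" using n(1) s(2)[of n] d by (simp add: dist_norm)
      ultimately show False using False K'(5) by blast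
    qed
    ultimately show ?thesis using out False by simp
  qed
  have E_bound: "\<bar>?E n z * \<phi> z\<bar> \<le> (B * L) * indicator K' z" if "\<forall>z\<in>K'. \<bar>w n z\<bar> \<le> B \<and> \<bar>?E n z\<bar> \<le> B" for n z
  proof (cases "z \<in> K")
    case True
    then have "z \<in> K'" using K'(3) by auto
    then have "\<bar>?E n z\<bar> \<le> B" "\<bar>\<phi> z\<bar> \<le> L" using that L(2)[of z] True by auto
    then have "\<bar>?E n z * \<phi> z\<bar> \<le> B * L" by (rule abs_mult_bound)
    then show ?thesis using \<open>z \<in> K'\<close> by simp
  next
    case False
    then show ?thesis using out B0 L(1) by (auto simp: indicator_def)
  qed
  have eq: "(\<integral>z. ?A n z \<partial>lborel) = (\<integral>z. ?E n z * \<phi> z \<partial>lborel)"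
    if n: "s n < \<epsilon>" "\<forall>z\<in>K'. \<bar>w n z\<bar> \<le> B \<and> \<bar>?E n z\<bar> \<le> B" for n
  proof -
    let ?p = "\<lambda>z. w n z * \<phi> (z - s n *\<^sub>R d) / s n" and ?q = "\<lambda>z. w n z * \<phi> z / s n"
    have q: "integrable lborel ?q"
    proof (rule integrable_bounded_compact[OF _ K'(2)])
      fix z
      show "\<bar>?q z\<bar> \<le> (B * L / s n) * indicator K' z"
      proof (cases "z \<in> K")
        case True
        then have "z \<in> K'" using K'(3) by auto
        then have "\<bar>w n z\<bar> \<le> B" "\<bar>\<phi> z\<bar> \<le> L" using n L(2)[of z] True by auto
        then have "\<bar>w n z * \<phi> z\<bar> \<le> B * L" by (rule abs_mult_bound)
        then show ?thesis using \<open>z \<in> K'\<close> s(2)[of n] by (simp add: divide_right_mono)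
      next
        case False
        then show ?thesis using out B0 L(1) s(2)[of n] by (auto simp: indicator_def)
      qed
    qed measurable
    have A: "integrable lborel (?A n)"
      by (rule integrable_bounded_compact[OF _ K'(2) A_bound[OF n]]) measurable
    \<comment> \<open>Integrability of the shifted product follows from that of \<open>?A n\<close>
      and \<open>?q\<close>, which have been estimated on \<open>K'\<close>.\<close>
    have p: "integrable lborel ?p"
    proof -
      have "?p = (\<lambda>z. ?A n z + ?q z)"
        by (auto simp: fun_eq_iff field_simps diff_divide_distrib)
      then show ?thesis using A q by simp
    qed
    have "(\<integral>z. ?A n z \<partial>lborel) = (\<integral>z. ?p z - ?q z \<partial>lborel)"
      by (intro Bochner_Integration.integral_cong) (auto simp: field_simps diff_divide_distrib)
    also have "\<dots> = (\<integral>z. ?p z \<partial>lborel) - (\<integral>z. ?q z \<partial>lborel)"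
      using p q by simp
    also have "(\<integral>z. ?p z \<partial>lborel) = (\<integral>z. ?p (z + s n *\<^sub>R d) \<partial>lborel)"
      by (rule lborel_integral_translate[symmetric]) measurable
    finally have e1: "(\<integral>z. ?A n z \<partial>lborel) = (\<integral>z. ?p (z + s n *\<^sub>R d) \<partial>lborel) - (\<integral>z. ?q z \<partial>lborel)" .
    have p': "integrable lborel (\<lambda>z. ?p (z + s n *\<^sub>R d))"
    proof -
      have "integrable lborel (\<lambda>z. ?E n z * \<phi> z)"
        by (rule integrable_bounded_compact[OF _ K'(2) E_bound[OF n(2)]]) measurable
      moreover have "(\<lambda>z. ?p (z + s n *\<^sub>R d)) = (\<lambda>z. ?E n z * \<phi> z + ?q z)"
        by (auto simp: fun_eq_iff field_simps diff_divide_distrib)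
      ultimately show ?thesis using q by simp
    qed
    have "(\<integral>z. ?p (z + s n *\<^sub>R d) \<partial>lborel) - (\<integral>z. ?q z \<partial>lborel) = (\<integral>z. ?p (z + s n *\<^sub>R d) - ?q z \<partial>lborel)"
      using p' q by simp
    also have "\<dots> = (\<integral>z. ?E n z * \<phi> z \<partial>lborel)"
      by (intro Bochner_Integration.integral_cong) (auto simp: field_simps diff_divide_distrib)
    finally show ?thesis using e1 by simp
  qed
  have m1: "(\<lambda>z. indicator \<Omega> z * W z * (- ?D z)) \<in> borel_measurable borel" using Wm by measurable
  have m2: "(\<lambda>z. indicator \<Omega> z * E z * \<phi> z) \<in> borel_measurable borel" using Em by measurable
  have l1: "(\<lambda>n. \<integral>z. ?A n z \<partial>lborel) \<longlonglongrightarrow> (\<integral>z. indicator \<Omega> z * W z * (- ?D z) \<partial>lborel)"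
  proof (rule integral_tendsto_compact(2)[OF _ m1 K'(2)])
    show "\<forall>\<^sub>F n in sequentially. \<forall>z. \<bar>?A n z\<bar> \<le> (B * L) * indicator K' z"
      using ev by eventually_elim (use A_bound in blast)
    show "AE z in lborel. (\<lambda>n. ?A n z) \<longlonglongrightarrow> indicator \<Omega> z * W z * (- ?D z)"
      using Wl
    proof eventually_elim
      case (elim z)
      have "(\<lambda>n. (\<phi> (z + (- s n) *\<^sub>R d) - \<phi> z) / (- s n)) \<longlonglongrightarrow> ?D z"
      proof (intro difference_quotient C1)
        show "(\<lambda>n. - s n) \<longlonglongrightarrow> 0" using tendsto_minus[OF s(1)] by simp
        show "- s n \<noteq> 0" for n using s(2)[of n] by simp
      qed
      then have dq: "(\<lambda>n. (\<phi> (z - s n *\<^sub>R d) - \<phi> z) / s n) \<longlonglongrightarrow> - ?D z"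
        using tendsto_minus by fastforce
      show ?case
      proof (cases "z \<in> \<Omega>")
        case True
        then show ?thesis using tendsto_mult[OF elim[rule_format, OF True] dq] by simp
      next
        \<comment> \<open>Outside \<Omega> nothing is known about convergence of \<open>w n\<close>,
          but the integrand vanishes there as soon as the step is below \<epsilon>.\<close>
        case False
        then have z: "z \<notin> K'" using K'(4) by auto
        have "\<forall>\<^sub>F n in sequentially. ?A n z = 0"
          using ev
        proof eventually_elim
          case (elim n)
          then show ?case using A_bound[of n z] z by auto
        qed
        then show ?thesis using False by (simp add: tendsto_eventually)
      qed
    qed
  qed measurable
  have l2: "(\<lambda>n. \<integral>z. ?E n z * \<phi> z \<partial>lborel) \<longlonglongrightarrow> (\<integral>z. indicator \<Omega> z * E z * \<phi> z \<partial>lborel)"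
  proof (rule integral_tendsto_compact(2)[OF _ m2 K'(2)])
    show "\<forall>\<^sub>F n in sequentially. \<forall>z. \<bar>?E n z * \<phi> z\<bar> \<le> (B * L) * indicator K' z"
      using ev by eventually_elim (use E_bound in blast)
    show "AE z in lborel. (\<lambda>n. ?E n z * \<phi> z) \<longlonglongrightarrow> indicator \<Omega> z * E z * \<phi> z"
      using El
    proof eventually_elim
      case (elim z)
      show ?case
      proof (cases "z \<in> \<Omega>")
        case True
        from tendsto_mult[OF elim[rule_format, OF True] tendsto_const, of "\<phi> z"]
        show ?thesis using True by simp
      next
        case False
        then have "\<phi> z = 0" using out K by auto
        then show ?thesis by simp
      qed
    qed
  qed measurable
  have "\<forall>\<^sub>F n in sequentially. (\<integral>z. ?A n z \<partial>lborel) = (\<integral>z. ?E n z * \<phi> z \<partial>lborel)"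
    using ev by eventually_elim (rule eq; simp)
  then have "(\<lambda>n. \<integral>z. ?A n z \<partial>lborel) \<longlonglongrightarrow> (\<integral>z. indicator \<Omega> z * E z * \<phi> z \<partial>lborel)"
    using l2 by (rule tendsto_cong[THEN iffD2])
  with l1 have "(\<integral>z. indicator \<Omega> z * W z * (- ?D z) \<partial>lborel) = (\<integral>z. indicator \<Omega> z * E z * \<phi> z \<partial>lborel)"
    by (rule LIMSEQ_unique)
  then have "- (\<integral>z. indicator \<Omega> z * (W z * ?D z) \<partial>lborel) = (\<integral>z. indicator \<Omega> z * (E z * \<phi> z) \<partial>lborel)"
    by (simp add: mult.assoc)
  then show "(LINT z:\<Omega>|lborel. W z * ?D z) = - (LINT z:\<Omega>|lborel. E z * \<phi> z)"
    by (simp add: set_lebesgue_integral_def)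
qed

section \<open>Convergence of the flux\<close>

text \<open>The approximations become functions on the whole space that depend only on the
  coordinate along e. Gradients are then multiples of e, and the p-Laplacian acts as the
  one-dimensional operator with flux \<open>j\<close>.\<close>

locale planar_approximation = approximation p f v \<delta> h u
  for p f v \<delta> h u +
  fixes e :: "'a::euclidean_space"
  assumes e_Basis: "e \<in> Basis"
begin

definition vz :: "nat \<Rightarrow> 'a \<times> real \<Rightarrow> real" where "vz n z = v n (fst z \<bullet> e) (snd z)"

definition Dz :: "nat \<Rightarrow> 'a \<times> real \<Rightarrow> real" where
  "Dz n z = (vz n (z + \<delta> n *\<^sub>R (e, 0)) - vz n z) / \<delta> n"

definition uz :: "'a \<times> real \<Rightarrow> real" where "uz z = u (fst z \<bullet> e) (snd z)"

lemma vz_shift_e: "vz n (z + s *\<^sub>R (e, 0)) = v n (fst z \<bullet> e + s) (snd z)"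
  using e_Basis by (simp add: vz_def inner_add_left)

lemma vz_shift_other: "i \<in> Basis \<Longrightarrow> i \<noteq> e \<Longrightarrow> vz n (z + s *\<^sub>R (i, 0)) = vz n z"
  using e_Basis by (simp add: vz_def inner_add_left inner_not_same_Basis)

lemma vz_shift_t: "vz n (z + s *\<^sub>R (0, 1)) = v n (fst z \<bullet> e) (snd z + s)"
  by (simp add: vz_def)

lemma Dz_eq: "Dz n z = (v n (fst z \<bullet> e + \<delta> n) (snd z) - v n (fst z \<bullet> e) (snd z)) / \<delta> n"
  unfolding Dz_def vz_shift_e by (simp add: vz_def)

lemma vz_measurable [measurable]: "vz n \<in> borel_measurable borel"
proof -
  have "(\<lambda>z::'a \<times> real. (fst z \<bullet> e, snd z)) \<in> borel_measurable borel"
    by (intro borel_measurable_continuous_onI continuous_intros)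
  from measurable_compose[OF this v_measurable[of n]] show ?thesis by (simp add: vz_def[abs_def])
qed

lemma Dz_measurable [measurable]: "Dz n \<in> borel_measurable borel"
  unfolding Dz_def[abs_def] by measurable

lemma uz_cont: "continuous_on Q_infty uz"
proof -
  have "continuous_on Q_infty ((\<lambda>(x, t). u x t) \<circ> (\<lambda>z. (fst z \<bullet> e, snd z)))"
    by (intro continuous_on_compose continuous_intros continuous_on_subset[OF u_cont])
      (auto simp: Q_infty_def)
  then show ?thesis by (simp add: uz_def[abs_def] comp_def)
qed

lemma open_Q: "open (Q_infty :: ('a \<times> real) set)"
  unfolding Q_infty_def by (intro open_Times) auto

lemma Q_measurable [measurable]: "(Q_infty :: ('a \<times> real) set) \<in> sets borel"
  using open_Q by (rule borel_open)

lemma Q_iff: "z \<in> Q_infty \<longleftrightarrow> 0 < snd z" for z :: "'a \<times> real"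
  by (cases z) (simp add: Q_infty_def)

lemma vz_lim: "z \<in> Q_infty \<Longrightarrow> (\<lambda>n. vz n z) \<longlonglongrightarrow> uz z"
  unfolding vz_def uz_def by (intro v_lim) (simp add: Q_iff)

lemma compact_abscissa:
  assumes "compact K" "K \<subseteq> Q_infty"
  obtains r t0 where "0 \<le> r" "0 < t0" "\<And>z::'a \<times> real. z \<in> K \<Longrightarrow> \<bar>fst z \<bullet> e\<bar> \<le> r \<and> t0 \<le> snd z"
proof -
  obtain r t0 where r: "0 \<le> r" "0 < t0" "\<And>z. z \<in> K \<Longrightarrow> norm (fst z) \<le> r \<and> t0 \<le> snd z"
    using compact_in_slab[OF assms] by blast
  show ?thesis
  proof (rule that[OF r(1,2)])
    fix z assume "z \<in> K"
    then show "\<bar>fst z \<bullet> e\<bar> \<le> r \<and> t0 \<le> snd z"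
      using r(3)[of z] Basis_le_norm[OF e_Basis, of "fst z"] by simp
  qed
qed

lemma vz_local:
  assumes "compact K" "K \<subseteq> Q_infty"
  shows "\<exists>C\<ge>0. \<forall>\<^sub>F n in sequentially. \<forall>z\<in>K. 1 \<le> vz n z \<and> vz n z \<le> C \<and> \<bar>j (Dz n z)\<bar> \<le> C \<and> \<bar>Dz n z\<bar> \<le> C"
proof -
  obtain r t0 where r: "0 \<le> r" "0 < t0" "\<And>z. z \<in> K \<Longrightarrow> \<bar>fst z \<bullet> e\<bar> \<le> r \<and> t0 \<le> snd z"
    using compact_abscissa[OF assms] by blast
  obtain C where "0 \<le> C" and C: "\<forall>\<^sub>F n in sequentially. \<forall>x t. \<bar>x\<bar> \<le> r \<longrightarrow> t0 \<le> t \<longrightarrow>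
      v n x t \<le> C \<and> \<bar>j ((v n (x + \<delta> n) t - v n x t) / \<delta> n)\<bar> \<le> C \<and> \<bar>(v n (x + \<delta> n) t - v n x t) / \<delta> n\<bar> \<le> C"
    using v_local[OF r(1,2)] by blast
  from C have "\<forall>\<^sub>F n in sequentially. \<forall>z\<in>K. 1 \<le> vz n z \<and> vz n z \<le> C \<and> \<bar>j (Dz n z)\<bar> \<le> C \<and> \<bar>Dz n z\<bar> \<le> C"
  proof eventually_elim
    case (elim n)
    show ?case unfolding Dz_eq unfolding vz_def using elim r(3) v_ge_1 by blast
  qed
  then show ?thesis using \<open>0 \<le> C\<close> by blast
qed

lemma uz_ge_1: "z \<in> Q_infty \<Longrightarrow> 1 \<le> uz z"
  by (rule tendsto_lowerbound[OF vz_lim]) (auto simp: vz_def v_ge_1)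

lemma uz_bounded:
  assumes "compact K" "K \<subseteq> Q_infty"
  shows "\<exists>C. \<forall>z\<in>K. \<bar>uz z\<bar> \<le> C"
proof -
  have "bounded (uz ` K)"
    using assms uz_cont by (intro compact_imp_bounded compact_continuous_image) (auto intro: continuous_on_subset)
  then show ?thesis by (auto simp: bounded_iff)
qed

lemma uz_measurable: "(\<lambda>z. indicator Q_infty z * uz z) \<in> borel_measurable borel"
  using borel_measurable_continuous_on_indicator[OF Q_measurable uz_cont] by simp

section \<open>Upper and lower limits of the flux\<close>

text \<open>Defined at every point and Borel measurable without any hypothesis. The function
  \<open>real_of_ereal\<close> sends infinite values to 0, which does not occur in
  \<open>Q_infty\<close>, where the fluxes are locally bounded.\<close>

definition flux_sup :: "'a \<times> real \<Rightarrow> real" where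
  "flux_sup z = real_of_ereal (limsup (\<lambda>n. ereal (j (Dz n z))))"

definition flux_inf :: "'a \<times> real \<Rightarrow> real" where
  "flux_inf z = real_of_ereal (liminf (\<lambda>n. ereal (j (Dz n z))))"

lemma j_measurable [measurable]: "j \<in> borel_measurable borel"
  using j_cont by (rule borel_measurable_continuous_onI)

lemma flux_sup_measurable [measurable]: "flux_sup \<in> borel_measurable borel"
  unfolding flux_sup_def[abs_def] by measurable

lemma flux_inf_measurable [measurable]: "flux_inf \<in> borel_measurable borel"
  unfolding flux_inf_def[abs_def] by measurable

lemma flux_sup_flux_inf_bounds:
  assumes "\<forall>\<^sub>F n in sequentially. \<bar>j (Dz n z)\<bar> \<le> C"
  shows "limsup (\<lambda>n. ereal (j (Dz n z))) = ereal (flux_sup z)" "liminf (\<lambda>n. ereal (j (Dz n z))) = ereal (flux_inf z)"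
    "- C \<le> flux_inf z" "flux_inf z \<le> flux_sup z" "flux_sup z \<le> C"
proof -
  let ?s = "limsup (\<lambda>n. ereal (j (Dz n z)))" and ?i = "liminf (\<lambda>n. ereal (j (Dz n z)))"
  have 1: "?s \<le> ereal C"
    by (rule Limsup_bounded) (use assms in \<open>auto elim!: eventually_mono\<close>)
  have 2: "ereal (- C) \<le> ?i"
    by (rule Liminf_bounded) (use assms in \<open>auto elim!: eventually_mono\<close>)
  have 3: "?i \<le> ?s" by (rule Liminf_le_Limsup) simp
  have "\<bar>?s\<bar> \<noteq> \<infinity>" "\<bar>?i\<bar> \<noteq> \<infinity>" using 1 2 3 by auto
  then show s: "?s = ereal (flux_sup z)" and i: "?i = ereal (flux_inf z)"
    by (simp_all add: flux_sup_def flux_inf_def ereal_real')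
  show "- C \<le> flux_inf z" "flux_inf z \<le> flux_sup z" "flux_sup z \<le> C"
    using 1 2 3 unfolding s i by simp_all
qed

text \<open>Both quantities are compared with the flux \<open>Q\<close> of the mean slope of u
  between x and x + s. This mean slope involves only values of the approximations, which are known
  to converge; hence the upper limit at the right end is at most Q + C s and the lower limit at the
  left end at least Q - C s.\<close>

lemma flux_sup_flux_inf_flux:
  assumes "0 \<le> r" "0 < t0"
  shows "\<exists>C\<ge>0. \<forall>z s. \<bar>fst z \<bullet> e\<bar> \<le> r \<longrightarrow> t0 \<le> snd z \<longrightarrow> 0 < s \<longrightarrow> \<bar>fst z \<bullet> e + s\<bar> \<le> r \<longrightarrow>
    - C \<le> flux_inf z \<and> flux_inf z \<le> flux_sup z \<and> flux_sup z \<le> C \<and> flux_sup (z + s *\<^sub>R (e, 0)) \<le> flux_inf z + C * s"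
proof -
  obtain C0 where C0: "0 \<le> C0" and loc: "\<forall>\<^sub>F n in sequentially. \<forall>x t. \<bar>x\<bar> \<le> r \<longrightarrow> t0 \<le> t \<longrightarrow>
      v n x t \<le> C0 \<and> \<bar>j ((v n (x + \<delta> n) t - v n x t) / \<delta> n)\<bar> \<le> C0 \<and> \<bar>(v n (x + \<delta> n) t - v n x t) / \<delta> n\<bar> \<le> C0"
    using v_local[OF assms] by blast
  obtain C where C: "0 \<le> C" and fl: "\<forall>\<^sub>F n in sequentially.
      \<forall>x y t. \<bar>x\<bar> \<le> r \<longrightarrow> \<bar>y\<bar> \<le> r \<longrightarrow> t0 \<le> t \<longrightarrow> \<delta> n < y - x \<longrightarrow>
       (\<exists>\<theta>. \<bar>\<theta> - (y - x)\<bar> \<le> \<delta> n \<and>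
         j ((v n (y + \<delta> n) t - v n y t) / \<delta> n) \<le> j ((v n y t - v n x t) / \<theta>) + C * (y - x + \<delta> n) \<and>
         j ((v n y t - v n x t) / \<theta>) \<le> j ((v n (x + \<delta> n) t - v n x t) / \<delta> n) + C * (y - x + \<delta> n))"
    using v_flux[OF assms] by blast
  have b: "\<forall>\<^sub>F n in sequentially. \<bar>j (Dz n z)\<bar> \<le> C0" if "\<bar>fst z \<bullet> e\<bar> \<le> r" "t0 \<le> snd z" for z
    using loc by eventually_elim (use that in \<open>auto simp: Dz_eq simp del: j_le_iff\<close>)
  have main: "flux_sup (z + s *\<^sub>R (e, 0)) \<le> flux_inf z + 2 * C * s"
    if z: "\<bar>fst z \<bullet> e\<bar> \<le> r" "t0 \<le> snd z" and s: "0 < s" "\<bar>fst z \<bullet> e + s\<bar> \<le> r" for z s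
  proof -
    let ?x = "fst z \<bullet> e" and ?t = "snd z"
    let ?y = "?x + s" and ?z = "z + s *\<^sub>R (e, 0)"
    have z': "fst ?z \<bullet> e = ?y" "snd ?z = ?t" using e_Basis by (simp_all add: inner_add_left)
    have "\<forall>\<^sub>F n in sequentially. \<delta> n < s" using s by (intro order_tendstoD(2)[OF \<delta>_lim])
    with fl have ev: "\<forall>\<^sub>F n in sequentially. \<exists>\<theta>. \<bar>\<theta> - s\<bar> \<le> \<delta> n \<and>
         j (Dz n ?z) \<le> j ((v n ?y ?t - v n ?x ?t) / \<theta>) + C * (s + \<delta> n) \<and>
         j ((v n ?y ?t - v n ?x ?t) / \<theta>) \<le> j (Dz n z) + C * (s + \<delta> n)"
    proof eventually_elim
      case (elim n)
      from elim(1)[rule_format, of ?x ?y ?t] show ?case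
        unfolding Dz_eq z' using z s elim(2) by simp
    qed
    define P where "P n \<theta> \<longleftrightarrow> \<bar>\<theta> - s\<bar> \<le> \<delta> n \<and>
         j (Dz n ?z) \<le> j ((v n ?y ?t - v n ?x ?t) / \<theta>) + C * (s + \<delta> n) \<and>
         j ((v n ?y ?t - v n ?x ?t) / \<theta>) \<le> j (Dz n z) + C * (s + \<delta> n)" for n \<theta>
    \<comment> \<open>The length depends on n through rounding; a choice is fixed, and only its
      convergence to s matters.\<close>
    define \<theta> where "\<theta> n = (SOME x. P n x)" for n
    have ev': "\<forall>\<^sub>F n in sequentially. P n (\<theta> n)"
      using ev unfolding P_def[symmetric] \<theta>_def by eventually_elim (rule someI_ex)
    have "(\<lambda>n. \<theta> n - s) \<longlonglongrightarrow> 0"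
    proof (rule Lim_null_comparison[OF _ \<delta>_lim])
      show "\<forall>\<^sub>F n in sequentially. norm (\<theta> n - s) \<le> \<delta> n"
        using ev' by eventually_elim (simp add: P_def)
    qed
    then have \<theta>: "\<theta> \<longlonglongrightarrow> s" by (simp add: LIM_zero_iff)
    have t: "0 < ?t" using z assms by simp
    define Q where "Q = j ((u ?y ?t - u ?x ?t) / s)"
    have "(\<lambda>n. (v n ?y ?t - v n ?x ?t) / \<theta> n) \<longlonglongrightarrow> (u ?y ?t - u ?x ?t) / s"
      using s by (intro tendsto_intros v_lim t \<theta>) auto
    then have jl: "(\<lambda>n. j ((v n ?y ?t - v n ?x ?t) / \<theta> n)) \<longlonglongrightarrow> Q"
      unfolding Q_def by (rule continuous_on_tendsto_compose[OF j_cont]) auto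
    have up: "flux_sup ?z \<le> Q + C * s"
    proof -
      have "(\<lambda>n. ereal (j ((v n ?y ?t - v n ?x ?t) / \<theta> n) + C * (s + \<delta> n))) \<longlonglongrightarrow> ereal (Q + C * (s + 0))"
        by (intro tendsto_ereal tendsto_intros jl \<delta>_lim)
      then have "limsup (\<lambda>n. ereal (j ((v n ?y ?t - v n ?x ?t) / \<theta> n) + C * (s + \<delta> n))) = ereal (Q + C * (s + 0))"
        by (rule lim_imp_Limsup[rotated]) simp
      moreover have "limsup (\<lambda>n. ereal (j (Dz n ?z))) \<le> limsup (\<lambda>n. ereal (j ((v n ?y ?t - v n ?x ?t) / \<theta> n) + C * (s + \<delta> n)))"
        by (rule Limsup_mono) (use ev' in \<open>auto simp: P_def elim!: eventually_mono\<close>)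
      moreover have "limsup (\<lambda>n. ereal (j (Dz n ?z))) = ereal (flux_sup ?z)"
        using b[of ?z] z z' s by (intro flux_sup_flux_inf_bounds(1)) auto
      ultimately show ?thesis by simp
    qed
    have lo: "Q - C * s \<le> flux_inf z"
    proof -
      have "(\<lambda>n. ereal (j ((v n ?y ?t - v n ?x ?t) / \<theta> n) - C * (s + \<delta> n))) \<longlonglongrightarrow> ereal (Q - C * (s + 0))"
        by (intro tendsto_ereal tendsto_intros jl \<delta>_lim)
      then have "liminf (\<lambda>n. ereal (j ((v n ?y ?t - v n ?x ?t) / \<theta> n) - C * (s + \<delta> n))) = ereal (Q - C * (s + 0))"
        by (rule lim_imp_Liminf[rotated]) simp
      moreover have "liminf (\<lambda>n. ereal (j ((v n ?y ?t - v n ?x ?t) / \<theta> n) - C * (s + \<delta> n))) \<le> liminf (\<lambda>n. ereal (j (Dz n z)))"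
        by (rule Liminf_mono) (use ev' in \<open>auto simp: P_def algebra_simps elim!: eventually_mono\<close>)
      moreover have "liminf (\<lambda>n. ereal (j (Dz n z))) = ereal (flux_inf z)"
        using b[of z] z by (intro flux_sup_flux_inf_bounds(2)) auto
      ultimately show ?thesis by simp
    qed
    from up lo show ?thesis by simp
  qed
  show ?thesis
  proof (intro exI[of _ "max C0 (2 * C)"] conjI allI impI)
    fix z s assume z: "\<bar>fst z \<bullet> e\<bar> \<le> r" "t0 \<le> snd z" "0 < s" "\<bar>fst z \<bullet> e + s\<bar> \<le> r"
    show "- max C0 (2 * C) \<le> flux_inf z" "flux_inf z \<le> flux_sup z" "flux_sup z \<le> max C0 (2 * C)"
      using flux_sup_flux_inf_bounds(3-5)[OF b[OF z(1,2)]] by auto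
    have "2 * C * s \<le> max C0 (2 * C) * s" using z by (intro mult_right_mono) auto
    with main[OF z] show "flux_sup (z + s *\<^sub>R (e, 0)) \<le> flux_inf z + max C0 (2 * C) * s" by simp
  qed (use C0 in auto)
qed

text \<open>The flux \<open>j (Dz n z)\<close> is almost decreasing along \<open>e\<close>, so its upper and lower limits
  differ only by a shift along \<open>e\<close> that can be made arbitrarily small. Integration against a
  weight removes the shift by translation invariance, which spares us Fubini's theorem and the
  countability of the discontinuities of monotone functions.\<close>

lemma flux_sup_eq_flux_inf_AE: "AE z in lborel. z \<in> Q_infty \<longrightarrow> flux_sup z = flux_inf z"
proof -
  \<comment> \<open>Weights that are positive exactly where norm z < k + 1 and t > 1 / (k + 1); over
    all k these sets exhaust \<open>Q_infty\<close>. Continuity of the weights makes their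
    translates converge.\<close>
  define \<psi> where "\<psi> k z = max 0 (real (Suc k) - norm z) * max 0 (snd z - 1 / real (Suc k))" for k and z :: "'a \<times> real"
  have \<psi>_cont: "continuous_on UNIV (\<psi> k)" for k unfolding \<psi>_def[abs_def] by (intro continuous_intros)
  have \<psi>_nonneg: "0 \<le> \<psi> k z" for k z by (simp add: \<psi>_def)
  have [measurable]: "\<psi> k \<in> borel_measurable borel" for k
    using \<psi>_cont by (rule borel_measurable_continuous_onI)
  have "AE z in lborel. (flux_sup z - flux_inf z) * \<psi> k z = 0" for k
  proof -
    \<comment> \<open>The radius is enlarged by 1 to contain the translated supports, all shifts
      \<open>s n\<close> being at most 1.\<close>
    define K :: "('a \<times> real) set" where "K = cball 0 (real (Suc k) + 1) \<inter> {z. 1 / real (Suc k) \<le> snd z}"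
    have K: "compact K" unfolding K_def
      by (intro compact_Int_closed compact_cball closed_Collect_le continuous_intros)
    have \<psi>_out: "\<psi> k z = 0" if "\<not> (norm z \<le> real (Suc k) \<and> 1 / real (Suc k) \<le> snd z)" for z
      using that by (auto simp: \<psi>_def max_def)
    define B where "B = (real (Suc k)) * (real (Suc k))"
    have \<psi>_B: "\<psi> k z \<le> B" for z
    proof (cases "norm z \<le> real (Suc k)")
      case True
      have "snd z \<le> norm z" by (metis abs_ge_self norm_snd_le order_trans prod.collapse real_norm_def)
      moreover have "0 \<le> 1 / real (Suc k)" by simp
      ultimately have "max 0 (snd z - 1 / real (Suc k)) \<le> real (Suc k)" using True by linarith
      then show ?thesis unfolding \<psi>_def B_def by (intro mult_mono) auto
    next
      case False
      then show ?thesis using \<psi>_out[of z] by (simp add: B_def)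
    qed
    define r where "r = real (Suc k) + 3"
    obtain C where C: "0 \<le> C" and c: "\<And>z s. \<bar>fst z \<bullet> e\<bar> \<le> r \<Longrightarrow> 1 / real (Suc k) \<le> snd z \<Longrightarrow> 0 < s \<Longrightarrow> \<bar>fst z \<bullet> e + s\<bar> \<le> r \<Longrightarrow>
      - C \<le> flux_inf z \<and> flux_inf z \<le> flux_sup z \<and> flux_sup z \<le> C \<and> flux_sup (z + s *\<^sub>R (e, 0)) \<le> flux_inf z + C * s"
      using flux_sup_flux_inf_flux[of r "1 / real (Suc k)"] by (auto simp: r_def)
    have inr: "\<bar>fst z \<bullet> e\<bar> \<le> real (Suc k) + 1" if "norm z \<le> real (Suc k) + 1" for z :: "'a \<times> real"
      using Basis_le_norm[OF e_Basis, of "fst z"] norm_fst_le[of "fst z" "snd z"] that by simp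
    have c1: "- C \<le> flux_inf z" "flux_inf z \<le> flux_sup z" "flux_sup z \<le> C" "\<bar>flux_sup z\<bar> \<le> C" "\<bar>flux_inf z\<bar> \<le> C"
      if "norm z \<le> real (Suc k) + 1" "1 / real (Suc k) \<le> snd z" for z
    proof -
      have "\<bar>fst z \<bullet> e\<bar> \<le> r" "\<bar>fst z \<bullet> e + 1\<bar> \<le> r"
        using inr[OF that(1)] unfolding r_def by linarith+
      from c[OF this(1) that(2) _ this(2)]
      show "- C \<le> flux_inf z" "flux_inf z \<le> flux_sup z" "flux_sup z \<le> C" "\<bar>flux_sup z\<bar> \<le> C" "\<bar>flux_inf z\<bar> \<le> C" by auto
    qed
    define s where "s n = 1 / real (Suc n)" for n
    have s: "0 < s n" "s n \<le> 1" for n by (simp_all add: s_def)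
    have sl: "s \<longlonglongrightarrow> 0" unfolding s_def[abs_def] by (rule LIMSEQ_Suc[OF lim_1_over_n])
    have sup: "norm z \<le> real (Suc k) + 1 \<and> 1 / real (Suc k) \<le> snd z" if "\<psi> k (z - s n *\<^sub>R (e, 0)) \<noteq> 0" for z n
    proof -
      have a: "norm (z - s n *\<^sub>R (e, 0)) \<le> real (Suc k) \<and> 1 / real (Suc k) \<le> snd (z - s n *\<^sub>R (e, 0))"
        using \<psi>_out that by blast
      have "norm z \<le> norm (z - s n *\<^sub>R (e, 0)) + norm (s n *\<^sub>R (e, 0::real))"
        by (metis diff_add_cancel norm_triangle_ineq)
      also have "norm (s n *\<^sub>R (e, 0::real)) \<le> 1" using s[of n] e_Basis by (simp add: norm_Pair)
      finally show ?thesis using a by simp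
    qed
    have gsb: "\<bar>flux_sup z * \<psi> k (z - s n *\<^sub>R (e, 0))\<bar> \<le> (C * B) * indicator K z" for z n
    proof (cases "\<psi> k (z - s n *\<^sub>R (e, 0)) = 0")
      case False
      from sup[OF this] have "\<bar>flux_sup z\<bar> \<le> C" "z \<in> K" using c1 by (auto simp: K_def)
      moreover have "\<bar>\<psi> k (z - s n *\<^sub>R (e, 0))\<bar> \<le> B" using \<psi>_B \<psi>_nonneg by simp
      ultimately show ?thesis using abs_mult_bound[of "flux_sup z" C] by simp
    qed (use C B_def in simp)
    have \<psi>b: "\<bar>g z * \<psi> k z\<bar> \<le> (A * B) * indicator K z"
      if "\<And>z. norm z \<le> real (Suc k) \<Longrightarrow> 1 / real (Suc k) \<le> snd z \<Longrightarrow> \<bar>g z\<bar> \<le> A" "0 \<le> A" for g A z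
    proof (cases "\<psi> k z = 0")
      case False
      then have "norm z \<le> real (Suc k)" "1 / real (Suc k) \<le> snd z" using \<psi>_out by blast+
      then have "\<bar>g z\<bar> \<le> A" "z \<in> K" using that(1)[of z] by (auto simp: K_def)
      moreover have "\<bar>\<psi> k z\<bar> \<le> B" using \<psi>_B \<psi>_nonneg by simp
      ultimately show ?thesis using abs_mult_bound[of "g z" A] by simp
    qed (use that B_def in simp)
    have int_gs: "integrable lborel (\<lambda>z. flux_sup z * \<psi> k z)"
      by (rule integrable_bounded_compact[OF _ K \<psi>b]) (use c1 C in auto)
    have int_gi: "integrable lborel (\<lambda>z. flux_inf z * \<psi> k z)"
      by (rule integrable_bounded_compact[OF _ K \<psi>b]) (use c1 C in auto)
    have int_\<psi>: "integrable lborel (\<lambda>z. 1 * \<psi> k z)"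
      by (rule integrable_bounded_compact[OF _ K \<psi>b[of "\<lambda>_. 1" 1]]) auto
    have l1: "(\<lambda>n. \<integral>z. flux_sup z * \<psi> k (z - s n *\<^sub>R (e, 0)) \<partial>lborel) \<longlonglongrightarrow> (\<integral>z. flux_sup z * \<psi> k z \<partial>lborel)"
    proof (rule integral_tendsto_compact(2)[OF _ _ K])
      show "\<forall>\<^sub>F n in sequentially. \<forall>z. \<bar>flux_sup z * \<psi> k (z - s n *\<^sub>R (e, 0))\<bar> \<le> (C * B) * indicator K z"
        using gsb by simp
      have "(\<lambda>n. flux_sup z * \<psi> k (z - s n *\<^sub>R (e, 0))) \<longlonglongrightarrow> flux_sup z * \<psi> k z" for z
      proof (intro tendsto_mult tendsto_const)
        have "(\<lambda>n. z - s n *\<^sub>R (e, 0)) \<longlonglongrightarrow> z - 0 *\<^sub>R (e, 0)" by (intro tendsto_intros sl)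
        then have "(\<lambda>n. z - s n *\<^sub>R (e, 0)) \<longlonglongrightarrow> z" by (simp only: scaleR_zero_left diff_zero)
        from continuous_on_tendsto_compose[OF \<psi>_cont[of k] this]
        show "(\<lambda>n. \<psi> k (z - s n *\<^sub>R (e, 0))) \<longlonglongrightarrow> \<psi> k z" by simp
      qed
      then show "AE z in lborel. (\<lambda>n. flux_sup z * \<psi> k (z - s n *\<^sub>R (e, 0))) \<longlonglongrightarrow> flux_sup z * \<psi> k z" by simp
    qed measurable
    \<comment> \<open>Translation moves the shift from the weight to the flux, where it costs C
      times \<open>s n\<close> and turns the upper limit into the lower one.\<close>
    have le: "(\<integral>z. flux_sup z * \<psi> k (z - s n *\<^sub>R (e, 0)) \<partial>lborel)
        \<le> (\<integral>z. flux_inf z * \<psi> k z \<partial>lborel) + C * s n * (\<integral>z. 1 * \<psi> k z \<partial>lborel)" for n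
    proof -
      have i: "integrable lborel (\<lambda>z. flux_sup z * \<psi> k (z - s n *\<^sub>R (e, 0)))"
        by (rule integrable_bounded_compact[OF _ K gsb]) measurable
      have tr: "(\<integral>z. flux_sup z * \<psi> k (z - s n *\<^sub>R (e, 0)) \<partial>lborel)
          = (\<integral>z. flux_sup (z + s n *\<^sub>R (e, 0)) * \<psi> k z \<partial>lborel)"
        using lborel_integral_translate[of "\<lambda>z. flux_sup z * \<psi> k (z - s n *\<^sub>R (e, 0))" "s n *\<^sub>R (e, 0)"] by simp
      have pt: "flux_sup (z + s n *\<^sub>R (e, 0)) * \<psi> k z \<le> flux_inf z * \<psi> k z + C * s n * (1 * \<psi> k z)" for z
      proof (cases "\<psi> k z = 0")
        case False
        then have z: "norm z \<le> real (Suc k)" "1 / real (Suc k) \<le> snd z" using \<psi>_out[of z] by auto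
        then have "flux_sup (z + s n *\<^sub>R (e, 0)) \<le> flux_inf z + C * s n"
        proof -
          have "\<bar>fst z \<bullet> e\<bar> \<le> r" "\<bar>fst z \<bullet> e + s n\<bar> \<le> r"
            using inr[of z] z s[of n] unfolding r_def by linarith+
          from c[OF this(1) z(2) s(1) this(2)] show ?thesis by blast
        qed
        from mult_right_mono[OF this \<psi>_nonneg[of k z]] show ?thesis by (simp add: algebra_simps)
      qed simp
      have i': "integrable lborel (\<lambda>z. flux_sup (z + s n *\<^sub>R (e, 0)) * \<psi> k z)"
      proof (rule integrable_bounded_compact[OF _ K \<psi>b[of _ C]])
        fix z :: "'a \<times> real" assume z: "norm z \<le> real (Suc k)" "1 / real (Suc k) \<le> snd z"
        have "\<psi> k z \<le> B" by (rule \<psi>_B)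
        have "norm (z + s n *\<^sub>R (e, 0)) \<le> norm z + norm (s n *\<^sub>R (e, 0::real))" by (rule norm_triangle_ineq)
        also have "norm (s n *\<^sub>R (e, 0::real)) \<le> 1" using s[of n] e_Basis by (simp add: norm_Pair)
        finally show "\<bar>flux_sup (z + s n *\<^sub>R (e, 0))\<bar> \<le> C" using z by (intro c1) auto
      qed (use C in measurable)
      have "(\<integral>z. flux_sup (z + s n *\<^sub>R (e, 0)) * \<psi> k z \<partial>lborel)
          \<le> (\<integral>z. flux_inf z * \<psi> k z + C * s n * (1 * \<psi> k z) \<partial>lborel)"
        by (intro integral_mono i' Bochner_Integration.integrable_add int_gi integrable_mult_right int_\<psi> pt)
      also have "\<dots> = (\<integral>z. flux_inf z * \<psi> k z \<partial>lborel) + C * s n * (\<integral>z. 1 * \<psi> k z \<partial>lborel)"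
        using int_gi int_\<psi> by simp
      finally show ?thesis unfolding tr .
    qed
    have "(\<lambda>n. (\<integral>z. flux_inf z * \<psi> k z \<partial>lborel) + C * s n * (\<integral>z. 1 * \<psi> k z \<partial>lborel)) \<longlonglongrightarrow>
        (\<integral>z. flux_inf z * \<psi> k z \<partial>lborel) + C * 0 * (\<integral>z. 1 * \<psi> k z \<partial>lborel)"
      by (intro tendsto_intros sl)
    from LIMSEQ_le[OF l1 this] have "(\<integral>z. flux_sup z * \<psi> k z \<partial>lborel) \<le> (\<integral>z. flux_inf z * \<psi> k z \<partial>lborel)"
      using le by auto
    then have le0: "(\<integral>z. (flux_sup z - flux_inf z) * \<psi> k z \<partial>lborel) \<le> 0"
      using int_gs int_gi by (simp add: left_diff_distrib)
    have nn: "0 \<le> (flux_sup z - flux_inf z) * \<psi> k z" for z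
    proof (cases "\<psi> k z = 0")
      case False
      then have "norm z \<le> real (Suc k)" "1 / real (Suc k) \<le> snd z" using \<psi>_out by blast+
      then have "flux_inf z \<le> flux_sup z" by (intro c1(2)) auto
      then show ?thesis using \<psi>_nonneg[of k z] by simp
    qed simp
    have "integrable lborel (\<lambda>z. (flux_sup z - flux_inf z) * \<psi> k z)"
      using int_gs int_gi by (simp add: left_diff_distrib)
    moreover have "(\<integral>z. (flux_sup z - flux_inf z) * \<psi> k z \<partial>lborel) = 0"
      using le0 nn by (intro antisym integral_nonneg) auto
    ultimately show ?thesis
      using integral_nonneg_eq_0_iff_AE[of lborel "\<lambda>z. (flux_sup z - flux_inf z) * \<psi> k z"] nn by simp
  qed
  then have "AE z in lborel. \<forall>k. (flux_sup z - flux_inf z) * \<psi> k z = 0" unfolding AE_all_countable by blast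
  then show ?thesis
  proof eventually_elim
    case (elim z)
    show ?case
    proof
      assume "z \<in> Q_infty"
      then have t: "0 < snd z" by (simp add: Q_iff)
      obtain k :: nat where k: "norm z + 1 / snd z < real k" using reals_Archimedean2 by blast
      have t1: "0 < 1 / snd z" using t by simp
      have "1 / snd z < real (Suc k)" using k norm_ge_zero[of z] unfolding of_nat_Suc by linarith
      then have "1 / real (Suc k) < snd z" using t by (simp add: field_simps)
      moreover have "norm z < real (Suc k)" using k t1 unfolding of_nat_Suc by linarith
      ultimately have "0 < \<psi> k z" by (simp add: \<psi>_def)
      then show "flux_sup z = flux_inf z" using elim[rule_format, of k] by simp
    qed
  qed
qed

definition Dlim :: "'a \<times> real \<Rightarrow> real" where "Dlim z = jinv p (flux_sup z)"

lemma Dlim_measurable [measurable]: "Dlim \<in> borel_measurable borel"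
proof -
  have [measurable]: "jinv p \<in> borel_measurable borel"
    using jinv_cont by (rule borel_measurable_continuous_onI)
  show ?thesis unfolding Dlim_def[abs_def] by measurable
qed

lemma Dlim_local:
  assumes "compact K" "K \<subseteq> Q_infty"
  shows "\<exists>C\<ge>0. \<forall>z\<in>K. \<bar>j (Dlim z)\<bar> \<le> C \<and> \<bar>Dlim z\<bar> \<le> C"
proof -
  obtain C where C: "0 \<le> C" and ev: "\<forall>\<^sub>F n in sequentially. \<forall>z\<in>K. 1 \<le> vz n z \<and> vz n z \<le> C \<and> \<bar>j (Dz n z)\<bar> \<le> C \<and> \<bar>Dz n z\<bar> \<le> C"
    using vz_local[OF assms] by blast
  have b: "\<bar>flux_sup z\<bar> \<le> C" if "z \<in> K" for z
  proof -
    have "\<forall>\<^sub>F n in sequentially. \<bar>j (Dz n z)\<bar> \<le> C" using ev by eventually_elim (use that in blast)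
    from flux_sup_flux_inf_bounds(3-5)[OF this] show ?thesis by simp
  qed
  have "\<bar>Dlim z\<bar> \<le> jinv p C" if "z \<in> K" for z
  proof -
    have "jinv p (flux_sup z) \<le> jinv p C" "jinv p (- C) \<le> jinv p (flux_sup z)"
      using b[OF that] unfolding jinv_le_iff by auto
    moreover have "jinv p (- C) = - jinv p C" by (simp add: jinv_def sgn_minus)
    ultimately show ?thesis unfolding Dlim_def by linarith
  qed
  then show ?thesis using b C
    by (intro exI[of _ "max C (jinv p C)"]) (auto simp: Dlim_def le_max_iff_disj)
qed

text \<open>Equality of upper and lower limit means convergence of the fluxes, and the continuous
  inverse \<open>jinv p\<close> transfers it to the slopes. The one-sided bound concerns fluxes, so
  the slopes cannot be treated directly.\<close>

lemma Dz_lim: "AE z in lborel. z \<in> Q_infty \<longrightarrow> (\<lambda>n. Dz n z) \<longlonglongrightarrow> Dlim z"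
  using flux_sup_eq_flux_inf_AE
proof eventually_elim
  case (elim z)
  show ?case
  proof
    assume z: "z \<in> Q_infty"
    have "compact {z}" "{z} \<subseteq> Q_infty" using z by auto
    from vz_local[OF this] obtain C where
      "\<forall>\<^sub>F n in sequentially. 1 \<le> vz n z \<and> vz n z \<le> C \<and> \<bar>j (Dz n z)\<bar> \<le> C \<and> \<bar>Dz n z\<bar> \<le> C"
      by auto
    then have "\<forall>\<^sub>F n in sequentially. \<bar>j (Dz n z)\<bar> \<le> C" by eventually_elim blast
    from flux_sup_flux_inf_bounds(1,2)[OF this] elim z have "(\<lambda>n. ereal (j (Dz n z))) \<longlonglongrightarrow> ereal (flux_sup z)"
      by (subst tendsto_iff_Liminf_eq_Limsup) auto
    then have "(\<lambda>n. j (Dz n z)) \<longlonglongrightarrow> flux_sup z" by simp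
    then have "(\<lambda>n. jinv p (j (Dz n z))) \<longlonglongrightarrow> jinv p (flux_sup z)"
      by (rule continuous_on_tendsto_compose[OF jinv_cont]) auto
    then show "(\<lambda>n. Dz n z) \<longlonglongrightarrow> Dlim z" by (simp add: Dlim_def)
  qed
qed

end

section \<open>Compositions with smooth functions\<close>

lemma lborel_integrable_translate:
  fixes \<phi> :: "'b::euclidean_space \<Rightarrow> real"
  assumes "integrable lborel \<phi>"
  shows "integrable lborel (\<lambda>z. \<phi> (z + d))"
proof -
  have "integrable (distr lborel borel ((+) d)) \<phi>" using assms by (simp add: lborel_distr_plus)
  then have "integrable lborel (\<lambda>z. \<phi> (d + z))"
    using assms by (subst (asm) integrable_distr_eq) auto
  then show ?thesis by (simp add: add.commute)
qed

lemma mvt_between: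
  fixes g h :: "real \<Rightarrow> real"
  assumes "\<And>s. 0 < s \<Longrightarrow> (g has_real_derivative h s) (at s)" "0 < a" "0 < b"
  shows "\<exists>\<xi>. min a b \<le> \<xi> \<and> \<xi> \<le> max a b \<and> g b - g a = (b - a) * h \<xi>"
proof -
  have *: "\<exists>\<xi>. a \<le> \<xi> \<and> \<xi> \<le> b \<and> g b - g a = (b - a) * h \<xi>" if "0 < a" "a < b" for a b
    using MVT2[OF that(2), of g h] assms(1) that by (metis less_imp_le order_less_le_trans)
  consider "a < b" | "b < a" | "a = b" by linarith
  then show ?thesis
  proof cases
    case 1 then show ?thesis using *[of a b] assms by (auto simp: min_def max_def)
  next
    case 2
    then obtain \<xi> where "b \<le> \<xi>" "\<xi> \<le> a" "g a - g b = (a - b) * h \<xi>" using *[of b a] assms by auto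
    then show ?thesis using 2 by (intro exI[of _ \<xi>]) (auto simp: algebra_simps)
  next
    case 3 then show ?thesis by (intro exI[of _ a]) auto
  qed
qed

text \<open>The base points \<open>a n\<close> move with n, so differentiability at the limit point
  alone would not suffice; the mean value theorem together with continuity of the derivative h takes
  care of this.\<close>

lemma chain_quotient:
  fixes g h :: "real \<Rightarrow> real"
  assumes g: "\<And>s. 0 < s \<Longrightarrow> (g has_real_derivative h s) (at s)" and h: "continuous_on UNIV h"
    and a: "a \<longlonglongrightarrow> a0" "\<And>n. 0 < a n" and b: "\<And>n. 0 < a n + s n * D n"
    and D: "D \<longlonglongrightarrow> D0" and s: "s \<longlonglongrightarrow> 0" "\<And>n. s n \<noteq> 0"
  shows "(\<lambda>n. (g (a n + s n * D n) - g (a n)) / s n) \<longlonglongrightarrow> h a0 * D0"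
proof -
  have "\<forall>n. \<exists>\<xi>. min (a n) (a n + s n * D n) \<le> \<xi> \<and> \<xi> \<le> max (a n) (a n + s n * D n) \<and>
      g (a n + s n * D n) - g (a n) = (a n + s n * D n - a n) * h \<xi>"
    using mvt_between[OF g a(2) b] by blast
  then obtain \<xi> where \<xi>: "\<And>n. min (a n) (a n + s n * D n) \<le> \<xi> n" "\<And>n. \<xi> n \<le> max (a n) (a n + s n * D n)"
      "\<And>n. g (a n + s n * D n) - g (a n) = (a n + s n * D n - a n) * h (\<xi> n)"
    by metis
  have ab: "(\<lambda>n. a n + s n * D n) \<longlonglongrightarrow> a0 + 0 * D0" by (intro tendsto_intros a D s)
  have "(\<lambda>n. min (a n) (a n + s n * D n)) \<longlonglongrightarrow> min a0 (a0 + 0 * D0)"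
    "(\<lambda>n. max (a n) (a n + s n * D n)) \<longlonglongrightarrow> max a0 (a0 + 0 * D0)"
    by (intro tendsto_min tendsto_max a(1) ab)+
  then have mm: "(\<lambda>n. min (a n) (a n + s n * D n)) \<longlonglongrightarrow> a0" "(\<lambda>n. max (a n) (a n + s n * D n)) \<longlonglongrightarrow> a0"
    by simp_all
  have "\<xi> \<longlonglongrightarrow> a0"
    by (rule tendsto_sandwich[OF _ _ mm]) (use \<xi> in auto)
  then have "(\<lambda>n. h (\<xi> n)) \<longlonglongrightarrow> h a0" by (intro continuous_on_tendsto_compose[OF h]) auto
  then have "(\<lambda>n. h (\<xi> n) * D n) \<longlonglongrightarrow> h a0 * D0" by (intro tendsto_intros D)
  moreover have "(g (a n + s n * D n) - g (a n)) / s n = h (\<xi> n) * D n" for n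
    unfolding \<xi>(3) using s(2)[of n] by simp
  ultimately show ?thesis by simp
qed

lemma continuous_bounded_interval:
  fixes g :: "real \<Rightarrow> real"
  assumes "continuous_on {1..C} g"
  shows "\<exists>B\<ge>0. \<forall>s. 1 \<le> s \<longrightarrow> s \<le> C \<longrightarrow> \<bar>g s\<bar> \<le> B"
proof -
  have "bounded (g ` {1..C})" using assms by (intro compact_imp_bounded compact_continuous_image) auto
  then obtain B where "\<forall>s\<in>{1..C}. \<bar>g s\<bar> \<le> B" by (auto simp: bounded_iff)
  then show ?thesis by (intro exI[of _ "max 0 B"]) (auto simp: le_max_iff_disj)
qed

lemma test_function_uniform_bounds:
  assumes "\<phi> \<in> Cc_infty \<Omega>" "d \<in> Basis"
  shows "\<exists>L\<ge>0. \<forall>z. \<bar>\<phi> z\<bar> \<le> L \<and> \<bar>frechet_derivative \<phi> (at z) d\<bar> \<le> L"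
proof -
  obtain K L where L: "0 \<le> L" "\<And>z. \<bar>\<phi> z\<bar> \<le> L * indicator K z"
    "\<And>z. \<bar>frechet_derivative \<phi> (at z) d\<bar> \<le> L * indicator K z"
    using test_function_bounds[OF assms] by metis
  have "L * indicator K z \<le> L" for z using L by (simp add: indicator_def)
  then show ?thesis using L by (meson order_trans)
qed

context planar_approximation begin

lemma vz_pos: "0 < vz n z" "1 \<le> vz n z"
  using v_ge_1[of n "fst z \<bullet> e" "snd z"] by (auto simp: vz_def)

text \<open>The factor e \<bullet> i is 1 or 0, which treats the direction e and the directions
  orthogonal to it in one formula.\<close>

lemma vz_shift:
  assumes "i \<in> Basis"
  shows "vz n (z + \<delta> n *\<^sub>R (i, 0)) = vz n z + \<delta> n * (Dz n z * (e \<bullet> i))"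
proof (cases "i = e")
  case True
  then show ?thesis using \<delta>_pos[of n] e_Basis by (simp add: Dz_def)
next
  case False
  then show ?thesis using vz_shift_other[OF assms False, of n z "\<delta> n"] e_Basis assms
    by (simp add: inner_not_same_Basis)
qed

lemma Basis_x: "i \<in> Basis \<Longrightarrow> (i, 0::real) \<in> Basis" and Basis_t: "(0::'a, 1::real) \<in> Basis"
  by (auto simp: Basis_prod_def)

lemma e_inner: "i \<in> Basis \<Longrightarrow> \<bar>e \<bullet> i\<bar> \<le> 1"
  using e_Basis by (simp add: inner_Basis)

lemma uz_weak_deriv:
  assumes i: "i \<in> Basis"
  shows "has_weak_deriv Q_infty (i, 0) uz (\<lambda>z. Dlim z * (e \<bullet> i))"
proof (rule weak_deriv_of_difference_quotients[OF open_Q Basis_x[OF i] \<delta>_lim \<delta>_pos vz_measurable uz_measurable])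
  have q: "(vz n (z + \<delta> n *\<^sub>R (i, 0)) - vz n z) / \<delta> n = Dz n z * (e \<bullet> i)" for n z
    unfolding vz_shift[OF i] using \<delta>_pos[of n] by simp
  show "(\<lambda>z. indicator Q_infty z * (Dlim z * (e \<bullet> i))) \<in> borel_measurable borel" by measurable
  fix K :: "('a \<times> real) set" assume K: "compact K" "K \<subseteq> Q_infty"
  show "\<exists>B. \<forall>z\<in>K. \<bar>uz z\<bar> \<le> B" by (rule uz_bounded[OF K])
  have m: "\<bar>a * (e \<bullet> i)\<bar> \<le> C" if "\<bar>a\<bar> \<le> C" for a C
    using abs_mult_bound[OF that e_inner[OF i]] by simp
  obtain C where C: "0 \<le> C" "\<forall>z\<in>K. \<bar>j (Dlim z)\<bar> \<le> C \<and> \<bar>Dlim z\<bar> \<le> C" using Dlim_local[OF K] by blast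
  then show "\<exists>B. \<forall>z\<in>K. \<bar>Dlim z * (e \<bullet> i)\<bar> \<le> B" using m by blast
  obtain C where C: "0 \<le> C" and ev: "\<forall>\<^sub>F n in sequentially. \<forall>z\<in>K. 1 \<le> vz n z \<and> vz n z \<le> C \<and> \<bar>j (Dz n z)\<bar> \<le> C \<and> \<bar>Dz n z\<bar> \<le> C"
    using vz_local[OF K] by blast
  have "\<forall>\<^sub>F n in sequentially. \<forall>z\<in>K. \<bar>vz n z\<bar> \<le> C \<and> \<bar>(vz n (z + \<delta> n *\<^sub>R (i, 0)) - vz n z) / \<delta> n\<bar> \<le> C"
    using ev unfolding q by eventually_elim (use m in \<open>auto simp: abs_of_pos vz_pos\<close>)
  then show "\<exists>B\<ge>0. \<forall>\<^sub>F n in sequentially. \<forall>z\<in>K. \<bar>vz n z\<bar> \<le> B \<and> \<bar>(vz n (z + \<delta> n *\<^sub>R (i, 0)) - vz n z) / \<delta> n\<bar> \<le> B"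
    using C by blast
next
  show "AE z in lborel. z \<in> Q_infty \<longrightarrow> (\<lambda>n. vz n z) \<longlonglongrightarrow> uz z" using vz_lim by simp
  have q: "(vz n (z + \<delta> n *\<^sub>R (i, 0)) - vz n z) / \<delta> n = Dz n z * (e \<bullet> i)" for n z
    unfolding vz_shift[OF i] using \<delta>_pos[of n] by simp
  show "AE z in lborel. z \<in> Q_infty \<longrightarrow> (\<lambda>n. (vz n (z + \<delta> n *\<^sub>R (i, 0)) - vz n z) / \<delta> n) \<longlonglongrightarrow> Dlim z * (e \<bullet> i)"
    unfolding q using Dz_lim by eventually_elim (auto intro: tendsto_intros)
qed

end

section \<open>The equation tested with g(u) \<phi> for continuously differentiable g\<close>

text \<open>Derivative rules are required only for positive arguments: the functions g and G to
  which this is applied are built with \<open>primitive\<close> and may have a corner at 0, while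
  all values of \<open>vz\<close>, and those of \<open>uz\<close> on \<open>Q_infty\<close>, are at
  least 1.\<close>

locale smooth_composition = planar_approximation p f v \<delta> h u e
  for p f v \<delta> h u and e :: "'a::euclidean_space" +
  fixes \<phi> :: "'a \<times> real \<Rightarrow> real" and k g G :: "real \<Rightarrow> real"
  assumes \<phi>: "\<phi> \<in> Cc_infty Q_infty"
    and k_cont: "continuous_on UNIV k"
    and g_deriv: "\<And>s. 0 < s \<Longrightarrow> (g has_real_derivative k s) (at s)"
    and G_deriv: "\<And>s. 0 < s \<Longrightarrow> (G has_real_derivative g s) (at s)"
    and g_measurable [measurable]: "g \<in> borel_measurable borel"
    and G_measurable [measurable]: "G \<in> borel_measurable borel"
begin

lemma g_cont: "continuous_on {0<..} g"
  using g_deriv by (auto intro!: continuous_at_imp_continuous_on DERIV_isCont)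

lemma G_cont: "continuous_on {0<..} G"
  using G_deriv by (auto intro!: continuous_at_imp_continuous_on DERIV_isCont)

lemma \<phi>_measurable [measurable]: "\<phi> \<in> borel_measurable borel"
  using Cc_infty_C1(2)[OF \<phi>] by (rule borel_measurable_continuous_onI)

lemma d\<phi>_measurable: "d \<in> Basis \<Longrightarrow> (\<lambda>z. frechet_derivative \<phi> (at z) d) \<in> borel_measurable borel"
  using Cc_infty_C1(3)[OF \<phi>] by (intro borel_measurable_continuous_onI)

lemma bounds_1: "\<exists>B\<ge>0. \<forall>s. 1 \<le> s \<longrightarrow> s \<le> C \<longrightarrow> \<bar>g s\<bar> \<le> B \<and> \<bar>k s\<bar> \<le> B \<and> \<bar>G s\<bar> \<le> B \<and> \<bar>f s\<bar> \<le> B"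
proof -
  obtain B1 where B1: "0 \<le> B1" "\<And>s. 1 \<le> s \<Longrightarrow> s \<le> C \<Longrightarrow> \<bar>g s\<bar> \<le> B1"
    using continuous_bounded_interval[OF continuous_on_subset[OF g_cont], of C] by force
  obtain B2 where B2: "0 \<le> B2" "\<And>s. 1 \<le> s \<Longrightarrow> s \<le> C \<Longrightarrow> \<bar>k s\<bar> \<le> B2"
    using continuous_bounded_interval[OF continuous_on_subset[OF k_cont], of C] by force
  obtain B3 where B3: "0 \<le> B3" "\<And>s. 1 \<le> s \<Longrightarrow> s \<le> C \<Longrightarrow> \<bar>G s\<bar> \<le> B3"
    using continuous_bounded_interval[OF continuous_on_subset[OF G_cont], of C] by force
  obtain B4 where B4: "0 \<le> B4" "\<And>s. 1 \<le> s \<Longrightarrow> s \<le> C \<Longrightarrow> \<bar>f s\<bar> \<le> B4"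
    using continuous_bounded_interval[OF continuous_on_subset[OF f_cont], of C] by force
  show ?thesis
  proof (intro exI[of _ "B1 + B2 + B3 + B4"] conjI allI impI)
    fix s assume s: "1 \<le> s" "s \<le> C"
    show "\<bar>g s\<bar> \<le> B1 + B2 + B3 + B4" "\<bar>k s\<bar> \<le> B1 + B2 + B3 + B4" "\<bar>G s\<bar> \<le> B1 + B2 + B3 + B4" "\<bar>f s\<bar> \<le> B1 + B2 + B3 + B4"
      using B1(1) B1(2)[OF s] B2(1) B2(2)[OF s] B3(1) B3(2)[OF s] B4(1) B4(2)[OF s] by auto
  qed (use B1(1) B2(1) B3(1) B4(1) in auto)
qed

lemma g_diff_bound:
  assumes "\<And>s. 1 \<le> s \<Longrightarrow> s \<le> C \<Longrightarrow> \<bar>k s\<bar> \<le> B" "1 \<le> a" "a \<le> C" "1 \<le> b" "b \<le> C"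
  shows "\<bar>g b - g a\<bar> \<le> \<bar>b - a\<bar> * B"
proof -
  obtain \<xi> where \<xi>: "min a b \<le> \<xi>" "\<xi> \<le> max a b" "g b - g a = (b - a) * k \<xi>"
    using mvt_between[OF g_deriv, of a b] assms by auto
  have "\<bar>k \<xi>\<bar> \<le> B" using \<xi> assms by (intro assms(1)) (auto simp: min_def max_def split: if_splits)
  then show ?thesis unfolding \<xi>(3) by (intro abs_mult_bound) auto
qed

lemma g_vz_lim: "z \<in> Q_infty \<Longrightarrow> (\<lambda>n. g (vz n z)) \<longlonglongrightarrow> g (uz z)"
  by (rule continuous_on_tendsto_compose[OF g_cont vz_lim])
    (use uz_ge_1[of z] in \<open>auto simp: vz_pos intro: less_le_trans[OF zero_less_one]\<close>)

lemma G_vz_lim: "z \<in> Q_infty \<Longrightarrow> (\<lambda>n. G (vz n z)) \<longlonglongrightarrow> G (uz z)"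
  by (rule continuous_on_tendsto_compose[OF G_cont vz_lim])
    (use uz_ge_1[of z] in \<open>auto simp: vz_pos intro: less_le_trans[OF zero_less_one]\<close>)

definition comp_quotient :: "'a \<Rightarrow> nat \<Rightarrow> 'a \<times> real \<Rightarrow> real" where
  "comp_quotient i n z = (g (vz n (z + \<delta> n *\<^sub>R (i, 0))) * \<phi> (z + \<delta> n *\<^sub>R (i, 0)) - g (vz n z) * \<phi> z) / \<delta> n"

definition comp_slope :: "'a \<Rightarrow> 'a \<times> real \<Rightarrow> real" where
  "comp_slope i z = k (uz z) * (Dlim z * (e \<bullet> i)) * \<phi> z + g (uz z) * frechet_derivative \<phi> (at z) (i, 0)"

lemma comp_quotient_split: "comp_quotient i n z = \<phi> (z + \<delta> n *\<^sub>R (i, 0)) * ((g (vz n (z + \<delta> n *\<^sub>R (i, 0))) - g (vz n z)) / \<delta> n)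
    + g (vz n z) * ((\<phi> (z + \<delta> n *\<^sub>R (i, 0)) - \<phi> z) / \<delta> n)"
proof -
  have "(a * b - c * d) / s = b * ((a - c) / s) + c * ((b - d) / s)" for a b c d s :: real
    by (simp add: algebra_simps diff_divide_distrib)
  then show ?thesis unfolding comp_quotient_def .
qed

lemma comp_quotient_measurable [measurable]: "comp_quotient i n \<in> borel_measurable borel"
  unfolding comp_quotient_def[abs_def] by measurable

lemma comp_quotient_lim:
  assumes i: "i \<in> Basis"
  shows "AE z in lborel. z \<in> Q_infty \<longrightarrow> (\<lambda>n. comp_quotient i n z) \<longlonglongrightarrow> comp_slope i z"
  using Dz_lim
proof eventually_elim
  case (elim z)
  show ?case
  proof
    assume z: "z \<in> Q_infty"
    have D: "(\<lambda>n. Dz n z * (e \<bullet> i)) \<longlonglongrightarrow> Dlim z * (e \<bullet> i)" using elim z by (auto intro: tendsto_intros)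
    have \<delta>0: "\<delta> n \<noteq> 0" for n using \<delta>_pos[of n] by simp
    have "(\<lambda>n. (g (vz n z + \<delta> n * (Dz n z * (e \<bullet> i))) - g (vz n z)) / \<delta> n) \<longlonglongrightarrow> k (uz z) * (Dlim z * (e \<bullet> i))"
    proof (rule chain_quotient[OF g_deriv k_cont vz_lim[OF z] vz_pos(1) _ D \<delta>_lim \<delta>0])
      show "0 < vz n z + \<delta> n * (Dz n z * (e \<bullet> i))" for n
        using vz_shift[OF i, of n z] vz_pos(1)[of n "z + \<delta> n *\<^sub>R (i, 0)"] by simp
    qed
    then have 1: "(\<lambda>n. (g (vz n (z + \<delta> n *\<^sub>R (i, 0))) - g (vz n z)) / \<delta> n) \<longlonglongrightarrow> k (uz z) * (Dlim z * (e \<bullet> i))"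
      by (simp only: vz_shift[OF i])
    have 2: "(\<lambda>n. (\<phi> (z + \<delta> n *\<^sub>R (i, 0)) - \<phi> z) / \<delta> n) \<longlonglongrightarrow> frechet_derivative \<phi> (at z) (i, 0)"
      by (rule difference_quotient[OF Cc_infty_C1(1)[OF \<phi>] \<delta>_lim \<delta>0])
    have "(\<lambda>n. z + \<delta> n *\<^sub>R (i, 0)) \<longlonglongrightarrow> z + 0 *\<^sub>R (i, 0)" by (intro tendsto_intros \<delta>_lim)
    then have "(\<lambda>n. z + \<delta> n *\<^sub>R (i, 0)) \<longlonglongrightarrow> z" by (simp only: scaleR_zero_left add_0_right)
    from continuous_on_tendsto_compose[OF Cc_infty_C1(2)[OF \<phi>] this]
    have 3: "(\<lambda>n. \<phi> (z + \<delta> n *\<^sub>R (i, 0))) \<longlonglongrightarrow> \<phi> z" by simp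
    have "(\<lambda>n. comp_quotient i n z) \<longlonglongrightarrow> \<phi> z * (k (uz z) * (Dlim z * (e \<bullet> i))) + g (uz z) * frechet_derivative \<phi> (at z) (i, 0)"
      unfolding comp_quotient_split by (intro tendsto_intros 1 2 3 g_vz_lim z)
    then show "(\<lambda>n. comp_quotient i n z) \<longlonglongrightarrow> comp_slope i z" by (simp add: comp_slope_def mult.commute)
  qed
qed

lemma comp_quotient_bound:
  assumes i: "i \<in> Basis" and K: "compact K" "K \<subseteq> Q_infty"
  shows "\<exists>B\<ge>0. \<forall>\<^sub>F n in sequentially. \<forall>z\<in>K. \<bar>g (vz n z) * \<phi> z\<bar> \<le> B \<and> \<bar>comp_quotient i n z\<bar> \<le> B"
proof -
  obtain L where L: "0 \<le> L" and L': "\<And>z. \<bar>\<phi> z\<bar> \<le> L" "\<And>z. \<bar>frechet_derivative \<phi> (at z) (i, 0)\<bar> \<le> L"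
    using test_function_uniform_bounds[OF \<phi> Basis_x[OF i]] by blast
  obtain C where C: "0 \<le> C" and ev: "\<forall>\<^sub>F n in sequentially. \<forall>z\<in>K. 1 \<le> vz n z \<and> vz n z \<le> C \<and> \<bar>j (Dz n z)\<bar> \<le> C \<and> \<bar>Dz n z\<bar> \<le> C"
    using vz_local[OF K] by blast
  \<comment> \<open>Bounds up to 2 C are needed because the shifted value exceeds the unshifted one
    by at most \<delta> n times the slope bound C, with \<delta> n < 1.\<close>
  obtain B where B: "0 \<le> B" "\<And>s. 1 \<le> s \<Longrightarrow> s \<le> 2 * C \<Longrightarrow> \<bar>g s\<bar> \<le> B" "\<And>s. 1 \<le> s \<Longrightarrow> s \<le> 2 * C \<Longrightarrow> \<bar>k s\<bar> \<le> B"
    using bounds_1[of "2 * C"] by blast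
  have "\<forall>\<^sub>F n in sequentially. \<delta> n < 1" by (rule order_tendstoD(2)[OF \<delta>_lim]) simp
  with ev have "\<forall>\<^sub>F n in sequentially. \<forall>z\<in>K. \<bar>g (vz n z) * \<phi> z\<bar> \<le> B * L + L * (C * B) \<and> \<bar>comp_quotient i n z\<bar> \<le> B * L + L * (C * B)"
  proof eventually_elim
    case (elim n)
    show ?case
    proof
      fix z assume "z \<in> K"
      with elim have z: "1 \<le> vz n z" "vz n z \<le> C" "\<bar>Dz n z\<bar> \<le> C" by blast+
      have gb: "\<bar>g (vz n z)\<bar> \<le> B" using z C by (intro B) auto
      have 1: "\<bar>g (vz n z) * \<phi> z\<bar> \<le> B * L" by (rule abs_mult_bound[OF gb L'(1)])
      have D: "\<bar>Dz n z * (e \<bullet> i)\<bar> \<le> C" using abs_mult_bound[OF z(3) e_inner[OF i]] by simp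
      have "\<bar>\<delta> n * (Dz n z * (e \<bullet> i))\<bar> \<le> 1 * C" using elim(2) \<delta>_pos[of n] by (intro abs_mult_bound D) simp
      then have "vz n (z + \<delta> n *\<^sub>R (i, 0)) \<le> 2 * C" using z unfolding vz_shift[OF i] by linarith
      then have "\<bar>g (vz n (z + \<delta> n *\<^sub>R (i, 0))) - g (vz n z)\<bar> \<le> \<bar>vz n (z + \<delta> n *\<^sub>R (i, 0)) - vz n z\<bar> * B"
        using z C vz_pos(2) by (intro g_diff_bound[of "2 * C"] B(3)) auto
      also have "\<bar>vz n (z + \<delta> n *\<^sub>R (i, 0)) - vz n z\<bar> = \<delta> n * \<bar>Dz n z * (e \<bullet> i)\<bar>"
        unfolding vz_shift[OF i] using \<delta>_pos[of n] by (simp add: abs_mult)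
      also have "\<delta> n * \<bar>Dz n z * (e \<bullet> i)\<bar> * B \<le> \<delta> n * C * B"
        using D \<delta>_pos[of n] B(1) by (intro mult_right_mono mult_left_mono) auto
      finally have "\<bar>(g (vz n (z + \<delta> n *\<^sub>R (i, 0))) - g (vz n z)) / \<delta> n\<bar> \<le> C * B"
        using \<delta>_pos[of n] by (simp add: field_simps)
      then have 2: "\<bar>\<phi> (z + \<delta> n *\<^sub>R (i, 0)) * ((g (vz n (z + \<delta> n *\<^sub>R (i, 0))) - g (vz n z)) / \<delta> n)\<bar> \<le> L * (C * B)"
        by (rule abs_mult_bound[OF L'(1)])
      have "\<bar>\<phi> (z + \<delta> n *\<^sub>R (i, 0)) - \<phi> z\<bar> \<le> L * \<bar>\<delta> n\<bar>"
        by (rule difference_bound[OF Cc_infty_C1(1)[OF \<phi>] L'(2)])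
      then have "\<bar>(\<phi> (z + \<delta> n *\<^sub>R (i, 0)) - \<phi> z) / \<delta> n\<bar> \<le> L"
        using \<delta>_pos[of n] by (simp add: field_simps)
      then have 3: "\<bar>g (vz n z) * ((\<phi> (z + \<delta> n *\<^sub>R (i, 0)) - \<phi> z) / \<delta> n)\<bar> \<le> B * L"
        by (rule abs_mult_bound[OF gb])
      have "0 \<le> L * (C * B)" using L C B(1) by simp
      moreover have "\<bar>comp_quotient i n z\<bar> \<le> L * (C * B) + B * L"
        unfolding comp_quotient_split by (rule order_trans[OF abs_triangle_ineq add_mono[OF 2 3]])
      ultimately show "\<bar>g (vz n z) * \<phi> z\<bar> \<le> B * L + L * (C * B) \<and> \<bar>comp_quotient i n z\<bar> \<le> B * L + L * (C * B)"
        using 1 by linarith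
    qed
  qed
  then show ?thesis using L C B(1) by (intro exI[of _ "B * L + L * (C * B)"]) auto
qed

lemma comp_measurable:
  fixes \<kappa> :: "real \<Rightarrow> real"
  assumes [measurable]: "\<kappa> \<in> borel_measurable borel"
  shows "(\<lambda>z. indicator Q_infty z * \<kappa> (uz z)) \<in> borel_measurable borel"
proof -
  have [measurable]: "(\<lambda>z. \<kappa> (indicator Q_infty z * uz z)) \<in> borel_measurable borel"
    by (rule measurable_compose[OF uz_measurable assms])
  have "(\<lambda>z. indicator Q_infty z * \<kappa> (indicator Q_infty z * uz z)) \<in> borel_measurable borel" by measurable
  moreover have "(\<lambda>z. indicator Q_infty z * \<kappa> (indicator Q_infty z * uz z)) = (\<lambda>z. indicator Q_infty z * \<kappa> (uz z))"
    by (auto simp: indicator_def fun_eq_iff)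
  ultimately show ?thesis by simp
qed

lemma k_measurable [measurable]: "k \<in> borel_measurable borel"
  using k_cont by (rule borel_measurable_continuous_onI)

lemma comp_slope_measurable:
  assumes i: "i \<in> Basis"
  shows "(\<lambda>z. indicator Q_infty z * comp_slope i z) \<in> borel_measurable borel"
proof -
  have [measurable]: "(\<lambda>z. frechet_derivative \<phi> (at z) (i, 0)) \<in> borel_measurable borel"
    by (rule d\<phi>_measurable[OF Basis_x[OF i]])
  have "(\<lambda>z. indicator Q_infty z * comp_slope i z) = (\<lambda>z. (indicator Q_infty z * k (uz z)) * (Dlim z * (e \<bullet> i)) * \<phi> z
      + (indicator Q_infty z * g (uz z)) * frechet_derivative \<phi> (at z) (i, 0))"
    by (auto simp: comp_slope_def fun_eq_iff algebra_simps)
  also have "\<dots> \<in> borel_measurable borel"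
    using comp_measurable[OF k_measurable] comp_measurable[OF g_measurable] by measurable
  finally show ?thesis .
qed

lemma comp_slope_local:
  assumes i: "i \<in> Basis" and K: "compact K" "K \<subseteq> Q_infty"
  shows "\<exists>B. \<forall>z\<in>K. \<bar>g (uz z) * \<phi> z\<bar> \<le> B" "\<exists>B. \<forall>z\<in>K. \<bar>comp_slope i z\<bar> \<le> B"
proof -
  obtain L where L: "0 \<le> L" and L': "\<And>z. \<bar>\<phi> z\<bar> \<le> L" "\<And>z. \<bar>frechet_derivative \<phi> (at z) (i, 0)\<bar> \<le> L"
    using test_function_uniform_bounds[OF \<phi> Basis_x[OF i]] by blast
  obtain C1 where C1: "\<And>z. z \<in> K \<Longrightarrow> \<bar>uz z\<bar> \<le> C1" using uz_bounded[OF K] by blast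
  obtain C2 where C2: "\<And>z. z \<in> K \<Longrightarrow> \<bar>Dlim z\<bar> \<le> C2" using Dlim_local[OF K] by blast
  obtain B where B: "0 \<le> B" "\<And>s. 1 \<le> s \<Longrightarrow> s \<le> C1 \<Longrightarrow> \<bar>g s\<bar> \<le> B" "\<And>s. 1 \<le> s \<Longrightarrow> s \<le> C1 \<Longrightarrow> \<bar>k s\<bar> \<le> B"
    using bounds_1[of C1] by blast
  have gb: "\<bar>g (uz z)\<bar> \<le> B" "\<bar>k (uz z)\<bar> \<le> B" if "z \<in> K" for z
    using C1[OF that] uz_ge_1[of z] that K by (auto intro!: B)
  show "\<exists>B. \<forall>z\<in>K. \<bar>g (uz z) * \<phi> z\<bar> \<le> B"
    using abs_mult_bound[OF gb(1) L'(1)] by blast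
  have "\<bar>comp_slope i z\<bar> \<le> B * (C2 * 1) * L + B * L" if "z \<in> K" for z
    unfolding comp_slope_def using that
    by (intro order_trans[OF abs_triangle_ineq] add_mono abs_mult_bound gb C2 L' e_inner i)
  then show "\<exists>B. \<forall>z\<in>K. \<bar>comp_slope i z\<bar> \<le> B" by blast
qed

lemma chain_weak_deriv:
  assumes i: "i \<in> Basis"
  shows "has_weak_deriv Q_infty (i, 0) (\<lambda>z. g (uz z) * \<phi> z) (comp_slope i)"
proof (rule weak_deriv_of_difference_quotients[where w = "\<lambda>n z. g (vz n z) * \<phi> z", OF open_Q Basis_x[OF i] \<delta>_lim \<delta>_pos])
  show "(\<lambda>z. g (vz n z) * \<phi> z) \<in> borel_measurable borel" for n by measurable
  have "(\<lambda>z. (indicator Q_infty z * g (uz z)) * \<phi> z) \<in> borel_measurable borel"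
    using comp_measurable[OF g_measurable] by measurable
  then show "(\<lambda>z. indicator Q_infty z * (g (uz z) * \<phi> z)) \<in> borel_measurable borel"
    by (simp add: mult.assoc)
  show "(\<lambda>z. indicator Q_infty z * comp_slope i z) \<in> borel_measurable borel" by (rule comp_slope_measurable[OF i])
  show "AE z in lborel. z \<in> Q_infty \<longrightarrow> (\<lambda>n. g (vz n z) * \<phi> z) \<longlonglongrightarrow> g (uz z) * \<phi> z"
    using g_vz_lim by (auto intro!: tendsto_intros)
  show "AE z in lborel. z \<in> Q_infty \<longrightarrow> (\<lambda>n. (g (vz n (z + \<delta> n *\<^sub>R (i, 0))) * \<phi> (z + \<delta> n *\<^sub>R (i, 0)) - g (vz n z) * \<phi> z) / \<delta> n) \<longlonglongrightarrow> comp_slope i z"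
    using comp_quotient_lim[OF i] unfolding comp_quotient_def .
  fix K :: "('a \<times> real) set" assume K: "compact K" "K \<subseteq> Q_infty"
  show "\<exists>B. \<forall>z\<in>K. \<bar>g (uz z) * \<phi> z\<bar> \<le> B" "\<exists>B. \<forall>z\<in>K. \<bar>comp_slope i z\<bar> \<le> B"
    by (rule comp_slope_local[OF i K])+
  show "\<exists>B\<ge>0. \<forall>\<^sub>F n in sequentially. \<forall>z\<in>K. \<bar>g (vz n z) * \<phi> z\<bar> \<le> B \<and>
      \<bar>(g (vz n (z + \<delta> n *\<^sub>R (i, 0))) * \<phi> (z + \<delta> n *\<^sub>R (i, 0)) - g (vz n z) * \<phi> z) / \<delta> n\<bar> \<le> B"
    using comp_quotient_bound[OF i K] unfolding comp_quotient_def .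
qed

end

context smooth_composition begin

text \<open>The scheme is multiplied by g(v) \<phi> and summed by parts in space and time.
  Everything matches except G(v') - G(v) - g(v) (v' - v), where v' is the value one time step later.
  This is at most a constant times (v - v')^2: one factor is uniformly small, and the other, divided
  by h and integrated against the modulus of \<phi>, is bounded since v - v' \<ge> 0 permits one
  more summation by parts.\<close>

lemma smooth_identity:
  "has_bochner_integral lborel (\<lambda>z. indicator Q_infty z *
     (- G (uz z) * frechet_derivative \<phi> (at z) (0, 1) + j (Dlim z) * comp_slope e z + f (uz z) * g (uz z) * \<phi> z)) 0"
proof -
  let ?et = "(0::'a, 1::real)" and ?ex = "(e, 0::real)"
  let ?Dt = "\<lambda>z. frechet_derivative \<phi> (at z) ?et"
  note e = e_Basis
  have [measurable]: "?Dt \<in> borel_measurable borel" by (rule d\<phi>_measurable[OF Basis_t])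
  obtain L1 where L1: "0 \<le> L1" "\<And>z. \<bar>\<phi> z\<bar> \<le> L1" "\<And>z. \<bar>?Dt z\<bar> \<le> L1"
    using test_function_uniform_bounds[OF \<phi> Basis_t] by blast
  obtain K L0 where K: "compact K" "K \<subseteq> Q_infty" and L0: "\<And>z. \<bar>\<phi> z\<bar> \<le> L0 * indicator K z"
    "\<And>z. \<bar>?Dt z\<bar> \<le> L0 * indicator K z"
    using test_function_bounds[OF \<phi> Basis_t] by metis
  have out: "\<phi> z = 0" "?Dt z = 0" if "z \<notin> K" for z using L0[of z] that by auto
  obtain \<epsilon> K' where K': "0 < \<epsilon>" "compact K'" "K \<subseteq> K'" "K' \<subseteq> Q_infty"
    "\<And>z y. y \<in> K \<Longrightarrow> dist z y \<le> \<epsilon> \<Longrightarrow> z \<in> K'"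
    using compact_neighbourhood[OF K(1) open_Q K(2)] by blast
  obtain C where C: "0 \<le> C" and loc: "\<forall>\<^sub>F n in sequentially. \<forall>z\<in>K'. 1 \<le> vz n z \<and> vz n z \<le> C \<and> \<bar>j (Dz n z)\<bar> \<le> C \<and> \<bar>Dz n z\<bar> \<le> C"
    using vz_local[OF K'(2,4)] by blast
  obtain B where B0: "0 \<le> B" and B: "\<And>s. 1 \<le> s \<Longrightarrow> s \<le> C \<Longrightarrow> \<bar>g s\<bar> \<le> B" "\<And>s. 1 \<le> s \<Longrightarrow> s \<le> C \<Longrightarrow> \<bar>k s\<bar> \<le> B"
    "\<And>s. 1 \<le> s \<Longrightarrow> s \<le> C \<Longrightarrow> \<bar>G s\<bar> \<le> B" "\<And>s. 1 \<le> s \<Longrightarrow> s \<le> C \<Longrightarrow> \<bar>f s\<bar> \<le> B"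
    using bounds_1[of C] by blast
  obtain BE where BE: "0 \<le> BE" "\<forall>\<^sub>F n in sequentially. \<forall>z\<in>K'. \<bar>g (vz n z) * \<phi> z\<bar> \<le> BE \<and> \<bar>comp_quotient e n z\<bar> \<le> BE"
    using comp_quotient_bound[OF e K'(2,4)] by blast
  obtain r t0 where r: "0 \<le> r" "0 < t0" "\<And>z. z \<in> K' \<Longrightarrow> \<bar>fst z \<bullet> e\<bar> \<le> r \<and> t0 \<le> snd z"
    using compact_abscissa[OF K'(2,4)] by blast
  \<comment> \<open>Everything that holds eventually is collected for a single index, so that the
    remainder can be estimated at a fixed n.\<close>
  define good where "good n \<longleftrightarrow> h n < \<epsilon> \<and> \<delta> n < \<epsilon> \<and>
    (\<forall>z\<in>K'. 1 \<le> vz n z \<and> vz n z \<le> C \<and> \<bar>j (Dz n z)\<bar> \<le> C \<and> \<bar>Dz n z\<bar> \<le> C) \<and>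
    (\<forall>z\<in>K'. \<bar>g (vz n z) * \<phi> z\<bar> \<le> BE \<and> \<bar>comp_quotient e n z\<bar> \<le> BE) \<and>
    (\<forall>x t. \<bar>x\<bar> \<le> r \<longrightarrow> t0 \<le> t \<longrightarrow>
      (v n x (t + h n) - v n x t) / h n = (j ((v n (x + \<delta> n) t - v n x t) / \<delta> n)
        - j ((v n x t - v n (x - \<delta> n) t) / \<delta> n)) / \<delta> n - f (v n x t))" for n
  have good: "\<forall>\<^sub>F n in sequentially. good n"
    unfolding good_def
    by (intro eventually_conj loc BE(2) v_eq r(1,2) order_tendstoD(2)[OF h_lim] order_tendstoD(2)[OF \<delta>_lim] K'(1))
  have near: "z \<in> K'" if "z + s *\<^sub>R d \<in> K" "\<bar>s\<bar> \<le> \<epsilon>" "d \<in> Basis" for z d s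
    using that by (intro K'(5)[OF that(1)]) (simp add: dist_norm)
  have near': "z + s *\<^sub>R d \<in> K'" if "z \<in> K" "\<bar>s\<bar> \<le> \<epsilon>" "d \<in> Basis" for z d s
    using that by (intro K'(5)[OF that(1)]) (simp add: dist_norm)
  have Bx: "?ex \<in> Basis" by (rule Basis_x[OF e])
  have Gz: "\<bar>g (vz n z)\<bar> \<le> B" "\<bar>G (vz n z)\<bar> \<le> B" "\<bar>f (vz n z)\<bar> \<le> B" "\<bar>j (Dz n z)\<bar> \<le> C" "\<bar>vz n z\<bar> \<le> C"
    if "good n" "z \<in> K'" for n z
    using that B vz_pos(2)[of n z] unfolding good_def by auto
  \<comment> \<open>Discrete counterparts of the three terms of the identity, with the difference
    quotients still on \<phi> in time and on g(v) \<phi> in space.\<close>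
  define T1 where "T1 n z = G (vz n z) * ((\<phi> (z + (- h n) *\<^sub>R ?et) - \<phi> z) / h n)" for n z
  define T2 where "T2 n z = j (Dz n z) * comp_quotient e n z" for n z
  define T3 where "T3 n z = f (vz n z) * g (vz n z) * \<phi> z" for n z
  have [measurable]: "T1 n \<in> borel_measurable borel" "T2 n \<in> borel_measurable borel" "T3 n \<in> borel_measurable borel" for n
    unfolding T1_def[abs_def] T2_def[abs_def] T3_def[abs_def] by measurable
  have T1b: "\<bar>T1 n z\<bar> \<le> (B * L1) * indicator K' z" if g: "good n" for n z
  proof (cases "z \<in> K'")
    case True
    have "\<bar>\<phi> (z + (- h n) *\<^sub>R ?et) - \<phi> z\<bar> \<le> L1 * \<bar>- h n\<bar>"
      by (rule difference_bound[OF Cc_infty_C1(1)[OF \<phi>] L1(3)])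
    then have "\<bar>(\<phi> (z + (- h n) *\<^sub>R ?et) - \<phi> z) / h n\<bar> \<le> L1"
      using h_pos[of n] by (simp add: field_simps)
    from abs_mult_bound[OF Gz(2)[OF g True] this] show ?thesis using True by (simp add: T1_def)
  next
    case False
    then have "z \<notin> K" using K'(3) by auto
    moreover have "z + (- h n) *\<^sub>R ?et \<notin> K"
      using near[OF _ _ Basis_t, of z "- h n"] False g h_pos[of n] unfolding good_def by auto
    ultimately have "T1 n z = 0" unfolding T1_def by (simp add: out del: scaleR_Pair)
    then show ?thesis using False by simp
  qed
  have T2b: "\<bar>T2 n z\<bar> \<le> (C * BE) * indicator K' z" if g: "good n" for n z
  proof (cases "z \<in> K'")
    case True
    have "\<bar>comp_quotient e n z\<bar> \<le> BE" using g True unfolding good_def by blast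
    from abs_mult_bound[OF Gz(4)[OF g True] this] show ?thesis using True by (simp add: T2_def)
  next
    case False
    then have "z \<notin> K" using K'(3) by auto
    moreover have "z + \<delta> n *\<^sub>R ?ex \<notin> K"
      using near[OF _ _ Bx, of z "\<delta> n"] False g \<delta>_pos[of n] unfolding good_def by auto
    ultimately have "T2 n z = 0" unfolding T2_def comp_quotient_def by (simp add: out del: scaleR_Pair)
    then show ?thesis using False by simp
  qed
  have T3b: "\<bar>T3 n z\<bar> \<le> (B * B * L1) * indicator K' z" if g: "good n" for n z
  proof (cases "z \<in> K'")
    case True
    from abs_mult_bound[OF abs_mult_bound[OF Gz(3)[OF g True] Gz(1)[OF g True]] L1(2)[of z]]
    show ?thesis using True by (simp add: T3_def)
  next
    case False
    then have "\<phi> z = 0" using K'(3) out(1) by blast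
    then show ?thesis using False by (simp add: T3_def)
  qed
  define T where "T z = indicator Q_infty z *
     (- G (uz z) * ?Dt z + j (Dlim z) * comp_slope e z + f (uz z) * g (uz z) * \<phi> z)" for z
  have [measurable]: "T \<in> borel_measurable borel"
  proof -
    have "T = (\<lambda>z. - (indicator Q_infty z * G (uz z)) * ?Dt z + j (Dlim z) * (indicator Q_infty z * comp_slope e z)
        + (indicator Q_infty z * f (uz z)) * (indicator Q_infty z * g (uz z)) * \<phi> z)"
      by (auto simp: T_def fun_eq_iff indicator_def algebra_simps)
    also have "\<dots> \<in> borel_measurable borel"
      using comp_measurable[OF G_measurable] comp_measurable[OF f_measurable] comp_measurable[OF g_measurable] comp_slope_measurable[OF e]
      by measurable
    finally show ?thesis .
  qed
  have lim: "AE z in lborel. (\<lambda>n. T1 n z + T2 n z + T3 n z) \<longlonglongrightarrow> T z"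
    using comp_quotient_lim[OF e] Dz_lim
  proof eventually_elim
    case (elim z)
    show ?case
    proof (cases "z \<in> Q_infty")
      case True
      have "(\<lambda>n. (\<phi> (z + (- h n) *\<^sub>R ?et) - \<phi> z) / (- h n)) \<longlonglongrightarrow> ?Dt z"
      proof (rule difference_quotient[OF Cc_infty_C1(1)[OF \<phi>]])
        show "(\<lambda>n. - h n) \<longlonglongrightarrow> 0" using tendsto_minus[OF h_lim] by simp
        show "- h n \<noteq> 0" for n using h_pos[of n] by simp
      qed
      from tendsto_minus[OF this] have 1: "(\<lambda>n. (\<phi> (z + (- h n) *\<^sub>R ?et) - \<phi> z) / h n) \<longlonglongrightarrow> - ?Dt z"
        by simp
      have 2: "(\<lambda>n. j (Dz n z)) \<longlonglongrightarrow> j (Dlim z)"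
        using elim(2) True by (intro continuous_on_tendsto_compose[OF j_cont]) auto
      have 3: "(\<lambda>n. f (vz n z)) \<longlonglongrightarrow> f (uz z)"
        by (rule continuous_on_tendsto_compose[OF f_cont vz_lim[OF True]]) auto
      have 4: "(\<lambda>n. comp_quotient e n z) \<longlonglongrightarrow> comp_slope e z" using elim(1) True by blast
      have "(\<lambda>n. T1 n z + T2 n z + T3 n z) \<longlonglongrightarrow> G (uz z) * (- ?Dt z) + j (Dlim z) * comp_slope e z + f (uz z) * g (uz z) * \<phi> z"
        unfolding T1_def T2_def T3_def by (intro tendsto_intros 1 2 3 4 G_vz_lim g_vz_lim True)
      then show ?thesis using True by (simp add: T_def)
    next
      case False
      then have "z \<notin> K'" using K'(4) by auto
      have "\<forall>\<^sub>F n in sequentially. T1 n z + T2 n z + T3 n z = 0"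
        using good
      proof eventually_elim
        case (elim n)
        then show ?case using T1b[of n z] T2b[of n z] T3b[of n z] \<open>z \<notin> K'\<close> by simp
      qed
      then show ?thesis using False by (simp add: T_def tendsto_eventually)
    qed
  qed
  have bnd: "\<forall>\<^sub>F n in sequentially. \<forall>z. \<bar>T1 n z + T2 n z + T3 n z\<bar> \<le> (B * L1 + C * BE + B * B * L1) * indicator K' z"
    using good
  proof eventually_elim
    case (elim n)
    show ?case
    proof
      fix z
      have "\<bar>T1 n z + T2 n z + T3 n z\<bar> \<le> (B * L1) * indicator K' z + (C * BE) * indicator K' z + (B * B * L1) * indicator K' z"
        using T1b[OF elim, of z] T2b[OF elim, of z] T3b[OF elim, of z] by linarith
      then show "\<bar>T1 n z + T2 n z + T3 n z\<bar> \<le> (B * L1 + C * BE + B * B * L1) * indicator K' z"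
        by (simp add: distrib_right)
    qed
  qed
  have T_int: "integrable lborel T" and T_lim: "(\<lambda>n. \<integral>z. T1 n z + T2 n z + T3 n z \<partial>lborel) \<longlonglongrightarrow> (\<integral>z. T z \<partial>lborel)"
    by (rule integral_tendsto_compact[OF _ _ K'(2) bnd lim]; measurable)+
  define A where "A = C * L1 * measure lborel K'"
  have A: "0 \<le> A" using C L1 by (simp add: A_def)
  have rem: "\<bar>\<integral>z. T1 n z + T2 n z + T3 n z \<partial>lborel\<bar> \<le> B * \<eta> * A"
    if g: "good n" and \<eta>: "0 < \<eta>" "\<forall>x t. \<bar>x\<bar> \<le> r \<longrightarrow> t0 \<le> t \<longrightarrow> v n x t - v n x (t + h n) \<le> \<eta>" for n \<eta>
  proof -
    have hp: "0 < h n" and dp: "0 < \<delta> n" by (rule h_pos \<delta>_pos)+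
    define up where "up z = vz n (z + h n *\<^sub>R ?et)" for z
    have up: "1 \<le> up z" "up z \<le> vz n z" for z
      using vz_pos(2)[of n "z + h n *\<^sub>R ?et"] v_antimono[of "snd z" "snd z + h n" n "fst z \<bullet> e"] hp
      by (auto simp: up_def vz_shift_t vz_def)
    have [measurable]: "up \<in> borel_measurable borel" unfolding up_def[abs_def] by measurable
    \<comment> \<open>The same terms after translation, when the differences fall on v:
      \<open>T1\<close> has the integral of \<open>P1\<close> minus \<open>P2\<close>, and
      \<open>T2\<close> that of \<open>P4\<close> minus \<open>P3\<close>.\<close>
    define P1 where "P1 z = \<phi> z * G (up z) / h n" for z
    define P2 where "P2 z = \<phi> z * G (vz n z) / h n" for z
    define P3 where "P3 z = \<phi> z * g (vz n z) * j (Dz n z) / \<delta> n" for z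
    define P4 where "P4 z = \<phi> z * g (vz n z) * j (Dz n (z + (- \<delta> n) *\<^sub>R ?ex)) / \<delta> n" for z
    have [measurable]: "P1 \<in> borel_measurable borel" "P2 \<in> borel_measurable borel" "P3 \<in> borel_measurable borel" "P4 \<in> borel_measurable borel"
      unfolding P1_def[abs_def] P2_def[abs_def] P3_def[abs_def] P4_def[abs_def] by measurable
    have supp: "\<bar>\<phi> z * a / c\<bar> \<le> (L1 * X / c) * indicator K z" if "0 < c" "z \<in> K \<Longrightarrow> \<bar>a\<bar> \<le> X" for z a c X
    proof (cases "z \<in> K")
      case True
      from abs_mult_bound[OF L1(2)[of z] that(2)[OF True]] show ?thesis
        using True that(1) by (simp add: divide_right_mono)
    next
      case False
      then show ?thesis by (simp add: out)
    qed
    have inK: "z \<in> K'" if "z \<in> K" for z using that K'(3) by auto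
    have upB: "\<bar>G (up z)\<bar> \<le> B" if "z \<in> K'" for z
      using up[of z] Gz(5)[OF g that] by (intro B) auto
    have i1: "integrable lborel P1"
    proof (rule integrable_bounded_compact[OF _ K(1)])
      show "\<bar>P1 z\<bar> \<le> (L1 * B / h n) * indicator K z" for z
        unfolding P1_def by (intro supp hp upB inK)
    qed measurable
    have i2: "integrable lborel P2"
    proof (rule integrable_bounded_compact[OF _ K(1)])
      show "\<bar>P2 z\<bar> \<le> (L1 * B / h n) * indicator K z" for z
        unfolding P2_def by (intro supp hp Gz(2)[OF g] inK)
    qed measurable
    have i3: "integrable lborel P3"
    proof (rule integrable_bounded_compact[OF _ K(1)])
      show "\<bar>P3 z\<bar> \<le> (L1 * (B * C) / \<delta> n) * indicator K z" for z
        unfolding P3_def mult.assoc by (intro supp dp abs_mult_bound Gz(1,4)[OF g] inK)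
    qed measurable
    have i4: "integrable lborel P4"
    proof (rule integrable_bounded_compact[OF _ K(1)])
      fix z
      have "\<bar>\<phi> z * (g (vz n z) * j (Dz n (z + (- \<delta> n) *\<^sub>R ?ex))) / \<delta> n\<bar> \<le> (L1 * (B * C) / \<delta> n) * indicator K z"
      proof (rule supp[OF dp])
        assume z: "z \<in> K"
        have "z + (- \<delta> n) *\<^sub>R ?ex \<in> K'" using g dp by (intro near'[OF z _ Bx]) (simp add: good_def)
        then show "\<bar>g (vz n z) * j (Dz n (z + (- \<delta> n) *\<^sub>R ?ex))\<bar> \<le> B * C"
          by (intro abs_mult_bound Gz(1)[OF g inK[OF z]] Gz(4)[OF g])
      qed
      then show "\<bar>P4 z\<bar> \<le> (L1 * (B * C) / \<delta> n) * indicator K z" by (simp only: P4_def mult.assoc)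
    qed measurable
    have iT3: "integrable lborel (T3 n)"
      by (rule integrable_bounded_compact[OF _ K'(2) T3b[OF g]]) measurable
    have iT2: "integrable lborel (T2 n)"
      by (rule integrable_bounded_compact[OF _ K'(2) T2b[OF g]]) measurable
    have iT1: "integrable lborel (T1 n)"
      by (rule integrable_bounded_compact[OF _ K'(2) T1b[OF g]]) measurable
    have e1: "(\<integral>z. T1 n z \<partial>lborel) = (\<integral>z. P1 z \<partial>lborel) - (\<integral>z. P2 z \<partial>lborel)"
    proof -
      have "T1 n z = P1 (z + (- h n) *\<^sub>R ?et) - P2 z" for z
      proof -
        have "z + (- h n) *\<^sub>R ?et + h n *\<^sub>R ?et = z" by (simp del: scaleR_Pair)
        then show ?thesis unfolding T1_def P1_def P2_def up_def by (simp add: algebra_simps diff_divide_distrib del: scaleR_Pair)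
      qed
      then have "(\<integral>z. T1 n z \<partial>lborel) = (\<integral>z. P1 (z + (- h n) *\<^sub>R ?et) - P2 z \<partial>lborel)" by simp
      also have "\<dots> = (\<integral>z. P1 (z + (- h n) *\<^sub>R ?et) \<partial>lborel) - (\<integral>z. P2 z \<partial>lborel)"
        by (intro Bochner_Integration.integral_diff lborel_integrable_translate i1 i2)
      also have "(\<integral>z. P1 (z + (- h n) *\<^sub>R ?et) \<partial>lborel) = (\<integral>z. P1 z \<partial>lborel)"
        by (rule lborel_integral_translate) measurable
      finally show ?thesis .
    qed
    have e2: "(\<integral>z. T2 n z \<partial>lborel) = (\<integral>z. P4 z \<partial>lborel) - (\<integral>z. P3 z \<partial>lborel)"
    proof -
      have "T2 n z = P4 (z + \<delta> n *\<^sub>R ?ex) - P3 z" for z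
      proof -
        have "z + \<delta> n *\<^sub>R ?ex + (- \<delta> n) *\<^sub>R ?ex = z" by (simp del: scaleR_Pair)
        then show ?thesis unfolding T2_def P4_def P3_def comp_quotient_def by (simp add: algebra_simps diff_divide_distrib del: scaleR_Pair)
      qed
      then have "(\<integral>z. T2 n z \<partial>lborel) = (\<integral>z. P4 (z + \<delta> n *\<^sub>R ?ex) - P3 z \<partial>lborel)" by simp
      also have "\<dots> = (\<integral>z. P4 (z + \<delta> n *\<^sub>R ?ex) \<partial>lborel) - (\<integral>z. P3 z \<partial>lborel)"
        by (intro Bochner_Integration.integral_diff lborel_integrable_translate i4 i3)
      also have "(\<integral>z. P4 (z + \<delta> n *\<^sub>R ?ex) \<partial>lborel) = (\<integral>z. P4 z \<partial>lborel)"
        by (rule lborel_integral_translate) measurable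
      finally show ?thesis .
    qed
    \<comment> \<open>The integrand after summation by parts. Inserting the scheme cancels
      everything in it up to the Taylor remainder of G.\<close>
    define R where "R z = P1 z - P2 z + (P4 z - P3 z) + T3 n z" for z
    have eR: "(\<integral>z. T1 n z + T2 n z + T3 n z \<partial>lborel) = (\<integral>z. R z \<partial>lborel)"
    proof -
      have "(\<integral>z. R z \<partial>lborel) = (\<integral>z. P1 z \<partial>lborel) - (\<integral>z. P2 z \<partial>lborel) + ((\<integral>z. P4 z \<partial>lborel) - (\<integral>z. P3 z \<partial>lborel)) + (\<integral>z. T3 n z \<partial>lborel)"
        unfolding R_def using i1 i2 i3 i4 iT3 by simp
      moreover have "(\<integral>z. T1 n z + T2 n z + T3 n z \<partial>lborel) = (\<integral>z. T1 n z \<partial>lborel) + (\<integral>z. T2 n z \<partial>lborel) + (\<integral>z. T3 n z \<partial>lborel)"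
        using iT1 iT2 iT3 by simp
      ultimately show ?thesis using e1 e2 by simp
    qed
    \<comment> \<open>The time increment needs no modulus, as v decreases in time. The integral of
      \<open>S\<close> is therefore bounded independently of n: the difference quotient is moved to
      the modulus of \<phi>, which is Lipschitz.\<close>
    define S where "S z = \<bar>\<phi> z\<bar> * (vz n z - up z) / h n" for z
    have Rb: "\<bar>R z\<bar> \<le> B * \<eta> * S z" for z
    proof (cases "z \<in> K")
      case True
      then have z: "z \<in> K'" by (rule inK)
      let ?a = "vz n z"
      have eqn: "(up z - ?a) / h n = (j (Dz n z) - j (Dz n (z + (- \<delta> n) *\<^sub>R ?ex))) / \<delta> n - f ?a"
      proof -
        have "(v n (fst z \<bullet> e) (snd z + h n) - v n (fst z \<bullet> e) (snd z)) / h n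
          = (j ((v n (fst z \<bullet> e + \<delta> n) (snd z) - v n (fst z \<bullet> e) (snd z)) / \<delta> n)
          - j ((v n (fst z \<bullet> e) (snd z) - v n (fst z \<bullet> e - \<delta> n) (snd z)) / \<delta> n)) / \<delta> n - f (v n (fst z \<bullet> e) (snd z))"
          using g r(3)[OF z] unfolding good_def by blast
        moreover have "Dz n (z + (- \<delta> n) *\<^sub>R ?ex) = (v n (fst z \<bullet> e) (snd z) - v n (fst z \<bullet> e - \<delta> n) (snd z)) / \<delta> n"
          using e by (simp add: Dz_eq inner_diff_left)
        moreover have "up z = v n (fst z \<bullet> e) (snd z + h n)" by (simp only: up_def vz_shift_t)
        ultimately show ?thesis by (simp only: Dz_eq vz_def)
      qed
      have "\<phi> z * g ?a * ((up z - ?a) / h n) = P3 z - P4 z - T3 n z"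
        unfolding eqn P3_def P4_def T3_def by (simp add: algebra_simps diff_divide_distrib del: scaleR_Pair)
      then have "R z = P1 z - P2 z - \<phi> z * g ?a * ((up z - ?a) / h n)" by (simp add: R_def)
      also have "\<dots> = \<phi> z * (G (up z) - G ?a - g ?a * (up z - ?a)) / h n"
        unfolding P1_def P2_def by (simp add: algebra_simps diff_divide_distrib add_divide_distrib)
      finally have Rz: "R z = \<phi> z * (G (up z) - G ?a - g ?a * (up z - ?a)) / h n" .
      obtain \<xi> where \<xi>: "min ?a (up z) \<le> \<xi>" "\<xi> \<le> max ?a (up z)" "G (up z) - G ?a = (up z - ?a) * g \<xi>"
        using mvt_between[OF G_deriv, of ?a "up z"] up[of z] vz_pos(1)[of n z] by auto
      have x: "1 \<le> \<xi>" "\<xi> \<le> ?a" "up z \<le> \<xi>" using \<xi>(1,2) up[of z] by auto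
      have aC: "?a \<le> C" using Gz(5)[OF g z] by simp
      have "?a - up z \<le> \<eta>"
        using \<eta>(2) r(3)[OF z] by (simp add: up_def vz_shift_t vz_def)
      have "\<bar>g \<xi> - g ?a\<bar> \<le> \<bar>\<xi> - ?a\<bar> * B"
        using x aC vz_pos(2)[of n z] by (intro g_diff_bound[of C] B(2)) auto
      also have "\<dots> \<le> \<eta> * B" using x \<open>?a - up z \<le> \<eta>\<close> B0 by (intro mult_right_mono) auto
      finally have gx: "\<bar>g \<xi> - g ?a\<bar> \<le> \<eta> * B" .
      have "G (up z) - G ?a - g ?a * (up z - ?a) = (g \<xi> - g ?a) * (up z - ?a)"
        using \<xi>(3) by (simp add: algebra_simps)
      moreover have "\<bar>(g \<xi> - g ?a) * (up z - ?a)\<bar> \<le> (\<eta> * B) * (?a - up z)"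
        using up(2)[of z] by (intro abs_mult_bound gx) simp
      ultimately have "\<bar>G (up z) - G ?a - g ?a * (up z - ?a)\<bar> \<le> (\<eta> * B) * (?a - up z)" by simp
      then have "\<bar>\<phi> z\<bar> * \<bar>G (up z) - G ?a - g ?a * (up z - ?a)\<bar> / h n \<le> \<bar>\<phi> z\<bar> * ((\<eta> * B) * (?a - up z)) / h n"
        using hp by (intro divide_right_mono mult_left_mono) auto
      then show ?thesis unfolding Rz S_def using hp by (simp add: abs_mult mult_ac)
    next
      case False
      then show ?thesis unfolding R_def P1_def P2_def P3_def P4_def T3_def S_def by (simp add: out)
    qed
    have [measurable]: "R \<in> borel_measurable borel" "S \<in> borel_measurable borel"
      unfolding R_def[abs_def] S_def[abs_def] by measurable
    define S1 where "S1 z = \<bar>\<phi> z\<bar> * up z / h n" for z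
    define S2 where "S2 z = \<bar>\<phi> z\<bar> * vz n z / h n" for z
    have [measurable]: "S1 \<in> borel_measurable borel" "S2 \<in> borel_measurable borel"
      unfolding S1_def[abs_def] S2_def[abs_def] by measurable
    have supp': "\<bar>\<bar>\<phi> z\<bar> * a / h n\<bar> \<le> (L1 * C / h n) * indicator K z" if "z \<in> K \<Longrightarrow> \<bar>a\<bar> \<le> C" for z a
      using supp[OF hp that, of z] by (simp add: abs_mult)
    have iS1: "integrable lborel S1"
    proof (rule integrable_bounded_compact[OF _ K(1)])
      show "\<bar>S1 z\<bar> \<le> (L1 * C / h n) * indicator K z" for z
        unfolding S1_def using up[of z] Gz(5)[OF g inK, of z] by (intro supp') auto
    qed measurable
    have iS2: "integrable lborel S2"
    proof (rule integrable_bounded_compact[OF _ K(1)])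
      show "\<bar>S2 z\<bar> \<le> (L1 * C / h n) * indicator K z" for z
        unfolding S2_def using Gz(5)[OF g inK, of z] by (intro supp') auto
    qed measurable
    have S12: "S z = S2 z - S1 z" for z by (simp add: S_def S1_def S2_def algebra_simps diff_divide_distrib)
    have iS: "integrable lborel S" using iS1 iS2 by (simp add: S12[abs_def])
    have "(\<integral>z. S z \<partial>lborel) = (\<integral>z. S2 z \<partial>lborel) - (\<integral>z. S1 z \<partial>lborel)"
      unfolding S12 using iS1 iS2 by simp
    also have "(\<integral>z. S1 z \<partial>lborel) = (\<integral>z. S1 (z + (- h n) *\<^sub>R ?et) \<partial>lborel)"
      by (rule lborel_integral_translate[symmetric]) measurable
    also have "(\<integral>z. S2 z \<partial>lborel) - \<dots> = (\<integral>z. S2 z - S1 (z + (- h n) *\<^sub>R ?et) \<partial>lborel)"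
      by (intro Bochner_Integration.integral_diff[symmetric] lborel_integrable_translate iS1 iS2)
    also have "\<dots> \<le> (\<integral>z. (C * L1) * indicator K' z \<partial>lborel)"
    proof (rule integral_mono)
      show "integrable lborel (\<lambda>z. S2 z - S1 (z + (- h n) *\<^sub>R ?et))"
        by (intro Bochner_Integration.integrable_diff lborel_integrable_translate iS1 iS2)
      show "integrable lborel (\<lambda>z. (C * L1) * indicator K' z :: real)"
      proof (rule integrable_bounded_compact[OF _ K'(2)])
        have [measurable]: "K' \<in> sets borel" using K'(2) by (rule borel_compact)
        show "(\<lambda>z. (C * L1) * indicator K' z :: real) \<in> borel_measurable borel" by measurable
        show "\<bar>(C * L1) * indicator K' z\<bar> \<le> (C * L1) * indicator K' z" for z
          using C L1(1) by (simp add: abs_mult)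
      qed
      fix z
      have shift: "up (z + (- h n) *\<^sub>R ?et) = vz n z"
      proof -
        have "z + (- h n) *\<^sub>R ?et + h n *\<^sub>R ?et = z" by (simp del: scaleR_Pair)
        then show ?thesis unfolding up_def by (rule arg_cong)
      qed
      have eq: "S2 z - S1 (z + (- h n) *\<^sub>R ?et) = vz n z * ((\<bar>\<phi> z\<bar> - \<bar>\<phi> (z + (- h n) *\<^sub>R ?et)\<bar>) / h n)"
        unfolding S1_def S2_def shift by (simp add: algebra_simps diff_divide_distrib del: scaleR_Pair)
      show "S2 z - S1 (z + (- h n) *\<^sub>R ?et) \<le> (C * L1) * indicator K' z"
      proof (cases "z \<in> K'")
        case True
        have "\<bar>\<phi> (z + (- h n) *\<^sub>R ?et) - \<phi> z\<bar> \<le> L1 * \<bar>- h n\<bar>"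
          by (rule difference_bound[OF Cc_infty_C1(1)[OF \<phi>] L1(3)])
        then have "\<bar>\<bar>\<phi> z\<bar> - \<bar>\<phi> (z + (- h n) *\<^sub>R ?et)\<bar>\<bar> \<le> L1 * h n" using hp by linarith
        then have "\<bar>(\<bar>\<phi> z\<bar> - \<bar>\<phi> (z + (- h n) *\<^sub>R ?et)\<bar>) / h n\<bar> \<le> L1"
          using hp by (simp add: field_simps)
        from abs_le_D1[OF abs_mult_bound[OF Gz(5)[OF g True] this]]
        show ?thesis unfolding eq using True by simp
      next
        case False
        then have "z \<notin> K" using K'(3) by auto
        moreover have "z + (- h n) *\<^sub>R ?et \<notin> K"
          using near[OF _ _ Basis_t, of z "- h n"] False g h_pos[of n] unfolding good_def by auto
        ultimately show ?thesis unfolding eq using False by (simp add: out del: scaleR_Pair)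
      qed
    qed
    also have "\<dots> = A" using K'(2) by (simp add: A_def borel_compact)
    finally have SA: "(\<integral>z. S z \<partial>lborel) \<le> A" .
    have iR: "integrable lborel R"
      unfolding R_def by (intro Bochner_Integration.integrable_add Bochner_Integration.integrable_diff i1 i2 i3 i4 iT3)
    have "\<bar>\<integral>z. R z \<partial>lborel\<bar> \<le> (\<integral>z. \<bar>R z\<bar> \<partial>lborel)" by (rule integral_abs_bound)
    also have "\<dots> \<le> (\<integral>z. B * \<eta> * S z \<partial>lborel)"
      by (intro integral_mono Rb integrable_abs iR integrable_mult_right iS)
    also have "\<dots> = B * \<eta> * (\<integral>z. S z \<partial>lborel)" using iS by simp
    also have "\<dots> \<le> B * \<eta> * A" using SA B0 \<eta>(1) by (intro mult_left_mono) auto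
    finally show ?thesis unfolding eR .
  qed
  have "(\<lambda>n. \<integral>z. T1 n z + T2 n z + T3 n z \<partial>lborel) \<longlonglongrightarrow> 0"
  proof (rule tendstoI)
    fix \<epsilon>' :: real assume e': "0 < \<epsilon>'"
    \<comment> \<open>Any \<eta> with B \<eta> A < \<epsilon>' serves; the added 1 keeps the
      denominator positive.\<close>
    define \<eta> where "\<eta> = \<epsilon>' / (B * A + 1)"
    have BA: "0 \<le> B * A" using B0 A by simp
    have \<eta>: "0 < \<eta>" using e' BA by (simp add: \<eta>_def)
    have lt: "B * \<eta> * A < \<epsilon>'"
    proof -
      have "B * \<eta> * A = \<eta> * (B * A)" by simp
      also have "\<dots> < \<eta> * (B * A + 1)" using \<eta> by simp
      also have "\<dots> = \<epsilon>'" using BA by (simp add: \<eta>_def)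
      finally show ?thesis .
    qed
    show "\<forall>\<^sub>F n in sequentially. dist (\<integral>z. T1 n z + T2 n z + T3 n z \<partial>lborel) 0 < \<epsilon>'"
      using good v_small[OF r(1,2) \<eta>]
    proof eventually_elim
      case (elim n)
      from rem[OF elim(1) \<eta> elim(2)] lt show ?case by (simp add: dist_real_def)
    qed
  qed
  from LIMSEQ_unique[OF T_lim this] T_int have "has_bochner_integral lborel T 0"
    by (simp add: has_bochner_integral_iff)
  then show ?thesis by (simp add: T_def[abs_def])
qed

end

section \<open>From smooth to Lipschitz compositions\<close>

text \<open>A functional form of the monotone class theorem. Indicators of open sets are limits of
  truncated multiples of the distance to the complement; the pi-lambda theorem leads to Borel sets,
  and simple functions to nonnegative bounded ones. Limits are available only under a common bound,
  so boundedness is carried through every step.\<close>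

lemma bounded_borel_induct:
  fixes h :: "'a::metric_space \<Rightarrow> real"
  assumes cont: "\<And>h. continuous_on UNIV h \<Longrightarrow> (\<forall>x. \<bar>h x\<bar> \<le> 1) \<Longrightarrow> P h"
    and lin: "\<And>h k a b. h \<in> borel_measurable borel \<Longrightarrow> k \<in> borel_measurable borel \<Longrightarrow>
      bounded (range h) \<Longrightarrow> bounded (range k) \<Longrightarrow>
      P h \<Longrightarrow> P k \<Longrightarrow> P (\<lambda>x. a * h x + b * k x)"
    and lim: "\<And>H h C. (\<And>n. H n \<in> borel_measurable borel) \<Longrightarrow> (\<And>n. P (H n)) \<Longrightarrow>
      (\<And>n x. \<bar>H n x\<bar> \<le> C) \<Longrightarrow> (\<And>x. (\<lambda>n. H n x) \<longlonglongrightarrow> h x) \<Longrightarrow> P h"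
    and h: "h \<in> borel_measurable borel" "\<And>x. \<bar>h x\<bar> \<le> C"
  shows "P h"
proof -
  have bdI: "bounded (range k)" if "\<And>x. \<bar>k x\<bar> \<le> B" for k :: "'a \<Rightarrow> real" and B
    using that by (auto intro!: boundedI)
  have P1: "P (\<lambda>_. 1)" and P0: "P (\<lambda>_. 0)"
    by (rule cont; simp)+
  have Popen: "P (indicator A)" if "open A" for A :: "'a set"
  \<comment> \<open>The function \<open>infdist\<close> to the empty set is 0 by convention, so the
    whole space is treated apart.\<close>
  proof (cases "A = UNIV")
    case True
    then show ?thesis using P1 by (simp add: indicator_def[abs_def])
  next
    case False
    then have ne: "- A \<noteq> {}" by auto
    define H where "H n x = min 1 (real n * infdist x (- A))" for n x
    have Hc: "continuous_on UNIV (H n)" for n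
      unfolding H_def by (intro continuous_intros)
    have Hb: "\<bar>H n x\<bar> \<le> 1" for n x
      by (simp add: H_def infdist_nonneg)
    show ?thesis
    proof (rule lim[where H = H and C = 1])
      show "H n \<in> borel_measurable borel" for n
        using Hc by (rule borel_measurable_continuous_onI)
      show "P (H n)" for n using Hc Hb by (intro cont) auto
      show "\<bar>H n x\<bar> \<le> 1" for n x by (rule Hb)
      fix x
      show "(\<lambda>n. H n x) \<longlonglongrightarrow> indicator A x"
      proof (cases "x \<in> A")
        case True
        have "infdist x (- A) \<noteq> 0"
          using in_closed_iff_infdist_zero[of "- A" x] that ne True by auto
        then have pos: "infdist x (- A) > 0" using infdist_nonneg[of x "- A"] by linarith
        obtain n0 :: nat where n0: "real n0 * infdist x (- A) > 1"
          using reals_Archimedean3[OF pos] by blast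
        have "\<forall>\<^sub>F n in sequentially. H n x = 1"
          using eventually_ge_at_top[of n0]
        proof eventually_elim
          case (elim n)
          have "real n0 * infdist x (- A) \<le> real n * infdist x (- A)"
            using elim pos by (intro mult_right_mono) auto
          with n0 show ?case by (simp add: H_def)
        qed
        then show ?thesis using True by (simp add: tendsto_eventually)
      next
        case False
        then have "H n x = 0" for n by (simp add: H_def infdist_zero)
        then show ?thesis using False by simp
      qed
    qed
  qed
  have Pset: "P (indicator A)" if "A \<in> sets borel" for A :: "'a set"
  proof -
    have "Int_stable {S::'a set. open S}" by (auto simp: Int_stable_def)
    moreover have "{S::'a set. open S} \<subseteq> Pow UNIV" by simp
    moreover have "A \<in> sigma_sets UNIV {S. open S}"
      using that by (simp add: borel_def)
    ultimately show ?thesis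
    proof (induction rule: sigma_sets_induct_disjoint)
      case (basic A) then show ?case using Popen by simp
    next
      case empty then show ?case using P0 by (simp add: indicator_def[abs_def])
    next
      case (compl A)
      then have A: "A \<in> sets borel" by (simp add: borel_def)
      have "P (\<lambda>x. 1 * 1 + (-1) * indicator A x)"
        using A P1 compl by (intro lin) (auto intro!: bdI[of _ 1] simp: indicator_def)
      moreover have "(\<lambda>x. 1 * 1 + (-1) * indicator A x) = (indicator (UNIV - A) :: 'a \<Rightarrow> real)"
        by (auto simp: indicator_def)
      ultimately show ?case by simp
    next
      case (union A)
      have A: "A i \<in> sets borel" for i using union by (auto simp: borel_def)
      have fin: "P (indicator (\<Union>i<n. A i))" for n
      proof (induction n)
        case 0 then show ?case using P0 by (simp add: indicator_def[abs_def])
      next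
        case (Suc n)
        have "P (\<lambda>x. 1 * indicator (\<Union>i<n. A i) x + 1 * indicator (A n) x)"
          using A union Suc by (intro lin) (auto intro!: bdI[of _ 1] simp: indicator_def)
        moreover have "(\<lambda>x. 1 * indicator (\<Union>i<n. A i) x + 1 * indicator (A n) x) =
            (indicator (\<Union>i<Suc n. A i) :: 'a \<Rightarrow> real)"
        proof
          fix x
          have "\<not> (x \<in> (\<Union>i<n. A i) \<and> x \<in> A n)"
            using union(1) by (auto simp: disjoint_family_on_def) (metis disjoint_iff less_irrefl)
          then show "1 * indicator (\<Union>i<n. A i) x + 1 * indicator (A n) x =
            (indicator (\<Union>i<Suc n. A i) x :: real)"
            by (auto simp: indicator_def less_Suc_eq)
        qed
        ultimately show ?case by simp
      qed
      show ?case
      proof (rule lim[where H = "\<lambda>n. indicator (\<Union>i<n. A i)" and C = 1])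
        show "(\<lambda>n. indicator (\<Union>i<n. A i) x :: real) \<longlonglongrightarrow> indicator (\<Union>i. A i) x" for x
          by (rule LIMSEQ_indicator_UN)
      qed (use A fin in \<open>auto simp: indicator_def\<close>)
    qed
  qed
  have Ppos: "bounded (range k) \<longrightarrow> P k"
    if "k \<in> borel_measurable borel" "\<And>x. 0 \<le> k x" for k :: "'a \<Rightarrow> real"
    using that
  proof (induction k rule: borel_measurable_induct_real)
    case (set A) then show ?case using Pset by simp
  next
    case (mult u c)
    show ?case
    proof (cases "c = 0")
      case True then show ?thesis using P0 by simp
    next
      case False
      show ?thesis
      proof
        assume "bounded (range (\<lambda>x. c * u x))"
        then obtain B where "\<And>x. \<bar>c * u x\<bar> \<le> B" by (auto simp: bounded_iff)
        then have "\<bar>u x\<bar> \<le> B / \<bar>c\<bar>" for x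
          using False by (simp add: field_simps abs_mult)
        then have b: "bounded (range u)" by (rule bdI)
        then have "P (\<lambda>x. c * u x + 0 * u x)" using mult by (intro lin) auto
        then show "P (\<lambda>x. c * u x)" by simp
      qed
    qed
  next
    case (add u v)
    show ?case
    proof
      assume "bounded (range (\<lambda>x. v x + u x))"
      then obtain B where B: "\<And>x. \<bar>v x + u x\<bar> \<le> B" by (auto simp: bounded_iff)
      have pos: "0 \<le> u x" "0 \<le> v x" for x by (rule add)+
      have "\<bar>u x\<bar> \<le> B" "\<bar>v x\<bar> \<le> B" for x using B[of x] pos[of x] by auto
      then have b: "bounded (range u)" "bounded (range v)" by (auto intro: bdI)
      then have "P (\<lambda>x. 1 * v x + 1 * u x)" using add by (intro lin) auto
      then show "P (\<lambda>x. v x + u x)" by simp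
    qed
  next
    case (seq U)
    show ?case
    proof
      assume "bounded (range k)"
      then obtain B where B: "\<And>x. \<bar>k x\<bar> \<le> B" by (auto simp: bounded_iff)
      have le: "U i x \<le> k x" for i x
        using seq by (intro incseq_le) (auto simp: incseq_def le_fun_def)
      have pos: "0 \<le> U i x" for i x by (rule seq)
      have Ub: "\<bar>U i x\<bar> \<le> B" for i x using le[of i x] pos[of i x] B[of x] by auto
      then have "bounded (range (U i))" for i by (rule bdI)
      moreover have "bounded (range (U i)) \<longrightarrow> P (U i)" for i by (rule seq)
      ultimately have PU: "P (U i)" for i by blast
      show "P k"
        by (rule lim[where H = U and C = B]) (use seq PU Ub in auto)
    qed
  qed
  have hb: "- C \<le> h x \<and> h x \<le> C" for x using h(2)[of x] by auto
  \<comment> \<open>Adding C makes the function nonnegative, and linearity removes the constant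
    again.\<close>
  have "bounded (range (\<lambda>x. h x + C))"
    by (rule bdI[of _ "2 * C"]) (use hb in \<open>smt (verit)\<close>)
  moreover from this have "P (\<lambda>x. h x + C)"
  proof (intro Ppos[THEN mp])
    show "(\<lambda>x. h x + C) \<in> borel_measurable borel" using h(1) by simp
    show "0 \<le> h x + C" for x using hb[of x] by simp
  qed
  ultimately have "P (\<lambda>x. 1 * (h x + C) + (- C) * 1)"
    using h(1) P1 by (intro lin) auto
  then show ?thesis by simp
qed

text \<open>The weak derivative \<open>h\<close> of a Lipschitz function \<open>g\<close> is defined only almost everywhere, while
  \<open>u\<close> may charge null sets. As the integral identity is affine in \<open>h\<close>, it passes from continuous
  to bounded Borel functions by a monotone class argument, once a representative is fixed.\<close>

definition primitive :: "(real \<Rightarrow> real) \<Rightarrow> real \<Rightarrow> real" where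
  "primitive h s = (\<integral>r. indicator {0..s} r * h r \<partial>lborel)"

text \<open>Bounds are asked only on intervals [0, s], so that primitives, which may grow, belong to
  the class again and \<open>primitive\<close> can be iterated.\<close>

definition locally_bounded_borel :: "(real \<Rightarrow> real) \<Rightarrow> bool" where
  "locally_bounded_borel h \<longleftrightarrow> h \<in> borel_measurable borel \<and> (\<forall>s. \<exists>C\<ge>0. \<forall>r. 0 \<le> r \<longrightarrow> r \<le> s \<longrightarrow> \<bar>h r\<bar> \<le> C)"

lemma locally_bounded_borelI:
  assumes "h \<in> borel_measurable borel" "\<And>r. \<bar>h r\<bar> \<le> C"
  shows "locally_bounded_borel h"
  unfolding locally_bounded_borel_def
  using assms by (intro conjI allI exI[of _ "max 0 C"]) (auto simp: le_max_iff_disj)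

lemma locally_bounded_borel_continuous:
  assumes "continuous_on UNIV h" shows "locally_bounded_borel h"
  unfolding locally_bounded_borel_def
proof (intro conjI allI)
  show "h \<in> borel_measurable borel" using assms by (rule borel_measurable_continuous_onI)
  fix s :: real
  have "bounded (h ` {0..s})"
    using assms by (intro compact_imp_bounded compact_continuous_image) (auto intro: continuous_on_subset)
  then obtain B where "\<forall>r\<in>{0..s}. \<bar>h r\<bar> \<le> B" by (auto simp: bounded_iff)
  then show "\<exists>C\<ge>0. \<forall>r. 0 \<le> r \<longrightarrow> r \<le> s \<longrightarrow> \<bar>h r\<bar> \<le> C"
    by (intro exI[of _ "max 0 B"]) (auto simp: le_max_iff_disj)
qed

lemma primitive_integrable:
  assumes "locally_bounded_borel h"
  shows "integrable lborel (\<lambda>r. indicator {0..s} r * h r)"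
proof -
  obtain C where C: "0 \<le> C" "\<And>r. 0 \<le> r \<Longrightarrow> r \<le> s \<Longrightarrow> \<bar>h r\<bar> \<le> C"
    using assms unfolding locally_bounded_borel_def by blast
  have [measurable]: "h \<in> borel_measurable borel" using assms by (simp add: locally_bounded_borel_def)
  show ?thesis
    by (rule integrable_bounded_compact[of _ "{0..s}" C]) (use C in \<open>auto simp: indicator_def\<close>)
qed

lemma primitive_linear:
  assumes "locally_bounded_borel h" "locally_bounded_borel k"
  shows "primitive (\<lambda>r. a * h r + b * k r) s = a * primitive h s + b * primitive k s"
proof -
  have "primitive (\<lambda>r. a * h r + b * k r) s
      = (\<integral>r. a * (indicator {0..s} r * h r) + b * (indicator {0..s} r * k r) \<partial>lborel)"
    unfolding primitive_def by (intro Bochner_Integration.integral_cong) (auto simp: algebra_simps)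
  also have "\<dots> = a * primitive h s + b * primitive k s"
    unfolding primitive_def using primitive_integrable[OF assms(1), of s] primitive_integrable[OF assms(2), of s] by simp
  finally show ?thesis .
qed

lemma primitive_diff_bound:
  assumes h: "locally_bounded_borel h" and C: "0 \<le> C" "\<And>r. 0 \<le> r \<Longrightarrow> r \<le> t \<Longrightarrow> \<bar>h r\<bar> \<le> C" and st: "s \<le> t"
  shows "\<bar>primitive h t - primitive h s\<bar> \<le> C * (t - s)"
proof -
  have "\<bar>primitive h t - primitive h s\<bar> = \<bar>\<integral>r. indicator {0..t} r * h r - indicator {0..s} r * h r \<partial>lborel\<bar>"
    unfolding primitive_def using primitive_integrable[OF h] by simp
  also have "\<dots> \<le> (\<integral>r. \<bar>indicator {0..t} r * h r - indicator {0..s} r * h r\<bar> \<partial>lborel)"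
    by (rule integral_abs_bound)
  also have "\<dots> \<le> (\<integral>r. C * indicator {s..t} r \<partial>lborel)"
  proof (rule integral_mono)
    show "integrable lborel (\<lambda>r. \<bar>indicator {0..t} r * h r - indicator {0..s} r * h r\<bar>)"
      by (intro integrable_abs Bochner_Integration.integrable_diff primitive_integrable h)
    show "integrable lborel (\<lambda>r. C * indicator {s..t} r :: real)"
      by (intro integrable_mult_right integrable_real_indicator) (use st in auto)
    show "\<bar>indicator {0..t} r * h r - indicator {0..s} r * h r\<bar> \<le> C * indicator {s..t} r" for r
      using C(1) C(2)[of r] st by (auto simp: indicator_def)
  qed
  also have "\<dots> = C * (t - s)" using st by simp
  finally show ?thesis .
qed

lemma primitive_0: "s \<le> 0 \<Longrightarrow> primitive h s = 0"
proof -
  assume s: "s \<le> 0"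
  have "primitive h s = (\<integral>(r::real). 0 \<partial>lborel)"
    unfolding primitive_def
  proof (rule integral_cong_AE)
    show "AE r in lborel. indicator {0..s} r * h r = 0"
      using AE_lborel_singleton[of 0] by eventually_elim (use s in \<open>auto simp: indicator_def\<close>)
    \<comment> \<open>Nothing is assumed about h: for s \<le> 0 the integrand can be nonzero only at
      the point 0, which yields measurability.\<close>
    have "(\<lambda>r. indicator {0..s} r * h r) = (\<lambda>r. if r \<in> {0..s} then h 0 else 0)"
    proof
      fix r
      have "r = 0" if "r \<in> {0..s}" using that s by simp
      then show "indicator {0..s} r * h r = (if r \<in> {0..s} then h 0 else 0)" by (auto simp: indicator_def)
    qed
    then show "(\<lambda>r. indicator {0..s} r * h r) \<in> borel_measurable lborel" by simp
  qed simp
  then show ?thesis by simp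
qed

lemma primitive_bound:
  assumes h: "locally_bounded_borel h" and C: "0 \<le> C" "\<And>r. 0 \<le> r \<Longrightarrow> r \<le> t \<Longrightarrow> \<bar>h r\<bar> \<le> C" and "0 \<le> t"
  shows "\<bar>primitive h t\<bar> \<le> C * t"
  using primitive_diff_bound[OF h C(1), of t 0] C(2) assms(4) primitive_0[of 0 h] by simp

lemma primitive_continuous:
  assumes h: "locally_bounded_borel h"
  shows "continuous_on UNIV (primitive h)"
proof (intro continuous_at_imp_continuous_on ballI)
  fix x :: real
  obtain C where C: "0 \<le> C" "\<And>r. 0 \<le> r \<Longrightarrow> r \<le> x + 1 \<Longrightarrow> \<bar>h r\<bar> \<le> C"
    using h unfolding locally_bounded_borel_def by blast
  have "(primitive h \<longlongrightarrow> primitive h x) (at x)"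
  proof (rule LIM_zero_cancel, rule Lim_null_comparison)
    have "((\<lambda>y. C * \<bar>y - x\<bar>) \<longlongrightarrow> C * \<bar>x - x\<bar>) (at x)" by (intro tendsto_intros)
    then show "((\<lambda>y. C * \<bar>y - x\<bar>) \<longlongrightarrow> 0) (at x)" by simp
    have "\<forall>\<^sub>F y in at x. dist y x < 1" by (intro tendstoD tendsto_ident_at) simp
    then show "\<forall>\<^sub>F y in at x. norm (primitive h y - primitive h x) \<le> C * \<bar>y - x\<bar>"
    proof eventually_elim
      case (elim y)
      show ?case
      proof (cases "x \<le> y")
        case True
        then show ?thesis using primitive_diff_bound[OF h C(1), of y x] C(2) elim by (auto simp: dist_real_def)
      next
        case False
        then show ?thesis using primitive_diff_bound[OF h C(1), of x y] C(2) elim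
          by (auto simp: dist_real_def abs_minus_commute)
      qed
    qed
  qed
  then show "isCont (primitive h) x" by (simp add: isCont_def)
qed

lemma locally_bounded_borel_primitive: "locally_bounded_borel h \<Longrightarrow> locally_bounded_borel (primitive h)"
  using locally_bounded_borel_continuous primitive_continuous by blast

lemma primitive_tendsto:
  assumes "\<And>n. H n \<in> borel_measurable borel" "h \<in> borel_measurable borel"
    and "\<And>n r. 0 \<le> r \<Longrightarrow> r \<le> s \<Longrightarrow> \<bar>H n r\<bar> \<le> C" "0 \<le> C"
    and "\<And>r. 0 \<le> r \<Longrightarrow> r \<le> s \<Longrightarrow> (\<lambda>n. H n r) \<longlonglongrightarrow> h r"
  shows "(\<lambda>n. primitive (H n) s) \<longlonglongrightarrow> primitive h s"
  unfolding primitive_def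
proof (rule integral_tendsto_compact(2)[of _ _ "{0..s}"])
  note assms(1,2)[measurable]
  show "(\<lambda>r. indicator {0..s} r * H n r) \<in> borel_measurable borel" for n by measurable
  show "(\<lambda>r. indicator {0..s} r * h r) \<in> borel_measurable borel" by measurable
  show "\<forall>\<^sub>F n in sequentially. \<forall>z. \<bar>indicator {0..s} z * H n z\<bar> \<le> C * indicator {0..s} z"
    using assms(3,4) by (auto simp: indicator_def)
  show "AE z in lborel. (\<lambda>n. indicator {0..s} z * H n z) \<longlonglongrightarrow> indicator {0..s} z * h z"
    using assms(5) by (auto simp: indicator_def)
qed simp

lemma primitive_derivative:
  assumes h: "continuous_on UNIV h" and s: "0 < s"
  shows "(primitive h has_real_derivative h s) (at s)"
proof -
  have eq: "primitive h t = integral {0..t} h" for t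
  proof -
    have "set_integrable lborel {0..t} h"
      unfolding set_integrable_def
      using primitive_integrable[OF locally_bounded_borel_continuous[OF h], of t] by simp
    from set_borel_integral_eq_integral(2)[OF this] show ?thesis
      by (simp add: primitive_def set_lebesgue_integral_def)
  qed
  have "((\<lambda>t. integral {0..t} h) has_real_derivative h s) (at s within {0..s + 1})"
    using s h by (intro integral_has_real_derivative) (auto intro: continuous_on_subset)
  moreover have "at s within {0..s + 1} = at s"
    using s by (intro at_within_interior) auto
  ultimately show ?thesis by (simp add: eq[abs_def])
qed

context planar_approximation begin

section \<open>Extension from continuous to bounded Borel derivatives\<close>

text \<open>The cut-off makes compositions with u Borel on the whole space without changing anything
  on \<open>Q_infty\<close>.\<close>

definition ux :: "'a \<times> real \<Rightarrow> real" where "ux z = indicator Q_infty z * uz z"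

lemma ux_measurable [measurable]: "ux \<in> borel_measurable borel"
  unfolding ux_def[abs_def] by (rule uz_measurable)

text \<open>The common shape of the identities to be extended. Here \<kappa> is the derivative of g,
  so that \<open>primitive \<kappa>\<close> stands for g and the double primitive for G, up to
  affine parts that go into \<open>c3\<close>.\<close>

definition affine_form where
  "affine_form c0 c1 c2 c3 \<kappa> z = primitive (primitive \<kappa>) (ux z) * c0 z + primitive \<kappa> (ux z) * c1 z + \<kappa> (ux z) * c2 z + (c3 z :: real)"

text \<open>Both the weak derivative of g(u) \<phi> and the equation itself are instances. The case
  \<kappa> = 0 shows that the constant part integrates to 0; what remains is linear in \<kappa>, and
  \<open>bounded_borel_induct\<close> applies, with dominated convergence on K.\<close>

lemma affine_form_zero:
  assumes c: "c0 \<in> borel_measurable borel" "c1 \<in> borel_measurable borel" "c2 \<in> borel_measurable borel" "c3 \<in> borel_measurable borel"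
    and K: "compact K" "K \<subseteq> Q_infty"
    and b: "\<And>z. \<bar>c0 z\<bar> \<le> B * indicator K z" "\<And>z. \<bar>c1 z\<bar> \<le> B * indicator K z"
      "\<And>z. \<bar>c2 z\<bar> \<le> B * indicator K z" "\<And>z. \<bar>c3 z\<bar> \<le> B * indicator K z"
    and cont: "\<And>\<kappa>. continuous_on UNIV \<kappa> \<Longrightarrow> (\<integral>z. affine_form c0 c1 c2 c3 \<kappa> z \<partial>lborel) = 0"
    and h: "\<kappa> \<in> borel_measurable borel" "\<And>s. \<bar>\<kappa> s\<bar> \<le> C"
  shows "has_bochner_integral lborel (affine_form c0 c1 c2 c3 \<kappa>) 0"
proof -
  note c[measurable]
  let ?X = "affine_form c0 c1 c2 (\<lambda>_. 0)"
  obtain S where S0: "\<And>z. z \<in> K \<Longrightarrow> \<bar>uz z\<bar> \<le> S" using uz_bounded[OF K] by blast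
  have S: "0 \<le> ux z" "ux z \<le> S" if "z \<in> K" for z
    using S0[OF that] uz_ge_1[of z] that K by (auto simp: ux_def)
  have off: "c0 z = 0" "c1 z = 0" "c2 z = 0" "c3 z = 0" if "z \<notin> K" for z using b[of z] that by auto
  have B: "0 \<le> B" if "z \<in> K" for z using b(1)[of z] that by simp
  have lb: "locally_bounded_borel k" if k: "k \<in> borel_measurable borel" "bounded (range k)" for k
  proof -
    obtain D where "\<And>r. \<bar>k r\<bar> \<le> D" using k(2) by (auto simp: bounded_iff)
    then show ?thesis by (rule locally_bounded_borelI[OF k(1)])
  qed
  have Xm: "?X k \<in> borel_measurable borel" if "locally_bounded_borel k" for k
  proof -
    have [measurable]: "k \<in> borel_measurable borel" "primitive k \<in> borel_measurable borel" "primitive (primitive k) \<in> borel_measurable borel"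
      using that locally_bounded_borel_primitive[OF that] locally_bounded_borel_primitive[OF locally_bounded_borel_primitive[OF that]]
      by (auto simp: locally_bounded_borel_def)
    show ?thesis unfolding affine_form_def[abs_def] by measurable
  qed
  have pb: "\<bar>primitive k s\<bar> \<le> D * S" "\<bar>primitive (primitive k) s\<bar> \<le> D * S * S"
    if k: "k \<in> borel_measurable borel" "\<And>r. \<bar>k r\<bar> \<le> D" and s: "0 \<le> s" "s \<le> S" for k D s
  proof -
    have D: "0 \<le> D" using k(2)[of 0] by simp
    have lk: "locally_bounded_borel k" by (rule locally_bounded_borelI[OF k])
    have 1: "\<bar>primitive k r\<bar> \<le> D * S" if "0 \<le> r" "r \<le> S" for r
    proof -
      have "\<bar>primitive k r\<bar> \<le> D * r" using that k(2) by (intro primitive_bound lk D)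
      also have "\<dots> \<le> D * S" using that D by (intro mult_left_mono)
      finally show ?thesis .
    qed
    show "\<bar>primitive k s\<bar> \<le> D * S" by (rule 1[OF s])
    have DS: "0 \<le> D * S" using D s by simp
    have "\<bar>primitive (primitive k) s\<bar> \<le> (D * S) * s"
      using s 1 by (intro primitive_bound locally_bounded_borel_primitive lk DS) auto
    also have "\<dots> \<le> D * S * S" using s DS by (intro mult_left_mono)
    finally show "\<bar>primitive (primitive k) s\<bar> \<le> D * S * S" .
  qed
  have Xb: "\<bar>?X k z\<bar> \<le> ((D * S * S + D * S + D) * B) * indicator K z"
    if k: "k \<in> borel_measurable borel" "\<And>r. \<bar>k r\<bar> \<le> D" for k D z
  proof (cases "z \<in> K")
    case True
    note pb = pb[OF k S[OF True]]
    have cb: "\<bar>c0 z\<bar> \<le> B" "\<bar>c1 z\<bar> \<le> B" "\<bar>c2 z\<bar> \<le> B" using b[of z] True by auto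
    have "\<bar>?X k z\<bar> \<le> D * S * S * B + D * S * B + D * B"
      unfolding affine_form_def add_0_right
      by (intro order_trans[OF abs_triangle_ineq] add_mono abs_mult_bound pb cb k(2))
    then show ?thesis using True by (simp add: algebra_simps)
  next
    case False
    then show ?thesis by (simp add: affine_form_def off)
  qed
  have Xi: "integrable lborel (?X k)" if k: "k \<in> borel_measurable borel" "\<And>r. \<bar>k r\<bar> \<le> D" for k D
    by (rule integrable_bounded_compact[OF Xm[OF locally_bounded_borelI[OF k]] K(1) Xb[OF k]])
  have c3i: "integrable lborel c3"
    by (rule integrable_bounded_compact[OF c(4) K(1) b(4)])
  have split: "affine_form c0 c1 c2 c3 k = (\<lambda>z. ?X k z + c3 z)" for k
    by (simp add: affine_form_def fun_eq_iff)
  have prim0: "primitive (\<lambda>_. 0) = (\<lambda>_. 0)" by (simp add: primitive_def fun_eq_iff)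
  have "(\<integral>z. c3 z \<partial>lborel) = 0"
    using cont[of "\<lambda>_. 0"] by (simp add: affine_form_def prim0)
  have Xcont: "(\<integral>z. ?X k z \<partial>lborel) = 0" if "continuous_on UNIV k" "\<forall>s. \<bar>k s\<bar> \<le> 1" for k
  proof -
    have "k \<in> borel_measurable borel" using that(1) by (rule borel_measurable_continuous_onI)
    then have "integrable lborel (?X k)" using that(2) by (intro Xi[of k 1]) auto
    then show ?thesis using cont[OF that(1)] c3i \<open>(\<integral>z. c3 z \<partial>lborel) = 0\<close> unfolding split by simp
  qed
  have X0: "(\<integral>z. ?X \<kappa> z \<partial>lborel) = 0"
  proof (rule bounded_borel_induct[where P = "\<lambda>\<kappa>. (\<integral>z. ?X \<kappa> z \<partial>lborel) = 0", OF Xcont _ _ h])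
    fix k l :: "real \<Rightarrow> real" and a b :: real
    assume kl: "k \<in> borel_measurable borel" "l \<in> borel_measurable borel" "bounded (range k)" "bounded (range l)"
      "(\<integral>z. ?X k z \<partial>lborel) = 0" "(\<integral>z. ?X l z \<partial>lborel) = 0"
    have lk: "locally_bounded_borel k" "locally_bounded_borel l" using kl by (auto intro: lb)
    have "?X (\<lambda>x. a * k x + b * l x) z = a * ?X k z + b * ?X l z" for z
    proof -
      have 1: "primitive (\<lambda>x. a * k x + b * l x) = (\<lambda>x. a * primitive k x + b * primitive l x)"
        using primitive_linear[OF lk] by (simp add: fun_eq_iff)
      show ?thesis unfolding affine_form_def 1
          primitive_linear[OF locally_bounded_borel_primitive[OF lk(1)] locally_bounded_borel_primitive[OF lk(2)]]
        by (simp add: algebra_simps)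
    qed
    moreover obtain D1 D2 where "\<And>r. \<bar>k r\<bar> \<le> D1" "\<And>r. \<bar>l r\<bar> \<le> D2"
      using kl(3,4) by (auto simp: bounded_iff)
    then have "integrable lborel (?X k)" "integrable lborel (?X l)" using Xi kl by blast+
    ultimately show "(\<integral>z. ?X (\<lambda>x. a * k x + b * l x) z \<partial>lborel) = 0" using kl by simp
  next
    fix H :: "nat \<Rightarrow> real \<Rightarrow> real" and k D
    assume H: "\<And>n. H n \<in> borel_measurable borel" "\<And>n. (\<integral>z. ?X (H n) z \<partial>lborel) = 0"
      "\<And>n x. \<bar>H n x\<bar> \<le> D" "\<And>x. (\<lambda>n. H n x) \<longlonglongrightarrow> k x"
    have km: "k \<in> borel_measurable borel" by (rule borel_measurable_LIMSEQ_real[OF H(4,1)])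
    have kD: "\<bar>k x\<bar> \<le> D" for x
      by (rule tendsto_upperbound[OF tendsto_rabs[OF H(4)]]) (use H(3) in auto)
    have D: "0 \<le> D" using kD[of 0] by simp
    have lk: "locally_bounded_borel k" "locally_bounded_borel (H n)" for n
      using locally_bounded_borelI km kD H(1,3) by blast+
    have pm: "primitive k \<in> borel_measurable borel" "primitive (H n) \<in> borel_measurable borel" for n
      using locally_bounded_borel_primitive[OF lk(1)] locally_bounded_borel_primitive[OF lk(2)]
      by (auto simp: locally_bounded_borel_def)
    have p1: "(\<lambda>n. primitive (H n) s) \<longlonglongrightarrow> primitive k s" for s
      using H km D by (intro primitive_tendsto[where C = D]) auto
    have p2: "(\<lambda>n. primitive (primitive (H n)) s) \<longlonglongrightarrow> primitive (primitive k) s" if "0 \<le> s" "s \<le> S" for s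
    proof (rule primitive_tendsto[where C = "D * S", OF pm(2) pm(1)])
      show "\<bar>primitive (H n) r\<bar> \<le> D * S" if "0 \<le> r" "r \<le> s" for n r
        using that \<open>s \<le> S\<close> by (intro pb H) auto
      show "0 \<le> D * S" using D that by simp
    qed (rule p1)
    have "(\<lambda>n. \<integral>z. ?X (H n) z \<partial>lborel) \<longlonglongrightarrow> (\<integral>z. ?X k z \<partial>lborel)"
    proof (rule integral_tendsto_compact(2)[OF Xm[OF lk(2)] Xm[OF lk(1)] K(1)])
      show "\<forall>\<^sub>F n in sequentially. \<forall>z. \<bar>?X (H n) z\<bar> \<le> ((D * S * S + D * S + D) * B) * indicator K z"
        using Xb[OF H(1,3)] by simp
      have "(\<lambda>n. ?X (H n) z) \<longlonglongrightarrow> ?X k z" for z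
      proof (cases "z \<in> K")
        case True
        show ?thesis unfolding affine_form_def by (intro tendsto_intros p1 p2 S True H(4))
      next
        case False
        then show ?thesis by (simp add: affine_form_def off)
      qed
      then show "AE z in lborel. (\<lambda>n. ?X (H n) z) \<longlonglongrightarrow> ?X k z" by simp
    qed
    then show "(\<integral>z. ?X k z \<partial>lborel) = 0" by (simp add: H(2) LIMSEQ_const_iff)
  qed
  have "integrable lborel (?X \<kappa>)" by (rule Xi[OF h])
  then show ?thesis
    unfolding split has_bochner_integral_iff using c3i X0 \<open>(\<integral>z. c3 z \<partial>lborel) = 0\<close> by simp
qed

end

section \<open>Test functions on the line\<close>

lemma frechet_derivative_real:
  assumes "(\<phi> has_real_derivative D) (at x)" shows "frechet_derivative \<phi> (at x) 1 = D"
proof -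
  have "(*) D = frechet_derivative \<phi> (at x)"
    using assms unfolding has_field_derivative_def by (rule frechet_derivative_at)
  from fun_cong[OF this, of 1] show ?thesis by simp
qed

text \<open>The only basis vector of the line is 1, which turns the recursion of \<open>C_k\<close>
  into a statement about ordinary derivatives.\<close>

lemma C_k_SucI:
  assumes "\<And>x. (\<phi> has_real_derivative \<phi>' x) (at x)" "C_k k \<phi>'"
  shows "C_k (Suc k) \<phi>"
proof -
  have "\<phi> differentiable (at x)" for x
    using assms(1)[of x] unfolding has_field_derivative_def differentiable_def by blast
  moreover have "(\<lambda>x. frechet_derivative \<phi> (at x) 1) = \<phi>'"
    using frechet_derivative_real[OF assms(1)] by auto
  ultimately show ?thesis using assms(2) by simp
qed

lemma C_k_SucD:
  fixes \<phi> :: "real \<Rightarrow> real"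
  assumes "C_k (Suc k) \<phi>"
  shows "\<exists>\<phi>'. (\<forall>x. (\<phi> has_real_derivative \<phi>' x) (at x)) \<and> C_k k \<phi>'"
proof -
  have d: "\<phi> differentiable (at x)" for x using assms by simp
  have "(\<phi> has_real_derivative frechet_derivative \<phi> (at x) 1) (at x)" for x
    using line_derivative[OF d, of 0 1 x] by simp
  moreover have "C_k k (\<lambda>x. frechet_derivative \<phi> (at x) 1)" using assms by simp
  ultimately show ?thesis by (intro exI[of _ "\<lambda>x. frechet_derivative \<phi> (at x) 1"] conjI allI)
qed

lemma C_k_mono:
  fixes \<phi> :: "real \<Rightarrow> real"
  shows "C_k (Suc k) \<phi> \<Longrightarrow> C_k k \<phi>"
proof (induction k arbitrary: \<phi>)
  case 0
  then obtain \<phi>' where "\<And>x. (\<phi> has_real_derivative \<phi>' x) (at x)" using C_k_SucD by blast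
  then show ?case by (auto intro!: continuous_at_imp_continuous_on DERIV_isCont)
next
  case (Suc k)
  obtain \<phi>' where "\<And>x. (\<phi> has_real_derivative \<phi>' x) (at x)" "C_k (Suc k) \<phi>'"
    using C_k_SucD[OF Suc.prems] by blast
  then show ?case using Suc.IH by (intro C_k_SucI)
qed

lemma C_k_add:
  fixes \<phi> \<psi> :: "real \<Rightarrow> real"
  shows "C_k k \<phi> \<Longrightarrow> C_k k \<psi> \<Longrightarrow> C_k k (\<lambda>x. \<phi> x + \<psi> x)"
proof (induction k arbitrary: \<phi> \<psi>)
  case 0
  then show ?case by (auto intro: continuous_on_add)
next
  case (Suc k)
  obtain \<phi>' where 1: "\<And>x. (\<phi> has_real_derivative \<phi>' x) (at x)" "C_k k \<phi>'" using C_k_SucD[OF Suc.prems(1)] by blast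
  obtain \<psi>' where 2: "\<And>x. (\<psi> has_real_derivative \<psi>' x) (at x)" "C_k k \<psi>'" using C_k_SucD[OF Suc.prems(2)] by blast
  show ?case by (rule C_k_SucI[OF DERIV_add[OF 1(1) 2(1)] Suc.IH[OF 1(2) 2(2)]])
qed

lemma C_k_mult:
  fixes \<phi> \<psi> :: "real \<Rightarrow> real"
  shows "C_k k \<phi> \<Longrightarrow> C_k k \<psi> \<Longrightarrow> C_k k (\<lambda>x. \<phi> x * \<psi> x)"
proof (induction k arbitrary: \<phi> \<psi>)
  case 0
  then show ?case by (auto intro: continuous_on_mult)
next
  case (Suc k)
  obtain \<phi>' where 1: "\<And>x. (\<phi> has_real_derivative \<phi>' x) (at x)" "C_k k \<phi>'" using C_k_SucD[OF Suc.prems(1)] by blast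
  obtain \<psi>' where 2: "\<And>x. (\<psi> has_real_derivative \<psi>' x) (at x)" "C_k k \<psi>'" using C_k_SucD[OF Suc.prems(2)] by blast
  have "C_k k (\<lambda>x. \<phi>' x * \<psi> x + \<psi>' x * \<phi> x)"
    by (rule C_k_add[OF Suc.IH[OF 1(2) C_k_mono[OF Suc.prems(2)]] Suc.IH[OF 2(2) C_k_mono[OF Suc.prems(1)]]])
  then show ?case by (rule C_k_SucI[OF DERIV_mult[OF 1(1) 2(1)]])
qed

lemma C_k_const: "C_k k (\<lambda>x::real. c)"
proof (induction k arbitrary: c)
  case (Suc k)
  show ?case by (rule C_k_SucI[OF DERIV_const Suc.IH])
qed simp

lemma C_k_affine:
  fixes \<phi> :: "real \<Rightarrow> real"
  shows "C_k k \<phi> \<Longrightarrow> C_k k (\<lambda>x. \<phi> (a * x + b))"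
proof (induction k arbitrary: \<phi>)
  case 0
  then have "continuous_on UNIV \<phi>" by simp
  then have "continuous_on UNIV (\<phi> \<circ> (\<lambda>x. a * x + b))"
    by (intro continuous_on_compose continuous_intros) (auto intro: continuous_on_subset)
  then show ?case by (simp add: comp_def)
next
  case (Suc k)
  obtain \<phi>' where 1: "\<And>x. (\<phi> has_real_derivative \<phi>' x) (at x)" "C_k k \<phi>'" using C_k_SucD[OF Suc.prems(1)] by blast
  have "((\<lambda>x. \<phi> (a * x + b)) has_real_derivative \<phi>' (a * x + b) * a) (at x)" for x
    by (rule DERIV_chain2[OF 1(1)]) (auto intro!: derivative_eq_intros)
  moreover have "C_k k (\<lambda>x. \<phi>' (a * x + b) * a)"
    by (rule C_k_mult[OF Suc.IH[OF 1(2)] C_k_const])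
  ultimately show ?case by (rule C_k_SucI)
qed

section \<open>A smooth bump and a smooth step\<close>

text \<open>The function exp(-1/x) with an arbitrary polynomial factor in 1/x: this family is closed
  under differentiation, so one computation of the derivative gives smoothness of all
  members.\<close>

definition flat :: "real poly \<Rightarrow> real \<Rightarrow> real" where
  "flat P x = (if 0 < x then poly P (1 / x) * exp (- (1 / x)) else 0)"

lemma poly_div_exp_tendsto_0: "((\<lambda>y::real. y ^ m * poly P y * exp (- y)) \<longlongrightarrow> 0) at_top"
proof (induction P arbitrary: m)
  case 0 then show ?case by simp
next
  case (pCons a P)
  have "((\<lambda>y. a * (y ^ m / exp y) + y ^ Suc m * poly P y * exp (- y)) \<longlongrightarrow> a * 0 + 0) at_top"
    by (intro tendsto_intros tendsto_power_div_exp_0 pCons.IH)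
  moreover have "(\<lambda>y. a * (y ^ m / exp y) + y ^ Suc m * poly P y * exp (- y)) = (\<lambda>y. y ^ m * poly (pCons a P) y * exp (- y))"
    by (auto simp: fun_eq_iff exp_minus field_simps)
  ultimately show ?case by simp
qed

text \<open>The derivative of P(1/x) exp(-1/x) is (P - P')(1/x) / x^2 times the exponential, and the
  polynomial factor \<open>[:0, 0, 1:]\<close> stands for 1 / x^2. At 0 the right difference
  quotient tends to 0 after the substitution y = 1/x.\<close>

lemma flat_derivative:
  "(flat P has_real_derivative flat ([:0, 0, 1:] * (P - pderiv P)) x) (at x)"
proof -
  consider "0 < x" | "x < 0" | "x = 0" by linarith
  then show ?thesis
  proof cases
    case 1
    have "((\<lambda>x. poly P (1 / x) * exp (- (1 / x))) has_real_derivative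
        poly ([:0, 0, 1:] * (P - pderiv P)) (1 / x) * exp (- (1 / x))) (at x)"
      using 1 by (auto intro!: derivative_eq_intros DERIV_chain2[OF poly_DERIV] simp: field_simps power2_eq_square)
    moreover have "\<forall>\<^sub>F y in nhds x. flat P y = poly P (1 / y) * exp (- (1 / y))"
      using 1 eventually_nhds_in_open[of "{0<..}" x] by (auto simp: flat_def elim!: eventually_mono)
    ultimately show ?thesis using 1 by (subst DERIV_cong_ev[OF refl _ refl]) (auto simp: flat_def)
  next
    case 2
    have "\<forall>\<^sub>F y in nhds x. flat P y = 0"
      using 2 eventually_nhds_in_open[of "{..<0}" x] by (auto simp: flat_def elim!: eventually_mono)
    then show ?thesis using 2 by (subst DERIV_cong_ev[OF refl _ refl]) (auto simp: flat_def)
  next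
    case 3
    have "((\<lambda>y. flat P y / y) \<longlongrightarrow> 0) (at_left 0)"
      by (rule tendsto_eventually) (auto simp: flat_def eventually_at_left_field intro!: exI[of _ "-1"])
    moreover have "((\<lambda>y. flat P y / y) \<longlongrightarrow> 0) (at_right 0)"
    proof -
      have "((\<lambda>x::real. (inverse x) ^ 1 * poly P (inverse x) * exp (- inverse x)) \<longlongrightarrow> 0) (at_right 0)"
        by (rule filterlim_compose[OF poly_div_exp_tendsto_0 filterlim_inverse_at_top_right])
      then show ?thesis
      proof (rule Lim_transform_eventually)
        show "\<forall>\<^sub>F x in at_right 0. (inverse x) ^ 1 * poly P (inverse x) * exp (- inverse x) = flat P x / x"
          by (auto simp: flat_def eventually_at_right_field divide_inverse mult_ac intro!: exI[of _ 1])
      qed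
    qed
    ultimately have "((\<lambda>y. flat P y / y) \<longlongrightarrow> 0) (at 0)" by (rule filterlim_split_at)
    then show ?thesis using 3 by (simp add: DERIV_def flat_def)
  qed
qed

lemma C_k_flat: "C_k k (flat P)"
proof (induction k arbitrary: P)
  case 0
  show ?case by (auto intro!: continuous_at_imp_continuous_on DERIV_isCont flat_derivative)
next
  case (Suc k)
  show ?case by (rule C_k_SucI[OF flat_derivative Suc.IH])
qed

text \<open>The support [1, 2] lies to the right of 0, so that the primitive from 0 is smooth
  everywhere, including the negative half line, where \<open>primitive\<close> is 0 by
  definition.\<close>

definition bump :: "real \<Rightarrow> real" where "bump x = flat 1 (x - 1) * flat 1 (2 - x)"

lemma C_k_bump: "C_k k bump"
proof -
  have "C_k k (\<lambda>x. flat 1 (1 * x + (- 1)) * flat 1 ((- 1) * x + 2))"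
    by (rule C_k_mult[OF C_k_affine[OF C_k_flat] C_k_affine[OF C_k_flat]])
  then show ?thesis by (simp add: bump_def[abs_def])
qed

lemma bump_cont: "continuous_on UNIV bump" using C_k_bump[of 0] by simp

lemma bump_pos: "1 < x \<Longrightarrow> x < 2 \<Longrightarrow> 0 < bump x"
  by (simp add: bump_def flat_def)

lemma bump_nonneg: "0 \<le> bump x" by (simp add: bump_def flat_def)

lemma bump_zero: "x \<le> 1 \<or> 2 \<le> x \<Longrightarrow> bump x = 0"
  by (auto simp: bump_def flat_def)

definition step :: "real \<Rightarrow> real" where "step = primitive bump"

lemma step_derivative: "(step has_real_derivative bump x) (at x)"
proof (cases "0 < x")
  case True
  then show ?thesis unfolding step_def by (intro primitive_derivative bump_cont)
next
  case False
  have zero: "step y = 0" if "y \<le> 1" for y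
  proof -
    have "(\<lambda>r. indicator {0..y} r * bump r) = (\<lambda>r. 0)"
      using that by (auto simp: fun_eq_iff indicator_def intro: bump_zero)
    then show ?thesis by (simp add: step_def primitive_def)
  qed
  have "\<forall>\<^sub>F y in nhds x. step y = 0"
    using False eventually_nhds_in_open[of "{..<1}" x] by (auto simp: zero elim!: eventually_mono)
  then show ?thesis using False by (subst DERIV_cong_ev[OF refl _ refl]) (auto simp: bump_zero)
qed

lemma step_cont: "continuous_on UNIV step"
  by (auto intro!: continuous_at_imp_continuous_on DERIV_isCont step_derivative)

lemma step_zero: "x \<le> 1 \<Longrightarrow> step x = 0"
proof -
  assume "x \<le> 1"
  then have "(\<lambda>r. indicator {0..x} r * bump r) = (\<lambda>r. 0)"
    by (auto simp: fun_eq_iff indicator_def intro: bump_zero)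
  then show ?thesis by (simp add: step_def primitive_def)
qed

lemma step_full: "2 \<le> x \<Longrightarrow> step x = (\<integral>r. bump r \<partial>lborel)"
  unfolding step_def primitive_def
proof (intro Bochner_Integration.integral_cong refl)
  fix r assume "2 \<le> x"
  then show "indicator {0..x} r * bump r = bump r"
    using bump_zero[of r] by (cases "r \<in> {0..x}") auto
qed

lemma step_mono: "x \<le> y \<Longrightarrow> step x \<le> step y"
  by (rule DERIV_nonneg_imp_nondecreasing) (auto intro: step_derivative bump_nonneg)

lemma bump_integral_pos: "0 < (\<integral>r. bump r \<partial>lborel)"
proof -
  obtain z where "1 < z" "z < 2" "step 2 - step 1 = (2 - 1) * bump z"
    using MVT2[of 1 2 step bump] step_derivative by auto
  then show ?thesis using bump_pos[of z] step_zero[of 1] step_full[of 2] by simp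
qed

lemma bump_bounded: "\<exists>B. \<forall>x. \<bar>bump x\<bar> \<le> B * indicator {1..2} x"
proof -
  have "bounded (bump ` {1..2})"
    using bump_cont by (intro compact_imp_bounded compact_continuous_image) (auto intro: continuous_on_subset)
  then obtain B where "\<forall>x\<in>{1..2}. \<bar>bump x\<bar> \<le> B" by (auto simp: bounded_iff)
  then show ?thesis by (intro exI[of _ B]) (auto simp: indicator_def bump_zero)
qed

text \<open>The rescaled bumps concentrate just to the right of a; after the substitution y = (n +
  1) (x - a) this is dominated convergence. They are not normalised, hence the integral of
  \<open>bump\<close> in the limit.\<close>

lemma bump_average_tendsto:
  assumes "continuous_on UNIV g"
  shows "(\<lambda>n. \<integral>x. g x * (real (Suc n) * bump (real (Suc n) * (x - a))) \<partial>lborel) \<longlonglongrightarrow> g a * (\<integral>r. bump r \<partial>lborel)"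
proof -
  have [measurable]: "bump \<in> borel_measurable borel" "g \<in> borel_measurable borel"
    using bump_cont assms by (auto intro: borel_measurable_continuous_onI)
  obtain B where B: "\<And>x. \<bar>bump x\<bar> \<le> B * indicator {1..2} x" using bump_bounded by blast
  have B0: "0 \<le> B" using B[of 1] by simp
  have eq: "(\<integral>x. g x * (real (Suc n) * bump (real (Suc n) * (x - a))) \<partial>lborel)
      = (\<integral>y. g (a + y / real (Suc n)) * bump y \<partial>lborel)" for n
  proof -
    have "(\<integral>x. g x * (real (Suc n) * bump (real (Suc n) * (x - a))) \<partial>lborel)
      = \<bar>1 / real (Suc n)\<bar> *\<^sub>R (\<integral>y. g (a + 1 / real (Suc n) * y) * (real (Suc n) * bump (real (Suc n) * (a + 1 / real (Suc n) * y - a))) \<partial>lborel)"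
      by (rule lborel_integral_real_affine) simp
    also have "\<dots> = (\<integral>y. \<bar>1 / real (Suc n)\<bar> * (g (a + 1 / real (Suc n) * y) * (real (Suc n) * bump (real (Suc n) * (a + 1 / real (Suc n) * y - a)))) \<partial>lborel)"
      by (simp only: real_scaleR_def Bochner_Integration.integral_mult_right_zero)
    also have "\<dots> = (\<integral>y. g (a + y / real (Suc n)) * bump y \<partial>lborel)"
    proof (intro Bochner_Integration.integral_cong refl)
      fix y
      have "real (Suc n) * (a + 1 / real (Suc n) * y - a) = y" by (simp del: of_nat_Suc)
      then show "\<bar>1 / real (Suc n)\<bar> * (g (a + 1 / real (Suc n) * y) * (real (Suc n) * bump (real (Suc n) * (a + 1 / real (Suc n) * y - a)))) = g (a + y / real (Suc n)) * bump y"
        by (simp del: of_nat_Suc)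
    qed
    finally show ?thesis .
  qed
  have "bounded (g ` {a..a + 2})"
    using assms by (intro compact_imp_bounded compact_continuous_image) (auto intro: continuous_on_subset)
  then obtain A where A: "\<forall>x\<in>{a..a + 2}. \<bar>g x\<bar> \<le> A" by (auto simp: bounded_iff)
  have "(\<lambda>n. \<integral>y. g (a + y / real (Suc n)) * bump y \<partial>lborel) \<longlonglongrightarrow> (\<integral>y. g a * bump y \<partial>lborel)"
  proof (rule integral_tendsto_compact(2)[of _ _ "{1..2}"])
    show "\<forall>\<^sub>F n in sequentially. \<forall>y. \<bar>g (a + y / real (Suc n)) * bump y\<bar> \<le> (A * B) * indicator {1..2} y"
    proof (intro always_eventually allI)
      fix n y
      show "\<bar>g (a + y / real (Suc n)) * bump y\<bar> \<le> (A * B) * indicator {1..2} y"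
      proof (cases "y \<in> {1..2}")
        case True
        have "0 \<le> y / real (Suc n)" using True by simp
        moreover have "y / real (Suc n) \<le> 2 / 1" using True by (intro frac_le) auto
        ultimately have "\<bar>g (a + y / real (Suc n))\<bar> \<le> A" by (intro A[rule_format]) auto
        moreover have "\<bar>bump y\<bar> \<le> B" using B[of y] True by simp
        ultimately show ?thesis using True abs_mult_bound by simp
      next
        case False
        then show ?thesis by (auto simp: bump_zero)
      qed
    qed
    have "(\<lambda>n. g (a + y / real (Suc n)) * bump y) \<longlonglongrightarrow> g a * bump y" for y
    proof -
      have "(\<lambda>n. a + y * (1 / real (Suc n))) \<longlonglongrightarrow> a + y * 0"
        by (intro tendsto_intros LIMSEQ_Suc[OF lim_1_over_n])
      then have "(\<lambda>n. a + y / real (Suc n)) \<longlonglongrightarrow> a" by simp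
      from continuous_on_tendsto_compose[OF assms this] show ?thesis by (intro tendsto_intros) auto
    qed
    then show "AE y in lborel. (\<lambda>n. g (a + y / real (Suc n)) * bump y) \<longlonglongrightarrow> g a * bump y" by simp
  qed auto
  then show ?thesis unfolding eq by simp
qed

section \<open>Lipschitz functions as primitives\<close>

text \<open>Testing the weak derivative against smooth approximations of the indicator of (0, s]
  gives the representation at every s, because g is continuous. The function h is bounded everywhere
  and not only almost everywhere, as \<open>bounded_borel_induct\<close> demands.\<close>

lemma W1_infty_primitive:
  assumes g: "continuous_on UNIV g" "g \<in> W1_infty"
  obtains h C where "h \<in> borel_measurable borel" "\<And>s. \<bar>h s\<bar> \<le> C" "\<And>s. 0 \<le> s \<Longrightarrow> g s = g 0 + primitive h s"
proof -
  obtain h0 where h0: "h0 \<in> L_infty" "has_weak_deriv UNIV 1 g h0" using g(2) by (auto simp: W1_infty_def)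
  then obtain C where C: "AE s in lborel. \<bar>h0 s\<bar> \<le> C" by (auto simp: L_infty_def)
  have [measurable]: "h0 \<in> borel_measurable borel" using h0(1) by (simp add: L_infty_def)
  \<comment> \<open>The weak derivative is set to 0 on the null set where it exceeds its essential
    bound.\<close>
  define h where "h s = (if \<bar>h0 s\<bar> \<le> C then h0 s else 0)" for s
  have [measurable]: "h \<in> borel_measurable borel" unfolding h_def[abs_def] by measurable
  have hC: "\<bar>h s\<bar> \<le> max 0 C" for s by (auto simp: h_def)
  have ae: "AE s in lborel. h0 s = h s" using C by eventually_elim (simp add: h_def)
  have [measurable]: "g \<in> borel_measurable borel" "step \<in> borel_measurable borel" "bump \<in> borel_measurable borel"
    using g(1) step_cont bump_cont by (auto intro: borel_measurable_continuous_onI)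
  define c where "c = (\<integral>r. bump r \<partial>lborel)"
  have c: "0 < c" unfolding c_def by (rule bump_integral_pos)
  have stepb: "0 \<le> step x" "step x \<le> c" for x
    using step_mono[of "min x 1" x] step_zero[of "min x 1"] step_mono[of x "max x 2"] step_full[of "max x 2"]
    by (auto simp: c_def)
  have main: "g s = g 0 + primitive h s" if s: "0 \<le> s" for s
  proof -
    \<comment> \<open>A smooth step up just after 0 and one down just after s; its height is c, the
      integral of \<open>bump\<close>, instead of 1.\<close>
    define \<phi> where "\<phi> n x = step (real (Suc n) * (x - 0)) - step (real (Suc n) * (x - s))" for n x
    define \<phi>' where "\<phi>' n x = real (Suc n) * bump (real (Suc n) * (x - 0)) - real (Suc n) * bump (real (Suc n) * (x - s))" for n x
    have d: "(\<phi> n has_real_derivative \<phi>' n x) (at x)" for n x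
      unfolding \<phi>_def[abs_def] \<phi>'_def
      by (intro DERIV_diff; rule DERIV_cong[OF DERIV_chain2[OF step_derivative]], auto intro!: derivative_eq_intros)
    have "C_k k (\<lambda>x. real (Suc n) * bump (real (Suc n) * x + b))" for k n b
      by (rule C_k_mult[OF C_k_const C_k_affine[OF C_k_bump]])
    then have C1: "C_k k (\<lambda>x. real (Suc n) * bump (real (Suc n) * x + 0) + (- 1) * (real (Suc n) * bump (real (Suc n) * x + (- (real (Suc n) * s)))))" for k n
      by (intro C_k_add[OF _ C_k_mult[OF C_k_const]])
    have "C_k k (\<phi>' n)" for k n
    proof -
      have "\<phi>' n = (\<lambda>x. real (Suc n) * bump (real (Suc n) * x + 0) + (- 1) * (real (Suc n) * bump (real (Suc n) * x + (- (real (Suc n) * s)))))"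
        by (auto simp: \<phi>'_def fun_eq_iff right_diff_distrib simp del: of_nat_Suc)
      then show ?thesis using C1[of k n] by simp
    qed
    then have Ck: "C_k k (\<phi> n)" for k n
      using C_k_mono[OF C_k_SucI[OF d]] by blast
    have supp: "\<phi> n x = 0" if "x \<notin> {0..s + 2}" for n x
    proof (cases "x < 0")
      case True
      then have "real (Suc n) * (x - 0) \<le> 0" "real (Suc n) * (x - s) \<le> 0"
        using s by (auto intro!: mult_nonneg_nonpos)
      then show ?thesis by (simp add: \<phi>_def step_zero)
    next
      case False
      then have x: "s + 2 < x" using that by auto
      then have "1 * 2 \<le> real (Suc n) * (x - 0)" "1 * 2 \<le> real (Suc n) * (x - s)"
        using s by (intro mult_mono; simp)+
      then show ?thesis by (simp add: \<phi>_def step_full)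
    qed
    have "closure {x. \<phi> n x \<noteq> 0} \<subseteq> {0..s + 2}" for n
    proof (rule closure_minimal)
      show "{x. \<phi> n x \<noteq> 0} \<subseteq> {0..s + 2}" using supp by blast
    qed simp
    then have "compact (closure {x. \<phi> n x \<noteq> 0})" for n
      by (meson bounded_closed_interval bounded_subset closed_closure compact_eq_bounded_closed)
    then have test: "\<phi> n \<in> Cc_infty UNIV" for n
      using Ck by (simp add: Cc_infty_def compact_support_in_def)
    have [measurable]: "\<phi> n \<in> borel_measurable borel" for n unfolding \<phi>_def[abs_def] by measurable
    have "(\<integral>x. g x * \<phi>' n x \<partial>lborel) = - (\<integral>x. h x * \<phi> n x \<partial>lborel)" for n
    proof -
      have "(LINT x:UNIV|lborel. g x * frechet_derivative (\<phi> n) (at x) 1) = - (LINT x:UNIV|lborel. h0 x * \<phi> n x)"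
        using h0(2) test unfolding has_weak_deriv_def by blast
      then have "(\<integral>x. g x * \<phi>' n x \<partial>lborel) = - (\<integral>x. h0 x * \<phi> n x \<partial>lborel)"
        by (simp add: set_lebesgue_integral_def frechet_derivative_real[OF d])
      also have "(\<integral>x. h0 x * \<phi> n x \<partial>lborel) = (\<integral>x. h x * \<phi> n x \<partial>lborel)"
        using ae by (intro integral_cong_AE) auto
      finally show ?thesis .
    qed
    moreover have "(\<lambda>n. \<integral>x. g x * \<phi>' n x \<partial>lborel) \<longlonglongrightarrow> g 0 * c - g s * c"
    proof -
      have int: "integrable lborel (\<lambda>x. g x * (real (Suc n) * bump (real (Suc n) * (x - a))))" for n a
      proof -
        have "bounded ((\<lambda>x. g x * (real (Suc n) * bump (real (Suc n) * (x - a)))) ` {a..a + 2})"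
        proof (intro compact_imp_bounded compact_continuous_image)
          have "continuous_on UNIV (\<lambda>x. bump (real (Suc n) * (x - a)))"
            by (rule continuous_on_compose2[OF bump_cont]) (auto intro!: continuous_intros)
          then have "continuous_on UNIV (\<lambda>x. g x * (real (Suc n) * bump (real (Suc n) * (x - a))))"
            using g(1) by (intro continuous_intros)
          then show "continuous_on {a..a + 2} (\<lambda>x. g x * (real (Suc n) * bump (real (Suc n) * (x - a))))"
            by (rule continuous_on_subset) simp
        qed simp
        then obtain A where A: "\<forall>x\<in>{a..a + 2}. \<bar>g x * (real (Suc n) * bump (real (Suc n) * (x - a)))\<bar> \<le> A"
          by (auto simp: bounded_iff)
        show ?thesis
        proof (rule integrable_bounded_compact[of _ "{a..a + 2}" A])
          fix x
          show "\<bar>g x * (real (Suc n) * bump (real (Suc n) * (x - a)))\<bar> \<le> A * indicator {a..a + 2} x"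
          proof (cases "x \<in> {a..a + 2}")
            case False
            have "bump (real (Suc n) * (x - a)) = 0"
            proof (cases "x < a")
              case True
              then have "real (Suc n) * (x - a) \<le> 0" by (intro mult_nonneg_nonpos) auto
              then show ?thesis by (intro bump_zero) simp
            next
              case False2: False
              then have "1 * 2 \<le> real (Suc n) * (x - a)" using False by (intro mult_mono) auto
              then show ?thesis by (intro bump_zero) simp
            qed
            then show ?thesis using False by simp
          next
            case True
            then show ?thesis using A by simp
          qed
        qed auto
      qed
      have "(\<integral>x. g x * \<phi>' n x \<partial>lborel) = (\<integral>x. g x * (real (Suc n) * bump (real (Suc n) * (x - 0))) \<partial>lborel)
          - (\<integral>x. g x * (real (Suc n) * bump (real (Suc n) * (x - s))) \<partial>lborel)" for n
        unfolding \<phi>'_def right_diff_distrib[of "g _"] by (rule Bochner_Integration.integral_diff[OF int int])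
      then show ?thesis
        using tendsto_diff[OF bump_average_tendsto[OF g(1), of 0] bump_average_tendsto[OF g(1), of s]]
        by (simp only: c_def)
    qed
    \<comment> \<open>The limiting interval is half open because both steps lie to the right of 0
      and s; its missing end point has measure 0.\<close>
    moreover have "(\<lambda>n. \<integral>x. h x * \<phi> n x \<partial>lborel) \<longlonglongrightarrow> (\<integral>x. c * (indicator {0<..s} x * h x) \<partial>lborel)"
    proof (rule integral_tendsto_compact(2)[of _ _ "{0..s + 2}"])
      show "\<forall>\<^sub>F n in sequentially. \<forall>x. \<bar>h x * \<phi> n x\<bar> \<le> (max 0 C * c) * indicator {0..s + 2} x"
      proof (intro always_eventually allI)
        fix n x
        show "\<bar>h x * \<phi> n x\<bar> \<le> (max 0 C * c) * indicator {0..s + 2} x"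
        proof (cases "x \<in> {0..s + 2}")
          case True
          have "\<bar>\<phi> n x\<bar> \<le> c" unfolding \<phi>_def
            using stepb[of "real (Suc n) * (x - 0)"] stepb[of "real (Suc n) * (x - s)"] by linarith
          from abs_mult_bound[OF hC[of x] this] True show ?thesis by simp
        qed (simp add: supp)
      qed
      have stepl: "(\<lambda>n. step (real (Suc n) * (x - a))) \<longlonglongrightarrow> c * indicator {a<..} x" for x a
      proof (cases "a < x")
        case True
        obtain N :: nat where N: "2 / (x - a) < real N" using reals_Archimedean2 by blast
        have "\<forall>\<^sub>F n in sequentially. step (real (Suc n) * (x - a)) = c"
          using eventually_ge_at_top[of N]
        proof eventually_elim
          case (elim n)
          have "2 < real N * (x - a)" using N True by (simp add: field_simps)
          also have "\<dots> \<le> real (Suc n) * (x - a)" using elim True by (intro mult_right_mono) auto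
          finally show ?case by (simp add: step_full c_def)
        qed
        then show ?thesis using True by (simp add: tendsto_eventually)
      next
        case False
        then have "real (Suc n) * (x - a) \<le> 0" for n by (intro mult_nonneg_nonpos) auto
        then have "step (real (Suc n) * (x - a)) = 0" for n by (intro step_zero) (meson order_trans zero_le_one)
        then show ?thesis using False by simp
      qed
      have "(\<lambda>n. h x * \<phi> n x) \<longlonglongrightarrow> h x * (c * indicator {0<..} x - c * indicator {s<..} x)" for x
        unfolding \<phi>_def by (intro tendsto_intros stepl)
      moreover have "h x * (c * indicator {0<..} x - c * indicator {s<..} x) = c * (indicator {0<..s} x * h x)" for x
        using s by (auto simp: indicator_def)
      ultimately show "AE x in lborel. (\<lambda>n. h x * \<phi> n x) \<longlonglongrightarrow> c * (indicator {0<..s} x * h x)" by simp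
    qed auto
    ultimately have "(\<lambda>n. - (\<integral>x. h x * \<phi> n x \<partial>lborel)) \<longlonglongrightarrow> g 0 * c - g s * c"
      "(\<lambda>n. - (\<integral>x. h x * \<phi> n x \<partial>lborel)) \<longlonglongrightarrow> - (\<integral>x. c * (indicator {0<..s} x * h x) \<partial>lborel)"
      by (auto intro: tendsto_minus)
    then have "g 0 * c - g s * c = - (\<integral>x. c * (indicator {0<..s} x * h x) \<partial>lborel)" by (rule LIMSEQ_unique)
    also have "(\<integral>x. c * (indicator {0<..s} x * h x) \<partial>lborel) = c * (\<integral>x. indicator {0<..s} x * h x \<partial>lborel)"
      by simp
    also have "(\<integral>x. indicator {0<..s} x * h x \<partial>lborel) = primitive h s"
      unfolding primitive_def
    proof (rule integral_cong_AE)
      show "AE x in lborel. indicator {0<..s} x * h x = indicator {0..s} x * h x"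
        using AE_lborel_singleton[of 0] by eventually_elim (auto simp: indicator_def)
    qed auto
    finally have "c * (g s) = c * (g 0 + primitive h s)" by (simp add: algebra_simps)
    then show ?thesis using c by simp
  qed
  show ?thesis by (rule that[OF _ hC main]) auto
qed

lemma L1_loc_mult_integrable:
  fixes W :: "'b::euclidean_space \<Rightarrow> real"
  assumes W: "W \<in> L1_loc \<Omega>" and K: "compact K" "K \<subseteq> \<Omega>"
    and c: "c \<in> borel_measurable borel" "\<And>z. \<bar>c z\<bar> \<le> L * indicator K z"
  shows "integrable lborel (\<lambda>z. indicator \<Omega> z * (W z * c z))"
proof -
  have i: "integrable lborel (\<lambda>z. indicator K z * W z)"
    using W K by (simp add: L1_loc_def set_integrable_def)
  have out: "c z = 0" if "z \<notin> K" for z using c(2)[of z] that by simp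
  have eq: "(\<lambda>z. indicator \<Omega> z * (W z * c z)) = (\<lambda>z. (indicator K z * W z) * c z)"
  proof
    fix z
    show "indicator \<Omega> z * (W z * c z) = (indicator K z * W z) * c z"
      using K(2) out[of z] by (cases "z \<in> K") (auto simp: indicator_def)
  qed
  have "integrable lborel (\<lambda>z. L * \<bar>indicator K z * W z\<bar>)"
    using i by (intro integrable_mult_right integrable_abs)
  then show ?thesis
  proof (rule Bochner_Integration.integrable_bound)
    show "(\<lambda>z. indicator \<Omega> z * (W z * c z)) \<in> borel_measurable lborel"
      unfolding eq using borel_measurable_integrable[OF i] c(1) by measurable
    show "AE z in lborel. norm (indicator \<Omega> z * (W z * c z)) \<le> norm (L * \<bar>indicator K z * W z\<bar>)"
    proof (rule AE_I2)
      fix z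
      show "norm (indicator \<Omega> z * (W z * c z)) \<le> norm (L * \<bar>indicator K z * W z\<bar>)"
      proof (cases "z \<in> K")
        case True
        have "\<bar>W z\<bar> * \<bar>c z\<bar> \<le> \<bar>W z\<bar> * \<bar>L\<bar>" using c(2)[of z] True by (intro mult_left_mono) auto
        then show ?thesis using True K(2) by (auto simp: abs_mult mult.commute)
      qed (simp add: out)
    qed
  qed
qed

section \<open>Independence of the values outside the domain\<close>

lemma L1_loc_cong: "(\<And>z. z \<in> \<Omega> \<Longrightarrow> w z = w' z) \<Longrightarrow> w \<in> L1_loc \<Omega> \<longleftrightarrow> w' \<in> L1_loc \<Omega>"
proof -
  assume eq: "\<And>z. z \<in> \<Omega> \<Longrightarrow> w z = w' z"
  have "set_integrable lborel K w = set_integrable lborel K w'" if "K \<subseteq> \<Omega>" for K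
    unfolding set_integrable_def using eq that
    by (intro arg_cong[where f = "integrable lborel"]) (auto simp: fun_eq_iff indicator_def)
  then show ?thesis unfolding L1_loc_def by auto
qed

lemma has_weak_deriv_cong:
  assumes "\<And>z. z \<in> \<Omega> \<Longrightarrow> w z = w' z" "\<And>z. z \<in> \<Omega> \<Longrightarrow> k z = k' z"
  shows "has_weak_deriv \<Omega> d w k \<longleftrightarrow> has_weak_deriv \<Omega> d w' k'"
proof -
  have "(LINT z:\<Omega>|lborel. w z * c z) = (LINT z:\<Omega>|lborel. w' z * c z)"
    "(LINT z:\<Omega>|lborel. k z * c z) = (LINT z:\<Omega>|lborel. k' z * c z)" for c
    unfolding set_lebesgue_integral_def
    by (intro Bochner_Integration.integral_cong; use assms in \<open>auto simp: indicator_def\<close>)+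
  moreover have "w \<in> L1_loc \<Omega> \<longleftrightarrow> w' \<in> L1_loc \<Omega>" "k \<in> L1_loc \<Omega> \<longleftrightarrow> k' \<in> L1_loc \<Omega>"
    by (rule L1_loc_cong; simp add: assms)+
  ultimately show ?thesis unfolding has_weak_deriv_def by simp
qed

text \<open>Neither the integrals nor the weak gradients see values outside \<open>Q_infty\<close>.
  This is needed because members of \<open>positive_solutions\<close> are cut off to be
  extensional.\<close>

lemma weak_solution_cong:
  fixes u u' :: "'a::euclidean_space \<times> real \<Rightarrow> real"
  assumes eq: "\<And>z. z \<in> Q_infty \<Longrightarrow> u z = u' z" and sol: "weak_solution p f u"
  shows "weak_solution p f u'"
proof -
  have g: "has_weak_grad (\<lambda>z. \<kappa> (u z) * \<phi> z) W = has_weak_grad (\<lambda>z. \<kappa> (u' z) * \<phi> z) W" for \<kappa> \<phi> W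
    unfolding has_weak_grad_def by (intro ball_cong refl has_weak_deriv_cong) (simp_all add: eq)
  have g': "has_weak_grad u W = has_weak_grad u' W" for W
    unfolding has_weak_grad_def by (intro ball_cong refl has_weak_deriv_cong) (simp_all add: eq)
  have i: "(\<lambda>z. indicator Q_infty z *\<^sub>R (X (u z) z :: real)) = (\<lambda>z. indicator Q_infty z *\<^sub>R X (u' z) z)" for X
    by (auto simp: fun_eq_iff indicator_def eq)
  show ?thesis
    using sol unfolding weak_solution_def g g'
      i[of "\<lambda>s z. - G s * frechet_derivative \<phi> (at z) (0, 1) + norm (V z) powr (p - 2) * (V z \<bullet> W z) + f s * g s * \<phi> z" for G \<phi> V W g]
    using L1_loc_cong[of Q_infty u u'] L1_loc_cong[of Q_infty "\<lambda>z. f (u z)" "\<lambda>z. f (u' z)"] eq by auto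
qed

context planar_approximation begin

lemma ux_eq: "z \<in> Q_infty \<Longrightarrow> ux z = uz z" by (simp add: ux_def)

context
  fixes \<phi> :: "'a \<times> real \<Rightarrow> real" and g0 G0 :: real
  assumes \<phi>: "\<phi> \<in> Cc_infty Q_infty"
begin

section \<open>The equation tested with g(u) \<phi> for Lipschitz g\<close>

definition lipschitz_comp where "lipschitz_comp \<kappa> z = (g0 + primitive \<kappa> (ux z)) * \<phi> z"

definition lipschitz_slope where "lipschitz_slope i \<kappa> z = \<kappa> (ux z) * (Dlim z * (e \<bullet> i)) * \<phi> z
  + (g0 + primitive \<kappa> (ux z)) * frechet_derivative \<phi> (at z) (i, 0)"

text \<open>On the positive half line every pair g, G with derivative \<kappa> of g has this form,
  with \<open>g0\<close> and \<open>G0\<close> the values at 0. Continuity of \<kappa> puts it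
  within reach of the identities for smooth compositions.\<close>

lemma smooth_composition_primitive:
  assumes \<kappa>: "continuous_on UNIV \<kappa>"
  shows "smooth_composition p f v \<delta> h u e \<phi> \<kappa> (\<lambda>s. g0 + primitive \<kappa> s)
    (\<lambda>s. G0 + g0 * s + primitive (primitive \<kappa>) s)"
proof
  have lb: "locally_bounded_borel \<kappa>" using \<kappa> by (rule locally_bounded_borel_continuous)
  have c: "continuous_on UNIV (primitive \<kappa>)" by (rule primitive_continuous[OF lb])
  show "\<phi> \<in> Cc_infty Q_infty" "continuous_on UNIV \<kappa>" by fact+
  show "((\<lambda>s. g0 + primitive \<kappa> s) has_real_derivative \<kappa> s) (at s)" if "0 < s" for s
    using primitive_derivative[OF \<kappa> that] by (auto intro!: derivative_eq_intros)
  show "((\<lambda>s. G0 + g0 * s + primitive (primitive \<kappa>) s) has_real_derivative g0 + primitive \<kappa> s) (at s)" if "0 < s" for s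
    using primitive_derivative[OF c that] by (auto intro!: derivative_eq_intros)
  have [measurable]: "primitive \<kappa> \<in> borel_measurable borel" "primitive (primitive \<kappa>) \<in> borel_measurable borel"
    using locally_bounded_borel_primitive[OF lb] locally_bounded_borel_primitive[OF locally_bounded_borel_primitive[OF lb]]
    by (auto simp: locally_bounded_borel_def)
  show "(\<lambda>s. g0 + primitive \<kappa> s) \<in> borel_measurable borel"
    "(\<lambda>s. G0 + g0 * s + primitive (primitive \<kappa>) s) \<in> borel_measurable borel" by measurable
qed

lemma test_measurable [measurable]: "\<phi> \<in> borel_measurable borel"
  using Cc_infty_C1(2)[OF \<phi>] by (rule borel_measurable_continuous_onI)

lemma dtest_measurable: "d \<in> Basis \<Longrightarrow> (\<lambda>z. frechet_derivative \<phi> (at z) d) \<in> borel_measurable borel"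
  using Cc_infty_C1(3)[OF \<phi>] by (intro borel_measurable_continuous_onI)

lemma lipschitz_comp_lipschitz_slope_L1:
  assumes \<kappa>: "\<kappa> \<in> borel_measurable borel" "\<And>s. \<bar>\<kappa> s\<bar> \<le> C" and i: "i \<in> Basis"
  shows "lipschitz_comp \<kappa> \<in> L1_loc Q_infty" "lipschitz_slope i \<kappa> \<in> L1_loc Q_infty"
proof -
  have lb: "locally_bounded_borel \<kappa>" by (rule locally_bounded_borelI[OF \<kappa>])
  have C: "0 \<le> C" using \<kappa>(2)[of 0] by simp
  have [measurable]: "primitive \<kappa> \<in> borel_measurable borel" "\<kappa> \<in> borel_measurable borel"
    using locally_bounded_borel_primitive[OF lb] \<kappa> by (auto simp: locally_bounded_borel_def)
  have [measurable]: "(\<lambda>z. frechet_derivative \<phi> (at z) (i, 0)) \<in> borel_measurable borel"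
    by (rule dtest_measurable[OF Basis_x[OF i]])
  have [measurable]: "lipschitz_comp \<kappa> \<in> borel_measurable borel" "lipschitz_slope i \<kappa> \<in> borel_measurable borel"
    unfolding lipschitz_comp_def[abs_def] lipschitz_slope_def[abs_def] by measurable
  obtain L where L: "\<And>z. \<bar>\<phi> z\<bar> \<le> L" "\<And>z. \<bar>frechet_derivative \<phi> (at z) (i, 0)\<bar> \<le> L"
    using test_function_uniform_bounds[OF \<phi> Basis_x[OF i]] by blast
  have bounds: "\<exists>B. \<forall>z\<in>K. \<bar>lipschitz_comp \<kappa> z\<bar> \<le> B \<and> \<bar>lipschitz_slope i \<kappa> z\<bar> \<le> B" if K: "compact K" "K \<subseteq> Q_infty" for K
  proof -
    obtain S where S: "\<And>z. z \<in> K \<Longrightarrow> \<bar>uz z\<bar> \<le> S" using uz_bounded[OF K] by blast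
    obtain C2 where C2: "\<And>z. z \<in> K \<Longrightarrow> \<bar>Dlim z\<bar> \<le> C2" using Dlim_local[OF K] by blast
    have gb: "\<bar>g0 + primitive \<kappa> (ux z)\<bar> \<le> \<bar>g0\<bar> + C * S" if "z \<in> K" for z
    proof -
      have zQ: "z \<in> Q_infty" using that K(2) by blast
      have u: "0 \<le> ux z" "ux z \<le> S" using S[OF that] uz_ge_1[OF zQ] ux_eq[OF zQ] by auto
      have "\<bar>primitive \<kappa> (ux z)\<bar> \<le> C * ux z" using u \<kappa>(2) by (intro primitive_bound lb C)
      also have "\<dots> \<le> C * S" using u C by (intro mult_left_mono)
      finally show ?thesis by linarith
    qed
    have "\<bar>lipschitz_comp \<kappa> z\<bar> \<le> (\<bar>g0\<bar> + C * S) * L \<and> \<bar>lipschitz_slope i \<kappa> z\<bar> \<le> C * (C2 * 1) * L + (\<bar>g0\<bar> + C * S) * L" if "z \<in> K" for z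
      unfolding lipschitz_comp_def lipschitz_slope_def using that
      by (intro conjI order_trans[OF abs_triangle_ineq] add_mono abs_mult_bound gb C2 L e_inner i \<kappa>(2))
    then have "\<bar>lipschitz_comp \<kappa> z\<bar> \<le> max ((\<bar>g0\<bar> + C * S) * L) (C * (C2 * 1) * L + (\<bar>g0\<bar> + C * S) * L) \<and>
      \<bar>lipschitz_slope i \<kappa> z\<bar> \<le> max ((\<bar>g0\<bar> + C * S) * L) (C * (C2 * 1) * L + (\<bar>g0\<bar> + C * S) * L)" if "z \<in> K" for z
      using that by (meson le_max_iff_disj)
    then show ?thesis by blast
  qed
  show "lipschitz_comp \<kappa> \<in> L1_loc Q_infty"
  proof (rule L1_locI[OF open_Q])
    show "(\<lambda>z. indicator Q_infty z * lipschitz_comp \<kappa> z) \<in> borel_measurable borel" by measurable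
    show "\<exists>B. \<forall>z\<in>K. \<bar>lipschitz_comp \<kappa> z\<bar> \<le> B" if "compact K" "K \<subseteq> Q_infty" for K
      using bounds[OF that] by blast
  qed
  show "lipschitz_slope i \<kappa> \<in> L1_loc Q_infty"
  proof (rule L1_locI[OF open_Q])
    show "(\<lambda>z. indicator Q_infty z * lipschitz_slope i \<kappa> z) \<in> borel_measurable borel" by measurable
    show "\<exists>B. \<forall>z\<in>K. \<bar>lipschitz_slope i \<kappa> z\<bar> \<le> B" if "compact K" "K \<subseteq> Q_infty" for K
      using bounds[OF that] by blast
  qed
qed

lemma smooth_weak_deriv:
  assumes \<kappa>: "continuous_on UNIV \<kappa>" and i: "i \<in> Basis"
  shows "has_weak_deriv Q_infty (i, 0) (lipschitz_comp \<kappa>) (lipschitz_slope i \<kappa>)"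
proof -
  interpret S: smooth_composition p f v \<delta> h u e \<phi> \<kappa> "\<lambda>s. g0 + primitive \<kappa> s" "\<lambda>s. G0 + g0 * s + primitive (primitive \<kappa>) s"
    by (rule smooth_composition_primitive[OF \<kappa>])
  show ?thesis
    by (rule has_weak_deriv_cong[THEN iffD1, OF _ _ S.chain_weak_deriv[OF i]])
      (simp_all add: lipschitz_comp_def lipschitz_slope_def S.comp_slope_def ux_eq)
qed

text \<open>For a fixed test function \<psi> the claim is an \<open>affine_form\<close> without the
  double primitive. It holds for continuous \<kappa> by the chain rule and extends by
  \<open>affine_form_zero\<close>, which avoids arguing at values of u where g is not
  differentiable.\<close>

lemma general_weak_deriv:
  assumes \<kappa>: "\<kappa> \<in> borel_measurable borel" "\<And>s. \<bar>\<kappa> s\<bar> \<le> C" and i: "i \<in> Basis"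
  shows "has_weak_deriv Q_infty (i, 0) (lipschitz_comp \<kappa>) (lipschitz_slope i \<kappa>)"
  unfolding has_weak_deriv_def
proof (intro conjI ballI)
  show L1: "lipschitz_comp \<kappa> \<in> L1_loc Q_infty" "lipschitz_slope i \<kappa> \<in> L1_loc Q_infty" by (rule lipschitz_comp_lipschitz_slope_L1[OF \<kappa> i])+
  fix \<psi> :: "'a \<times> real \<Rightarrow> real" assume \<psi>: "\<psi> \<in> Cc_infty Q_infty"
  let ?d\<psi> = "\<lambda>z. frechet_derivative \<psi> (at z) (i, 0)" and ?d\<phi> = "\<lambda>z. frechet_derivative \<phi> (at z) (i, 0)"
  have [measurable]: "\<psi> \<in> borel_measurable borel" "?d\<psi> \<in> borel_measurable borel" "?d\<phi> \<in> borel_measurable borel"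
    using Cc_infty_C1[OF \<psi>] Cc_infty_C1(3)[OF \<phi>] Basis_x[OF i] by (auto intro: borel_measurable_continuous_onI)
  obtain K M where K: "compact K" "K \<subseteq> Q_infty" and M: "0 \<le> M" "\<And>z. \<bar>\<psi> z\<bar> \<le> M * indicator K z" "\<And>z. \<bar>?d\<psi> z\<bar> \<le> M * indicator K z"
    using test_function_bounds[OF \<psi> Basis_x[OF i]] by metis
  obtain L where L0: "0 \<le> L" and L: "\<And>z. \<bar>\<phi> z\<bar> \<le> L" "\<And>z. \<bar>?d\<phi> z\<bar> \<le> L"
    using test_function_uniform_bounds[OF \<phi> Basis_x[OF i]] by blast
  obtain C2 where C2: "0 \<le> C2" "\<And>z. z \<in> K \<Longrightarrow> \<bar>Dlim z\<bar> \<le> C2" using Dlim_local[OF K] by blast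
  define c1 where "c1 z = \<phi> z * ?d\<psi> z + ?d\<phi> z * \<psi> z" for z
  define c2 where "c2 z = Dlim z * (e \<bullet> i) * \<phi> z * \<psi> z" for z
  let ?X = "affine_form (\<lambda>_. 0) c1 c2 (\<lambda>z. g0 * c1 z)"
  have out: "\<psi> z = 0" "?d\<psi> z = 0" if "z \<notin> K" for z using M(2,3)[of z] that by auto
  have X: "?X k = (\<lambda>z. indicator Q_infty z * (lipschitz_comp k z * ?d\<psi> z) + indicator Q_infty z * (lipschitz_slope i k z * \<psi> z))" for k
  proof
    fix z
    show "?X k z = indicator Q_infty z * (lipschitz_comp k z * ?d\<psi> z) + indicator Q_infty z * (lipschitz_slope i k z * \<psi> z)"
    proof (cases "z \<in> K")
      case True
      then have "z \<in> Q_infty" using K by blast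
      then show ?thesis by (simp add: affine_form_def lipschitz_comp_def lipschitz_slope_def c1_def c2_def algebra_simps)
    next
      case False
      then show ?thesis by (simp add: affine_form_def c1_def c2_def out)
    qed
  qed
  define B where "B = L * M + L * M + C2 * 1 * L * M + \<bar>g0\<bar> * (L * M + L * M)"
  have "has_bochner_integral lborel (?X \<kappa>) 0"
  proof (rule affine_form_zero[OF _ _ _ _ K _ _ _ _ _ \<kappa>])
    show "(\<lambda>_. 0) \<in> borel_measurable borel" "c1 \<in> borel_measurable borel" "c2 \<in> borel_measurable borel"
      "(\<lambda>z. g0 * c1 z) \<in> borel_measurable borel"
      unfolding c1_def[abs_def] c2_def[abs_def] by measurable
    have c1b: "\<bar>c1 z\<bar> \<le> L * M + L * M" if "z \<in> K" for z
      unfolding c1_def using M(2,3)[of z] that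
      by (intro order_trans[OF abs_triangle_ineq] add_mono abs_mult_bound L) auto
    have c2b: "\<bar>c2 z\<bar> \<le> C2 * 1 * L * M" if "z \<in> K" for z
      unfolding c2_def using M(2)[of z] that by (intro abs_mult_bound C2(2) e_inner i L) auto
    have nn: "0 \<le> L * M" "0 \<le> C2 * 1 * L * M" "0 \<le> \<bar>g0\<bar> * (L * M + L * M)" using L0 M(1) C2(1) by auto
    show "\<bar>0\<bar> \<le> B * indicator K z" "\<bar>c1 z\<bar> \<le> B * indicator K z" "\<bar>c2 z\<bar> \<le> B * indicator K z"
      "\<bar>g0 * c1 z\<bar> \<le> B * indicator K z" for z
    proof -
      have "\<bar>g0 * c1 z\<bar> \<le> \<bar>g0\<bar> * (L * M + L * M)" if "z \<in> K"
        by (rule abs_mult_bound[OF order_refl c1b[OF that]])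
      moreover have "c1 z = 0 \<and> c2 z = 0" if "z \<notin> K" by (simp add: c1_def c2_def out that)
      ultimately show "\<bar>0\<bar> \<le> B * indicator K z" "\<bar>c1 z\<bar> \<le> B * indicator K z" "\<bar>c2 z\<bar> \<le> B * indicator K z"
        "\<bar>g0 * c1 z\<bar> \<le> B * indicator K z"
        using c1b[of z] c2b[of z] nn by (cases "z \<in> K"; simp add: B_def)+
    qed
    fix k :: "real \<Rightarrow> real" assume k: "continuous_on UNIV k"
    have wd: "has_weak_deriv Q_infty (i, 0) (lipschitz_comp k) (lipschitz_slope i k)" by (rule smooth_weak_deriv[OF k i])
    have I: "integrable lborel (\<lambda>z. indicator Q_infty z * (lipschitz_comp k z * ?d\<psi> z))"
      "integrable lborel (\<lambda>z. indicator Q_infty z * (lipschitz_slope i k z * \<psi> z))"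
      using wd by (auto simp: has_weak_deriv_def intro!: L1_loc_mult_integrable[OF _ K _ M(2)] L1_loc_mult_integrable[OF _ K _ M(3)])
    have "(LINT z:Q_infty|lborel. lipschitz_comp k z * ?d\<psi> z) = - (LINT z:Q_infty|lborel. lipschitz_slope i k z * \<psi> z)"
      using wd \<psi> unfolding has_weak_deriv_def by blast
    then show "(\<integral>z. ?X k z \<partial>lborel) = 0"
      unfolding X using I by (simp add: set_lebesgue_integral_def)
  qed
  moreover have "integrable lborel (\<lambda>z. indicator Q_infty z * (lipschitz_comp \<kappa> z * ?d\<psi> z))"
    "integrable lborel (\<lambda>z. indicator Q_infty z * (lipschitz_slope i \<kappa> z * \<psi> z))"
    using L1 by (auto intro!: L1_loc_mult_integrable[OF _ K _ M(2)] L1_loc_mult_integrable[OF _ K _ M(3)])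
  ultimately show "(LINT z:Q_infty|lborel. lipschitz_comp \<kappa> z * ?d\<psi> z) = - (LINT z:Q_infty|lborel. lipschitz_slope i \<kappa> z * \<psi> z)"
    unfolding X by (simp add: set_lebesgue_integral_def has_bochner_integral_iff)
qed

text \<open>The same extension for the equation. Here \<kappa> enters through G, through g and
  through the gradient of g(u) \<phi>, with coefficients \<open>- ?dt\<close>, \<open>c1\<close> and
  \<open>c2\<close> respectively.\<close>

lemma general_identity:
  assumes \<kappa>: "\<kappa> \<in> borel_measurable borel" "\<And>s. \<bar>\<kappa> s\<bar> \<le> C"
  shows "has_bochner_integral lborel (\<lambda>z. indicator Q_infty z *
     (- (G0 + g0 * uz z + primitive (primitive \<kappa>) (uz z)) * frechet_derivative \<phi> (at z) (0, 1)
      + j (Dlim z) * lipschitz_slope e \<kappa> z + f (uz z) * (g0 + primitive \<kappa> (uz z)) * \<phi> z)) 0"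
proof -
  let ?dt = "\<lambda>z. frechet_derivative \<phi> (at z) (0::'a, 1::real)" and ?dx = "\<lambda>z. frechet_derivative \<phi> (at z) (e, 0::real)"
  have [measurable]: "?dt \<in> borel_measurable borel" "?dx \<in> borel_measurable borel"
    by (rule dtest_measurable[OF Basis_t], rule dtest_measurable[OF Basis_x[OF e_Basis]])
  define K where "K = closure {z. \<phi> z \<noteq> 0}"
  have K: "compact K" "K \<subseteq> Q_infty" using \<phi> by (auto simp: K_def Cc_infty_def compact_support_in_def)
  have out: "\<phi> z = 0" "?dt z = 0" "?dx z = 0" if "z \<notin> K" for z
    using that frechet_derivative_zero_outside[of z \<phi>] closure_subset[of "{z. \<phi> z \<noteq> 0}"] unfolding K_def by blast+
  obtain L where L0: "0 \<le> L" and L: "\<And>z. \<bar>\<phi> z\<bar> \<le> L" "\<And>z. \<bar>?dt z\<bar> \<le> L"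
    using test_function_uniform_bounds[OF \<phi> Basis_t] by blast
  obtain L' where L0': "0 \<le> L'" and L': "\<And>z. \<bar>?dx z\<bar> \<le> L'"
    using test_function_uniform_bounds[OF \<phi> Basis_x[OF e_Basis]] by blast
  obtain C2 where C2: "0 \<le> C2" "\<And>z. z \<in> K \<Longrightarrow> \<bar>j (Dlim z)\<bar> \<le> C2 \<and> \<bar>Dlim z\<bar> \<le> C2" using Dlim_local[OF K] by blast
  obtain S0 where S0: "\<And>z. z \<in> K \<Longrightarrow> \<bar>uz z\<bar> \<le> S0" using uz_bounded[OF K] by blast
  define S where "S = max 0 S0"
  have S: "0 \<le> S" "\<And>z. z \<in> K \<Longrightarrow> \<bar>ux z\<bar> \<le> S" using S0 K by (auto simp: S_def ux_def le_max_iff_disj)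
  define c1 where "c1 z = j (Dlim z) * ?dx z + f (ux z) * \<phi> z" for z
  define c2 where "c2 z = j (Dlim z) * (Dlim z * (e \<bullet> e)) * \<phi> z" for z
  define c3 where "c3 z = - ((G0 + g0 * ux z) * ?dt z) + g0 * c1 z" for z
  let ?X = "affine_form (\<lambda>z. - ?dt z) c1 c2 c3"
  define Y where "Y k z = indicator Q_infty z *
     (- (G0 + g0 * uz z + primitive (primitive k) (uz z)) * ?dt z
      + j (Dlim z) * lipschitz_slope e k z + f (uz z) * (g0 + primitive k (uz z)) * \<phi> z)" for k z
  have X: "?X k = Y k" for k
  proof
    fix z
    show "?X k z = Y k z"
    proof (cases "z \<in> K")
      case True
      then have "z \<in> Q_infty" using K by blast
      then show ?thesis by (simp add: Y_def affine_form_def lipschitz_slope_def c1_def c2_def c3_def ux_eq algebra_simps)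
    next
      case False
      then show ?thesis by (simp add: Y_def lipschitz_slope_def affine_form_def c1_def c2_def c3_def out)
    qed
  qed
  define A1 where "A1 = C2 * L' + f S * L"
  define A2 where "A2 = C2 * (C2 * 1) * L"
  define A3 where "A3 = (\<bar>G0\<bar> + \<bar>g0\<bar> * S) * L + \<bar>g0\<bar> * A1"
  have fS: "0 \<le> f S" using S(1) by (rule f_nonneg)
  have A: "0 \<le> A1" "0 \<le> A2" "0 \<le> A3" using C2(1) L0 L0' S(1) fS by (auto simp: A1_def A2_def A3_def)
  have "has_bochner_integral lborel (?X \<kappa>) 0"
  proof (rule affine_form_zero[OF _ _ _ _ K _ _ _ _ _ \<kappa>])
    show "(\<lambda>z. - ?dt z) \<in> borel_measurable borel" "c1 \<in> borel_measurable borel" "c2 \<in> borel_measurable borel" "c3 \<in> borel_measurable borel"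
      unfolding c3_def[abs_def] c1_def[abs_def] c2_def[abs_def] by measurable
    have ee: "\<bar>e \<bullet> e\<bar> \<le> 1" using e_inner[OF e_Basis] .
    have fb: "\<bar>f (ux z)\<bar> \<le> f S" if "z \<in> K" for z
    proof -
      have "0 \<le> ux z" using uz_ge_1[of z] that K by (auto simp: ux_def)
      then show ?thesis using f_nonneg[of "ux z"] f_le[of "ux z" S] S(2)[OF that] by simp
    qed
    have b1: "\<bar>c1 z\<bar> \<le> A1" if "z \<in> K" for z
      unfolding c1_def A1_def using C2(2)[OF that] that
      by (intro order_trans[OF abs_triangle_ineq] add_mono abs_mult_bound L L' fb) auto
    have b2: "\<bar>c2 z\<bar> \<le> A2" if "z \<in> K" for z
      unfolding c2_def A2_def using C2(2)[OF that] by (intro abs_mult_bound L ee) auto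
    have b3: "\<bar>c3 z\<bar> \<le> A3" if "z \<in> K" for z
      unfolding c3_def A3_def
    proof (intro order_trans[OF abs_triangle_ineq] add_mono)
      show "\<bar>- ((G0 + g0 * ux z) * ?dt z)\<bar> \<le> (\<bar>G0\<bar> + \<bar>g0\<bar> * S) * L"
        unfolding abs_minus_cancel
        by (intro abs_mult_bound L order_trans[OF abs_triangle_ineq] add_mono S that order_refl)
      show "\<bar>g0 * c1 z\<bar> \<le> \<bar>g0\<bar> * A1" by (intro abs_mult_bound b1 that order_refl)
    qed
    have off: "c1 z = 0" "c2 z = 0" "c3 z = 0" if "z \<notin> K" for z
      by (simp_all add: c1_def c2_def c3_def out that)
    show "\<bar>- ?dt z\<bar> \<le> (L + A1 + A2 + A3) * indicator K z" for z
      using L(2)[of z] A out(2)[of z] by (cases "z \<in> K") auto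
    show "\<bar>c1 z\<bar> \<le> (L + A1 + A2 + A3) * indicator K z" for z
      using b1[of z] A L0 off(1)[of z] by (cases "z \<in> K") auto
    show "\<bar>c2 z\<bar> \<le> (L + A1 + A2 + A3) * indicator K z" for z
      using b2[of z] A L0 off(2)[of z] by (cases "z \<in> K") auto
    show "\<bar>c3 z\<bar> \<le> (L + A1 + A2 + A3) * indicator K z" for z
      using b3[of z] A L0 off(3)[of z] by (cases "z \<in> K") auto
    fix k :: "real \<Rightarrow> real" assume k: "continuous_on UNIV k"
    interpret S: smooth_composition p f v \<delta> h u e \<phi> k "\<lambda>s. g0 + primitive k s" "\<lambda>s. G0 + g0 * s + primitive (primitive k) s"
      by (rule smooth_composition_primitive[OF k])
    have "Y k = (\<lambda>z. indicator Q_infty z *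
     (- (G0 + g0 * uz z + primitive (primitive k) (uz z)) * ?dt z + j (Dlim z) * S.comp_slope e z
       + f (uz z) * (g0 + primitive k (uz z)) * \<phi> z))"
      by (auto simp: Y_def fun_eq_iff indicator_def S.comp_slope_def lipschitz_slope_def ux_eq)
    with S.smooth_identity show "(\<integral>z. ?X k z \<partial>lborel) = 0"
      unfolding X by (simp add: has_bochner_integral_iff)
  qed
  then show ?thesis unfolding X Y_def[abs_def] .
qed

end

end

section \<open>Solutions with infinite initial trace\<close>

context planar_approximation begin

lemma weak_solution_uz: "weak_solution p f uz"
proof -
  define V where "V z = Dlim z *\<^sub>R e" for z
  have L1_uz: "uz \<in> L1_loc Q_infty"
    by (rule L1_locI[OF open_Q uz_measurable]) (rule uz_bounded)
  have L1_f: "(\<lambda>z. f (uz z)) \<in> L1_loc Q_infty"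
  proof (rule L1_locI[OF open_Q])
    have "(\<lambda>z. indicator Q_infty z * f (ux z)) \<in> borel_measurable borel" by measurable
    moreover have "(\<lambda>z. indicator Q_infty z * f (ux z)) = (\<lambda>z. indicator Q_infty z * f (uz z))"
      by (auto simp: fun_eq_iff indicator_def ux_eq)
    ultimately show "(\<lambda>z. indicator Q_infty z * f (uz z)) \<in> borel_measurable borel" by simp
    fix K :: "('a \<times> real) set" assume K: "compact K" "K \<subseteq> Q_infty"
    obtain C where C: "\<forall>z\<in>K. \<bar>uz z\<bar> \<le> C" using uz_bounded[OF K] by blast
    have "\<bar>f (uz z)\<bar> \<le> f C" if "z \<in> K" for z
    proof -
      have "1 \<le> uz z" "uz z \<le> C" using C that K uz_ge_1[of z] by auto
      then show ?thesis using f_nonneg[of "uz z"] f_le[of "uz z" C] by simp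
    qed
    then show "\<exists>B. \<forall>z\<in>K. \<bar>f (uz z)\<bar> \<le> B" by blast
  qed
  have L1_V: "(\<lambda>z. norm (V z) powr p) \<in> L1_loc Q_infty"
  proof (rule L1_locI[OF open_Q])
    show "(\<lambda>z. indicator Q_infty z * norm (V z) powr p) \<in> borel_measurable borel"
      unfolding V_def by measurable
    fix K :: "('a \<times> real) set" assume K: "compact K" "K \<subseteq> Q_infty"
    obtain C where "\<forall>z\<in>K. \<bar>j (Dlim z)\<bar> \<le> C \<and> \<bar>Dlim z\<bar> \<le> C" using Dlim_local[OF K] by blast
    then have "\<bar>norm (V z) powr p\<bar> \<le> C powr p" if "z \<in> K" for z
      using that p2 e_Basis by (auto simp: V_def intro!: powr_mono2)
    then show "\<exists>B. \<forall>z\<in>K. \<bar>norm (V z) powr p\<bar> \<le> B" by blast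
  qed
  have grad: "has_weak_grad uz V"
    unfolding has_weak_grad_def V_def using uz_weak_deriv by simp
  have "\<exists>W. has_weak_grad (\<lambda>z. g (uz z) * \<phi> z) W \<and>
      has_bochner_integral lborel
        (\<lambda>z. indicator Q_infty z *\<^sub>R
           (- G (uz z) * frechet_derivative \<phi> (at z) (0, 1)
            + norm (V z) powr (p - 2) * (V z \<bullet> W z)
            + f (uz z) * g (uz z) * \<phi> z)) 0"
    if \<phi>: "\<phi> \<in> Cc_infty Q_infty" and g: "continuous_on UNIV g" "g \<in> W1_infty"
      and G: "\<forall>s. (G has_real_derivative g s) (at s)" for \<phi> :: "'a \<times> real \<Rightarrow> real" and g G
  proof -
    obtain \<kappa> C where \<kappa>: "\<kappa> \<in> borel_measurable borel" "\<And>s. \<bar>\<kappa> s\<bar> \<le> C"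
      and g_eq: "\<And>s. 0 \<le> s \<Longrightarrow> g s = g 0 + primitive \<kappa> s"
      using W1_infty_primitive[OF g] by metis
    have lb: "locally_bounded_borel (primitive \<kappa>)"
      by (intro locally_bounded_borel_primitive locally_bounded_borelI[OF \<kappa>])
    have cp: "continuous_on UNIV (primitive \<kappa>)"
      by (intro primitive_continuous locally_bounded_borelI[OF \<kappa>])
    \<comment> \<open>The difference of the two sides has derivative 0 for positive arguments.
      Continuity carries the constant to the end point 0, where the primitives need not be
      differentiable.\<close>
    have G_eq: "G s = G 0 + g 0 * s + primitive (primitive \<kappa>) s" if "0 < s" for s
    proof -
      let ?H = "\<lambda>s. G s - (g 0 * s + primitive (primitive \<kappa>) s)"
      have "continuous_on UNIV G"
        using G by (auto intro!: continuous_at_imp_continuous_on DERIV_isCont)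
      then have "continuous_on {0..s} ?H"
        by (intro continuous_intros continuous_on_subset[OF primitive_continuous[OF lb]])
          (auto intro: continuous_on_subset)
      moreover have "(?H has_real_derivative 0) (at x)" if "0 < x" for x
        using primitive_derivative[OF cp that] G g_eq[of x] that
        by (auto intro!: derivative_eq_intros)
      ultimately have "?H s = ?H 0" using that by (intro DERIV_isconst_end) auto
      then show ?thesis by (simp add: primitive_0)
    qed
    \<comment> \<open>The test function contributes components in all directions, but only the one
      along e meets V.\<close>
    define W where "W z = (\<Sum>i\<in>Basis. lipschitz_slope \<phi> (g 0) i \<kappa> z *\<^sub>R i)" for z
    have W: "W z \<bullet> i = lipschitz_slope \<phi> (g 0) i \<kappa> z" if "i \<in> Basis" for z i
      using that by (simp add: W_def inner_sum_left_Basis)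
    have on_Q: "g (uz z) = g 0 + primitive \<kappa> (uz z)"
      "G (uz z) = G 0 + g 0 * uz z + primitive (primitive \<kappa>) (uz z)" if "z \<in> Q_infty" for z
      using uz_ge_1[OF that] by (auto intro!: g_eq G_eq)
    have "has_weak_grad (\<lambda>z. g (uz z) * \<phi> z) W"
      unfolding has_weak_grad_def
    proof
      fix i :: 'a assume i: "i \<in> Basis"
      show "has_weak_deriv Q_infty (i, 0) (\<lambda>z. g (uz z) * \<phi> z) (\<lambda>z. W z \<bullet> i)"
        by (rule has_weak_deriv_cong[THEN iffD1, OF _ _ general_weak_deriv[OF \<phi> \<kappa> i, of "g 0"]])
          (simp_all add: W[OF i] lipschitz_comp_def[OF \<phi>] ux_eq on_Q)
    qed
    moreover have "(\<lambda>z. indicator Q_infty z *\<^sub>R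
           (- G (uz z) * frechet_derivative \<phi> (at z) (0, 1)
            + norm (V z) powr (p - 2) * (V z \<bullet> W z)
            + f (uz z) * g (uz z) * \<phi> z)) =
      (\<lambda>z. indicator Q_infty z *
        (- (G 0 + g 0 * uz z + primitive (primitive \<kappa>) (uz z)) * frechet_derivative \<phi> (at z) (0, 1)
         + j (Dlim z) * lipschitz_slope \<phi> (g 0) e \<kappa> z + f (uz z) * (g 0 + primitive \<kappa> (uz z)) * \<phi> z))"
    proof
      fix z
      have "V z \<bullet> W z = Dlim z * lipschitz_slope \<phi> (g 0) e \<kappa> z"
        using W[OF e_Basis, of z] by (simp add: V_def inner_commute)
      then have "norm (V z) powr (p - 2) * (V z \<bullet> W z) = j (Dlim z) * lipschitz_slope \<phi> (g 0) e \<kappa> z"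
        using e_Basis by (simp add: V_def j_eq_powr_mult)
      then show "indicator Q_infty z *\<^sub>R
           (- G (uz z) * frechet_derivative \<phi> (at z) (0, 1)
            + norm (V z) powr (p - 2) * (V z \<bullet> W z)
            + f (uz z) * g (uz z) * \<phi> z) =
        indicator Q_infty z *
        (- (G 0 + g 0 * uz z + primitive (primitive \<kappa>) (uz z)) * frechet_derivative \<phi> (at z) (0, 1)
         + j (Dlim z) * lipschitz_slope \<phi> (g 0) e \<kappa> z + f (uz z) * (g 0 + primitive \<kappa> (uz z)) * \<phi> z)"
        by (cases "z \<in> Q_infty") (simp_all add: on_Q)
    qed
    ultimately show ?thesis using general_identity[OF \<phi> \<kappa>, of "G 0" "g 0"] by (intro exI[of _ W]) simp
  qed
  moreover have "\<forall>z\<in>Q_infty. 0 \<le> uz z" using uz_ge_1 by force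
  ultimately show ?thesis
    unfolding weak_solution_def using L1_uz L1_f L1_V grad by blast
qed

definition sol :: "'a \<times> real \<Rightarrow> real" where "sol = restrict uz Q_infty"

lemma sol_eq: "0 < t \<Longrightarrow> sol (x, t) = u (x \<bullet> e) t"
  by (simp add: sol_def Q_infty_def uz_def)

lemma sol_positive_solution: "sol \<in> positive_solutions p f"
  unfolding positive_solutions_def
proof (intro CollectI conjI)
  show "sol \<in> extensional Q_infty" by (simp add: sol_def)
  show "continuous_on Q_infty sol"
    using uz_cont by (rule continuous_on_eq) (simp add: sol_def)
  show "weak_solution p f sol"
    by (rule weak_solution_cong[OF _ weak_solution_uz]) (simp add: sol_def)
  have "(0, 1) \<in> (Q_infty :: ('a \<times> real) set)" by (simp add: Q_infty_def)
  then show "\<exists>z\<in>Q_infty. sol z \<noteq> 0" using uz_ge_1[of "(0, 1)"] by (intro bexI[of _ "(0, 1)"]) (auto simp: sol_def)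
qed

section \<open>The initial trace\<close>

text \<open>At a regular point the integrals against a tent function would have a finite limit L.
  For small t, however, the solution exceeds any prescribed level uniformly in space, which pushes
  these integrals up to L + 1.\<close>

lemma sol_trace: "has_initial_trace sol nu_infty"
  unfolding has_initial_trace_nu_infty_iff
proof (rule ccontr)
  assume "singular_set sol \<noteq> UNIV"
  then obtain y where "y \<in> regular_set sol" by (auto simp: singular_set_def)
  then obtain U \<mu> where U: "open U" "y \<in> U" "initial_measure_on sol U \<mu>"
    unfolding regular_set_def by blast
  obtain r where r: "0 < r" "cball y r \<subseteq> U" using U(1,2) open_contains_cball by blast
  define \<zeta> where "\<zeta> x = max 0 (r - dist y x)" for x
  have \<zeta>_cont: "continuous_on UNIV \<zeta>" unfolding \<zeta>_def[abs_def] by (intro continuous_intros)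
  have \<zeta>_nonneg: "0 \<le> \<zeta> x" for x by (simp add: \<zeta>_def)
  have \<zeta>_out: "\<zeta> x = 0" if "x \<notin> cball y r" for x using that by (simp add: \<zeta>_def)
  have "closure {x. \<zeta> x \<noteq> 0} \<subseteq> cball y r"
    by (rule closure_minimal) (use \<zeta>_out in blast, simp)
  moreover from this have "compact (closure {x. \<zeta> x \<noteq> 0})"
    by (meson bounded_cball bounded_subset closed_closure compact_eq_bounded_closed)
  ultimately have "\<zeta> \<in> Cc U" using \<zeta>_cont r(2) by (auto simp: Cc_def compact_support_in_def)
  then have lim: "((\<lambda>t. LINT x:U|lborel. sol (x, t) * \<zeta> x) \<longlongrightarrow> (LINT x|\<mu>. \<zeta> x)) (at_right 0)"
    using U(3) by (simp add: initial_measure_on_def)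
  define L where "L = (LINT x|\<mu>. \<zeta> x)"
  \<comment> \<open>A lower bound for the integral of the tent, which is at least r / 2 on the ball
    of half the radius. The level m is chosen so that m c reaches L + 1.\<close>
  define c where "c = r / 2 * measure lborel (cball y (r / 2))"
  have c: "0 < c" unfolding c_def using r(1) content_cball_pos[of "r / 2" y] by simp
  define m where "m = (\<bar>L\<bar> + 1) / c"
  have m: "0 \<le> m" using c by (simp add: m_def)
  obtain t1 where t1: "0 < t1" "\<And>x t. 0 < t \<Longrightarrow> t \<le> t1 \<Longrightarrow> m \<le> u x t" using u_blowup[OF m] by blast
  have "\<forall>\<^sub>F t in at_right 0. (LINT x:U|lborel. sol (x, t) * \<zeta> x) < L + 1"
    using lim by (rule order_tendstoD) (simp add: L_def)
  moreover have "\<forall>\<^sub>F t in at_right 0. 0 < t \<and> t \<le> t1"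
    using t1(1) by (auto simp: eventually_at_right_field intro!: exI[of _ t1])
  ultimately have "\<forall>\<^sub>F t in at_right 0. (LINT x:U|lborel. sol (x, t) * \<zeta> x) < L + 1 \<and> 0 < t \<and> t \<le> t1"
    by (rule eventually_conj)
  then have "\<exists>t. (LINT x:U|lborel. sol (x, t) * \<zeta> x) < L + 1 \<and> 0 < t \<and> t \<le> t1"
    by (rule eventually_happens'[rotated]) simp
  then obtain t where t: "(LINT x:U|lborel. sol (x, t) * \<zeta> x) < L + 1" "0 < t" "t \<le> t1" by blast
  have uc: "continuous_on UNIV (\<lambda>x. u (x \<bullet> e) t * \<zeta> x)"
  proof (intro continuous_on_mult \<zeta>_cont)
    have "continuous_on UNIV ((\<lambda>(x, t). u x t) \<circ> (\<lambda>x::'a. (x \<bullet> e, t)))"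
      using t(2) by (intro continuous_on_compose continuous_intros continuous_on_subset[OF u_cont]) auto
    then show "continuous_on UNIV (\<lambda>x::'a. u (x \<bullet> e) t)" by (simp add: comp_def)
  qed
  have eq: "(LINT x:U|lborel. sol (x, t) * \<zeta> x) = (\<integral>x. u (x \<bullet> e) t * \<zeta> x \<partial>lborel)"
    unfolding set_lebesgue_integral_def
  proof (intro Bochner_Integration.integral_cong refl)
    fix x
    show "indicator U x *\<^sub>R (sol (x, t) * \<zeta> x) = u (x \<bullet> e) t * \<zeta> x"
      using \<zeta>_out[of x] r(2) t(2) by (cases "x \<in> cball y r") (auto simp: indicator_def sol_eq)
  qed
  have i: "integrable lborel (\<lambda>x. u (x \<bullet> e) t * \<zeta> x)"
  proof -
    have "bounded ((\<lambda>x. u (x \<bullet> e) t * \<zeta> x) ` cball y r)"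
      by (intro compact_imp_bounded compact_continuous_image continuous_on_subset[OF uc]) auto
    then obtain A where A: "\<forall>x\<in>cball y r. \<bar>u (x \<bullet> e) t * \<zeta> x\<bar> \<le> A" by (auto simp: bounded_iff)
    show ?thesis
    proof (rule integrable_bounded_compact[of _ "cball y r" A])
      show "(\<lambda>x. u (x \<bullet> e) t * \<zeta> x) \<in> borel_measurable borel" using uc by (rule borel_measurable_continuous_onI)
      show "\<bar>u (x \<bullet> e) t * \<zeta> x\<bar> \<le> A * indicator (cball y r) x" for x
        using A \<zeta>_out[of x] by (cases "x \<in> cball y r") auto
    qed simp
  qed
  have "L + 1 \<le> m * c" using c by (simp add: m_def)
  also have "m * c = (\<integral>x. m * (r / 2) * indicator (cball y (r / 2)) x \<partial>lborel)"
    by (simp add: c_def)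
  also have "\<dots> \<le> (\<integral>x. u (x \<bullet> e) t * \<zeta> x \<partial>lborel)"
  proof (rule integral_mono[OF _ i])
    show "integrable lborel (\<lambda>x. m * (r / 2) * indicator (cball y (r / 2)) x :: real)"
      by (intro integrable_mult_right integrable_real_indicator)
        (auto simp: emeasure_compact_finite[unfolded infinity_ennreal_def])
    fix x
    have um: "m \<le> u (x \<bullet> e) t" by (rule t1(2)[OF t(2,3)])
    show "m * (r / 2) * indicator (cball y (r / 2)) x \<le> u (x \<bullet> e) t * \<zeta> x"
    proof (cases "x \<in> cball y (r / 2)")
      case True
      then have "r / 2 \<le> r - dist y x" by simp
      then have "r / 2 \<le> \<zeta> x" unfolding \<zeta>_def by (rule max.coboundedI2)
      then have "m * (r / 2) \<le> u (x \<bullet> e) t * \<zeta> x" using um m r(1) by (intro mult_mono) auto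
      then show ?thesis using True by simp
    next
      case False
      then show ?thesis using um m \<zeta>_nonneg[of x] by (simp add: mult_nonneg_nonneg)
    qed
  qed
  finally show False using t(1) eq by simp
qed

end

section \<open>Translates and conclusion\<close>

text \<open>The local requirements hold for every radius, so a translation by c only replaces r by r
  + |c|; the growth bound loses |c| in the constant b.\<close>

lemma (in approximation) translate:
  "approximation p f (\<lambda>n x. v n (c + x)) \<delta> h (\<lambda>x. u (c + x))"
proof unfold_locales
  show "0 < \<delta> n" "0 < h n" "\<delta> \<longlonglongrightarrow> 0" "h \<longlonglongrightarrow> 0" for n by (rule \<delta>_pos h_pos \<delta>_lim h_lim)+
  show "1 \<le> v n (c + x) t" for n x t by (rule v_ge_1)
  show "v n (c + x) t \<le> v n (c + x) s" if "s \<le> t" for n x s t using that by (rule v_antimono)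
  show "(\<lambda>n. v n (c + x) t) \<longlonglongrightarrow> u (c + x) t" if "0 < t" for x t using that by (rule v_lim)
  show "(\<lambda>z. v n (c + fst z) (snd z)) \<in> borel_measurable borel" for n
  proof -
    have "(\<lambda>z::real \<times> real. (c + fst z, snd z)) \<in> borel_measurable borel"
      by (intro borel_measurable_continuous_onI continuous_intros)
    from measurable_compose[OF this v_measurable[of n]] show ?thesis by simp
  qed
  have "continuous_on (UNIV \<times> {0<..}) ((\<lambda>(x, t). u x t) \<circ> (\<lambda>z. (c + fst z, snd z)))"
    by (intro continuous_on_compose continuous_intros continuous_on_subset[OF u_cont]) auto
  then show "continuous_on (UNIV \<times> {0<..}) (\<lambda>(x, t). u (c + x) t)"
    by (simp add: comp_def case_prod_unfold)
  show "\<exists>t1>0. \<forall>x t. 0 < t \<longrightarrow> t \<le> t1 \<longrightarrow> m \<le> u (c + x) t" if "0 \<le> m" for m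
    using u_blowup[OF that] by blast
  obtain a b where ab: "0 < a" "\<And>x t. 0 < t \<Longrightarrow> a * (\<bar>x\<bar> - b) \<le> u x t" using u_growth by blast
  have "a * (\<bar>x\<bar> - (b + \<bar>c\<bar>)) \<le> u (c + x) t" if "0 < t" for x t
  proof -
    have "a * (\<bar>x\<bar> - (b + \<bar>c\<bar>)) \<le> a * (\<bar>c + x\<bar> - b)" using ab(1) by (intro mult_left_mono) auto
    also have "\<dots> \<le> u (c + x) t" by (rule ab(2)[OF that])
    finally show ?thesis .
  qed
  then show "\<exists>a b. 0 < a \<and> (\<forall>x t. 0 < t \<longrightarrow> a * (\<bar>x\<bar> - b) \<le> u (c + x) t)" using ab(1) by blast
  fix r t0 :: real assume r: "0 \<le> r" "0 < t0"
  have r': "0 \<le> r + \<bar>c\<bar>" using r by simp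
  have cx: "\<bar>c + x\<bar> \<le> r + \<bar>c\<bar>" if "\<bar>x\<bar> \<le> r" for x using that by linarith
  have sh: "c + (x + s) = (c + x) + s" "c + (x - s) = (c + x) - s" for x s by simp_all
  show "\<exists>C\<ge>0. \<forall>\<^sub>F n in sequentially. \<forall>x t. \<bar>x\<bar> \<le> r \<longrightarrow> t0 \<le> t \<longrightarrow>
      v n (c + x) t \<le> C \<and> \<bar>j ((v n (c + (x + \<delta> n)) t - v n (c + x) t) / \<delta> n)\<bar> \<le> C \<and>
      \<bar>(v n (c + (x + \<delta> n)) t - v n (c + x) t) / \<delta> n\<bar> \<le> C"
  proof -
    obtain C where "0 \<le> C" and C: "\<forall>\<^sub>F n in sequentially. \<forall>x t. \<bar>x\<bar> \<le> r + \<bar>c\<bar> \<longrightarrow> t0 \<le> t \<longrightarrow>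
      v n x t \<le> C \<and> \<bar>j ((v n (x + \<delta> n) t - v n x t) / \<delta> n)\<bar> \<le> C \<and> \<bar>(v n (x + \<delta> n) t - v n x t) / \<delta> n\<bar> \<le> C"
      using v_local[OF r' r(2)] by blast
    have "\<forall>\<^sub>F n in sequentially. \<forall>x t. \<bar>x\<bar> \<le> r \<longrightarrow> t0 \<le> t \<longrightarrow>
      v n (c + x) t \<le> C \<and> \<bar>j ((v n (c + (x + \<delta> n)) t - v n (c + x) t) / \<delta> n)\<bar> \<le> C \<and>
      \<bar>(v n (c + (x + \<delta> n)) t - v n (c + x) t) / \<delta> n\<bar> \<le> C"
      using C unfolding sh by eventually_elim (use cx in blast)
    then show ?thesis using \<open>0 \<le> C\<close> by blast
  qed
  show "\<forall>\<^sub>F n in sequentially. \<forall>x t. \<bar>x\<bar> \<le> r \<longrightarrow> t0 \<le> t \<longrightarrow>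
      (v n (c + x) (t + h n) - v n (c + x) t) / h n = (j ((v n (c + (x + \<delta> n)) t - v n (c + x) t) / \<delta> n)
        - j ((v n (c + x) t - v n (c + (x - \<delta> n)) t) / \<delta> n)) / \<delta> n - f (v n (c + x) t)"
    using v_eq[OF r' r(2)] unfolding sh by eventually_elim (use cx in blast)
  show "\<forall>\<^sub>F n in sequentially. \<forall>x t. \<bar>x\<bar> \<le> r \<longrightarrow> t0 \<le> t \<longrightarrow> v n (c + x) t - v n (c + x) (t + h n) \<le> \<epsilon>"
    if "0 < \<epsilon>" for \<epsilon>
    using v_small[OF r' r(2) that] by eventually_elim (use cx in blast)
  obtain C where "0 \<le> C" and C: "\<forall>\<^sub>F n in sequentially.
      \<forall>x y t. \<bar>x\<bar> \<le> r + \<bar>c\<bar> \<longrightarrow> \<bar>y\<bar> \<le> r + \<bar>c\<bar> \<longrightarrow> t0 \<le> t \<longrightarrow> \<delta> n < y - x \<longrightarrow>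
       (\<exists>\<theta>. \<bar>\<theta> - (y - x)\<bar> \<le> \<delta> n \<and>
         j ((v n (y + \<delta> n) t - v n y t) / \<delta> n) \<le> j ((v n y t - v n x t) / \<theta>) + C * (y - x + \<delta> n) \<and>
         j ((v n y t - v n x t) / \<theta>) \<le> j ((v n (x + \<delta> n) t - v n x t) / \<delta> n) + C * (y - x + \<delta> n))"
    using v_flux[OF r' r(2)] by blast
  have "\<forall>\<^sub>F n in sequentially.
      \<forall>x y t. \<bar>x\<bar> \<le> r \<longrightarrow> \<bar>y\<bar> \<le> r \<longrightarrow> t0 \<le> t \<longrightarrow> \<delta> n < y - x \<longrightarrow>
       (\<exists>\<theta>. \<bar>\<theta> - (y - x)\<bar> \<le> \<delta> n \<and>
         j ((v n (c + (y + \<delta> n)) t - v n (c + y) t) / \<delta> n) \<le> j ((v n (c + y) t - v n (c + x) t) / \<theta>) + C * (y - x + \<delta> n) \<and>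
         j ((v n (c + y) t - v n (c + x) t) / \<theta>) \<le> j ((v n (c + (x + \<delta> n)) t - v n (c + x) t) / \<delta> n) + C * (y - x + \<delta> n))"
    using C
  proof eventually_elim
    case (elim n)
    show ?case
    proof (intro allI impI)
      fix x y t assume a: "\<bar>x\<bar> \<le> r" "\<bar>y\<bar> \<le> r" "t0 \<le> t" "\<delta> n < y - x"
      have d: "(c + y) - (c + x) = y - x" by simp
      from elim[rule_format, OF cx[OF a(1)] cx[OF a(2)] a(3), unfolded d, OF a(4)]
      show "\<exists>\<theta>. \<bar>\<theta> - (y - x)\<bar> \<le> \<delta> n \<and>
         j ((v n (c + (y + \<delta> n)) t - v n (c + y) t) / \<delta> n) \<le> j ((v n (c + y) t - v n (c + x) t) / \<theta>) + C * (y - x + \<delta> n) \<and>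
         j ((v n (c + y) t - v n (c + x) t) / \<theta>) \<le> j ((v n (c + (x + \<delta> n)) t - v n (c + x) t) / \<delta> n) + C * (y - x + \<delta> n)"
        unfolding sh .
    qed
  qed
  then show "\<exists>C\<ge>0. \<forall>\<^sub>F n in sequentially.
      \<forall>x y t. \<bar>x\<bar> \<le> r \<longrightarrow> \<bar>y\<bar> \<le> r \<longrightarrow> t0 \<le> t \<longrightarrow> \<delta> n < y - x \<longrightarrow>
       (\<exists>\<theta>. \<bar>\<theta> - (y - x)\<bar> \<le> \<delta> n \<and>
         j ((v n (c + (y + \<delta> n)) t - v n (c + y) t) / \<delta> n) \<le> j ((v n (c + y) t - v n (c + x) t) / \<theta>) + C * (y - x + \<delta> n) \<and>
         j ((v n (c + y) t - v n (c + x) t) / \<theta>) \<le> j ((v n (c + (x + \<delta> n)) t - v n (c + x) t) / \<delta> n) + C * (y - x + \<delta> n))"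
    using \<open>0 \<le> C\<close> by blast
qed

theorem corollary5p4:
  fixes p :: real and f F :: "real \<Rightarrow> real"
  assumes "p > 2"
    and "continuous_on UNIV f" and "mono f"
    and "\<And>s. f s = 0 \<longleftrightarrow> s = 0"
    and "convex_on {0..} f"
    and "\<And>s. F s = (LBINT \<sigma>=0..s. f \<sigma>)"
    and "(\<integral>\<^sup>+s\<in>{1..}. ennreal (s powr (- p - p / real CARD('n)) * f s) \<partial>lborel) < \<infinity>"
    and "(\<integral>\<^sup>+s\<in>{1..}. ennreal (1 / f s) \<partial>lborel) < \<infinity>"
    and "(\<integral>\<^sup>+s\<in>{1..}. ennreal (1 / F s powr (1 / p)) \<partial>lborel) = \<infinity>"
  shows "infinite {u :: (real ^ 'n::finite) \<times> real \<Rightarrow> real.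
           u \<in> positive_solutions p f \<and> has_initial_trace u nu_infty}"
proof
  assume fin: "finite {u :: (real ^ 'n) \<times> real \<Rightarrow> real.
           u \<in> positive_solutions p f \<and> has_initial_trace u nu_infty}"
  interpret flat_absorption p f F
    by unfold_locales (use assms in auto)
  obtain v \<delta> h u where "approximation p f v \<delta> h u" using ex_approximation by blast
  then interpret A: approximation p f v \<delta> h u .
  obtain e :: "real ^ 'n" where e: "e \<in> Basis" using nonempty_Basis by blast
  define U :: "nat \<Rightarrow> (real ^ 'n) \<times> real \<Rightarrow> real" where
    "U m = restrict (\<lambda>z. u (real m + fst z \<bullet> e) (snd z)) Q_infty" for m
  have "U m \<in> positive_solutions p f \<and> has_initial_trace (U m) nu_infty" for m
  proof -
    interpret P: planar_approximation p f "\<lambda>n x. v n (real m + x)" \<delta> h "\<lambda>x. u (real m + x)" e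
      by (intro planar_approximation.intro A.translate planar_approximation_axioms.intro e)
    have "P.sol = U m" by (simp add: P.sol_def U_def P.uz_def[abs_def])
    then show ?thesis using P.sol_positive_solution P.sol_trace by simp
  qed
  then have "range U \<subseteq> {u. u \<in> positive_solutions p f \<and> has_initial_trace u nu_infty}" by blast
  then have "finite (range U)" using fin finite_subset by blast
  then have "\<not> inj U" using finite_imageD by fastforce
  \<comment> \<open>If two translates coincide, the slice at time 1 is periodic in the coordinate
    along e, so it takes its value at 0 again along an unbounded arithmetic progression, against its
    linear growth.\<close>
  then obtain m m' where mm: "m < m'" "U m = U m'"
    unfolding inj_def by (metis linorder_neqE_nat)
  define d where "d = real m' - real m"
  have d: "0 < d" using mm(1) by (simp add: d_def)
  have per: "u (x + d) 1 = u x 1" for x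
  proof -
    have ee: "e \<bullet> e = 1" using e by simp
    have "U k ((x - real m) *\<^sub>R e, 1) = u (real k + (x - real m)) 1" for k
      using ee by (simp add: U_def Q_infty_def)
    from this[of m] this[of m'] mm(2) show ?thesis by (simp add: d_def algebra_simps)
  qed
  have perk: "u (real k * d) 1 = u 0 1" for k
  proof (induction k)
    case (Suc k)
    then show ?case using per[of "real k * d"] by (simp add: algebra_simps)
  qed simp
  obtain a b where ab: "0 < a" "\<And>x t. 0 < t \<Longrightarrow> a * (\<bar>x\<bar> - b) \<le> u x t" using A.u_growth by blast
  obtain k :: nat where k: "(u 0 1 / a + b) / d < real k" using reals_Archimedean2 by blast
  then have "u 0 1 / a < real k * d - b" using d by (simp add: field_simps)
  then have "u 0 1 < a * (real k * d - b)" using ab(1) by (simp add: field_simps)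
  also have "\<dots> \<le> u (real k * d) 1" using ab(2)[of 1 "real k * d"] d by (simp add: abs_mult)
  finally show False using perk[of k] by simp
qed

end
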